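(* Let $C=\mathcal{C}_\mu(R,\sigma,t)$ be a regular, $\mu$-consistent TGWC of rank $m$ with canonical generators $X_1^{\pm},\dots,X_m^{\pm}$, canonical ideal $\mathcal J$, and associated TGWA $A=C/\mathcal J$, and let $D=\mathcal{C}_\nu(S,\rho,h)$ be a regular, $\nu$-consistent TGWC of rank $n$ with canonical generators $Y_1^{\pm},\dots,Y_n^{\pm}$, canonical ideal $\mathcal I$, and associated TGWA $B=D/\mathcal I$. Assume that the $\sigma_j$ ($j\in[m]$) and the $\rho_i$ ($i\in[n]$) are extended to commuting automorphisms of $R\otimes S$ (denoted by the same letters) such that $\rho_i(R\otimes 1)\subset R\otimes 1$ and $\sigma_j(1\otimes S)\subset 1\otimes S$ for all $i,j$; thus each $\rho_i$ also acts on $R$ and each $\sigma_j$ also acts on $S$. Let $q_{ij}^{(\pm,\pm)}\in k^\times$ ($i\in[n]$, $j\in[m]$) be scalars such that for all $i\in[n]$, $j\in[m]$ $$\rho_i(t_j)=q_{ij}^{(+,-)}q_{ij}^{(+,+)}t_j\qquad\text{and}\qquad \sigma_j(h_i)=q_{ij}^{(-,-)}q_{ij}^{(+,-)}h_i .$$ Let $\tau:D\otimes C\to C\otimes D$ be the $k$-linear map defined by $$\tau(sY_{\mathbf v}\otimes rX_{\mathbf u})=q_{(\mathbf v,\mathbf u)}\,\rho^{d(\mathbf v)}(r)X_{\mathbf u}\otimes\sigma^{-d(\mathbf u)}(s)Y_{\mathbf v}$$ for all $r\in R$, $s\in S$ and all finite sequences $\mathbf u$ in $\pm[m]$ and $\mathbf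 v$ in $\pm[n]$, and denote also by $\tau$ the twisting map $B\otimes A\to A\otimes B$ induced by it. Set $T=R\otimes S$, and define $\pi=(\pi_1,\dots,\pi_{m+n})$, $w=(w_1,\dots,w_{m+n})$ and $\eta=(\eta_{ij})$ by $$\pi_i=\begin{cases}\sigma_i & i\le m\\ \rho_{i-m}& i>m,\end{cases}\qquad w_i=\begin{cases}t_i\otimes 1& i\le m\\ 1\otimes h_{i-m}& i>m,\end{cases}\qquad \eta_{ij}=\begin{cases}\mu_{ij}& i,j\le m\\ \bigl(q_{j-m,i}^{(-,+)}\bigr)^{-1}& i\le m<j\\ q_{i-m,j}^{(+,-)}& j\le m<i\\ \nu_{i-m,j-m}& i,j>m.\end{cases}$$ Then $A\otimes_\tau B$ is (up to isomorphism, with underlying TGWD $(T,\pi,w)$) a regular $\eta$-consistent TGWA of rank $m+n$.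
   Context: $k$ is a field; algebras are unital $k$-algebras; $\otimes=\otimes_k$; $[n]=\{1,\dots,n\}$; $\pm[n]=\{\pm1,\dots,\pm n\}$; $Z(R)$ is the center of $R$; $\mathbf e_i$ is the $i$-th standard basis vector. A twisted generalized Weyl datum (TGWD) of rank $n$ is a triple $(R,\sigma,t)$ with $R$ an algebra, $\sigma=(\sigma_1,\dots,\sigma_n)$ commuting automorphisms of $R$, and $t=(t_1,\dots,t_n)\in Z(R)^n$. For $\mu=(\mu_{ij})\in M_n(k^\times)$, the twisted generalized Weyl construction (TGWC) $\mathcal{C}_\mu(R,\sigma,t)$ is the algebra generated over $R$ by $X_1^{\pm},\dots,X_n^{\pm}$ (the canonical generators) with relations $X_i^{\pm}r=\sigma_i^{\pm1}(r)X_i^{\pm}$, $X_i^-X_i^+=t_i$, $X_i^+X_i^-=\sigma_i(t_i)$ for $r\in R$, $i\in[n]$, and $X_i^+X_j^-=\mu_{ij}X_j^-X_i^+$ for $i\ne j$. It is $\mathbb Z^n$-graded by $\deg r=\mathbf 0$, $\deg X_i^{\pm}=\pm\mathbf e_i$. The twisted generalized Weyl algebra (TGWA) is $\mathcal{A}_\mu(R,\sigma,t)=\mathcal{C}_\mu(R,\sigma,t)/\mathcal J$, where the canonical ideal $\mathcal J$ is the sum of all graded ideals $J$ with $J_{\mathbf 0}=\{0\}$. The datum is regular if every $t_i$ is a regular element (non-zero-divisor) of $R$, and $\mu$-consistent if the canonical map $R\to\mathcal{A}_\mu(R,\sigma,t)$ is injective; a TGWC or TGWA is regular (resp. $\mu$-consistent)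 if its datum is. Notation: for $u\in\pm[m]$, $X_u=X_{|u|}^{\mathfrak s(u)}$ where $\mathfrak s(u)$ is the sign of $u$; for $\mathbf u=(u_1,\dots,u_p)\in(\pm[m])^p$, $X_{\mathbf u}=X_{u_1}\cdots X_{u_p}$ and $d(\mathbf u)=\deg X_{\mathbf u}\in\mathbb Z^m$; similarly $Y_{\mathbf v}$ and $d(\mathbf v)\in\mathbb Z^n$ for $\mathbf v\in(\pm[n])^\ell$. For $\alpha\in\mathbb Z^m$, $\sigma^\alpha=\sigma_1^{\alpha_1}\cdots\sigma_m^{\alpha_m}$; similarly $\rho^\beta$ for $\beta\in\mathbb Z^n$. For $v\in\pm[n]$, $u\in\pm[m]$, $q_{v,u}=q_{|v|,|u|}^{(\mathfrak s(v),\mathfrak s(u))}$, and $q_{(\mathbf v,\mathbf u)}=\prod_{i,j}q_{v_i,u_j}$. A twisting map is a $k$-linear $\tau:B\otimes A\to A\otimes B$ with $\tau(b\otimes1)=1\otimes b$ and $\tau(1\otimes a)=a\otimes1$. The twisted tensor product $A\otimes_\tau B$ is $A\otimes B$ with multiplication $(\mu_A\otimes\mu_B)\circ(\mathrm{id}_A\otimes\tau\otimes\mathrm{id}_B)$, where $\mu_A,\mu_B$ are the multiplications of $A,B$.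
   Formalization: The k-linear map τ on D⊗C with the displayed values is assumed to exist: the stated conditions on the scalars q do not ensure this, since well-definedness also forces the product of the four scalars q_ij^(±,±) to be 1 when R⊗S is nonzero. *)

theory Defs
  imports "HOL-Algebra.Module" "HOL-Algebra.QuotRing"
begin

section \<open>Algebras over a field\<close>

locale k_algebra = K?: field K + A?: module K A + A?: ring A
  for K (structure) and A (structure) +
  assumes smult_mult_left:
    "\<lbrakk>c \<in> carrier K; x \<in> carrier A; y \<in> carrier A\<rbrakk>
      \<Longrightarrow> (c \<odot>\<^bsub>A\<^esub> x) \<otimes>\<^bsub>A\<^esub> y = c \<odot>\<^bsub>A\<^esub> (x \<otimes>\<^bsub>A\<^esub> y)"
    and smult_mult_right:
    "\<lbrakk>c \<in> carrier K; x \<in> carrier A; y \<in> carrier A\<rbrakk>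
      \<Longrightarrow> x \<otimes>\<^bsub>A\<^esub> (c \<odot>\<^bsub>A\<^esub> y) = c \<odot>\<^bsub>A\<^esub> (x \<otimes>\<^bsub>A\<^esub> y)"

definition lin_hom ::
  "'k ring \<Rightarrow> ('k, 'a) module \<Rightarrow> ('k, 'b) module \<Rightarrow> ('a \<Rightarrow> 'b) set" where
  "lin_hom K M N = {f. f \<in> carrier M \<rightarrow> carrier N
     \<and> (\<forall>x\<in>carrier M. \<forall>y\<in>carrier M. f (x \<oplus>\<^bsub>M\<^esub> y) = f x \<oplus>\<^bsub>N\<^esub> f y)
     \<and> (\<forall>c\<in>carrier K. \<forall>x\<in>carrier M. f (c \<odot>\<^bsub>M\<^esub> x) = c \<odot>\<^bsub>N\<^esub> f x)}"

definition alg_iso ::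
  "'k ring \<Rightarrow> ('k, 'a) module \<Rightarrow> ('k, 'b) module \<Rightarrow> ('a \<Rightarrow> 'b) set" where
  "alg_iso K A B = ring_iso A B \<inter> lin_hom K A B"

definition center :: "('a, 'm) ring_scheme \<Rightarrow> 'a set" where
  "center R = {z \<in> carrier R. \<forall>r\<in>carrier R. z \<otimes>\<^bsub>R\<^esub> r = r \<otimes>\<^bsub>R\<^esub> z}"

definition regular_element :: "('a, 'm) ring_scheme \<Rightarrow> 'a \<Rightarrow> bool" where
  "regular_element R a \<longleftrightarrow> a \<in> carrier R
     \<and> (\<forall>r\<in>carrier R. a \<otimes>\<^bsub>R\<^esub> r = \<zero>\<^bsub>R\<^esub> \<longrightarrow> r = \<zero>\<^bsub>R\<^esub>)
     \<and> (\<forall>r\<in>carrier R. r \<otimes>\<^bsub>R\<^esub> a = \<zero>\<^bsub>R\<^esub> \<longrightarrow> r = \<zero>\<^bsub>R\<^esub>)"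

text \<open>The quotient ring \<open>A Quot J\<close> together with the scalar multiplication
  \<open>c (J + x) = J + c x\<close>.\<close>

definition alg_quot :: "('k, 'a) module \<Rightarrow> 'a set \<Rightarrow> ('k, 'a set) module" where
  "alg_quot A J = ring.extend (A Quot J)
     (module.fields (\<lambda>c P. \<Union>x\<in>P. J +>\<^bsub>A\<^esub> (c \<odot>\<^bsub>A\<^esub> x)))"


section \<open>Modules and algebras given by generators and relations\<close>

text \<open>The module (unital associative algebra) over \<open>K\<close> presented by a set \<open>X\<close> of generators and
  a set \<open>Rel\<close> of relations, given as pairs of terms to be identified: terms in \<open>X\<close> modulo the
  least congruence that contains \<open>Rel\<close> and the module (algebra) axioms.\<close>

datatype ('k, 'x) lin_term =
    LVar 'x
  | LZero
  | LAdd "('k, 'x) lin_term" "('k, 'x) lin_term"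
  | LScal 'k "('k, 'x) lin_term"

inductive_set lin_terms :: "'k ring \<Rightarrow> 'x set \<Rightarrow> ('k, 'x) lin_term set"
  for K :: "'k ring" and X :: "'x set" where
  "x \<in> X \<Longrightarrow> LVar x \<in> lin_terms K X"
| "LZero \<in> lin_terms K X"
| "\<lbrakk>p \<in> lin_terms K X; q \<in> lin_terms K X\<rbrakk> \<Longrightarrow> LAdd p q \<in> lin_terms K X"
| "\<lbrakk>c \<in> carrier K; p \<in> lin_terms K X\<rbrakk> \<Longrightarrow> LScal c p \<in> lin_terms K X"

inductive_set lin_cong ::
    "'k ring \<Rightarrow> 'x set \<Rightarrow> ('k, 'x) lin_term rel \<Rightarrow> ('k, 'x) lin_term rel"
  for K :: "'k ring" and X :: "'x set" and Rel :: "('k, 'x) lin_term rel" where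
  rel: "\<lbrakk>(p, q) \<in> Rel; p \<in> lin_terms K X; q \<in> lin_terms K X\<rbrakk> \<Longrightarrow> (p, q) \<in> lin_cong K X Rel"
| refl: "p \<in> lin_terms K X \<Longrightarrow> (p, p) \<in> lin_cong K X Rel"
| sym: "(p, q) \<in> lin_cong K X Rel \<Longrightarrow> (q, p) \<in> lin_cong K X Rel"
| trans: "\<lbrakk>(p, q) \<in> lin_cong K X Rel; (q, r) \<in> lin_cong K X Rel\<rbrakk> \<Longrightarrow> (p, r) \<in> lin_cong K X Rel"
| add: "\<lbrakk>(p, p') \<in> lin_cong K X Rel; (q, q') \<in> lin_cong K X Rel\<rbrakk>
    \<Longrightarrow> (LAdd p q, LAdd p' q') \<in> lin_cong K X Rel"
| scal: "\<lbrakk>c \<in> carrier K; (p, p') \<in> lin_cong K X Rel\<rbrakk>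
    \<Longrightarrow> (LScal c p, LScal c p') \<in> lin_cong K X Rel"
| add_assoc: "\<lbrakk>p \<in> lin_terms K X; q \<in> lin_terms K X; r \<in> lin_terms K X\<rbrakk>
    \<Longrightarrow> (LAdd (LAdd p q) r, LAdd p (LAdd q r)) \<in> lin_cong K X Rel"
| add_comm: "\<lbrakk>p \<in> lin_terms K X; q \<in> lin_terms K X\<rbrakk>
    \<Longrightarrow> (LAdd p q, LAdd q p) \<in> lin_cong K X Rel"
| add_zero: "p \<in> lin_terms K X \<Longrightarrow> (LAdd LZero p, p) \<in> lin_cong K X Rel"
| add_neg: "p \<in> lin_terms K X
    \<Longrightarrow> (LAdd (LScal (\<ominus>\<^bsub>K\<^esub> \<one>\<^bsub>K\<^esub>) p) p, LZero) \<in> lin_cong K X Rel"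
| scal_one: "p \<in> lin_terms K X \<Longrightarrow> (LScal \<one>\<^bsub>K\<^esub> p, p) \<in> lin_cong K X Rel"
| scal_scal: "\<lbrakk>c \<in> carrier K; d \<in> carrier K; p \<in> lin_terms K X\<rbrakk>
    \<Longrightarrow> (LScal (c \<otimes>\<^bsub>K\<^esub> d) p, LScal c (LScal d p)) \<in> lin_cong K X Rel"
| scal_distl: "\<lbrakk>c \<in> carrier K; d \<in> carrier K; p \<in> lin_terms K X\<rbrakk>
    \<Longrightarrow> (LScal (c \<oplus>\<^bsub>K\<^esub> d) p, LAdd (LScal c p) (LScal d p)) \<in> lin_cong K X Rel"
| scal_distr: "\<lbrakk>c \<in> carrier K; p \<in> lin_terms K X; q \<in> lin_terms K X\<rbrakk>
    \<Longrightarrow> (LScal c (LAdd p q), LAdd (LScal c p) (LScal c q)) \<in> lin_cong K X Rel"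

definition presented_module ::
  "'k ring \<Rightarrow> 'x set \<Rightarrow> ('k, 'x) lin_term rel \<Rightarrow> ('k, ('k, 'x) lin_term set) module" where
  "presented_module K X Rel =
    (let E = lin_cong K X Rel in
     \<lparr>carrier = lin_terms K X // E,
      mult = undefined,
      one = undefined,
      zero = E `` {LZero},
      add = (\<lambda>P Q. \<Union>p\<in>P. \<Union>q\<in>Q. E `` {LAdd p q}),
      smult = (\<lambda>c P. \<Union>p\<in>P. E `` {LScal c p})\<rparr>)"

primrec lin_eval :: "('k, 'a) module \<Rightarrow> ('x \<Rightarrow> 'a) \<Rightarrow> ('k, 'x) lin_term \<Rightarrow> 'a" where
  "lin_eval M f (LVar x) = f x"
| "lin_eval M f LZero = \<zero>\<^bsub>M\<^esub>"
| "lin_eval M f (LAdd p q) = lin_eval M f p \<oplus>\<^bsub>M\<^esub> lin_eval M f q"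
| "lin_eval M f (LScal c p) = c \<odot>\<^bsub>M\<^esub> lin_eval M f p"

datatype ('k, 'x) alg_term =
    AVar 'x
  | AZero
  | AOne
  | AAdd "('k, 'x) alg_term" "('k, 'x) alg_term"
  | AMult "('k, 'x) alg_term" "('k, 'x) alg_term"
  | AScal 'k "('k, 'x) alg_term"

inductive_set alg_terms :: "'k ring \<Rightarrow> 'x set \<Rightarrow> ('k, 'x) alg_term set"
  for K :: "'k ring" and X :: "'x set" where
  "x \<in> X \<Longrightarrow> AVar x \<in> alg_terms K X"
| "AZero \<in> alg_terms K X"
| "AOne \<in> alg_terms K X"
| "\<lbrakk>p \<in> alg_terms K X; q \<in> alg_terms K X\<rbrakk> \<Longrightarrow> AAdd p q \<in> alg_terms K X"
| "\<lbrakk>p \<in> alg_terms K X; q \<in> alg_terms K X\<rbrakk> \<Longrightarrow> AMult p q \<in> alg_terms K X"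
| "\<lbrakk>c \<in> carrier K; p \<in> alg_terms K X\<rbrakk> \<Longrightarrow> AScal c p \<in> alg_terms K X"

inductive_set alg_cong ::
    "'k ring \<Rightarrow> 'x set \<Rightarrow> ('k, 'x) alg_term rel \<Rightarrow> ('k, 'x) alg_term rel"
  for K :: "'k ring" and X :: "'x set" and Rel :: "('k, 'x) alg_term rel" where
  rel: "\<lbrakk>(p, q) \<in> Rel; p \<in> alg_terms K X; q \<in> alg_terms K X\<rbrakk> \<Longrightarrow> (p, q) \<in> alg_cong K X Rel"
| refl: "p \<in> alg_terms K X \<Longrightarrow> (p, p) \<in> alg_cong K X Rel"
| sym: "(p, q) \<in> alg_cong K X Rel \<Longrightarrow> (q, p) \<in> alg_cong K X Rel"
| trans: "\<lbrakk>(p, q) \<in> alg_cong K X Rel; (q, r) \<in> alg_cong K X Rel\<rbrakk> \<Longrightarrow> (p, r) \<in> alg_cong K X Rel"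
| add: "\<lbrakk>(p, p') \<in> alg_cong K X Rel; (q, q') \<in> alg_cong K X Rel\<rbrakk>
    \<Longrightarrow> (AAdd p q, AAdd p' q') \<in> alg_cong K X Rel"
| mult: "\<lbrakk>(p, p') \<in> alg_cong K X Rel; (q, q') \<in> alg_cong K X Rel\<rbrakk>
    \<Longrightarrow> (AMult p q, AMult p' q') \<in> alg_cong K X Rel"
| scal: "\<lbrakk>c \<in> carrier K; (p, p') \<in> alg_cong K X Rel\<rbrakk>
    \<Longrightarrow> (AScal c p, AScal c p') \<in> alg_cong K X Rel"
| add_assoc: "\<lbrakk>p \<in> alg_terms K X; q \<in> alg_terms K X; r \<in> alg_terms K X\<rbrakk>
    \<Longrightarrow> (AAdd (AAdd p q) r, AAdd p (AAdd q r)) \<in> alg_cong K X Rel"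
| add_comm: "\<lbrakk>p \<in> alg_terms K X; q \<in> alg_terms K X\<rbrakk>
    \<Longrightarrow> (AAdd p q, AAdd q p) \<in> alg_cong K X Rel"
| add_zero: "p \<in> alg_terms K X \<Longrightarrow> (AAdd AZero p, p) \<in> alg_cong K X Rel"
| add_neg: "p \<in> alg_terms K X
    \<Longrightarrow> (AAdd (AScal (\<ominus>\<^bsub>K\<^esub> \<one>\<^bsub>K\<^esub>) p) p, AZero) \<in> alg_cong K X Rel"
| scal_one: "p \<in> alg_terms K X \<Longrightarrow> (AScal \<one>\<^bsub>K\<^esub> p, p) \<in> alg_cong K X Rel"
| scal_scal: "\<lbrakk>c \<in> carrier K; d \<in> carrier K; p \<in> alg_terms K X\<rbrakk>
    \<Longrightarrow> (AScal (c \<otimes>\<^bsub>K\<^esub> d) p, AScal c (AScal d p)) \<in> alg_cong K X Rel"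
| scal_distl: "\<lbrakk>c \<in> carrier K; d \<in> carrier K; p \<in> alg_terms K X\<rbrakk>
    \<Longrightarrow> (AScal (c \<oplus>\<^bsub>K\<^esub> d) p, AAdd (AScal c p) (AScal d p)) \<in> alg_cong K X Rel"
| scal_distr: "\<lbrakk>c \<in> carrier K; p \<in> alg_terms K X; q \<in> alg_terms K X\<rbrakk>
    \<Longrightarrow> (AScal c (AAdd p q), AAdd (AScal c p) (AScal c q)) \<in> alg_cong K X Rel"
| mult_assoc: "\<lbrakk>p \<in> alg_terms K X; q \<in> alg_terms K X; r \<in> alg_terms K X\<rbrakk>
    \<Longrightarrow> (AMult (AMult p q) r, AMult p (AMult q r)) \<in> alg_cong K X Rel"
| one_left: "p \<in> alg_terms K X \<Longrightarrow> (AMult AOne p, p) \<in> alg_cong K X Rel"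
| one_right: "p \<in> alg_terms K X \<Longrightarrow> (AMult p AOne, p) \<in> alg_cong K X Rel"
| distl: "\<lbrakk>p \<in> alg_terms K X; q \<in> alg_terms K X; r \<in> alg_terms K X\<rbrakk>
    \<Longrightarrow> (AMult (AAdd p q) r, AAdd (AMult p r) (AMult q r)) \<in> alg_cong K X Rel"
| distr: "\<lbrakk>p \<in> alg_terms K X; q \<in> alg_terms K X; r \<in> alg_terms K X\<rbrakk>
    \<Longrightarrow> (AMult r (AAdd p q), AAdd (AMult r p) (AMult r q)) \<in> alg_cong K X Rel"
| mult_scal_left: "\<lbrakk>c \<in> carrier K; p \<in> alg_terms K X; q \<in> alg_terms K X\<rbrakk>
    \<Longrightarrow> (AMult (AScal c p) q, AScal c (AMult p q)) \<in> alg_cong K X Rel"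
| mult_scal_right: "\<lbrakk>c \<in> carrier K; p \<in> alg_terms K X; q \<in> alg_terms K X\<rbrakk>
    \<Longrightarrow> (AMult p (AScal c q), AScal c (AMult p q)) \<in> alg_cong K X Rel"

definition presented_algebra ::
  "'k ring \<Rightarrow> 'x set \<Rightarrow> ('k, 'x) alg_term rel \<Rightarrow> ('k, ('k, 'x) alg_term set) module" where
  "presented_algebra K X Rel =
    (let E = alg_cong K X Rel in
     \<lparr>carrier = alg_terms K X // E,
      mult = (\<lambda>P Q. \<Union>p\<in>P. \<Union>q\<in>Q. E `` {AMult p q}),
      one = E `` {AOne},
      zero = E `` {AZero},
      add = (\<lambda>P Q. \<Union>p\<in>P. \<Union>q\<in>Q. E `` {AAdd p q}),
      smult = (\<lambda>c P. \<Union>p\<in>P. E `` {AScal c p})\<rparr>)"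


section \<open>Tensor products and twisted tensor products\<close>

definition tensor_rels ::
  "'k ring \<Rightarrow> ('k, 'a) module \<Rightarrow> ('k, 'b) module \<Rightarrow> ('k, 'a \<times> 'b) lin_term rel" where
  "tensor_rels K M N =
     {(LVar (x \<oplus>\<^bsub>M\<^esub> x', y), LAdd (LVar (x, y)) (LVar (x', y))) | x x' y.
        x \<in> carrier M \<and> x' \<in> carrier M \<and> y \<in> carrier N}
   \<union> {(LVar (x, y \<oplus>\<^bsub>N\<^esub> y'), LAdd (LVar (x, y)) (LVar (x, y'))) | x y y'.
        x \<in> carrier M \<and> y \<in> carrier N \<and> y' \<in> carrier N}
   \<union> {(LVar (c \<odot>\<^bsub>M\<^esub> x, y), LScal c (LVar (x, y))) | c x y.
        c \<in> carrier K \<and> x \<in> carrier M \<and> y \<in> carrier N}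
   \<union> {(LVar (x, c \<odot>\<^bsub>N\<^esub> y), LScal c (LVar (x, y))) | c x y.
        c \<in> carrier K \<and> x \<in> carrier M \<and> y \<in> carrier N}"

type_synonym ('k, 'a, 'b) tens = "('k, 'a \<times> 'b) lin_term set"

definition tensor ::
  "'k ring \<Rightarrow> ('k, 'a) module \<Rightarrow> ('k, 'b) module \<Rightarrow> ('k, ('k, 'a, 'b) tens) module" where
  "tensor K M N = presented_module K (carrier M \<times> carrier N) (tensor_rels K M N)"

text \<open>The pure tensor \<open>x \<otimes> y\<close>.\<close>

definition tens ::
  "'k ring \<Rightarrow> ('k, 'a) module \<Rightarrow> ('k, 'b) module \<Rightarrow> 'a \<Rightarrow> 'b \<Rightarrow> ('k, 'a, 'b) tens" where
  "tens K M N x y = lin_cong K (carrier M \<times> carrier N) (tensor_rels K M N) `` {LVar (x, y)}"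

text \<open>For bilinear \<open>f\<close>, the linear map with values in \<open>P\<close> that sends \<open>x \<otimes> y\<close> to \<open>f x y\<close>;
  bilinearity makes the value independent of the representative.\<close>

definition tensor_lift :: "('k, 'c) module \<Rightarrow> ('a \<Rightarrow> 'b \<Rightarrow> 'c) \<Rightarrow> ('k, 'a, 'b) tens \<Rightarrow> 'c" where
  "tensor_lift P f z = lin_eval P (case_prod f) (SOME p. p \<in> z)"

definition tensor_map ::
  "'k ring \<Rightarrow> ('k, 'c) module \<Rightarrow> ('k, 'd) module \<Rightarrow> ('a \<Rightarrow> 'c) \<Rightarrow> ('b \<Rightarrow> 'd)
    \<Rightarrow> ('k, 'a, 'b) tens \<Rightarrow> ('k, 'c, 'd) tens" where
  "tensor_map K M' N' f g = tensor_lift (tensor K M' N') (\<lambda>x y. tens K M' N' (f x) (g y))"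

definition twisting_map ::
  "'k ring \<Rightarrow> ('k, 'a) module \<Rightarrow> ('k, 'b) module
    \<Rightarrow> (('k, 'b, 'a) tens \<Rightarrow> ('k, 'a, 'b) tens) \<Rightarrow> bool" where
  "twisting_map K A B \<tau> \<longleftrightarrow> \<tau> \<in> lin_hom K (tensor K B A) (tensor K A B)
     \<and> (\<forall>b\<in>carrier B. \<tau> (tens K B A b \<one>\<^bsub>A\<^esub>) = tens K A B \<one>\<^bsub>A\<^esub> b)
     \<and> (\<forall>a\<in>carrier A. \<tau> (tens K B A \<one>\<^bsub>B\<^esub> a) = tens K A B a \<one>\<^bsub>B\<^esub>)"

text \<open>The multiplication \<open>(\<mu>\<^sub>A \<otimes> \<mu>\<^sub>B) \<circ> (id \<otimes> \<tau> \<otimes> id)\<close> on tensors: if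
  \<open>\<tau> (b \<otimes> a') = \<Sum>\<^sub>l x\<^sub>l \<otimes> y\<^sub>l\<close>, then \<open>(a \<otimes> b) (a' \<otimes> b') = \<Sum>\<^sub>l a x\<^sub>l \<otimes> y\<^sub>l b'\<close>.\<close>

definition twisted_mult ::
  "'k ring \<Rightarrow> ('k, 'a) module \<Rightarrow> ('k, 'b) module
    \<Rightarrow> (('k, 'b, 'a) tens \<Rightarrow> ('k, 'a, 'b) tens)
    \<Rightarrow> ('k, 'a, 'b) tens \<Rightarrow> ('k, 'a, 'b) tens \<Rightarrow> ('k, 'a, 'b) tens" where
  "twisted_mult K A B \<tau> z z' =
     tensor_lift (tensor K A B) (\<lambda>a b.
       tensor_lift (tensor K A B) (\<lambda>a' b'.
         tensor_lift (tensor K A B) (\<lambda>x y. tens K A B (a \<otimes>\<^bsub>A\<^esub> x) (y \<otimes>\<^bsub>B\<^esub> b'))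
           (\<tau> (tens K B A b a')))
         z')
       z"

definition twisted_tensor ::
  "'k ring \<Rightarrow> ('k, 'a) module \<Rightarrow> ('k, 'b) module
    \<Rightarrow> (('k, 'b, 'a) tens \<Rightarrow> ('k, 'a, 'b) tens) \<Rightarrow> ('k, ('k, 'a, 'b) tens) module" where
  "twisted_tensor K A B \<tau> = (tensor K A B)
     \<lparr>mult := twisted_mult K A B \<tau>, one := tens K A B \<one>\<^bsub>A\<^esub> \<one>\<^bsub>B\<^esub>\<rparr>"

text \<open>The usual algebra \<open>A \<otimes> B\<close>, with \<open>(a \<otimes> b) (a' \<otimes> b') = a a' \<otimes> b b'\<close>: here \<open>\<tau>\<close> is the
  flip \<open>b \<otimes> a \<mapsto> a \<otimes> b\<close>.\<close>

definition tensor_algebra ::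
  "'k ring \<Rightarrow> ('k, 'a) module \<Rightarrow> ('k, 'b) module \<Rightarrow> ('k, ('k, 'a, 'b) tens) module" where
  "tensor_algebra K A B =
     twisted_tensor K A B (tensor_lift (tensor K A B) (\<lambda>b a. tens K A B a b))"


section \<open>Automorphisms\<close>

definition commuting_automorphisms ::
  "'k ring \<Rightarrow> nat \<Rightarrow> ('k, 'a) module \<Rightarrow> (nat \<Rightarrow> 'a \<Rightarrow> 'a) \<Rightarrow> bool" where
  "commuting_automorphisms K n A f \<longleftrightarrow>
     (\<forall>i\<in>{1..n}. f i \<in> alg_iso K A A)
     \<and> (\<forall>i\<in>{1..n}. \<forall>j\<in>{1..n}. \<forall>x\<in>carrier A. f i (f j x) = f j (f i x))"

text \<open>The power \<open>g\<^sup>z\<close> of a bijection \<open>g\<close> of the carrier of \<open>A\<close>.\<close>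

definition aut_pow :: "('a, 'm) ring_scheme \<Rightarrow> ('a \<Rightarrow> 'a) \<Rightarrow> int \<Rightarrow> 'a \<Rightarrow> 'a" where
  "aut_pow A g z =
     (if z \<ge> 0 then g ^^ nat z else inv_into (carrier A) g ^^ nat (- z))"

text \<open>\<open>f\<^sup>\<alpha> = f\<^sub>1\<^bsup>\<alpha> 1\<^esup> \<circ> \<dots> \<circ> f\<^sub>n\<^bsup>\<alpha> n\<^esup>\<close>\<close>

definition multi_aut_pow ::
  "('a, 'm) ring_scheme \<Rightarrow> nat \<Rightarrow> (nat \<Rightarrow> 'a \<Rightarrow> 'a) \<Rightarrow> (nat \<Rightarrow> int) \<Rightarrow> 'a \<Rightarrow> 'a" where
  "multi_aut_pow A n f \<alpha> = foldr (\<lambda>i g. aut_pow A (f i) (\<alpha> i) \<circ> g) [1..<Suc n] id"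

text \<open>The actions on \<open>R\<close> and on \<open>S\<close> of a self-map of \<open>R \<otimes> S\<close> that preserves \<open>R \<otimes> 1\<close>,
  respectively \<open>1 \<otimes> S\<close>. The maps \<open>r \<mapsto> r \<otimes> 1\<close> and \<open>s \<mapsto> 1 \<otimes> s\<close> are injective unless
  \<open>R \<otimes> S\<close> is the zero algebra.\<close>

definition act_left ::
  "'k ring \<Rightarrow> ('k, 'r) module \<Rightarrow> ('k, 's) module
    \<Rightarrow> (('k, 'r, 's) tens \<Rightarrow> ('k, 'r, 's) tens) \<Rightarrow> 'r \<Rightarrow> 'r" where
  "act_left K R S g r =
     inv_into (carrier R) (\<lambda>x. tens K R S x \<one>\<^bsub>S\<^esub>) (g (tens K R S r \<one>\<^bsub>S\<^esub>))"

definition act_right ::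
  "'k ring \<Rightarrow> ('k, 'r) module \<Rightarrow> ('k, 's) module
    \<Rightarrow> (('k, 'r, 's) tens \<Rightarrow> ('k, 'r, 's) tens) \<Rightarrow> 's \<Rightarrow> 's" where
  "act_right K R S g s =
     inv_into (carrier S) (\<lambda>y. tens K R S \<one>\<^bsub>R\<^esub> y) (g (tens K R S \<one>\<^bsub>R\<^esub> s))"


section \<open>Twisted generalized Weyl constructions and algebras\<close>

definition tgwd ::
  "'k ring \<Rightarrow> nat \<Rightarrow> ('k, 'r) module \<Rightarrow> (nat \<Rightarrow> 'r \<Rightarrow> 'r) \<Rightarrow> (nat \<Rightarrow> 'r) \<Rightarrow> bool" where
  "tgwd K n R \<sigma> t \<longleftrightarrow> k_algebra K R \<and> commuting_automorphisms K n R \<sigma>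
     \<and> (\<forall>i\<in>{1..n}. t i \<in> center R)"

definition regular_datum :: "nat \<Rightarrow> ('k, 'r) module \<Rightarrow> (nat \<Rightarrow> 'r) \<Rightarrow> bool" where
  "regular_datum n R t \<longleftrightarrow> (\<forall>i\<in>{1..n}. regular_element R (t i))"

text \<open>The set \<open>\<plusminus>[n]\<close>.\<close>

definition pm :: "nat \<Rightarrow> int set" where
  "pm n = {u. u \<noteq> 0 \<and> \<bar>u\<bar> \<le> int n}"

text \<open>\<open>Gen u\<close> stands for \<open>X\<^sub>u\<close>; thus \<open>X\<^sub>i\<^sup>+\<close> is \<open>Gen i\<close> and \<open>X\<^sub>i\<^sup>-\<close> is \<open>Gen (- i)\<close>.\<close>

datatype 'r letter = Coeff 'r | Gen int

definition tgwc_gens :: "nat \<Rightarrow> ('k, 'r) module \<Rightarrow> 'r letter set" where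
  "tgwc_gens n R = Coeff ` carrier R \<union> Gen ` pm n"

text \<open>The first four rules make \<open>r \<mapsto> Coeff r\<close> an algebra homomorphism.\<close>

inductive_set tgwc_rels ::
    "'k ring \<Rightarrow> nat \<Rightarrow> (nat \<Rightarrow> nat \<Rightarrow> 'k) \<Rightarrow> ('k, 'r) module \<Rightarrow> (nat \<Rightarrow> 'r \<Rightarrow> 'r) \<Rightarrow> (nat \<Rightarrow> 'r)
      \<Rightarrow> ('k, 'r letter) alg_term rel"
  for K :: "'k ring" and n :: nat and \<mu> :: "nat \<Rightarrow> nat \<Rightarrow> 'k" and R :: "('k, 'r) module"
    and \<sigma> :: "nat \<Rightarrow> 'r \<Rightarrow> 'r" and t :: "nat \<Rightarrow> 'r" where
  coeff_add: "\<lbrakk>r \<in> carrier R; r' \<in> carrier R\<rbrakk>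
    \<Longrightarrow> (AVar (Coeff (r \<oplus>\<^bsub>R\<^esub> r')), AAdd (AVar (Coeff r)) (AVar (Coeff r'))) \<in> tgwc_rels K n \<mu> R \<sigma> t"
| coeff_mult: "\<lbrakk>r \<in> carrier R; r' \<in> carrier R\<rbrakk>
    \<Longrightarrow> (AVar (Coeff (r \<otimes>\<^bsub>R\<^esub> r')), AMult (AVar (Coeff r)) (AVar (Coeff r'))) \<in> tgwc_rels K n \<mu> R \<sigma> t"
| coeff_one: "(AVar (Coeff \<one>\<^bsub>R\<^esub>), AOne) \<in> tgwc_rels K n \<mu> R \<sigma> t"
| coeff_scal: "\<lbrakk>c \<in> carrier K; r \<in> carrier R\<rbrakk>
    \<Longrightarrow> (AVar (Coeff (c \<odot>\<^bsub>R\<^esub> r)), AScal c (AVar (Coeff r))) \<in> tgwc_rels K n \<mu> R \<sigma> t"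
| plus_coeff: "\<lbrakk>i \<in> {1..n}; r \<in> carrier R\<rbrakk>
    \<Longrightarrow> (AMult (AVar (Gen (int i))) (AVar (Coeff r)),
         AMult (AVar (Coeff (\<sigma> i r))) (AVar (Gen (int i)))) \<in> tgwc_rels K n \<mu> R \<sigma> t"
| minus_coeff: "\<lbrakk>i \<in> {1..n}; r \<in> carrier R\<rbrakk>
    \<Longrightarrow> (AMult (AVar (Gen (- int i))) (AVar (Coeff r)),
         AMult (AVar (Coeff (inv_into (carrier R) (\<sigma> i) r))) (AVar (Gen (- int i))))
          \<in> tgwc_rels K n \<mu> R \<sigma> t"
| minus_plus: "i \<in> {1..n}
    \<Longrightarrow> (AMult (AVar (Gen (- int i))) (AVar (Gen (int i))), AVar (Coeff (t i)))
          \<in> tgwc_rels K n \<mu> R \<sigma> t"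
| plus_minus: "i \<in> {1..n}
    \<Longrightarrow> (AMult (AVar (Gen (int i))) (AVar (Gen (- int i))), AVar (Coeff (\<sigma> i (t i))))
          \<in> tgwc_rels K n \<mu> R \<sigma> t"
| exchange: "\<lbrakk>i \<in> {1..n}; j \<in> {1..n}; i \<noteq> j\<rbrakk>
    \<Longrightarrow> (AMult (AVar (Gen (int i))) (AVar (Gen (- int j))),
         AScal (\<mu> i j) (AMult (AVar (Gen (- int j))) (AVar (Gen (int i))))) \<in> tgwc_rels K n \<mu> R \<sigma> t"

type_synonym ('k, 'r) tgwc = "('k, 'r letter) alg_term set"

definition TGWC ::
  "'k ring \<Rightarrow> nat \<Rightarrow> (nat \<Rightarrow> nat \<Rightarrow> 'k) \<Rightarrow> ('k, 'r) module \<Rightarrow> (nat \<Rightarrow> 'r \<Rightarrow> 'r) \<Rightarrow> (nat \<Rightarrow> 'r)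
    \<Rightarrow> ('k, ('k, 'r) tgwc) module" where
  "TGWC K n \<mu> R \<sigma> t = presented_algebra K (tgwc_gens n R) (tgwc_rels K n \<mu> R \<sigma> t)"

definition tgwc_letter ::
  "'k ring \<Rightarrow> nat \<Rightarrow> (nat \<Rightarrow> nat \<Rightarrow> 'k) \<Rightarrow> ('k, 'r) module \<Rightarrow> (nat \<Rightarrow> 'r \<Rightarrow> 'r) \<Rightarrow> (nat \<Rightarrow> 'r)
    \<Rightarrow> 'r letter \<Rightarrow> ('k, 'r) tgwc" where
  "tgwc_letter K n \<mu> R \<sigma> t a = alg_cong K (tgwc_gens n R) (tgwc_rels K n \<mu> R \<sigma> t) `` {AVar a}"

text \<open>The element \<open>r X\<^sub>u\<close> of the construction, for a finite sequence \<open>u\<close> in \<open>\<plusminus>[n]\<close>.\<close>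

definition tgwc_monom ::
  "'k ring \<Rightarrow> nat \<Rightarrow> (nat \<Rightarrow> nat \<Rightarrow> 'k) \<Rightarrow> ('k, 'r) module \<Rightarrow> (nat \<Rightarrow> 'r \<Rightarrow> 'r) \<Rightarrow> (nat \<Rightarrow> 'r)
    \<Rightarrow> 'r \<Rightarrow> int list \<Rightarrow> ('k, 'r) tgwc" where
  "tgwc_monom K n \<mu> R \<sigma> t r us =
     (let C = TGWC K n \<mu> R \<sigma> t; X = tgwc_letter K n \<mu> R \<sigma> t in
      X (Coeff r) \<otimes>\<^bsub>C\<^esub> foldr (\<lambda>u x. X (Gen u) \<otimes>\<^bsub>C\<^esub> x) us \<one>\<^bsub>C\<^esub>)"

text \<open>Degrees, elements of \<open>\<int>\<^sup>n\<close>, are functions that vanish outside \<open>{1..n}\<close>.\<close>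

definition gen_degree :: "int \<Rightarrow> nat \<Rightarrow> int" where
  "gen_degree u = (\<lambda>i. if \<bar>u\<bar> = int i then sgn u else 0)"

fun letter_degree :: "'r letter \<Rightarrow> nat \<Rightarrow> int" where
  "letter_degree (Coeff r) = (\<lambda>_. 0)"
| "letter_degree (Gen u) = gen_degree u"

definition word_degree :: "int list \<Rightarrow> nat \<Rightarrow> int" where
  "word_degree us = (\<lambda>i. \<Sum>u\<leftarrow>us. gen_degree u i)"

text \<open>The grading determined by the degrees of the letters:
  \<open>tgwc_homogeneous K n \<mu> R \<sigma> t \<alpha> x\<close> says that \<open>x\<close> is homogeneous of degree \<open>\<alpha>\<close>.\<close>

inductive tgwc_homogeneous ::
    "'k ring \<Rightarrow> nat \<Rightarrow> (nat \<Rightarrow> nat \<Rightarrow> 'k) \<Rightarrow> ('k, 'r) module \<Rightarrow> (nat \<Rightarrow> 'r \<Rightarrow> 'r) \<Rightarrow> (nat \<Rightarrow> 'r)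
      \<Rightarrow> (nat \<Rightarrow> int) \<Rightarrow> ('k, 'r) tgwc \<Rightarrow> bool"
  for K :: "'k ring" and n :: nat and \<mu> :: "nat \<Rightarrow> nat \<Rightarrow> 'k" and R :: "('k, 'r) module"
    and \<sigma> :: "nat \<Rightarrow> 'r \<Rightarrow> 'r" and t :: "nat \<Rightarrow> 'r" where
  letter: "a \<in> tgwc_gens n R
    \<Longrightarrow> tgwc_homogeneous K n \<mu> R \<sigma> t (letter_degree a) (tgwc_letter K n \<mu> R \<sigma> t a)"
| zero: "tgwc_homogeneous K n \<mu> R \<sigma> t \<alpha> \<zero>\<^bsub>TGWC K n \<mu> R \<sigma> t\<^esub>"
| add: "\<lbrakk>tgwc_homogeneous K n \<mu> R \<sigma> t \<alpha> x; tgwc_homogeneous K n \<mu> R \<sigma> t \<alpha> y\<rbrakk>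
    \<Longrightarrow> tgwc_homogeneous K n \<mu> R \<sigma> t \<alpha> (x \<oplus>\<^bsub>TGWC K n \<mu> R \<sigma> t\<^esub> y)"
| scal: "\<lbrakk>c \<in> carrier K; tgwc_homogeneous K n \<mu> R \<sigma> t \<alpha> x\<rbrakk>
    \<Longrightarrow> tgwc_homogeneous K n \<mu> R \<sigma> t \<alpha> (c \<odot>\<^bsub>TGWC K n \<mu> R \<sigma> t\<^esub> x)"
| mult: "\<lbrakk>tgwc_homogeneous K n \<mu> R \<sigma> t \<alpha> x; tgwc_homogeneous K n \<mu> R \<sigma> t \<beta> y\<rbrakk>
    \<Longrightarrow> tgwc_homogeneous K n \<mu> R \<sigma> t (\<lambda>i. \<alpha> i + \<beta> i) (x \<otimes>\<^bsub>TGWC K n \<mu> R \<sigma> t\<^esub> y)"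

definition tgwc_component ::
  "'k ring \<Rightarrow> nat \<Rightarrow> (nat \<Rightarrow> nat \<Rightarrow> 'k) \<Rightarrow> ('k, 'r) module \<Rightarrow> (nat \<Rightarrow> 'r \<Rightarrow> 'r) \<Rightarrow> (nat \<Rightarrow> 'r)
    \<Rightarrow> (nat \<Rightarrow> int) \<Rightarrow> ('k, 'r) tgwc set" where
  "tgwc_component K n \<mu> R \<sigma> t \<alpha> = {x. tgwc_homogeneous K n \<mu> R \<sigma> t \<alpha> x}"

definition tgwc_graded_ideal ::
  "'k ring \<Rightarrow> nat \<Rightarrow> (nat \<Rightarrow> nat \<Rightarrow> 'k) \<Rightarrow> ('k, 'r) module \<Rightarrow> (nat \<Rightarrow> 'r \<Rightarrow> 'r) \<Rightarrow> (nat \<Rightarrow> 'r)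
    \<Rightarrow> ('k, 'r) tgwc set \<Rightarrow> bool" where
  "tgwc_graded_ideal K n \<mu> R \<sigma> t J \<longleftrightarrow>
     (let C = TGWC K n \<mu> R \<sigma> t in
      ideal J C \<and>
      (\<forall>x\<in>J. \<exists>F c. finite F \<and> (\<forall>\<alpha>\<in>F. c \<alpha> \<in> J \<inter> tgwc_component K n \<mu> R \<sigma> t \<alpha>)
         \<and> x = (\<Oplus>\<^bsub>C\<^esub>\<alpha>\<in>F. c \<alpha>)))"

text \<open>The sum of all graded ideals whose component of degree 0 is zero.\<close>

definition canonical_ideal ::
  "'k ring \<Rightarrow> nat \<Rightarrow> (nat \<Rightarrow> nat \<Rightarrow> 'k) \<Rightarrow> ('k, 'r) module \<Rightarrow> (nat \<Rightarrow> 'r \<Rightarrow> 'r) \<Rightarrow> (nat \<Rightarrow> 'r)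
    \<Rightarrow> ('k, 'r) tgwc set" where
  "canonical_ideal K n \<mu> R \<sigma> t =
     (let C = TGWC K n \<mu> R \<sigma> t;
          \<G> = {J. tgwc_graded_ideal K n \<mu> R \<sigma> t J
                 \<and> J \<inter> tgwc_component K n \<mu> R \<sigma> t (\<lambda>_. 0) = {\<zero>\<^bsub>C\<^esub>}}
      in {(\<Oplus>\<^bsub>C\<^esub>J\<in>F. c J) | F c. finite F \<and> F \<subseteq> \<G> \<and> (\<forall>J\<in>F. c J \<in> J)})"

definition TGWA ::
  "'k ring \<Rightarrow> nat \<Rightarrow> (nat \<Rightarrow> nat \<Rightarrow> 'k) \<Rightarrow> ('k, 'r) module \<Rightarrow> (nat \<Rightarrow> 'r \<Rightarrow> 'r) \<Rightarrow> (nat \<Rightarrow> 'r)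
    \<Rightarrow> ('k, ('k, 'r) tgwc set) module" where
  "TGWA K n \<mu> R \<sigma> t = alg_quot (TGWC K n \<mu> R \<sigma> t) (canonical_ideal K n \<mu> R \<sigma> t)"

definition tgwa_proj ::
  "'k ring \<Rightarrow> nat \<Rightarrow> (nat \<Rightarrow> nat \<Rightarrow> 'k) \<Rightarrow> ('k, 'r) module \<Rightarrow> (nat \<Rightarrow> 'r \<Rightarrow> 'r) \<Rightarrow> (nat \<Rightarrow> 'r)
    \<Rightarrow> ('k, 'r) tgwc \<Rightarrow> ('k, 'r) tgwc set" where
  "tgwa_proj K n \<mu> R \<sigma> t x = canonical_ideal K n \<mu> R \<sigma> t +>\<^bsub>TGWC K n \<mu> R \<sigma> t\<^esub> x"

definition consistent_datum ::
  "'k ring \<Rightarrow> nat \<Rightarrow> (nat \<Rightarrow> nat \<Rightarrow> 'k) \<Rightarrow> ('k, 'r) module \<Rightarrow> (nat \<Rightarrow> 'r \<Rightarrow> 'r) \<Rightarrow> (nat \<Rightarrow> 'r)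
    \<Rightarrow> bool" where
  "consistent_datum K n \<mu> R \<sigma> t \<longleftrightarrow>
     inj_on (\<lambda>r. tgwa_proj K n \<mu> R \<sigma> t (tgwc_letter K n \<mu> R \<sigma> t (Coeff r))) (carrier R)"

definition nonzero_matrix :: "'k ring \<Rightarrow> nat \<Rightarrow> (nat \<Rightarrow> nat \<Rightarrow> 'k) \<Rightarrow> bool" where
  "nonzero_matrix K n \<mu> \<longleftrightarrow> (\<forall>i\<in>{1..n}. \<forall>j\<in>{1..n}. \<mu> i j \<in> carrier K - {\<zero>\<^bsub>K\<^esub>})"

text \<open>All the data of a regular, \<open>\<mu>\<close>-consistent TGWC or TGWA of rank \<open>n\<close>.\<close>

definition regular_consistent ::
  "'k ring \<Rightarrow> nat \<Rightarrow> (nat \<Rightarrow> nat \<Rightarrow> 'k) \<Rightarrow> ('k, 'r) module \<Rightarrow> (nat \<Rightarrow> 'r \<Rightarrow> 'r) \<Rightarrow> (nat \<Rightarrow> 'r)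
    \<Rightarrow> bool" where
  "regular_consistent K n \<mu> R \<sigma> t \<longleftrightarrow> tgwd K n R \<sigma> t \<and> nonzero_matrix K n \<mu>
     \<and> regular_datum n R t \<and> consistent_datum K n \<mu> R \<sigma> t"


section \<open>The scalars and the combined datum\<close>

text \<open>The scalar \<open>q\<^sub>i\<^sub>j\<^bsup>(a,b)\<^esup>\<close> is written \<open>q i j a b\<close>, with the signs \<open>a\<close> and \<open>b\<close> encoded as
  \<open>1\<close> and \<open>-1\<close>.\<close>

definition q_words ::
  "'k ring \<Rightarrow> (nat \<Rightarrow> nat \<Rightarrow> int \<Rightarrow> int \<Rightarrow> 'k) \<Rightarrow> int list \<Rightarrow> int list \<Rightarrow> 'k" where
  "q_words K q vs us = (\<Otimes>\<^bsub>K\<^esub>i\<in>{..<length vs}. \<Otimes>\<^bsub>K\<^esub>j\<in>{..<length us}.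
     q (nat \<bar>vs ! i\<bar>) (nat \<bar>us ! j\<bar>) (sgn (vs ! i)) (sgn (us ! j)))"

definition comb_aut :: "nat \<Rightarrow> (nat \<Rightarrow> 'a \<Rightarrow> 'a) \<Rightarrow> (nat \<Rightarrow> 'a \<Rightarrow> 'a) \<Rightarrow> nat \<Rightarrow> 'a \<Rightarrow> 'a" where
  "comb_aut m \<sigma> \<rho> i = (if i \<le> m then \<sigma> i else \<rho> (i - m))"

definition comb_elem ::
  "'k ring \<Rightarrow> ('k, 'r) module \<Rightarrow> ('k, 's) module \<Rightarrow> nat \<Rightarrow> (nat \<Rightarrow> 'r) \<Rightarrow> (nat \<Rightarrow> 's)
    \<Rightarrow> nat \<Rightarrow> ('k, 'r, 's) tens" where
  "comb_elem K R S m t h i =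
     (if i \<le> m then tens K R S (t i) \<one>\<^bsub>S\<^esub> else tens K R S \<one>\<^bsub>R\<^esub> (h (i - m)))"

definition comb_matrix ::
  "'k ring \<Rightarrow> nat \<Rightarrow> (nat \<Rightarrow> nat \<Rightarrow> 'k) \<Rightarrow> (nat \<Rightarrow> nat \<Rightarrow> 'k)
    \<Rightarrow> (nat \<Rightarrow> nat \<Rightarrow> int \<Rightarrow> int \<Rightarrow> 'k) \<Rightarrow> nat \<Rightarrow> nat \<Rightarrow> 'k" where
  "comb_matrix K m \<mu> \<nu> q i j =
     (if i \<le> m \<and> j \<le> m then \<mu> i j
      else if i \<le> m then inv\<^bsub>K\<^esub> (q (j - m) i (-1) 1)
      else if j \<le> m then q (i - m) j 1 (-1)
      else \<nu> (i - m) (j - m))"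

end

theory Submission
  imports Defs
begin

text \<open>The argument rests on a criterion that recognizes twisted generalized Weyl algebras. Let an algebra \<open>A\<close> be
  generated by images of the coefficients and of the letters that satisfy the relations of a datum, so that it is spanned
  by monomials \<open>r X\<^sub>u\<close>, and let \<open>p\<^sub>0\<close> be a linear projection onto the monomials of degree \<open>0\<close> that kills the others. The
  relations turn every word of degree \<open>0\<close> into a coefficient (\<open>degree_zero_coeff\<close>), so \<open>p\<^sub>0\<close> takes values in the image of
  \<open>R\<close>. If \<open>R\<close> embeds into \<open>A\<close> and every \<open>z \<noteq> 0\<close> satisfies \<open>p\<^sub>0 (a z b) \<noteq> 0\<close> for some \<open>a\<close> and \<open>b\<close>, then \<open>A\<close> is the
  algebra \<open>TGWA\<close> of the datum, and the datum is consistent (\<open>tgwa_iso\<close>). The reason is that the canonical ideal is the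
  set of all \<open>x\<close> with \<open>p\<^sub>0 (a x b) = 0\<close> for all \<open>a\<close>, \<open>b\<close> (\<open>canonical_ideal_eq\<close>): this set is a graded ideal without
  component of degree \<open>0\<close>, it contains all others, and it is the kernel of the map from the construction to \<open>A\<close>.

  The twisting map descends to the quotients because, on the component of degree \<open>\<alpha>\<close>, \<open>\<tau> (s Y\<^sub>v \<otimes> x)\<close> equals
  \<open>\<theta> x \<otimes> \<sigma>\<^bsup>-\<alpha>\<^esup>(s) Y\<^sub>v\<close>, where \<open>\<theta>\<close> is a surjective endomorphism that multiplies monomials by nonzero scalars and moves
  their coefficients by a power of \<open>\<rho>\<close>. Such a map commutes with \<open>p\<^sub>0\<close>, so it preserves the canonical ideal
  (\<open>scaling_radical\<close>, \<open>G_radical\<close>).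

  Products of monomials in \<open>A \<otimes>\<^sub>\<tau> B\<close> are explicit (\<open>M_mult\<close>); associativity and the relations of the combined datum can be
  read off. The criterion applies with the projection \<open>p\<^sub>0 \<otimes> p\<^sub>0\<close>. Coefficients embed because over a field the tensor
  product of injective maps is injective (\<open>map_nonzero\<close>); the same fact makes the combined datum regular. For the
  nondegeneracy, regularity allows one to multiply on one side only: \<open>p\<^sub>0 (a x) \<noteq> 0\<close> for some \<open>a\<close> if \<open>x \<noteq> 0\<close>, and likewise
  on the right (\<open>regular_nondeg\<close>). Hence an element \<open>z \<noteq> 0\<close> of \<open>A \<otimes> B\<close> is multiplied by some \<open>a \<otimes> 1\<close> on the left and by some
  \<open>1 \<otimes> b\<close> on the right; each multiplication acts on one tensor factor without involving \<open>\<tau>\<close>, and linear functionals on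
  the other factor reduce the claim to \<open>A\<close> and to \<open>B\<close> (\<open>W_nondeg\<close>).\<close>


section \<open>Vector spaces\<close>

text \<open>Additive spans suffice for all spanning sets below, since each of them is stable under scalars: pure tensors and
  monomials.\<close>

inductive_set add_span :: "('a, 'm) ring_scheme \<Rightarrow> 'a set \<Rightarrow> 'a set"
  for M and B where
  zero: "\<zero>\<^bsub>M\<^esub> \<in> add_span M B"
| add: "b \<in> B \<Longrightarrow> x \<in> add_span M B \<Longrightarrow> b \<oplus>\<^bsub>M\<^esub> x \<in> add_span M B"

lemma (in abelian_monoid) add_span_add:
  assumes "B \<subseteq> carrier G" "x \<in> add_span G B" "y \<in> add_span G B"
  shows "x \<in> carrier G \<and> x \<oplus> y \<in> add_span G B"
proof -
  have c: "y \<in> carrier G" if "y \<in> add_span G B" for y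
    using that by induction (use assms(1) in auto)
  show ?thesis
    using assms(2)
  proof induction
    case zero then show ?case using assms c by auto
  next
    case (add b x)
    then have "b \<oplus> x \<oplus> y = b \<oplus> (x \<oplus> y)"
      using assms(1) c[OF assms(3)] by (auto intro!: a_assoc)
    then show ?case using add assms(1) by (auto intro: add_span.add)
  qed
qed

lemma (in abelian_monoid) add_span_carrier: "B \<subseteq> carrier G \<Longrightarrow> x \<in> add_span G B \<Longrightarrow> x \<in> carrier G"
  using add_span_add by blast

lemma (in abelian_monoid) add_span_base: "B \<subseteq> carrier G \<Longrightarrow> b \<in> B \<Longrightarrow> b \<in> add_span G B"
  using add_span.add[OF _ add_span.zero, of b B G] by auto

locale vec_space = K?: field K + module K M
  for K :: "'k ring" (structure) and M :: "('k, 'a) module" (structure)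

lemma k_algebra_vec_space: "k_algebra K A \<Longrightarrow> vec_space K A"
  by (simp add: k_algebra_def vec_space_def)

lemma vec_spaceI: "field K \<Longrightarrow> module K M \<Longrightarrow> vec_space K M"
  by (simp add: vec_space_def)

lemma lin_homD:
  assumes "f \<in> lin_hom K M N"
  shows "x \<in> carrier M \<Longrightarrow> f x \<in> carrier N"
    "x \<in> carrier M \<Longrightarrow> y \<in> carrier M \<Longrightarrow> f (x \<oplus>\<^bsub>M\<^esub> y) = f x \<oplus>\<^bsub>N\<^esub> f y"
    "c \<in> carrier K \<Longrightarrow> x \<in> carrier M \<Longrightarrow> f (c \<odot>\<^bsub>M\<^esub> x) = c \<odot>\<^bsub>N\<^esub> f x"
  using assms unfolding lin_hom_def by auto

lemma lin_homI:
  assumes "\<And>x. x \<in> carrier M \<Longrightarrow> f x \<in> carrier N"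
    "\<And>x y. x \<in> carrier M \<Longrightarrow> y \<in> carrier M \<Longrightarrow> f (x \<oplus>\<^bsub>M\<^esub> y) = f x \<oplus>\<^bsub>N\<^esub> f y"
    "\<And>c x. c \<in> carrier K \<Longrightarrow> x \<in> carrier M \<Longrightarrow> f (c \<odot>\<^bsub>M\<^esub> x) = c \<odot>\<^bsub>N\<^esub> f x"
  shows "f \<in> lin_hom K M N"
  using assms unfolding lin_hom_def by auto

lemma lin_hom_zero:
  assumes "f \<in> lin_hom K M N" "vec_space K M" "vec_space K N"
  shows "f \<zero>\<^bsub>M\<^esub> = \<zero>\<^bsub>N\<^esub>"
proof -
  interpret M: vec_space K M by fact
  interpret N: vec_space K N by fact
  have "f (\<zero>\<^bsub>K\<^esub> \<odot>\<^bsub>M\<^esub> \<zero>\<^bsub>M\<^esub>) = \<zero>\<^bsub>K\<^esub> \<odot>\<^bsub>N\<^esub> f \<zero>\<^bsub>M\<^esub>"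
    by (rule lin_homD[OF assms(1)]) auto
  then show ?thesis using lin_homD(1)[OF assms(1)] by simp
qed

lemma (in vec_space) uminus_eq_smult: "x \<in> carrier M \<Longrightarrow> \<ominus>\<^bsub>M\<^esub> x = (\<ominus> \<one>) \<odot>\<^bsub>M\<^esub> x"
  by (simp add: smult_l_minus)

lemma lin_hom_minus:
  assumes "f \<in> lin_hom K M N" "vec_space K M" "vec_space K N" "x \<in> carrier M" "y \<in> carrier M"
  shows "f (x \<ominus>\<^bsub>M\<^esub> y) = f x \<ominus>\<^bsub>N\<^esub> f y"
proof -
  interpret M: vec_space K M by fact
  interpret N: vec_space K N by fact
  show ?thesis using assms lin_homD[OF assms(1)]
    by (simp add: a_minus_def M.uminus_eq_smult N.uminus_eq_smult)
qed

lemma zero_lin_hom: "vec_space K P \<Longrightarrow> (\<lambda>_. \<zero>\<^bsub>P\<^esub>) \<in> lin_hom K M P"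
proof -
  assume "vec_space K P"
  then interpret P: vec_space K P .
  show ?thesis by (rule lin_homI) auto
qed

lemma lin_hom_comp:
  "f \<in> lin_hom K M N \<Longrightarrow> g \<in> lin_hom K N P \<Longrightarrow> (\<lambda>x. g (f x)) \<in> lin_hom K M P"
  by (rule lin_homI) (simp_all add: lin_homD)

text \<open>Equalities between linear maps are verified on generators; nearly every identity in a tensor product or in an algebra
  spanned by monomials is reduced to an explicit computation in this way.\<close>

lemma lin_hom_eq_on_span:
  assumes "f \<in> lin_hom K M N" "g \<in> lin_hom K M N" "vec_space K M" "vec_space K N"
    "carrier M \<subseteq> add_span M B" "B \<subseteq> carrier M" "\<And>b. b \<in> B \<Longrightarrow> f b = g b" "x \<in> carrier M"
  shows "f x = g x"
proof -
  interpret M: vec_space K M by fact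
  have "x \<in> add_span M B" using assms by auto
  then show ?thesis
  proof induction
    case zero then show ?case using lin_hom_zero assms by metis
  next
    case (add b x)
    then show ?case using assms M.add_span_carrier[OF assms(6)] by (auto simp: lin_homD)
  qed
qed

text \<open>The ring \<open>K\<close> is not a module record, so functionals are not literally elements of some \<open>lin_hom\<close>.\<close>

definition dual :: "'k ring \<Rightarrow> ('k, 'a) module \<Rightarrow> ('a \<Rightarrow> 'k) set" where
  "dual K M = {f. f \<in> carrier M \<rightarrow> carrier K
     \<and> (\<forall>x\<in>carrier M. \<forall>y\<in>carrier M. f (x \<oplus>\<^bsub>M\<^esub> y) = f x \<oplus>\<^bsub>K\<^esub> f y)
     \<and> (\<forall>c\<in>carrier K. \<forall>x\<in>carrier M. f (c \<odot>\<^bsub>M\<^esub> x) = c \<otimes>\<^bsub>K\<^esub> f x)}"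

lemma dualD:
  assumes "f \<in> dual K M"
  shows "x \<in> carrier M \<Longrightarrow> f x \<in> carrier K"
    "x \<in> carrier M \<Longrightarrow> y \<in> carrier M \<Longrightarrow> f (x \<oplus>\<^bsub>M\<^esub> y) = f x \<oplus>\<^bsub>K\<^esub> f y"
    "c \<in> carrier K \<Longrightarrow> x \<in> carrier M \<Longrightarrow> f (c \<odot>\<^bsub>M\<^esub> x) = c \<otimes>\<^bsub>K\<^esub> f x"
  using assms unfolding dual_def by auto

definition subspace_of :: "'k ring \<Rightarrow> ('k, 'a) module \<Rightarrow> 'a set \<Rightarrow> bool" where
  "subspace_of K M U \<longleftrightarrow> U \<subseteq> carrier M \<and> \<zero>\<^bsub>M\<^esub> \<in> U \<and> (\<forall>x\<in>U. \<forall>y\<in>U. x \<oplus>\<^bsub>M\<^esub> y \<in> U)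
     \<and> (\<forall>c\<in>carrier K. \<forall>x\<in>U. c \<odot>\<^bsub>M\<^esub> x \<in> U)"

lemma subspace_ofD:
  assumes "subspace_of K M U"
  shows "x \<in> U \<Longrightarrow> x \<in> carrier M" "\<zero>\<^bsub>M\<^esub> \<in> U" "x \<in> U \<Longrightarrow> y \<in> U \<Longrightarrow> x \<oplus>\<^bsub>M\<^esub> y \<in> U"
    "c \<in> carrier K \<Longrightarrow> x \<in> U \<Longrightarrow> c \<odot>\<^bsub>M\<^esub> x \<in> U"
  using assms unfolding subspace_of_def by auto

context vec_space
begin

lemma minus_zero_M [simp]: "\<ominus>\<^bsub>M\<^esub> \<zero>\<^bsub>M\<^esub> = \<zero>\<^bsub>M\<^esub>"
  by (simp add: uminus_eq_smult)

lemma diff_eq_zero_iff: "x \<in> carrier M \<Longrightarrow> y \<in> carrier M \<Longrightarrow> x \<ominus>\<^bsub>M\<^esub> y = \<zero>\<^bsub>M\<^esub> \<longleftrightarrow> x = y"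
  by (metis M.add.inv_equality M.add.inv_inv M.add.inv_closed M.minus_eq M.r_neg)

lemma subspace_diff:
  "subspace_of K M U \<Longrightarrow> x \<in> U \<Longrightarrow> y \<in> U \<Longrightarrow> x \<ominus>\<^bsub>M\<^esub> y \<in> U"
  by (simp add: a_minus_def uminus_eq_smult subspace_ofD)

lemma smult_inv_cancel:
  "c \<in> carrier K \<Longrightarrow> c \<noteq> \<zero> \<Longrightarrow> x \<in> carrier M \<Longrightarrow> inv c \<odot>\<^bsub>M\<^esub> (c \<odot>\<^bsub>M\<^esub> x) = x"
  using K.Units_inv_closed[of c] K.Units_l_inv[of c]
  by (simp add: smult_assoc1[symmetric] field_Units)

text \<open>A subspace that is maximal among those containing \<open>U\<close> but not \<open>v\<close> is a complement of the
  line through \<open>v\<close>; the functional is the coordinate along \<open>v\<close>.\<close>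

lemma functional_exists:
  assumes U: "subspace_of K M U" and v: "v \<in> carrier M" "v \<notin> U"
  shows "\<exists>f\<in>dual K M. (\<forall>u\<in>U. f u = \<zero>) \<and> f v = \<one>"
proof -
  \<comment> \<open>The subspaces that contain \<open>U\<close> and avoid \<open>v\<close> are closed under unions of chains.\<close>
  define \<W> where "\<W> = {W. subspace_of K M W \<and> U \<subseteq> W \<and> v \<notin> W}"
  have "\<Union>\<C> \<in> \<W>" if ne: "\<C> \<noteq> {}" and ch: "subset.chain \<W> \<C>" for \<C>
  proof -
    have sub: "\<And>W. W \<in> \<C> \<Longrightarrow> subspace_of K M W \<and> U \<subseteq> W \<and> v \<notin> W"
      using ch unfolding subset.chain_def \<W>_def by blast
    have tot: "\<And>V W. V \<in> \<C> \<Longrightarrow> W \<in> \<C> \<Longrightarrow> V \<subseteq> W \<or> W \<subseteq> V"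
      using ch unfolding subset.chain_def by blast
    have add: "x \<oplus>\<^bsub>M\<^esub> y \<in> \<Union>\<C>" if xy: "x \<in> \<Union>\<C>" "y \<in> \<Union>\<C>" for x y
    proof -
      obtain V W where "V \<in> \<C>" "W \<in> \<C>" "x \<in> V" "y \<in> W" using xy by blast
      then obtain Z where "Z \<in> \<C>" "x \<in> Z" "y \<in> Z" using tot[of V W] by blast
      then show ?thesis using sub[of Z] subspace_ofD(3)[of K M Z x y] by blast
    qed
    have "subspace_of K M (\<Union>\<C>)"
      unfolding subspace_of_def
    proof (intro conjI ballI)
      show "\<Union>\<C> \<subseteq> carrier M" using sub unfolding subspace_of_def by blast
      show "\<zero>\<^bsub>M\<^esub> \<in> \<Union>\<C>" using sub ne unfolding subspace_of_def by blast
      show "c \<odot>\<^bsub>M\<^esub> x \<in> \<Union>\<C>" if "c \<in> carrier K" "x \<in> \<Union>\<C>" for c x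
        using sub that unfolding subspace_of_def by blast
    qed (use add in auto)
    then show ?thesis using sub ne unfolding \<W>_def by blast
  qed
  moreover have "\<W> \<noteq> {}" using U v unfolding \<W>_def by blast
  ultimately obtain W where W: "W \<in> \<W>" and max: "\<And>V. V \<in> \<W> \<Longrightarrow> W \<subseteq> V \<Longrightarrow> V = W"
    using subset_Zorn_nonempty[of \<W>] by metis
  have sW: "subspace_of K M W" and UW: "U \<subseteq> W" and vW: "v \<notin> W" using W unfolding \<W>_def by auto
  note sWD = subspace_ofD[OF sW]
  \<comment> \<open>If \<open>x\<close> is not in \<open>W\<close>, then \<open>v\<close> lies in \<open>W + K x\<close> by maximality; solve for \<open>x\<close>.\<close>
  have ex: "\<exists>c\<in>carrier K. x \<ominus>\<^bsub>M\<^esub> c \<odot>\<^bsub>M\<^esub> v \<in> W" if x: "x \<in> carrier M" for x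
  proof (cases "x \<in> W")
    case True
    then show ?thesis using v by (intro bexI[of _ \<zero>]) (auto simp: a_minus_def sWD(1))
  next
    case False
    define V where "V = {w \<oplus>\<^bsub>M\<^esub> c \<odot>\<^bsub>M\<^esub> x | w c. w \<in> W \<and> c \<in> carrier K}"
    have "subspace_of K M V"
      unfolding subspace_of_def
    proof (intro conjI ballI)
      show "V \<subseteq> carrier M" unfolding V_def using sWD x by auto
      show "\<zero>\<^bsub>M\<^esub> \<in> V" unfolding V_def using sWD(2) x
        by (intro CollectI exI[of _ "\<zero>\<^bsub>M\<^esub>"] exI[of _ "\<zero>"]) auto
      fix a assume "a \<in> V"
      then obtain w c where a: "a = w \<oplus>\<^bsub>M\<^esub> c \<odot>\<^bsub>M\<^esub> x" "w \<in> W" "c \<in> carrier K" unfolding V_def by blast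
      { fix b assume "b \<in> V"
        then obtain w' c' where b: "b = w' \<oplus>\<^bsub>M\<^esub> c' \<odot>\<^bsub>M\<^esub> x" "w' \<in> W" "c' \<in> carrier K" unfolding V_def by blast
        have "a \<oplus>\<^bsub>M\<^esub> b = (w \<oplus>\<^bsub>M\<^esub> w') \<oplus>\<^bsub>M\<^esub> (c \<oplus> c') \<odot>\<^bsub>M\<^esub> x"
          using a b x sWD(1) by (simp add: smult_l_distr M.a_ac)
        then show "a \<oplus>\<^bsub>M\<^esub> b \<in> V" unfolding V_def using a b sWD(3) by blast }
      fix d assume d: "d \<in> carrier K"
      have "d \<odot>\<^bsub>M\<^esub> a = d \<odot>\<^bsub>M\<^esub> w \<oplus>\<^bsub>M\<^esub> (d \<otimes> c) \<odot>\<^bsub>M\<^esub> x"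
        using a d x sWD(1) by (simp add: smult_r_distr smult_assoc1)
      then show "d \<odot>\<^bsub>M\<^esub> a \<in> V" unfolding V_def using a d sWD(4) by blast
    qed
    moreover have "W \<subseteq> V" unfolding V_def
    proof
      fix w assume "w \<in> W" then show "w \<in> {w \<oplus>\<^bsub>M\<^esub> c \<odot>\<^bsub>M\<^esub> x | w c. w \<in> W \<and> c \<in> carrier K}"
        using x sWD(1) by (intro CollectI exI[of _ w] exI[of _ \<zero>]) auto
    qed
    moreover have "x \<in> V" unfolding V_def using x sWD(2)
      by (intro CollectI exI[of _ "\<zero>\<^bsub>M\<^esub>"] exI[of _ \<one>]) auto
    ultimately have "v \<in> V" using max[of V] UW False unfolding \<W>_def by blast
    then obtain w c where c: "v = w \<oplus>\<^bsub>M\<^esub> c \<odot>\<^bsub>M\<^esub> x" "w \<in> W" "c \<in> carrier K" unfolding V_def by blast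
    have c0: "c \<noteq> \<zero>" using c vW x sWD(1) by auto
    have ic: "inv c \<in> carrier K" using c c0 by (simp add: field_Units)
    have "inv c \<odot>\<^bsub>M\<^esub> v = inv c \<odot>\<^bsub>M\<^esub> w \<oplus>\<^bsub>M\<^esub> x"
      using c c0 ic x sWD(1)[OF c(2)] by (simp add: smult_r_distr smult_inv_cancel)
    then have "x \<ominus>\<^bsub>M\<^esub> inv c \<odot>\<^bsub>M\<^esub> v = \<ominus>\<^bsub>M\<^esub> (inv c \<odot>\<^bsub>M\<^esub> w)"
      using x ic sWD(1)[OF c(2)] by (simp add: a_minus_def M.minus_add M.l_neg M.a_assoc M.a_comm[of x])
    moreover have "\<ominus>\<^bsub>M\<^esub> (inv c \<odot>\<^bsub>M\<^esub> w) \<in> W"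
      using sWD(1,4) c(2) ic by (simp add: uminus_eq_smult)
    ultimately have "x \<ominus>\<^bsub>M\<^esub> inv c \<odot>\<^bsub>M\<^esub> v \<in> W" by simp
    then show ?thesis using ic by blast
  qed
  have uniq: "c = d" if "c \<in> carrier K" "d \<in> carrier K" "x \<in> carrier M"
    "x \<ominus>\<^bsub>M\<^esub> c \<odot>\<^bsub>M\<^esub> v \<in> W" "x \<ominus>\<^bsub>M\<^esub> d \<odot>\<^bsub>M\<^esub> v \<in> W" for c d x
  proof (rule ccontr)
    assume ne: "c \<noteq> d"
    have "(x \<ominus>\<^bsub>M\<^esub> d \<odot>\<^bsub>M\<^esub> v) \<ominus>\<^bsub>M\<^esub> (x \<ominus>\<^bsub>M\<^esub> c \<odot>\<^bsub>M\<^esub> v) = (c \<ominus> d) \<odot>\<^bsub>M\<^esub> v"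
      using that v by (simp add: a_minus_def smult_l_distr smult_l_minus M.minus_add M.a_ac M.r_neg1 M.r_neg2)
    then have "(c \<ominus> d) \<odot>\<^bsub>M\<^esub> v \<in> W" using subspace_diff[OF sW that(5,4)] by simp
    moreover have nz: "c \<ominus> d \<in> carrier K" "c \<ominus> d \<noteq> \<zero>" using that ne K.add.right_cancel[of "\<ominus> d" c d] by (auto simp: a_minus_def K.r_neg)
    moreover have "inv (c \<ominus> d) \<in> carrier K" using nz by (simp add: field_Units)
    ultimately have "v \<in> W" using sWD(4)[of "inv (c \<ominus> d)" "(c \<ominus> d) \<odot>\<^bsub>M\<^esub> v"] smult_inv_cancel[of "c \<ominus> d" v] v
      by simp
    then show False using vW by simp
  qed
  define f where "f x = (THE c. c \<in> carrier K \<and> x \<ominus>\<^bsub>M\<^esub> c \<odot>\<^bsub>M\<^esub> v \<in> W)" for x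
  have feq: "f x = c" if "c \<in> carrier K" "x \<in> carrier M" "x \<ominus>\<^bsub>M\<^esub> c \<odot>\<^bsub>M\<^esub> v \<in> W" for x c
    unfolding f_def by (rule the_equality) (use that uniq in blast)+
  have f: "f x \<in> carrier K" "x \<ominus>\<^bsub>M\<^esub> f x \<odot>\<^bsub>M\<^esub> v \<in> W" if "x \<in> carrier M" for x
    using ex[OF that] feq[OF _ that] by auto
  show ?thesis
  proof (intro bexI[of _ f] conjI ballI)
    show "f v = \<one>" using v sWD(2) by (intro feq) (auto simp: a_minus_def M.r_neg)
    fix u assume "u \<in> U"
    then show "f u = \<zero>" using UW sWD(1) v by (intro feq) (auto simp: a_minus_def)
  next
    have "f (x \<oplus>\<^bsub>M\<^esub> y) = f x \<oplus> f y" if "x \<in> carrier M" "y \<in> carrier M" for x y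
    proof (rule feq)
      have "(x \<oplus>\<^bsub>M\<^esub> y) \<ominus>\<^bsub>M\<^esub> (f x \<oplus> f y) \<odot>\<^bsub>M\<^esub> v = (x \<ominus>\<^bsub>M\<^esub> f x \<odot>\<^bsub>M\<^esub> v) \<oplus>\<^bsub>M\<^esub> (y \<ominus>\<^bsub>M\<^esub> f y \<odot>\<^bsub>M\<^esub> v)"
        using that f v by (simp add: a_minus_def smult_l_distr M.minus_add M.a_ac)
      then show "(x \<oplus>\<^bsub>M\<^esub> y) \<ominus>\<^bsub>M\<^esub> (f x \<oplus> f y) \<odot>\<^bsub>M\<^esub> v \<in> W" using f that sWD(3) by simp
    qed (use f that in auto)
    moreover have "f (c \<odot>\<^bsub>M\<^esub> x) = c \<otimes> f x" if "c \<in> carrier K" "x \<in> carrier M" for c x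
    proof (rule feq)
      have "c \<odot>\<^bsub>M\<^esub> x \<ominus>\<^bsub>M\<^esub> (c \<otimes> f x) \<odot>\<^bsub>M\<^esub> v = c \<odot>\<^bsub>M\<^esub> (x \<ominus>\<^bsub>M\<^esub> f x \<odot>\<^bsub>M\<^esub> v)"
        using that f v by (simp add: a_minus_def smult_r_distr smult_r_minus smult_assoc1)
      then show "c \<odot>\<^bsub>M\<^esub> x \<ominus>\<^bsub>M\<^esub> (c \<otimes> f x) \<odot>\<^bsub>M\<^esub> v \<in> W" using f that sWD(4) by simp
    qed (use f that in auto)
    ultimately show "f \<in> dual K M" unfolding dual_def using f by auto
  qed
qed

lemma functional_exists_nonzero:
  assumes "v \<in> carrier M" "v \<noteq> \<zero>\<^bsub>M\<^esub>"
  shows "\<exists>f\<in>dual K M. f v = \<one>"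
proof -
  have "subspace_of K M {\<zero>\<^bsub>M\<^esub>}" unfolding subspace_of_def by auto
  from functional_exists[OF this] assms show ?thesis by auto
qed

end


section \<open>Presented modules and tensor products\<close>

text \<open>The operations of presented modules and algebras are unions over all representatives. They can be computed from
  arbitrary representatives once the term constructors respect the congruence.\<close>

lemma UN_equiv_classes1:
  assumes "equiv A E" "\<And>p p'. (p, p') \<in> E \<Longrightarrow> (F p, F p') \<in> E" "p \<in> A"
  shows "(\<Union>p\<in>E `` {p}. E `` {F p}) = E `` {F p}"
proof -
  have "E `` {F p'} = E `` {F p}" if "p' \<in> E `` {p}" for p'
    using assms(2)[of p p'] that equiv_class_eq[OF assms(1), of "F p" "F p'"] by simp
  moreover have "p \<in> E `` {p}" by (rule equiv_class_self[OF assms(1,3)])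
  ultimately show ?thesis by blast
qed

lemma UN_equiv_classes2:
  assumes "equiv A E" "\<And>p p' q q'. (p, p') \<in> E \<Longrightarrow> (q, q') \<in> E \<Longrightarrow> (F p q, F p' q') \<in> E"
    "p \<in> A" "q \<in> A"
  shows "(\<Union>p\<in>E `` {p}. \<Union>q\<in>E `` {q}. E `` {F p q}) = E `` {F p q}"
proof -
  have "E `` {F p' q'} = E `` {F p q}" if "p' \<in> E `` {p}" "q' \<in> E `` {q}" for p' q'
    using assms(2)[of p p' q q'] that equiv_class_eq[OF assms(1), of "F p q" "F p' q'"] by simp
  moreover have "p \<in> E `` {p}" "q \<in> E `` {q}" by (rule equiv_class_self[OF assms(1)], fact)+
  ultimately show ?thesis by blast
qed

lemma lin_cong_terms:
  assumes "field K" "(p, q) \<in> lin_cong K X Rel"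
  shows "p \<in> lin_terms K X \<and> q \<in> lin_terms K X"
proof -
  interpret K: field K by fact
  show ?thesis using assms(2)
    by induction (auto intro: lin_terms.intros)
qed

lemma equiv_lin_cong: "field K \<Longrightarrow> equiv (lin_terms K X) (lin_cong K X Rel)"
  by (auto intro!: equivI refl_onI symI transI intro: lin_cong.refl lin_cong.sym lin_cong.trans
      dest: lin_cong_terms)

lemma presented_module_simps:
  assumes "field K"
  shows "carrier (presented_module K X Rel) = lin_terms K X // lin_cong K X Rel"
    "\<zero>\<^bsub>presented_module K X Rel\<^esub> = lin_cong K X Rel `` {LZero}"
    "p \<in> lin_terms K X \<Longrightarrow> q \<in> lin_terms K X \<Longrightarrow>
      lin_cong K X Rel `` {p} \<oplus>\<^bsub>presented_module K X Rel\<^esub> lin_cong K X Rel `` {q} = lin_cong K X Rel `` {LAdd p q}"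
    "c \<in> carrier K \<Longrightarrow> p \<in> lin_terms K X \<Longrightarrow>
      c \<odot>\<^bsub>presented_module K X Rel\<^esub> lin_cong K X Rel `` {p} = lin_cong K X Rel `` {LScal c p}"
  unfolding presented_module_def Let_def
  by (simp_all add: UN_equiv_classes1[OF equiv_lin_cong[OF assms]]
      UN_equiv_classes2[OF equiv_lin_cong[OF assms]] lin_cong.add lin_cong.scal)

lemma presented_module_vec_space:
  assumes "field K"
  shows "vec_space K (presented_module K X Rel)"
proof (rule vec_spaceI[OF assms])
  interpret K: field K by fact
  let ?M = "presented_module K X Rel" and ?E = "lin_cong K X Rel" and ?T = "lin_terms K X"
  note simps = presented_module_simps[OF assms, where X = X and Rel = Rel]
  have eq: "?E `` {p} = ?E `` {q}" if "(p, q) \<in> ?E" for p q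
    using equiv_class_eq[OF equiv_lin_cong[OF assms] that] .
  have cls: "?E `` {p} \<in> carrier ?M" if "p \<in> ?T" for p using that by (simp add: simps quotientI)
  have E: "\<exists>p\<in>?T. x = ?E `` {p}" if "x \<in> carrier ?M" for x using that by (auto simp: simps elim!: quotientE)
  note I = lin_terms.intros
  show "module K ?M"
  proof (rule moduleI[OF K.is_cring])
    show "abelian_group ?M"
    proof (rule abelian_groupI)
      fix x y z assume "x \<in> carrier ?M" "y \<in> carrier ?M" "z \<in> carrier ?M"
      then obtain p q r where [simp]: "x = ?E `` {p}" "y = ?E `` {q}" "z = ?E `` {r}"
        and t [simp]: "p \<in> ?T" "q \<in> ?T" "r \<in> ?T" using E by metis
      show "x \<oplus>\<^bsub>?M\<^esub> y \<in> carrier ?M" by (simp add: simps(3) cls I)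
      show "(x \<oplus>\<^bsub>?M\<^esub> y) \<oplus>\<^bsub>?M\<^esub> z = x \<oplus>\<^bsub>?M\<^esub> (y \<oplus>\<^bsub>?M\<^esub> z)"
        by (simp add: simps(3) I) (rule eq, rule lin_cong.add_assoc, auto)
    next
      fix x y assume "x \<in> carrier ?M" "y \<in> carrier ?M"
      then obtain p q where [simp]: "x = ?E `` {p}" "y = ?E `` {q}"
        and t [simp]: "p \<in> ?T" "q \<in> ?T" using E by metis
      show "x \<oplus>\<^bsub>?M\<^esub> y = y \<oplus>\<^bsub>?M\<^esub> x"
        by (simp add: simps(3) I) (rule eq, rule lin_cong.add_comm, auto)
    next
      fix x assume "x \<in> carrier ?M"
      then obtain p where [simp]: "x = ?E `` {p}" and t [simp]: "p \<in> ?T" using E by metis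
      show "\<zero>\<^bsub>?M\<^esub> \<oplus>\<^bsub>?M\<^esub> x = x"
        by (simp add: simps(2,3) I) (rule eq, rule lin_cong.add_zero, auto)
      show "\<exists>y\<in>carrier ?M. y \<oplus>\<^bsub>?M\<^esub> x = \<zero>\<^bsub>?M\<^esub>"
        by (rule bexI[of _ "?E `` {LScal (\<ominus>\<^bsub>K\<^esub> \<one>\<^bsub>K\<^esub>) p}"])
          (simp_all add: simps(2,3) cls I eq lin_cong.add_neg)
    qed (simp add: simps(2) cls I)
    show "\<one>\<^bsub>K\<^esub> \<odot>\<^bsub>?M\<^esub> x = x" if "x \<in> carrier ?M" for x
      using E[OF that] eq[OF lin_cong.scal_one] by (auto simp: simps(4))
    fix a x assume a: "a \<in> carrier K" and "x \<in> carrier ?M"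
    then obtain p where [simp]: "x = ?E `` {p}" and p [simp]: "p \<in> ?T" using E by metis
    show "a \<odot>\<^bsub>?M\<^esub> x \<in> carrier ?M" using a by (simp add: simps(4) cls I)
    { fix b assume b: "b \<in> carrier K"
      show "(a \<oplus>\<^bsub>K\<^esub> b) \<odot>\<^bsub>?M\<^esub> x = a \<odot>\<^bsub>?M\<^esub> x \<oplus>\<^bsub>?M\<^esub> b \<odot>\<^bsub>?M\<^esub> x"
        using a b by (simp add: simps(3,4) I eq lin_cong.scal_distl)
      show "(a \<otimes>\<^bsub>K\<^esub> b) \<odot>\<^bsub>?M\<^esub> x = a \<odot>\<^bsub>?M\<^esub> (b \<odot>\<^bsub>?M\<^esub> x)"
        using a b by (simp add: simps(3,4) I eq lin_cong.scal_scal) }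
    fix y assume "y \<in> carrier ?M"
    then obtain q where [simp]: "y = ?E `` {q}" and q [simp]: "q \<in> ?T" using E by metis
    show "a \<odot>\<^bsub>?M\<^esub> (x \<oplus>\<^bsub>?M\<^esub> y) = a \<odot>\<^bsub>?M\<^esub> x \<oplus>\<^bsub>?M\<^esub> a \<odot>\<^bsub>?M\<^esub> y"
      using a by (simp add: simps(3,4) I eq lin_cong.scal_distr)
  qed
qed

text \<open>Evaluation of terms in a vector space respects every axiom in the congruence, so only the given relations have to be
  verified. This yields the linear maps out of a presented module.\<close>

lemma lin_eval_cong:
  assumes P: "vec_space K P" and f: "\<And>x. x \<in> X \<Longrightarrow> f x \<in> carrier P"
    and rel: "\<And>p q. (p, q) \<in> Rel \<Longrightarrow> p \<in> lin_terms K X \<Longrightarrow> q \<in> lin_terms K X \<Longrightarrow> lin_eval P f p = lin_eval P f q"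
  shows "p \<in> lin_terms K X \<Longrightarrow> lin_eval P f p \<in> carrier P"
    and "(p, q) \<in> lin_cong K X Rel \<Longrightarrow> lin_eval P f p = lin_eval P f q"
proof -
  interpret P: vec_space K P by fact
  show cl: "lin_eval P f p \<in> carrier P" if "p \<in> lin_terms K X" for p
    using that by induction (auto simp: f)
  show "lin_eval P f p = lin_eval P f q" if "(p, q) \<in> lin_cong K X Rel"
    using that
    by induction (auto simp: rel cl P.smult_assoc1 P.smult_l_distr P.smult_r_distr P.M.a_ac
        P.smult_l_minus P.M.r_neg)
qed

locale tensor_prod = M: vec_space K M + N: vec_space K N
  for K :: "'k ring" and M :: "('k, 'a) module" and N :: "('k, 'b) module"
begin

abbreviation TT where "TT \<equiv> tensor K M N"
abbreviation tn where "tn \<equiv> tens K M N"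

lemma TT_vec_space: "vec_space K TT"
  unfolding tensor_def by (rule presented_module_vec_space) (rule M.K.field_axioms)

sublocale T: vec_space K "tensor K M N" by (rule TT_vec_space)

lemma tens_closed [simp, intro]: "x \<in> carrier M \<Longrightarrow> y \<in> carrier N \<Longrightarrow> tn x y \<in> carrier TT"
  unfolding tensor_def tens_def
  by (simp add: presented_module_simps M.K.field_axioms quotientI lin_terms.intros)

lemma tens_cong:
  assumes "(p, q) \<in> tensor_rels K M N" "p \<in> lin_terms K (carrier M \<times> carrier N)" "q \<in> lin_terms K (carrier M \<times> carrier N)"
  shows "lin_cong K (carrier M \<times> carrier N) (tensor_rels K M N) `` {p} = lin_cong K (carrier M \<times> carrier N) (tensor_rels K M N) `` {q}"
  using equiv_class_eq[OF equiv_lin_cong lin_cong.rel] assms M.K.field_axioms by metis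

lemma tens_add_left:
  "x \<in> carrier M \<Longrightarrow> x' \<in> carrier M \<Longrightarrow> y \<in> carrier N \<Longrightarrow> tn (x \<oplus>\<^bsub>M\<^esub> x') y = tn x y \<oplus>\<^bsub>TT\<^esub> tn x' y"
  unfolding tensor_def tens_def
  by (simp add: presented_module_simps M.K.field_axioms lin_terms.intros)
    (rule tens_cong, auto simp: tensor_rels_def intro!: lin_terms.intros)

lemma tens_add_right:
  "x \<in> carrier M \<Longrightarrow> y \<in> carrier N \<Longrightarrow> y' \<in> carrier N \<Longrightarrow> tn x (y \<oplus>\<^bsub>N\<^esub> y') = tn x y \<oplus>\<^bsub>TT\<^esub> tn x y'"
  unfolding tensor_def tens_def
  by (simp add: presented_module_simps M.K.field_axioms lin_terms.intros)
    (rule tens_cong, auto simp: tensor_rels_def intro!: lin_terms.intros)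

lemma tens_smult_left:
  "c \<in> carrier K \<Longrightarrow> x \<in> carrier M \<Longrightarrow> y \<in> carrier N \<Longrightarrow> tn (c \<odot>\<^bsub>M\<^esub> x) y = c \<odot>\<^bsub>TT\<^esub> tn x y"
  unfolding tensor_def tens_def
  by (simp add: presented_module_simps M.K.field_axioms lin_terms.intros)
    (rule tens_cong, auto simp: tensor_rels_def intro!: lin_terms.intros)

lemma tens_smult_right:
  "c \<in> carrier K \<Longrightarrow> x \<in> carrier M \<Longrightarrow> y \<in> carrier N \<Longrightarrow> tn x (c \<odot>\<^bsub>N\<^esub> y) = c \<odot>\<^bsub>TT\<^esub> tn x y"
  unfolding tensor_def tens_def
  by (simp add: presented_module_simps M.K.field_axioms lin_terms.intros)
    (rule tens_cong, auto simp: tensor_rels_def intro!: lin_terms.intros)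

lemma tens_zero_left [simp]: "y \<in> carrier N \<Longrightarrow> tn \<zero>\<^bsub>M\<^esub> y = \<zero>\<^bsub>TT\<^esub>"
  using tens_smult_left[of "\<zero>\<^bsub>K\<^esub>" "\<zero>\<^bsub>M\<^esub>" y] by simp

lemma tens_zero_right [simp]: "x \<in> carrier M \<Longrightarrow> tn x \<zero>\<^bsub>N\<^esub> = \<zero>\<^bsub>TT\<^esub>"
  using tens_smult_right[of "\<zero>\<^bsub>K\<^esub>" x "\<zero>\<^bsub>N\<^esub>"] by simp

abbreviation pure_tensors where "pure_tensors \<equiv> case_prod tn ` (carrier M \<times> carrier N)"

lemma pure_tensors_carrier: "pure_tensors \<subseteq> carrier TT"
  by auto

text \<open>By induction on terms; a scalar is absorbed into the first component of a pure tensor.\<close>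

lemma tensor_span: "carrier TT \<subseteq> add_span TT pure_tensors"
proof
  let ?X = "carrier M \<times> carrier N" and ?R = "tensor_rels K M N"
  let ?c = "\<lambda>p. lin_cong K ?X ?R `` {p}"
  note simps = presented_module_simps[OF M.K.field_axioms, where X = ?X and Rel = ?R, folded tensor_def]
  fix z assume "z \<in> carrier TT"
  then obtain p where p: "p \<in> lin_terms K ?X" and z: "z = ?c p"
    by (auto simp: simps elim!: quotientE)
  have "?c p \<in> add_span TT pure_tensors"
    using p
  proof induction
    case (1 x)
    then have "?c (LVar x) \<in> pure_tensors" by (force simp: tens_def)
    then show ?case by (rule T.M.add_span_base[OF pure_tensors_carrier])
  next
    case 2 then show ?case using add_span.zero[of TT] by (simp add: simps)
  next
    case (3 p q)
    then show ?case using T.M.add_span_add[OF pure_tensors_carrier] by (simp flip: simps(3))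
  next
    case (4 c p)
    have *: "c \<odot>\<^bsub>TT\<^esub> z \<in> add_span TT pure_tensors" if "z \<in> add_span TT pure_tensors" for z
      using that
    proof induction
      case zero then show ?case using 4 add_span.zero by auto
    next
      case (add b x)
      then obtain u v where uv: "b = tn u v" "u \<in> carrier M" "v \<in> carrier N" by auto
      have "x \<in> carrier TT" using add(2) T.M.add_span_carrier[OF pure_tensors_carrier] by blast
      then have "c \<odot>\<^bsub>TT\<^esub> (b \<oplus>\<^bsub>TT\<^esub> x) = tn (c \<odot>\<^bsub>M\<^esub> u) v \<oplus>\<^bsub>TT\<^esub> c \<odot>\<^bsub>TT\<^esub> x"
        using uv 4 by (simp add: T.smult_r_distr tens_smult_left)
      then show ?case using add uv 4 by (force intro!: add_span.add)
    qed
    show ?case using *[OF 4(3)] 4 by (simp add: simps)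
  qed
  then show "z \<in> add_span TT pure_tensors" by (simp add: z)
qed

lemma tensor_induct [consumes 1, case_names zero add]:
  assumes "z \<in> carrier TT" "P \<zero>\<^bsub>TT\<^esub>"
    "\<And>x y z. x \<in> carrier M \<Longrightarrow> y \<in> carrier N \<Longrightarrow> z \<in> carrier TT \<Longrightarrow> P z \<Longrightarrow> P (tn x y \<oplus>\<^bsub>TT\<^esub> z)"
  shows "P z"
proof -
  have "z \<in> add_span TT pure_tensors" using assms(1) tensor_span by blast
  then show ?thesis
  proof induction
    case (add b x) then show ?case
      using assms(3) T.M.add_span_carrier[OF pure_tensors_carrier, of x] by auto
  qed (rule assms)
qed

lemma tensor_linear_eqI:
  assumes "f \<in> lin_hom K TT P" "g \<in> lin_hom K TT P" "vec_space K P"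
    "\<And>x y. x \<in> carrier M \<Longrightarrow> y \<in> carrier N \<Longrightarrow> f (tn x y) = g (tn x y)" "z \<in> carrier TT"
  shows "f z = g z"
  by (rule lin_hom_eq_on_span[OF assms(1,2) TT_vec_space assms(3) tensor_span pure_tensors_carrier _ assms(5)])
    (use assms(4) in auto)

end

definition bilinear_map ::
  "'k ring \<Rightarrow> ('k, 'a) module \<Rightarrow> ('k, 'b) module \<Rightarrow> ('k, 'c) module \<Rightarrow> ('a \<Rightarrow> 'b \<Rightarrow> 'c) \<Rightarrow> bool" where
  "bilinear_map K M N P f \<longleftrightarrow> (\<forall>x\<in>carrier M. f x \<in> lin_hom K N P)
     \<and> (\<forall>y\<in>carrier N. (\<lambda>x. f x y) \<in> lin_hom K M P)"

lemma bilinear_mapI: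
  assumes "\<And>x y. x \<in> carrier M \<Longrightarrow> y \<in> carrier N \<Longrightarrow> f x y \<in> carrier P"
    "\<And>x x' y. x \<in> carrier M \<Longrightarrow> x' \<in> carrier M \<Longrightarrow> y \<in> carrier N \<Longrightarrow> f (x \<oplus>\<^bsub>M\<^esub> x') y = f x y \<oplus>\<^bsub>P\<^esub> f x' y"
    "\<And>x y y'. x \<in> carrier M \<Longrightarrow> y \<in> carrier N \<Longrightarrow> y' \<in> carrier N \<Longrightarrow> f x (y \<oplus>\<^bsub>N\<^esub> y') = f x y \<oplus>\<^bsub>P\<^esub> f x y'"
    "\<And>c x y. c \<in> carrier K \<Longrightarrow> x \<in> carrier M \<Longrightarrow> y \<in> carrier N \<Longrightarrow> f (c \<odot>\<^bsub>M\<^esub> x) y = c \<odot>\<^bsub>P\<^esub> f x y"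
    "\<And>c x y. c \<in> carrier K \<Longrightarrow> x \<in> carrier M \<Longrightarrow> y \<in> carrier N \<Longrightarrow> f x (c \<odot>\<^bsub>N\<^esub> y) = c \<odot>\<^bsub>P\<^esub> f x y"
  shows "bilinear_map K M N P f"
  unfolding bilinear_map_def using assms by (auto intro!: lin_homI)

lemma bilinear_mapD:
  assumes "bilinear_map K M N P f"
  shows "x \<in> carrier M \<Longrightarrow> y \<in> carrier N \<Longrightarrow> f x y \<in> carrier P"
    "x \<in> carrier M \<Longrightarrow> x' \<in> carrier M \<Longrightarrow> y \<in> carrier N \<Longrightarrow> f (x \<oplus>\<^bsub>M\<^esub> x') y = f x y \<oplus>\<^bsub>P\<^esub> f x' y"
    "x \<in> carrier M \<Longrightarrow> y \<in> carrier N \<Longrightarrow> y' \<in> carrier N \<Longrightarrow> f x (y \<oplus>\<^bsub>N\<^esub> y') = f x y \<oplus>\<^bsub>P\<^esub> f x y'"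
    "c \<in> carrier K \<Longrightarrow> x \<in> carrier M \<Longrightarrow> y \<in> carrier N \<Longrightarrow> f (c \<odot>\<^bsub>M\<^esub> x) y = c \<odot>\<^bsub>P\<^esub> f x y"
    "c \<in> carrier K \<Longrightarrow> x \<in> carrier M \<Longrightarrow> y \<in> carrier N \<Longrightarrow> f x (c \<odot>\<^bsub>N\<^esub> y) = c \<odot>\<^bsub>P\<^esub> f x y"
  using assms unfolding bilinear_map_def lin_hom_def by auto

context tensor_prod
begin

lemma
  assumes P: "vec_space K P" and f: "bilinear_map K M N P f"
  shows tensor_lift_linear: "tensor_lift P f \<in> lin_hom K TT P"
    and tensor_lift_tens: "x \<in> carrier M \<Longrightarrow> y \<in> carrier N \<Longrightarrow> tensor_lift P f (tn x y) = f x y"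
proof -
  interpret P: vec_space K P by fact
  let ?X = "carrier M \<times> carrier N" and ?R = "tensor_rels K M N" and ?f = "case_prod f"
  let ?E = "lin_cong K ?X ?R"
  note simps = presented_module_simps[OF M.K.field_axioms, where X = ?X and Rel = ?R, folded tensor_def]
  have rel: "lin_eval P ?f p = lin_eval P ?f q" if "(p, q) \<in> ?R" for p q
    using that unfolding tensor_rels_def by (auto simp: bilinear_mapD[OF f])
  note ev = lin_eval_cong[OF P, of ?X ?f ?R]
  have cl: "lin_eval P ?f p \<in> carrier P" if "p \<in> lin_terms K ?X" for p
    by (rule ev(1)[OF _ _ that]) (auto simp: bilinear_mapD[OF f] rel)
  have val: "tensor_lift P f (?E `` {p}) = lin_eval P ?f p" if "p \<in> lin_terms K ?X" for p
  proof -
    have "p \<in> ?E `` {p}" using that by (simp add: lin_cong.refl)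
    then have "(SOME q. q \<in> ?E `` {p}) \<in> ?E `` {p}" by (rule someI)
    then have "(p, SOME q. q \<in> ?E `` {p}) \<in> ?E" by simp
    then have "lin_eval P ?f p = lin_eval P ?f (SOME q. q \<in> ?E `` {p})"
      by (rule ev(2)[rotated 2]) (auto simp: bilinear_mapD[OF f] rel)
    then show ?thesis by (simp add: tensor_lift_def)
  qed
  show "tensor_lift P f \<in> lin_hom K TT P"
  proof (rule lin_homI)
    fix x assume "x \<in> carrier TT"
    then obtain p where p: "p \<in> lin_terms K ?X" "x = ?E `` {p}" by (auto simp: simps elim!: quotientE)
    then show "tensor_lift P f x \<in> carrier P" by (simp add: val cl)
    { fix c assume "c \<in> carrier K"
      then show "tensor_lift P f (c \<odot>\<^bsub>TT\<^esub> x) = c \<odot>\<^bsub>P\<^esub> tensor_lift P f x"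
        using p by (simp add: val simps lin_terms.intros) }
    fix y assume "y \<in> carrier TT"
    then obtain q where q: "q \<in> lin_terms K ?X" "y = ?E `` {q}" by (auto simp: simps elim!: quotientE)
    show "tensor_lift P f (x \<oplus>\<^bsub>TT\<^esub> y) = tensor_lift P f x \<oplus>\<^bsub>P\<^esub> tensor_lift P f y"
      using p q by (simp add: val simps lin_terms.intros)
  qed
  show "x \<in> carrier M \<Longrightarrow> y \<in> carrier N \<Longrightarrow> tensor_lift P f (tn x y) = f x y"
    unfolding tens_def by (subst val) (auto intro: lin_terms.intros)
qed

lemma contract_right_bilinear: "f \<in> dual K N \<Longrightarrow> bilinear_map K M N M (\<lambda>x y. f y \<odot>\<^bsub>M\<^esub> x)"
  by (rule bilinear_mapI)
    (simp_all add: dualD M.smult_l_distr M.smult_r_distr M.smult_assoc1[symmetric] M.K.m_comm)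

lemma contract_left_bilinear: "f \<in> dual K M \<Longrightarrow> bilinear_map K M N N (\<lambda>x y. f x \<odot>\<^bsub>N\<^esub> y)"
  by (rule bilinear_mapI)
    (simp_all add: dualD N.smult_l_distr N.smult_r_distr N.smult_assoc1[symmetric] M.K.m_comm)

text \<open>The maps \<open>id \<otimes> f : M \<otimes> N \<rightarrow> M\<close> and \<open>f \<otimes> id : M \<otimes> N \<rightarrow> N\<close>. They are the means to detect that an element of a
  tensor product is nonzero.\<close>

definition contract_right :: "('b \<Rightarrow> 'k) \<Rightarrow> ('k, 'a, 'b) tens \<Rightarrow> 'a" where
  "contract_right f = tensor_lift M (\<lambda>x y. f y \<odot>\<^bsub>M\<^esub> x)"

definition contract_left :: "('a \<Rightarrow> 'k) \<Rightarrow> ('k, 'a, 'b) tens \<Rightarrow> 'b" where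
  "contract_left f = tensor_lift N (\<lambda>x y. f x \<odot>\<^bsub>N\<^esub> y)"

lemma contract_right_linear: "f \<in> dual K N \<Longrightarrow> contract_right f \<in> lin_hom K TT M"
  and contract_right_tens: "f \<in> dual K N \<Longrightarrow> x \<in> carrier M \<Longrightarrow> y \<in> carrier N
    \<Longrightarrow> contract_right f (tn x y) = f y \<odot>\<^bsub>M\<^esub> x"
  unfolding contract_right_def
  by (simp_all add: tensor_lift_linear tensor_lift_tens contract_right_bilinear M.vec_space_axioms)

lemma contract_left_linear: "f \<in> dual K M \<Longrightarrow> contract_left f \<in> lin_hom K TT N"
  and contract_left_tens: "f \<in> dual K M \<Longrightarrow> x \<in> carrier M \<Longrightarrow> y \<in> carrier N
    \<Longrightarrow> contract_left f (tn x y) = f x \<odot>\<^bsub>N\<^esub> y"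
  unfolding contract_left_def
  by (simp_all add: tensor_lift_linear tensor_lift_tens contract_left_bilinear N.vec_space_axioms)

abbreviation tsum :: "('a \<times> 'b) list \<Rightarrow> ('k, 'a, 'b) tens" where
  "tsum ps \<equiv> foldr (\<lambda>(x, y) z. tn x y \<oplus>\<^bsub>TT\<^esub> z) ps \<zero>\<^bsub>TT\<^esub>"

lemma tsum_closed: "set ps \<subseteq> carrier M \<times> carrier N \<Longrightarrow> tsum ps \<in> carrier TT"
  by (induction ps) auto

lemma tsum_exists: "z \<in> carrier TT \<Longrightarrow> \<exists>ps. set ps \<subseteq> carrier M \<times> carrier N \<and> z = tsum ps"
proof (induction rule: tensor_induct)
  case zero show ?case by (rule exI[of _ "[]"]) simp
next
  case (add x y z)
  then obtain ps where "set ps \<subseteq> carrier M \<times> carrier N" "z = tsum ps" by blast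
  then show ?case using add by (intro exI[of _ "(x, y) # ps"]) simp
qed

text \<open>If the second components of the summands \<open>x\<^sub>k \<otimes> y\<^sub>k\<close> are dependent, one summand can be
  absorbed into the others; otherwise a functional that singles out one \<open>y\<^sub>k\<close> shows \<open>x\<^sub>k = 0\<close>.\<close>

lemma tsum_zeroI:
  "set ps \<subseteq> carrier M \<times> carrier N \<Longrightarrow> (\<And>f. f \<in> dual K N \<Longrightarrow> contract_right f (tsum ps) = \<zero>\<^bsub>M\<^esub>)
    \<Longrightarrow> tsum ps = \<zero>\<^bsub>TT\<^esub>"
proof (induction "length ps" arbitrary: ps)
  case 0 then show ?case by simp
next
  case (Suc n)
  then obtain x y qs where ps: "ps = (x, y) # qs" and n: "n = length qs" by (cases ps) auto
  have xy: "x \<in> carrier M" "y \<in> carrier N" and qs: "set qs \<subseteq> carrier M \<times> carrier N"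
    using Suc.prems(1) ps by auto
  \<comment> \<open>\<open>U\<close> replaces the span of the second components of \<open>qs\<close>: multiples of these vectors can be absorbed without lengthening the sum.\<close>
  let ?ok = "\<lambda>qs'. map snd qs' = map snd qs \<and> set qs' \<subseteq> carrier M \<times> carrier N"
  define U where "U = {v \<in> carrier N. \<forall>x\<in>carrier M. \<forall>qs'. ?ok qs' \<longrightarrow> (\<exists>qs''. ?ok qs'' \<and> tn x v \<oplus>\<^bsub>TT\<^esub> tsum qs' = tsum qs'')}"
  have UD: "\<exists>qs''. ?ok qs'' \<and> tn x v \<oplus>\<^bsub>TT\<^esub> tsum qs' = tsum qs''" if "v \<in> U" "x \<in> carrier M" "?ok qs'" for v x qs'
    using that unfolding U_def by blast
  have UN: "v \<in> carrier N" if "v \<in> U" for v using that unfolding U_def by blast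
  have sub: "subspace_of K N U"
    unfolding subspace_of_def
  proof (intro conjI ballI)
    show "U \<subseteq> carrier N" using UN by blast
    show "\<zero>\<^bsub>N\<^esub> \<in> U" unfolding U_def using tsum_closed by auto
    fix v assume v: "v \<in> U"
    { fix w assume w: "w \<in> U"
      have "\<exists>qs''. ?ok qs'' \<and> tn x (v \<oplus>\<^bsub>N\<^esub> w) \<oplus>\<^bsub>TT\<^esub> tsum qs' = tsum qs''" if x: "x \<in> carrier M" and q: "?ok qs'" for x qs'
      proof -
        obtain q1 where q1: "?ok q1" "tn x w \<oplus>\<^bsub>TT\<^esub> tsum qs' = tsum q1" using UD[OF w x q] by blast
        obtain q2 where q2: "?ok q2" "tn x v \<oplus>\<^bsub>TT\<^esub> tsum q1 = tsum q2" using UD[OF v x q1(1)] by blast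
        have "tn x (v \<oplus>\<^bsub>N\<^esub> w) \<oplus>\<^bsub>TT\<^esub> tsum qs' = tsum q2"
          using x UN[OF v] UN[OF w] tsum_closed[of qs'] q
          by (simp add: tens_add_right T.M.a_assoc q1(2) q2(2))
        then show ?thesis using q2 by blast
      qed
      then show "v \<oplus>\<^bsub>N\<^esub> w \<in> U" unfolding U_def using UN[OF v] UN[OF w] by auto }
    fix c assume c: "c \<in> carrier K"
    have "tn x (c \<odot>\<^bsub>N\<^esub> v) = tn (c \<odot>\<^bsub>M\<^esub> x) v" if "x \<in> carrier M" for x
      using that c UN[OF v] by (simp add: tens_smult_left tens_smult_right)
    then show "c \<odot>\<^bsub>N\<^esub> v \<in> U" using UD[OF v, of "c \<odot>\<^bsub>M\<^esub> x" for x] c UN[OF v] unfolding U_def by auto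
  qed
  have absorb: "v \<in> snd ` set qs' \<Longrightarrow> set qs' \<subseteq> carrier M \<times> carrier N \<Longrightarrow> x \<in> carrier M \<Longrightarrow>
      \<exists>qs''. map snd qs'' = map snd qs' \<and> set qs'' \<subseteq> carrier M \<times> carrier N \<and> tn x v \<oplus>\<^bsub>TT\<^esub> tsum qs' = tsum qs''" for v qs' x
  proof (induction qs')
    case (Cons p qs')
    obtain a b where p: "p = (a, b)" by (cases p)
    have ab: "a \<in> carrier M" "b \<in> carrier N" and t: "tsum qs' \<in> carrier TT"
      using Cons.prems p tsum_closed by auto
    show ?case
    proof (cases "v = b")
      case True
      then show ?thesis using Cons.prems ab p t
        by (intro exI[of _ "(x \<oplus>\<^bsub>M\<^esub> a, b) # qs'"]) (simp add: tens_add_left T.M.a_assoc)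
    next
      case False
      then obtain q2 where q2: "map snd q2 = map snd qs'" "set q2 \<subseteq> carrier M \<times> carrier N"
        "tn x v \<oplus>\<^bsub>TT\<^esub> tsum qs' = tsum q2" using Cons p by auto
      have "v \<in> carrier N" using Cons.prems by auto
      then show ?thesis using Cons.prems ab p t q2
        by (intro exI[of _ "(a, b) # q2"]) (simp add: T.M.a_lcomm flip: q2(3))
    qed
  qed simp
  have qU: "v \<in> U" if "v \<in> snd ` set qs" for v
  proof -
    have "v \<in> carrier N" using that qs by auto
    moreover have "v \<in> snd ` set qs'" if "map snd qs' = map snd qs" for qs' :: "('a \<times> 'b) list"
      using that \<open>v \<in> snd ` set qs\<close> by (metis list.set_map)
    ultimately show ?thesis unfolding U_def
    proof (intro CollectI conjI ballI allI impI)
      fix x qs' assume "x \<in> carrier M" and ok: "?ok qs'"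
      then show "\<exists>qs''. ?ok qs'' \<and> tn x v \<oplus>\<^bsub>TT\<^esub> tsum qs' = tsum qs''"
        using absorb[of v qs' x] \<open>\<And>qs'. map snd qs' = map snd qs \<Longrightarrow> v \<in> snd ` set qs'\<close>[of qs'] by metis
    qed
  qed
  \<comment> \<open>If \<open>y\<close> is outside \<open>U\<close>, a functional vanishing on \<open>U\<close> with value \<open>1\<close> at \<open>y\<close> maps the sum to \<open>x\<close>.\<close>
  show ?case
  proof (cases "y \<in> U")
    case True
    then obtain q2 where q2: "?ok q2" "tn x y \<oplus>\<^bsub>TT\<^esub> tsum qs = tsum q2" using UD[of y x qs] xy qs by blast
    then have "tsum ps = tsum q2" by (simp add: ps)
    moreover have "n = length q2" using q2(1) n by (metis length_map)
    ultimately show ?thesis using Suc.hyps(1)[of q2] Suc.prems(2) q2(1) by simp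
  next
    case False
    then obtain f where f: "f \<in> dual K N" "\<And>u. u \<in> U \<Longrightarrow> f u = \<zero>\<^bsub>K\<^esub>" "f y = \<one>\<^bsub>K\<^esub>"
      using N.functional_exists[OF sub xy(2)] by blast
    have "set qs' \<subseteq> set qs \<Longrightarrow> contract_right f (tsum qs') = \<zero>\<^bsub>M\<^esub>" for qs'
    proof (induction qs')
      case Nil then show ?case
        using lin_hom_zero[OF contract_right_linear[OF f(1)] TT_vec_space M.vec_space_axioms] by simp
    next
      case (Cons p qs')
      have "tsum qs' \<in> carrier TT" using Cons.prems qs by (intro tsum_closed) auto
      moreover obtain a b where p: "p = (a, b)" by (cases p)
      moreover have "(a, b) \<in> set qs" using Cons.prems p by auto
      moreover have "a \<in> carrier M" "b \<in> carrier N" using \<open>(a, b) \<in> set qs\<close> qs by auto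
      moreover have "f b = \<zero>\<^bsub>K\<^esub>" using \<open>(a, b) \<in> set qs\<close> by (intro f(2) qU) force
      ultimately show ?case using Cons
        by (simp add: lin_homD[OF contract_right_linear[OF f(1)]] contract_right_tens[OF f(1)])
    qed
    then have "contract_right f (tsum ps) = x"
      using xy f(3) tsum_closed[OF qs]
      by (simp add: ps lin_homD[OF contract_right_linear[OF f(1)]] contract_right_tens[OF f(1)])
    then have "x = \<zero>\<^bsub>M\<^esub>" using Suc.prems(2)[OF f(1)] by simp
    then have "tsum ps = tsum qs" using xy tsum_closed[OF qs] by (simp add: ps)
    then show ?thesis using Suc.hyps(1)[of qs] Suc.prems(2) n qs by simp
  qed
qed

lemma separate_right:
  assumes "z \<in> carrier TT" "z \<noteq> \<zero>\<^bsub>TT\<^esub>"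
  shows "\<exists>f\<in>dual K N. contract_right f z \<noteq> \<zero>\<^bsub>M\<^esub>"
  using tsum_zeroI tsum_exists[OF assms(1)] assms(2) by metis

end

definition flip_tensor where
  "flip_tensor K M N = tensor_lift (tensor K N M) (\<lambda>x y. tens K N M y x)"

context tensor_prod
begin

lemma flip_bilinear: "bilinear_map K M N (tensor K N M) (\<lambda>x y. tens K N M y x)"
proof -
  interpret F: tensor_prod K N M ..
  show ?thesis
    by (rule bilinear_mapI)
      (simp_all add: F.tens_add_left F.tens_add_right F.tens_smult_left F.tens_smult_right)
qed

lemma flip_linear: "flip_tensor K M N \<in> lin_hom K TT (tensor K N M)"
  and flip_tens: "x \<in> carrier M \<Longrightarrow> y \<in> carrier N \<Longrightarrow> flip_tensor K M N (tn x y) = tens K N M y x"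
proof -
  interpret F: tensor_prod K N M ..
  show "flip_tensor K M N \<in> lin_hom K TT (tensor K N M)"
    "x \<in> carrier M \<Longrightarrow> y \<in> carrier N \<Longrightarrow> flip_tensor K M N (tn x y) = tens K N M y x"
    unfolding flip_tensor_def
    by (simp_all add: tensor_lift_linear tensor_lift_tens flip_bilinear F.TT_vec_space)
qed

text \<open>Exchanging the factors turns a contraction of the first factor into one of the second.\<close>

lemma separate_left:
  assumes z: "z \<in> carrier TT" "z \<noteq> \<zero>\<^bsub>TT\<^esub>"
  shows "\<exists>f\<in>dual K M. contract_left f z \<noteq> \<zero>\<^bsub>N\<^esub>"
proof -
  interpret F: tensor_prod K N M ..
  let ?z = "flip_tensor K M N z"
  have "flip_tensor K N M ?z = z"
    by (rule tensor_linear_eqI[OF lin_hom_comp[OF flip_linear F.flip_linear] lin_homI TT_vec_space])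
      (simp_all add: z flip_tens F.flip_tens)
  then have "?z \<noteq> \<zero>\<^bsub>tensor K N M\<^esub>"
    using lin_hom_zero[OF F.flip_linear F.TT_vec_space TT_vec_space] z by auto
  then obtain f where f: "f \<in> dual K M" "F.contract_right f ?z \<noteq> \<zero>\<^bsub>N\<^esub>"
    using F.separate_right[of ?z] lin_homD(1)[OF flip_linear] z by auto
  have "contract_left f z = F.contract_right f ?z"
    by (rule tensor_linear_eqI[OF contract_left_linear lin_hom_comp[OF flip_linear F.contract_right_linear] N.vec_space_axioms])
      (simp_all add: z f flip_tens F.contract_right_tens contract_left_tens)
  then have "contract_left f z \<noteq> \<zero>\<^bsub>N\<^esub>" using f(2) by simp
  then show ?thesis using f(1) by blast
qed

end


lemma lin_hom_addf:
  assumes "vec_space K P" "f \<in> lin_hom K M P" "g \<in> lin_hom K M P"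
  shows "(\<lambda>x. f x \<oplus>\<^bsub>P\<^esub> g x) \<in> lin_hom K M P"
proof -
  interpret P: vec_space K P by fact
  show ?thesis using assms(2,3)
    by (intro lin_homI) (simp_all add: lin_homD P.M.a_ac P.smult_r_distr)
qed

lemma lin_hom_smultf:
  assumes "vec_space K P" "f \<in> lin_hom K M P" "c \<in> carrier K"
  shows "(\<lambda>x. c \<odot>\<^bsub>P\<^esub> f x) \<in> lin_hom K M P"
proof -
  interpret P: vec_space K P by fact
  show ?thesis using assms(2,3)
    by (intro lin_homI) (simp_all add: lin_homD P.smult_r_distr P.K.m_comm flip: P.smult_assoc1)
qed

lemma dual_comp:
  assumes "\<phi> \<in> dual K N" "g \<in> lin_hom K M N"
  shows "(\<lambda>x. \<phi> (g x)) \<in> dual K M"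
  unfolding dual_def using assms by (simp add: dualD lin_homD)

context tensor_prod
begin

lemma tensor_lift_add:
  assumes "vec_space K P" "bilinear_map K M N P f" "bilinear_map K M N P g" "bilinear_map K M N P h"
    "\<And>x y. x \<in> carrier M \<Longrightarrow> y \<in> carrier N \<Longrightarrow> h x y = f x y \<oplus>\<^bsub>P\<^esub> g x y" "z \<in> carrier TT"
  shows "tensor_lift P h z = tensor_lift P f z \<oplus>\<^bsub>P\<^esub> tensor_lift P g z"
  by (rule tensor_linear_eqI[OF _ lin_hom_addf assms(1)])
    (simp_all add: assms tensor_lift_linear tensor_lift_tens)

lemma tensor_lift_smult:
  assumes "vec_space K P" "bilinear_map K M N P f" "bilinear_map K M N P h" "c \<in> carrier K"
    "\<And>x y. x \<in> carrier M \<Longrightarrow> y \<in> carrier N \<Longrightarrow> h x y = c \<odot>\<^bsub>P\<^esub> f x y" "z \<in> carrier TT"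
  shows "tensor_lift P h z = c \<odot>\<^bsub>P\<^esub> tensor_lift P f z"
  by (rule tensor_linear_eqI[OF _ lin_hom_smultf assms(1)])
    (simp_all add: assms tensor_lift_linear tensor_lift_tens)

text \<open>If both factors are spanned by certain elements, then pure tensors of these elements suffice: a pure tensor is expanded
  in one factor and then in the other.\<close>

lemma tensor_product_span:
  assumes BM: "BM \<subseteq> carrier M" "carrier M \<subseteq> add_span M BM"
    and BN: "BN \<subseteq> carrier N" "carrier N \<subseteq> add_span N BN"
  shows "carrier TT \<subseteq> add_span TT (case_prod tn ` (BM \<times> BN))"
proof
  let ?B = "case_prod tn ` (BM \<times> BN)"
  have B: "?B \<subseteq> carrier TT" using BM BN by auto
  have 1: "tn x y \<in> add_span TT ?B" if "x \<in> BM" "y \<in> carrier N" for x y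
  proof -
    have "y \<in> add_span N BN" using that BN by auto
    then show ?thesis
    proof induction
      case zero
      have "x \<in> carrier M" using that BM by auto
      then show ?case by (simp add: add_span.zero)
    next
      case (add b y)
      then have "b \<in> carrier N" "y \<in> carrier N" "x \<in> carrier M"
        using BN N.M.add_span_carrier[OF BN(1)] that BM by auto
      then show ?case using add that by (auto simp: tens_add_right intro!: add_span.add)
    qed
  qed
  have 2: "tn x y \<in> add_span TT ?B" if "x \<in> carrier M" "y \<in> carrier N" for x y
  proof -
    have "x \<in> add_span M BM" using that BM by auto
    then show ?thesis
    proof induction
      case zero then show ?case using that by (simp add: add_span.zero)
    next
      case (add b x)
      then have "b \<in> carrier M" "x \<in> carrier M" using BM M.M.add_span_carrier[OF BM(1)] by auto
      then show ?case using add that 1 by (auto simp: tens_add_left intro!: T.M.add_span_add[OF B, THEN conjunct2])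
    qed
  qed
  fix z assume "z \<in> carrier TT"
  then show "z \<in> add_span TT ?B"
  proof (induction rule: tensor_induct)
    case zero then show ?case by (rule add_span.zero)
  next
    case (add x y z)
    then show ?case using 2 T.M.add_span_add[OF B] by blast
  qed
qed

end

text \<open>The tensor product \<open>f \<otimes> g\<close> of two linear maps. Contractions of \<open>(f \<otimes> g) z\<close> are computed from contractions of \<open>z\<close>, which
  allows functionals to be transported along \<open>f \<otimes> g\<close>.\<close>

locale tensor_prod_map = S: tensor_prod K M N + S': tensor_prod K M' N'
  for K :: "'k ring" and M :: "('k, 'a) module" and N :: "('k, 'b) module"
    and M' :: "('k, 'c) module" and N' :: "('k, 'd) module" +
  fixes f :: "'a \<Rightarrow> 'c" and g :: "'b \<Rightarrow> 'd"
  assumes f: "f \<in> lin_hom K M M'" and g: "g \<in> lin_hom K N N'"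
begin

lemma bil: "bilinear_map K M N (tensor K M' N') (\<lambda>x y. tens K M' N' (f x) (g y))"
  using f g
  by (intro bilinear_mapI)
    (simp_all add: lin_homD S'.tens_add_left S'.tens_add_right S'.tens_smult_left S'.tens_smult_right)

lemma map_linear: "tensor_map K M' N' f g \<in> lin_hom K (tensor K M N) (tensor K M' N')"
  unfolding tensor_map_def by (rule S.tensor_lift_linear[OF S'.TT_vec_space bil])

lemma map_tens: "x \<in> carrier M \<Longrightarrow> y \<in> carrier N \<Longrightarrow>
    tensor_map K M' N' f g (tens K M N x y) = tens K M' N' (f x) (g y)"
  unfolding tensor_map_def by (rule S.tensor_lift_tens[OF S'.TT_vec_space bil])

lemma contract_right_map:
  assumes "\<phi> \<in> dual K N'" "z \<in> carrier (tensor K M N)"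
  shows "S'.contract_right \<phi> (tensor_map K M' N' f g z) = f (S.contract_right (\<lambda>y. \<phi> (g y)) z)"
proof -
  note \<phi> = dual_comp[OF assms(1) g]
  show ?thesis
  proof (rule S.tensor_linear_eqI[where f = "\<lambda>z. S'.contract_right \<phi> (tensor_map K M' N' f g z)"
        and g = "\<lambda>z. f (S.contract_right (\<lambda>y. \<phi> (g y)) z)"])
    show "(\<lambda>z. S'.contract_right \<phi> (tensor_map K M' N' f g z)) \<in> lin_hom K (tensor K M N) M'"
      by (rule lin_hom_comp[OF map_linear S'.contract_right_linear[OF assms(1)]])
    show "(\<lambda>z. f (S.contract_right (\<lambda>y. \<phi> (g y)) z)) \<in> lin_hom K (tensor K M N) M'"
      by (rule lin_hom_comp[OF S.contract_right_linear[OF \<phi>] f])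
    fix x y assume "x \<in> carrier M" "y \<in> carrier N"
    then show "S'.contract_right \<phi> (tensor_map K M' N' f g (tens K M N x y))
        = f (S.contract_right (\<lambda>y. \<phi> (g y)) (tens K M N x y))"
      by (simp add: map_tens S'.contract_right_tens[OF assms(1)] S.contract_right_tens[OF \<phi>]
          lin_homD[OF f] lin_homD[OF g] dualD[OF assms(1)])
  qed (rule S'.M.vec_space_axioms assms(2))+
qed

lemma contract_left_map:
  assumes "\<phi> \<in> dual K M'" "z \<in> carrier (tensor K M N)"
  shows "S'.contract_left \<phi> (tensor_map K M' N' f g z) = g (S.contract_left (\<lambda>y. \<phi> (f y)) z)"
proof -
  note \<phi> = dual_comp[OF assms(1) f]
  show ?thesis
  proof (rule S.tensor_linear_eqI[where f = "\<lambda>z. S'.contract_left \<phi> (tensor_map K M' N' f g z)"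
        and g = "\<lambda>z. g (S.contract_left (\<lambda>y. \<phi> (f y)) z)"])
    show "(\<lambda>z. S'.contract_left \<phi> (tensor_map K M' N' f g z)) \<in> lin_hom K (tensor K M N) N'"
      by (rule lin_hom_comp[OF map_linear S'.contract_left_linear[OF assms(1)]])
    show "(\<lambda>z. g (S.contract_left (\<lambda>y. \<phi> (f y)) z)) \<in> lin_hom K (tensor K M N) N'"
      by (rule lin_hom_comp[OF S.contract_left_linear[OF \<phi>] g])
    fix x y assume "x \<in> carrier M" "y \<in> carrier N"
    then show "S'.contract_left \<phi> (tensor_map K M' N' f g (tens K M N x y))
        = g (S.contract_left (\<lambda>y. \<phi> (f y)) (tens K M N x y))"
      by (simp add: map_tens S'.contract_left_tens[OF assms(1)] S.contract_left_tens[OF \<phi>]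
          lin_homD[OF f] lin_homD[OF g] dualD[OF assms(1)])
  qed (rule S'.N.vec_space_axioms assms(2))+
qed

end

lemma tensor_prod_mapI:
  "vec_space K M \<Longrightarrow> vec_space K N \<Longrightarrow> vec_space K M' \<Longrightarrow> vec_space K N' \<Longrightarrow>
    f \<in> lin_hom K M M' \<Longrightarrow> g \<in> lin_hom K N N' \<Longrightarrow> tensor_prod_map K M N M' N' f g"
  by (simp add: tensor_prod_map_def tensor_prod_def tensor_prod_map_axioms_def)

lemma id_lin_hom: "(\<lambda>x. x) \<in> lin_hom K M M"
  by (rule lin_homI) auto

text \<open>Write \<open>f \<otimes> g\<close> as \<open>(id \<otimes> g) \<circ> (f \<otimes> id)\<close>. If a contraction of \<open>z\<close> to \<open>M\<close> is nonzero, then its image under \<open>f\<close>, which is a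
  contraction of \<open>(f \<otimes> id) z\<close>, is nonzero, too; the second map is treated in the same way with contractions to \<open>N\<close>.\<close>

lemma (in tensor_prod_map) map_nonzero:
  assumes "\<And>x. x \<in> carrier M \<Longrightarrow> f x = \<zero>\<^bsub>M'\<^esub> \<Longrightarrow> x = \<zero>\<^bsub>M\<^esub>"
    "\<And>x. x \<in> carrier N \<Longrightarrow> g x = \<zero>\<^bsub>N'\<^esub> \<Longrightarrow> x = \<zero>\<^bsub>N\<^esub>"
    "z \<in> carrier (tensor K M N)" "tensor_map K M' N' f g z = \<zero>\<^bsub>tensor K M' N'\<^esub>"
  shows "z = \<zero>\<^bsub>tensor K M N\<^esub>"
proof (rule ccontr)
  assume nz: "z \<noteq> \<zero>\<^bsub>tensor K M N\<^esub>"
  interpret F: tensor_prod_map K M N M' N f "\<lambda>y. y"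
    by (rule tensor_prod_mapI) (unfold_locales, auto intro: f id_lin_hom)
  interpret G: tensor_prod_map K M' N M' N' "\<lambda>y. y" g
    by (rule tensor_prod_mapI) (unfold_locales, auto intro: g id_lin_hom)
  let ?z = "tensor_map K M' N f (\<lambda>y. y) z"
  have zc: "?z \<in> carrier (tensor K M' N)" using lin_homD(1)[OF F.map_linear assms(3)] .
  obtain \<phi> where \<phi>: "\<phi> \<in> dual K N" "S.contract_right \<phi> z \<noteq> \<zero>\<^bsub>M\<^esub>"
    using S.separate_right[OF assms(3) nz] by blast
  have "f (S.contract_right \<phi> z) \<noteq> \<zero>\<^bsub>M'\<^esub>"
    using assms(1)[of "S.contract_right \<phi> z"] \<phi> lin_homD(1)[OF S.contract_right_linear[OF \<phi>(1)] assms(3)] by auto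
  then have "F.S'.contract_right \<phi> ?z \<noteq> \<zero>\<^bsub>M'\<^esub>" using F.contract_right_map[OF \<phi>(1) assms(3)] by simp
  then have "?z \<noteq> \<zero>\<^bsub>tensor K M' N\<^esub>"
    using lin_hom_zero[OF F.S'.contract_right_linear[OF \<phi>(1)] F.S'.TT_vec_space S'.M.vec_space_axioms] by auto
  then obtain \<psi> where \<psi>: "\<psi> \<in> dual K M'" "F.S'.contract_left \<psi> ?z \<noteq> \<zero>\<^bsub>N\<^esub>"
    using F.S'.separate_left[OF zc] by blast
  have "g (F.S'.contract_left \<psi> ?z) \<noteq> \<zero>\<^bsub>N'\<^esub>"
    using assms(2)[of "F.S'.contract_left \<psi> ?z"] \<psi> lin_homD(1)[OF F.S'.contract_left_linear[OF \<psi>(1)] zc] by auto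
  then have "S'.contract_left \<psi> (tensor_map K M' N' (\<lambda>y. y) g ?z) \<noteq> \<zero>\<^bsub>N'\<^esub>"
    using G.contract_left_map[OF \<psi>(1) zc] by simp
  moreover have "tensor_map K M' N' (\<lambda>y. y) g ?z = tensor_map K M' N' f g z"
    by (rule S.tensor_linear_eqI[OF lin_hom_comp[OF F.map_linear G.map_linear] map_linear S'.TT_vec_space])
      (use f in \<open>simp_all add: assms F.map_tens G.map_tens map_tens lin_homD\<close>)
  ultimately show False
    using assms(4) lin_hom_zero[OF S'.contract_left_linear[OF \<psi>(1)] S'.TT_vec_space S'.N.vec_space_axioms] by simp
qed


section \<open>Twisted tensor products\<close>

locale twist = A: k_algebra K A + B: k_algebra K B
  for K :: "'k ring" and A :: "('k, 'a) module" and B :: "('k, 'b) module" +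
  fixes \<tau> :: "('k, 'b, 'a) tens \<Rightarrow> ('k, 'a, 'b) tens"
  assumes \<tau>_lin: "\<tau> \<in> lin_hom K (tensor K B A) (tensor K A B)"
begin

sublocale AB: tensor_prod K A B ..
sublocale BA: tensor_prod K B A ..

abbreviation tn where "tn \<equiv> tens K A B"
abbreviation W where "W \<equiv> twisted_tensor K A B \<tau>"

lemma W_simps [simp]:
  "carrier W = carrier (tensor K A B)" "add W = add (tensor K A B)" "zero W = zero (tensor K A B)"
  "smult W = smult (tensor K A B)" "mult W = twisted_mult K A B \<tau>" "one W = tn \<one>\<^bsub>A\<^esub> \<one>\<^bsub>B\<^esub>"
  by (simp_all add: twisted_tensor_def)

text \<open>The linear map \<open>x \<otimes> y \<mapsto> a x \<otimes> y b'\<close>; the product of \<open>a \<otimes> b\<close> and \<open>a' \<otimes> b'\<close> is its value at \<open>\<tau> (b \<otimes> a')\<close>.\<close>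

definition sandwich :: "'a \<Rightarrow> 'b \<Rightarrow> ('k, 'a, 'b) tens \<Rightarrow> ('k, 'a, 'b) tens" where
  "sandwich a b' = tensor_lift (tensor K A B) (\<lambda>x y. tn (a \<otimes>\<^bsub>A\<^esub> x) (y \<otimes>\<^bsub>B\<^esub> b'))"

lemma sandwich_bilinear: "a \<in> carrier A \<Longrightarrow> b' \<in> carrier B \<Longrightarrow>
    bilinear_map K A B (tensor K A B) (\<lambda>x y. tn (a \<otimes>\<^bsub>A\<^esub> x) (y \<otimes>\<^bsub>B\<^esub> b'))"
  by (rule bilinear_mapI)
    (simp_all add: A.r_distr B.l_distr A.smult_mult_right B.smult_mult_left AB.tens_add_left
      AB.tens_add_right AB.tens_smult_left AB.tens_smult_right)

lemma sandwich_linear: "a \<in> carrier A \<Longrightarrow> b' \<in> carrier B \<Longrightarrow> sandwich a b' \<in> lin_hom K (tensor K A B) (tensor K A B)"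
  and sandwich_tens: "a \<in> carrier A \<Longrightarrow> b' \<in> carrier B \<Longrightarrow> x \<in> carrier A \<Longrightarrow> y \<in> carrier B \<Longrightarrow>
    sandwich a b' (tn x y) = tn (a \<otimes>\<^bsub>A\<^esub> x) (y \<otimes>\<^bsub>B\<^esub> b')"
  unfolding sandwich_def
  by (simp_all add: AB.tensor_lift_linear AB.tensor_lift_tens sandwich_bilinear AB.TT_vec_space)

lemma sandwich_bilinear2:
  assumes "w \<in> carrier (tensor K A B)"
  shows "bilinear_map K A B (tensor K A B) (\<lambda>a b'. sandwich a b' w)"
  unfolding sandwich_def
  by (rule bilinear_mapI)
    (simp_all add: assms lin_homD[OF sandwich_linear, unfolded sandwich_def]
      AB.tensor_lift_add[OF AB.TT_vec_space sandwich_bilinear sandwich_bilinear sandwich_bilinear]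
      AB.tensor_lift_smult[OF AB.TT_vec_space sandwich_bilinear sandwich_bilinear]
      A.l_distr B.r_distr A.smult_mult_left B.smult_mult_right AB.tens_add_left
      AB.tens_add_right AB.tens_smult_left AB.tens_smult_right)

lemmas sandwichD = lin_homD[OF sandwich_linear] bilinear_mapD[OF sandwich_bilinear2]

lemma \<tau>_tens_bilinear: "bilinear_map K B A (tensor K A B) (\<lambda>b a'. \<tau> (tens K B A b a'))"
  by (rule bilinear_mapI)
    (simp_all add: lin_homD[OF \<tau>_lin] BA.tens_add_left BA.tens_add_right BA.tens_smult_left BA.tens_smult_right)

lemmas \<tau>D = bilinear_mapD[OF \<tau>_tens_bilinear]

lemma inner_bilinear: "a \<in> carrier A \<Longrightarrow> b \<in> carrier B \<Longrightarrow>
    bilinear_map K A B (tensor K A B) (\<lambda>a' b'. sandwich a b' (\<tau> (tens K B A b a')))"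
  by (rule bilinear_mapI) (simp_all add: sandwichD \<tau>D)

lemma outer_bilinear:
  assumes "z' \<in> carrier (tensor K A B)"
  shows "bilinear_map K A B (tensor K A B)
    (\<lambda>a b. tensor_lift (tensor K A B) (\<lambda>a' b'. sandwich a b' (\<tau> (tens K B A b a'))) z')"
proof (rule bilinear_mapI)
  fix x y assume "x \<in> carrier A" "y \<in> carrier B"
  then show "tensor_lift (tensor K A B) (\<lambda>a' b'. sandwich x b' (\<tau> (tens K B A y a'))) z' \<in> carrier (tensor K A B)"
    using lin_homD(1)[OF AB.tensor_lift_linear[OF AB.TT_vec_space inner_bilinear] assms] by blast
qed ((rule AB.tensor_lift_add[OF AB.TT_vec_space inner_bilinear inner_bilinear inner_bilinear _ assms]
    AB.tensor_lift_smult[OF AB.TT_vec_space inner_bilinear inner_bilinear _ _ assms]; simp add: sandwichD \<tau>D)+)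

lemma twisted_mult_eq: "twisted_mult K A B \<tau> z z' = tensor_lift (tensor K A B)
    (\<lambda>a b. tensor_lift (tensor K A B) (\<lambda>a' b'. sandwich a b' (\<tau> (tens K B A b a'))) z') z"
  by (simp add: twisted_mult_def sandwich_def)

lemma mult_linear_left: "z' \<in> carrier (tensor K A B) \<Longrightarrow>
    (\<lambda>z. twisted_mult K A B \<tau> z z') \<in> lin_hom K (tensor K A B) (tensor K A B)"
  unfolding twisted_mult_eq
  by (rule AB.tensor_lift_linear[OF AB.TT_vec_space outer_bilinear])

lemma mult_tens_left: "a \<in> carrier A \<Longrightarrow> b \<in> carrier B \<Longrightarrow> z' \<in> carrier (tensor K A B) \<Longrightarrow>
    twisted_mult K A B \<tau> (tn a b) z' = tensor_lift (tensor K A B) (\<lambda>a' b'. sandwich a b' (\<tau> (tens K B A b a'))) z'"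
  unfolding twisted_mult_eq
  by (rule AB.tensor_lift_tens[OF AB.TT_vec_space outer_bilinear])

lemma mult_tens: "a \<in> carrier A \<Longrightarrow> b \<in> carrier B \<Longrightarrow> a' \<in> carrier A \<Longrightarrow> b' \<in> carrier B \<Longrightarrow>
    twisted_mult K A B \<tau> (tn a b) (tn a' b') = sandwich a b' (\<tau> (tens K B A b a'))"
  using AB.tensor_lift_tens[OF AB.TT_vec_space inner_bilinear, of a b a' b'] by (simp add: mult_tens_left)

lemma mult_linear_right:
  assumes "z \<in> carrier (tensor K A B)"
  shows "twisted_mult K A B \<tau> z \<in> lin_hom K (tensor K A B) (tensor K A B)"
proof (rule lin_homI)
  note L = lin_homD[OF mult_linear_left]
  note I = AB.tensor_lift_linear[OF AB.TT_vec_space inner_bilinear]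
  fix x assume x: "x \<in> carrier (tensor K A B)"
  then show "twisted_mult K A B \<tau> z x \<in> carrier (tensor K A B)" using L(1)[OF x assms] by simp
  { fix y assume y: "y \<in> carrier (tensor K A B)"
    show "twisted_mult K A B \<tau> z (x \<oplus>\<^bsub>tensor K A B\<^esub> y) = twisted_mult K A B \<tau> z x \<oplus>\<^bsub>tensor K A B\<^esub> twisted_mult K A B \<tau> z y"
      by (rule AB.tensor_linear_eqI[OF mult_linear_left lin_hom_addf[OF AB.TT_vec_space mult_linear_left mult_linear_left] AB.TT_vec_space])
        (use x y assms in \<open>simp_all add: mult_tens_left lin_homD[OF I]\<close>) }
  fix c assume c: "c \<in> carrier K"
  show "twisted_mult K A B \<tau> z (c \<odot>\<^bsub>tensor K A B\<^esub> x) = c \<odot>\<^bsub>tensor K A B\<^esub> twisted_mult K A B \<tau> z x"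
    by (rule AB.tensor_linear_eqI[OF mult_linear_left lin_hom_smultf[OF AB.TT_vec_space mult_linear_left] AB.TT_vec_space])
      (use x c assms in \<open>simp_all add: mult_tens_left lin_homD[OF I]\<close>)
qed

text \<open>For an arbitrary twisting map the product need not be associative. Since it is bilinear, associativity can be verified on
  pure tensors of spanning elements; the unit laws are built into the notion of a twisting map.\<close>

lemma twisted_k_algebra:
  assumes tw: "twisting_map K A B \<tau>"
    and BM: "BM \<subseteq> carrier A" "carrier A \<subseteq> add_span A BM"
    and BN: "BN \<subseteq> carrier B" "carrier B \<subseteq> add_span B BN"
    and assoc: "\<And>a b a' b' a'' b''. a \<in> BM \<Longrightarrow> b \<in> BN \<Longrightarrow> a' \<in> BM \<Longrightarrow> b' \<in> BN \<Longrightarrow> a'' \<in> BM \<Longrightarrow> b'' \<in> BN \<Longrightarrow>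
      tn a b \<otimes>\<^bsub>W\<^esub> tn a' b' \<otimes>\<^bsub>W\<^esub> tn a'' b'' = tn a b \<otimes>\<^bsub>W\<^esub> (tn a' b' \<otimes>\<^bsub>W\<^esub> tn a'' b'')"
  shows "k_algebra K W"
proof -
  let ?T = "tensor K A B" and ?B = "case_prod tn ` (BM \<times> BN)" and ?m = "twisted_mult K A B \<tau>"
  note L = lin_homD[OF mult_linear_left] and R = lin_homD[OF mult_linear_right]
  have B: "?B \<subseteq> carrier ?T" using BM BN by auto
  note span = AB.tensor_product_span[OF BM BN]
  note ext = lin_hom_eq_on_span[OF _ _ AB.TT_vec_space AB.TT_vec_space span B]
  have as1: "?m (?m x y) z = ?m x (?m y z)" if "x \<in> ?B" "y \<in> ?B" "z \<in> ?B" for x y z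
    using that assoc by auto
  have as2: "?m (?m x y) z = ?m x (?m y z)" if x: "x \<in> ?B" and y: "y \<in> ?B" and z: "z \<in> carrier ?T" for x y z
  proof (rule ext[where f = "\<lambda>z. ?m (?m x y) z" and g = "\<lambda>z. ?m x (?m y z)"])
    have xy: "x \<in> carrier ?T" "y \<in> carrier ?T" using x y B by blast+
    show "(\<lambda>z. ?m (?m x y) z) \<in> lin_hom K ?T ?T" using mult_linear_right[OF L(1)[OF xy(2,1)]] .
    show "(\<lambda>z. ?m x (?m y z)) \<in> lin_hom K ?T ?T"
      by (rule lin_hom_comp[OF mult_linear_right[OF xy(2)] mult_linear_right[OF xy(1)]])
  qed (rule as1[OF x y], assumption, rule z)
  have as3: "?m (?m x y) z = ?m x (?m y z)" if x: "x \<in> ?B" and y: "y \<in> carrier ?T" and z: "z \<in> carrier ?T" for x y z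
  proof (rule ext[where f = "\<lambda>y. ?m (?m x y) z" and g = "\<lambda>y. ?m x (?m y z)"])
    have xc: "x \<in> carrier ?T" using x B by blast
    show "(\<lambda>y. ?m (?m x y) z) \<in> lin_hom K ?T ?T"
      by (rule lin_hom_comp[OF mult_linear_right[OF xc] mult_linear_left[OF z]])
    show "(\<lambda>y. ?m x (?m y z)) \<in> lin_hom K ?T ?T"
      by (rule lin_hom_comp[OF mult_linear_left[OF z] mult_linear_right[OF xc]])
  qed (rule as2[OF x _ z], assumption, rule y)
  have as: "?m (?m x y) z = ?m x (?m y z)" if x: "x \<in> carrier ?T" and y: "y \<in> carrier ?T" and z: "z \<in> carrier ?T" for x y z
  proof (rule ext[where f = "\<lambda>x. ?m (?m x y) z" and g = "\<lambda>x. ?m x (?m y z)"])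
    show "(\<lambda>x. ?m (?m x y) z) \<in> lin_hom K ?T ?T"
      by (rule lin_hom_comp[OF mult_linear_left[OF y] mult_linear_left[OF z]])
    show "(\<lambda>x. ?m x (?m y z)) \<in> lin_hom K ?T ?T"
      by (rule mult_linear_left[OF L(1)[OF z y]])
  qed (rule as3[OF _ y z], assumption, rule x)
  have \<tau>1: "\<tau> (tens K B A b \<one>\<^bsub>A\<^esub>) = tn \<one>\<^bsub>A\<^esub> b" "\<tau> (tens K B A \<one>\<^bsub>B\<^esub> a) = tn a \<one>\<^bsub>B\<^esub>"
    if "a \<in> carrier A" "b \<in> carrier B" for a b using tw that unfolding twisting_map_def by auto
  have one_l: "?m (tn \<one>\<^bsub>A\<^esub> \<one>\<^bsub>B\<^esub>) x = x" if "x \<in> carrier ?T" for x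
    by (rule AB.tensor_linear_eqI[OF mult_linear_right id_lin_hom AB.TT_vec_space])
      (use that in \<open>simp_all add: mult_tens \<tau>1 sandwich_tens\<close>)
  have one_r: "?m x (tn \<one>\<^bsub>A\<^esub> \<one>\<^bsub>B\<^esub>) = x" if "x \<in> carrier ?T" for x
    by (rule AB.tensor_linear_eqI[OF mult_linear_left id_lin_hom AB.TT_vec_space])
      (use that in \<open>simp_all add: mult_tens \<tau>1 sandwich_tens\<close>)
  have ag: "abelian_group W"
  proof (rule abelian_groupI)
    fix x assume "x \<in> carrier W"
    then show "\<exists>y\<in>carrier W. y \<oplus>\<^bsub>W\<^esub> x = \<zero>\<^bsub>W\<^esub>"
      by (intro bexI[of _ "\<ominus>\<^bsub>?T\<^esub> x"]) (simp_all add: AB.T.M.l_neg)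
  qed (simp_all add: AB.T.M.a_ac)
  have mod: "module K W"
    by (rule moduleI[OF A.K.is_cring ag])
      (simp_all add: AB.T.smult_l_distr AB.T.smult_r_distr AB.T.smult_assoc1)
  have mon: "monoid W"
    by (rule monoidI) (simp_all add: L(1) as one_l one_r)
  have rg: "ring W"
    by (rule ringI[OF ag mon]) (simp_all add: L R)
  show ?thesis
    using A.K.field_axioms mod rg unfolding k_algebra_def
    by (auto simp: k_algebra_axioms_def L R)
qed

end

text \<open>The tensor product algebra is the twisted tensor product for the exchange of factors, so its properties are instances of
  the twisted ones.\<close>

lemma tensor_algebra_eq: "tensor_algebra K A B = twisted_tensor K A B (flip_tensor K B A)"
  by (simp add: tensor_algebra_def flip_tensor_def)

locale tensor_alg = A: k_algebra K A + B: k_algebra K B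
  for K :: "'k ring" and A :: "('k, 'a) module" and B :: "('k, 'b) module"
begin

sublocale BA: tensor_prod K B A ..

sublocale tw: twist K A B "flip_tensor K B A"
  by unfold_locales (rule BA.flip_linear)

lemma TA_simps [simp]:
  "carrier (tensor_algebra K A B) = carrier (tensor K A B)"
  "add (tensor_algebra K A B) = add (tensor K A B)" "zero (tensor_algebra K A B) = zero (tensor K A B)"
  "smult (tensor_algebra K A B) = smult (tensor K A B)"
  "one (tensor_algebra K A B) = tens K A B \<one>\<^bsub>A\<^esub> \<one>\<^bsub>B\<^esub>"
  by (simp_all add: tensor_algebra_eq)

lemma tens_mult:
  "a \<in> carrier A \<Longrightarrow> b \<in> carrier B \<Longrightarrow> a' \<in> carrier A \<Longrightarrow> b' \<in> carrier B \<Longrightarrow>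
    tens K A B a b \<otimes>\<^bsub>tensor_algebra K A B\<^esub> tens K A B a' b' = tens K A B (a \<otimes>\<^bsub>A\<^esub> a') (b \<otimes>\<^bsub>B\<^esub> b')"
  by (simp add: tensor_algebra_eq tw.mult_tens BA.flip_tens tw.sandwich_tens)

lemma flip_twisting_map: "twisting_map K A B (flip_tensor K B A)"
  unfolding twisting_map_def using BA.flip_linear by (auto simp: BA.flip_tens)

lemma tensor_k_algebra: "k_algebra K (tensor_algebra K A B)"
  unfolding tensor_algebra_eq
proof (rule tw.twisted_k_algebra[OF flip_twisting_map, of "carrier A" "carrier B"])
  show "carrier A \<subseteq> add_span A (carrier A)" "carrier B \<subseteq> add_span B (carrier B)"
    using A.M.add_span_base[of "carrier A"] B.M.add_span_base[of "carrier B"] by auto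
next
  fix a b a' b' a'' b''
  assume "a \<in> carrier A" "b \<in> carrier B" "a' \<in> carrier A" "b' \<in> carrier B" "a'' \<in> carrier A" "b'' \<in> carrier B"
  then show "tw.tn a b \<otimes>\<^bsub>tw.W\<^esub> tw.tn a' b' \<otimes>\<^bsub>tw.W\<^esub> tw.tn a'' b'' = tw.tn a b \<otimes>\<^bsub>tw.W\<^esub> (tw.tn a' b' \<otimes>\<^bsub>tw.W\<^esub> tw.tn a'' b'')"
    by (simp add: tens_mult[unfolded tensor_algebra_eq] A.m_assoc B.m_assoc del: tw.W_simps(5))
qed auto

end


section \<open>Presented algebras and quotient algebras\<close>

definition alg_hom :: "'k ring \<Rightarrow> ('k, 'a) module \<Rightarrow> ('k, 'b) module \<Rightarrow> ('a \<Rightarrow> 'b) set" where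
  "alg_hom K A B = ring_hom A B \<inter> lin_hom K A B"

lemma alg_homD:
  assumes "f \<in> alg_hom K A B"
  shows "f \<in> lin_hom K A B"
    "x \<in> carrier A \<Longrightarrow> f x \<in> carrier B"
    "x \<in> carrier A \<Longrightarrow> y \<in> carrier A \<Longrightarrow> f (x \<oplus>\<^bsub>A\<^esub> y) = f x \<oplus>\<^bsub>B\<^esub> f y"
    "c \<in> carrier K \<Longrightarrow> x \<in> carrier A \<Longrightarrow> f (c \<odot>\<^bsub>A\<^esub> x) = c \<odot>\<^bsub>B\<^esub> f x"
    "x \<in> carrier A \<Longrightarrow> y \<in> carrier A \<Longrightarrow> f (x \<otimes>\<^bsub>A\<^esub> y) = f x \<otimes>\<^bsub>B\<^esub> f y"
    "f \<one>\<^bsub>A\<^esub> = \<one>\<^bsub>B\<^esub>"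
  using assms unfolding alg_hom_def ring_hom_def lin_hom_def by auto

lemma alg_homI:
  assumes "f \<in> lin_hom K A B"
    "\<And>x y. x \<in> carrier A \<Longrightarrow> y \<in> carrier A \<Longrightarrow> f (x \<otimes>\<^bsub>A\<^esub> y) = f x \<otimes>\<^bsub>B\<^esub> f y"
    "f \<one>\<^bsub>A\<^esub> = \<one>\<^bsub>B\<^esub>"
  shows "f \<in> alg_hom K A B"
  using assms unfolding alg_hom_def ring_hom_def lin_hom_def by auto

lemma alg_iso_iff: "f \<in> alg_iso K A B \<longleftrightarrow> f \<in> alg_hom K A B \<and> bij_betw f (carrier A) (carrier B)"
  unfolding alg_iso_def alg_hom_def ring_iso_def by auto

lemma alg_cong_terms:
  assumes "field K" "(p, q) \<in> alg_cong K X Rel"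
  shows "p \<in> alg_terms K X \<and> q \<in> alg_terms K X"
proof -
  interpret K: field K by fact
  show ?thesis using assms(2)
    by induction (auto intro: alg_terms.intros)
qed

lemma equiv_alg_cong: "field K \<Longrightarrow> equiv (alg_terms K X) (alg_cong K X Rel)"
  by (auto intro!: equivI refl_onI symI transI intro: alg_cong.refl alg_cong.sym alg_cong.trans
      dest: alg_cong_terms)

lemma presented_algebra_simps:
  assumes "field K"
  shows "carrier (presented_algebra K X Rel) = alg_terms K X // alg_cong K X Rel"
    "\<zero>\<^bsub>presented_algebra K X Rel\<^esub> = alg_cong K X Rel `` {AZero}"
    "\<one>\<^bsub>presented_algebra K X Rel\<^esub> = alg_cong K X Rel `` {AOne}"
    "p \<in> alg_terms K X \<Longrightarrow> q \<in> alg_terms K X \<Longrightarrow>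
      alg_cong K X Rel `` {p} \<oplus>\<^bsub>presented_algebra K X Rel\<^esub> alg_cong K X Rel `` {q} = alg_cong K X Rel `` {AAdd p q}"
    "p \<in> alg_terms K X \<Longrightarrow> q \<in> alg_terms K X \<Longrightarrow>
      alg_cong K X Rel `` {p} \<otimes>\<^bsub>presented_algebra K X Rel\<^esub> alg_cong K X Rel `` {q} = alg_cong K X Rel `` {AMult p q}"
    "c \<in> carrier K \<Longrightarrow> p \<in> alg_terms K X \<Longrightarrow>
      c \<odot>\<^bsub>presented_algebra K X Rel\<^esub> alg_cong K X Rel `` {p} = alg_cong K X Rel `` {AScal c p}"
  unfolding presented_algebra_def Let_def
  by (simp_all add: UN_equiv_classes1[OF equiv_alg_cong[OF assms]]
      UN_equiv_classes2[OF equiv_alg_cong[OF assms]] alg_cong.add alg_cong.mult alg_cong.scal)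

lemma presented_algebra_k_algebra:
  assumes "field K"
  shows "k_algebra K (presented_algebra K X Rel)"
proof -
  interpret K: field K by fact
  let ?M = "presented_algebra K X Rel" and ?E = "alg_cong K X Rel" and ?T = "alg_terms K X"
  note simps = presented_algebra_simps[OF assms, where X = X and Rel = Rel]
  have eq: "?E `` {p} = ?E `` {q}" if "(p, q) \<in> ?E" for p q
    using equiv_class_eq[OF equiv_alg_cong[OF assms] that] .
  have cls: "?E `` {p} \<in> carrier ?M" if "p \<in> ?T" for p using that by (simp add: simps quotientI)
  have E: "\<exists>p\<in>?T. x = ?E `` {p}" if "x \<in> carrier ?M" for x using that by (auto simp: simps elim!: quotientE)
  note I = alg_terms.intros
  have zc: "\<zero>\<^bsub>?M\<^esub> \<in> carrier ?M" "\<one>\<^bsub>?M\<^esub> \<in> carrier ?M" by (simp_all add: simps(2,3) cls I)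
  have A1: "x \<oplus>\<^bsub>?M\<^esub> y \<in> carrier ?M \<and> x \<otimes>\<^bsub>?M\<^esub> y \<in> carrier ?M \<and>
      (x \<oplus>\<^bsub>?M\<^esub> y) \<oplus>\<^bsub>?M\<^esub> z = x \<oplus>\<^bsub>?M\<^esub> (y \<oplus>\<^bsub>?M\<^esub> z) \<and>
      (x \<otimes>\<^bsub>?M\<^esub> y) \<otimes>\<^bsub>?M\<^esub> z = x \<otimes>\<^bsub>?M\<^esub> (y \<otimes>\<^bsub>?M\<^esub> z) \<and>
      (x \<oplus>\<^bsub>?M\<^esub> y) \<otimes>\<^bsub>?M\<^esub> z = x \<otimes>\<^bsub>?M\<^esub> z \<oplus>\<^bsub>?M\<^esub> y \<otimes>\<^bsub>?M\<^esub> z \<and>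
      z \<otimes>\<^bsub>?M\<^esub> (x \<oplus>\<^bsub>?M\<^esub> y) = z \<otimes>\<^bsub>?M\<^esub> x \<oplus>\<^bsub>?M\<^esub> z \<otimes>\<^bsub>?M\<^esub> y \<and>
      x \<oplus>\<^bsub>?M\<^esub> y = y \<oplus>\<^bsub>?M\<^esub> x"
    if xyz: "x \<in> carrier ?M" "y \<in> carrier ?M" "z \<in> carrier ?M" for x y z
  proof -
    obtain p q r where [simp]: "x = ?E `` {p}" "y = ?E `` {q}" "z = ?E `` {r}"
      and t [simp]: "p \<in> ?T" "q \<in> ?T" "r \<in> ?T" using E xyz by metis
    note eqs = eq[OF alg_cong.add_assoc[OF t]] eq[OF alg_cong.mult_assoc[OF t]] eq[OF alg_cong.distl[OF t]]
      eq[OF alg_cong.distr[OF t]] eq[OF alg_cong.add_comm[OF t(1,2)]]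
    show ?thesis by (simp add: simps(4,5) cls I eqs(1-4)) (rule eqs(5))
  qed
  have A2: "\<zero>\<^bsub>?M\<^esub> \<oplus>\<^bsub>?M\<^esub> x = x \<and> \<one>\<^bsub>?M\<^esub> \<otimes>\<^bsub>?M\<^esub> x = x \<and> x \<otimes>\<^bsub>?M\<^esub> \<one>\<^bsub>?M\<^esub> = x \<and> \<one>\<^bsub>K\<^esub> \<odot>\<^bsub>?M\<^esub> x = x
      \<and> (\<exists>y\<in>carrier ?M. y \<oplus>\<^bsub>?M\<^esub> x = \<zero>\<^bsub>?M\<^esub>)" if x: "x \<in> carrier ?M" for x
  proof -
    obtain p where [simp]: "x = ?E `` {p}" and t [simp]: "p \<in> ?T" using E[OF x] by metis
    note eqs = eq[OF alg_cong.add_zero[OF t]] eq[OF alg_cong.one_left[OF t]] eq[OF alg_cong.one_right[OF t]]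
      eq[OF alg_cong.scal_one[OF t]] eq[OF alg_cong.add_neg[OF t]]
    show ?thesis
      by (simp add: simps(2-6) I eqs)
        (rule bexI[of _ "?E `` {AScal (\<ominus>\<^bsub>K\<^esub> \<one>\<^bsub>K\<^esub>) p}"], simp_all add: simps(4) cls I eqs)
  qed
  have A3: "a \<odot>\<^bsub>?M\<^esub> x \<in> carrier ?M \<and> (a \<oplus>\<^bsub>K\<^esub> b) \<odot>\<^bsub>?M\<^esub> x = a \<odot>\<^bsub>?M\<^esub> x \<oplus>\<^bsub>?M\<^esub> b \<odot>\<^bsub>?M\<^esub> x \<and>
      (a \<otimes>\<^bsub>K\<^esub> b) \<odot>\<^bsub>?M\<^esub> x = a \<odot>\<^bsub>?M\<^esub> (b \<odot>\<^bsub>?M\<^esub> x) \<and>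
      a \<odot>\<^bsub>?M\<^esub> (x \<oplus>\<^bsub>?M\<^esub> y) = a \<odot>\<^bsub>?M\<^esub> x \<oplus>\<^bsub>?M\<^esub> a \<odot>\<^bsub>?M\<^esub> y \<and>
      (a \<odot>\<^bsub>?M\<^esub> x) \<otimes>\<^bsub>?M\<^esub> y = a \<odot>\<^bsub>?M\<^esub> (x \<otimes>\<^bsub>?M\<^esub> y) \<and> x \<otimes>\<^bsub>?M\<^esub> (a \<odot>\<^bsub>?M\<^esub> y) = a \<odot>\<^bsub>?M\<^esub> (x \<otimes>\<^bsub>?M\<^esub> y)"
    if ab: "a \<in> carrier K" "b \<in> carrier K" and xy: "x \<in> carrier ?M" "y \<in> carrier ?M" for a b x y
  proof -
    obtain p q where [simp]: "x = ?E `` {p}" "y = ?E `` {q}" and t [simp]: "p \<in> ?T" "q \<in> ?T" using E xy by metis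
    note eqs = eq[OF alg_cong.scal_distl[OF ab t(1)]] eq[OF alg_cong.scal_scal[OF ab t(1)]]
      eq[OF alg_cong.scal_distr[OF ab(1) t]] eq[OF alg_cong.mult_scal_left[OF ab(1) t]]
      eq[OF alg_cong.mult_scal_right[OF ab(1) t]]
    show ?thesis using ab by (simp add: simps(4-6) cls I eqs)
  qed
  have 1: "x \<oplus>\<^bsub>?M\<^esub> y \<in> carrier ?M" "x \<otimes>\<^bsub>?M\<^esub> y \<in> carrier ?M" "x \<oplus>\<^bsub>?M\<^esub> y = y \<oplus>\<^bsub>?M\<^esub> x"
    if "x \<in> carrier ?M" "y \<in> carrier ?M" for x y
    using A1[OF that that(1)] by blast+
  have 3: "a \<odot>\<^bsub>?M\<^esub> x \<in> carrier ?M" "(a \<oplus>\<^bsub>K\<^esub> b) \<odot>\<^bsub>?M\<^esub> x = a \<odot>\<^bsub>?M\<^esub> x \<oplus>\<^bsub>?M\<^esub> b \<odot>\<^bsub>?M\<^esub> x"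
    "(a \<otimes>\<^bsub>K\<^esub> b) \<odot>\<^bsub>?M\<^esub> x = a \<odot>\<^bsub>?M\<^esub> (b \<odot>\<^bsub>?M\<^esub> x)"
    if "a \<in> carrier K" "b \<in> carrier K" "x \<in> carrier ?M" for a b x
    using A3[OF that that(3)] by blast+
  have 4: "a \<odot>\<^bsub>?M\<^esub> (x \<oplus>\<^bsub>?M\<^esub> y) = a \<odot>\<^bsub>?M\<^esub> x \<oplus>\<^bsub>?M\<^esub> a \<odot>\<^bsub>?M\<^esub> y"
      "(a \<odot>\<^bsub>?M\<^esub> x) \<otimes>\<^bsub>?M\<^esub> y = a \<odot>\<^bsub>?M\<^esub> (x \<otimes>\<^bsub>?M\<^esub> y)" "x \<otimes>\<^bsub>?M\<^esub> (a \<odot>\<^bsub>?M\<^esub> y) = a \<odot>\<^bsub>?M\<^esub> (x \<otimes>\<^bsub>?M\<^esub> y)"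
    if "a \<in> carrier K" "x \<in> carrier ?M" "y \<in> carrier ?M" for a x y
    using A3[OF that(1,1,2,3)] by blast+
  have ag: "abelian_group ?M"
  proof (rule abelian_groupI)
    show "\<exists>y\<in>carrier ?M. y \<oplus>\<^bsub>?M\<^esub> x = \<zero>\<^bsub>?M\<^esub>" if "x \<in> carrier ?M" for x
      using A2[OF that] by blast
    show "(x \<oplus>\<^bsub>?M\<^esub> y) \<oplus>\<^bsub>?M\<^esub> z = x \<oplus>\<^bsub>?M\<^esub> (y \<oplus>\<^bsub>?M\<^esub> z)"
      if "x \<in> carrier ?M" "y \<in> carrier ?M" "z \<in> carrier ?M" for x y z
      using A1[OF that] by blast
    show "\<zero>\<^bsub>?M\<^esub> \<oplus>\<^bsub>?M\<^esub> x = x" if "x \<in> carrier ?M" for x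
      using A2[OF that] by blast
    show "x \<oplus>\<^bsub>?M\<^esub> y = y \<oplus>\<^bsub>?M\<^esub> x" if "x \<in> carrier ?M" "y \<in> carrier ?M" for x y
      by (rule 1(3)[OF that])
  qed (simp_all add: 1(1) zc)
  have mod: "module K ?M"
    by (rule moduleI[OF K.is_cring ag]) (simp_all add: A2 3(2,3) 4(1) 3(1)[OF _ K.zero_closed])
  have mon: "monoid ?M"
    by (rule monoidI) (simp_all add: 1(2) A1 A2 zc)
  have rg: "ring ?M"
    by (rule ringI[OF ag mon]) (simp_all add: A1)
  show ?thesis
    using assms mod rg unfolding k_algebra_def k_algebra_axioms_def by (simp add: 4(2,3))
qed

primrec alg_eval :: "('k, 'a) module \<Rightarrow> ('x \<Rightarrow> 'a) \<Rightarrow> ('k, 'x) alg_term \<Rightarrow> 'a" where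
  "alg_eval M f (AVar x) = f x"
| "alg_eval M f AZero = \<zero>\<^bsub>M\<^esub>"
| "alg_eval M f AOne = \<one>\<^bsub>M\<^esub>"
| "alg_eval M f (AAdd p q) = alg_eval M f p \<oplus>\<^bsub>M\<^esub> alg_eval M f q"
| "alg_eval M f (AMult p q) = alg_eval M f p \<otimes>\<^bsub>M\<^esub> alg_eval M f q"
| "alg_eval M f (AScal c p) = c \<odot>\<^bsub>M\<^esub> alg_eval M f p"

lemma alg_eval_cong:
  assumes P: "k_algebra K P" and f: "\<And>x. x \<in> X \<Longrightarrow> f x \<in> carrier P"
    and rel: "\<And>p q. (p, q) \<in> Rel \<Longrightarrow> p \<in> alg_terms K X \<Longrightarrow> q \<in> alg_terms K X \<Longrightarrow> alg_eval P f p = alg_eval P f q"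
  shows "p \<in> alg_terms K X \<Longrightarrow> alg_eval P f p \<in> carrier P"
    and "(p, q) \<in> alg_cong K X Rel \<Longrightarrow> alg_eval P f p = alg_eval P f q"
proof -
  interpret P: k_algebra K P by fact
  show cl: "alg_eval P f p \<in> carrier P" if "p \<in> alg_terms K X" for p
    using that by induction (auto simp: f)
  show "alg_eval P f p = alg_eval P f q" if "(p, q) \<in> alg_cong K X Rel"
    using that
    by induction (auto simp: rel cl P.smult_assoc1 P.smult_l_distr P.smult_r_distr P.M.a_ac
        P.smult_l_minus P.M.r_neg P.m_assoc P.l_distr P.r_distr P.smult_mult_left P.smult_mult_right)
qed

text \<open>Evaluation of terms is constant on congruence classes; this is the universal property of the presentation.\<close>

lemma presented_algebra_hom:
  assumes P: "k_algebra K P" and f: "\<And>x. x \<in> X \<Longrightarrow> f x \<in> carrier P"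
    and rel: "\<And>p q. (p, q) \<in> Rel \<Longrightarrow> p \<in> alg_terms K X \<Longrightarrow> q \<in> alg_terms K X \<Longrightarrow> alg_eval P f p = alg_eval P f q"
  shows "\<exists>\<phi>\<in>alg_hom K (presented_algebra K X Rel) P. \<forall>x\<in>X. \<phi> (alg_cong K X Rel `` {AVar x}) = f x"
proof -
  interpret P: k_algebra K P by fact
  let ?E = "alg_cong K X Rel" and ?M = "presented_algebra K X Rel"
  note simps = presented_algebra_simps[OF P.K.field_axioms, where X = X and Rel = Rel]
  define \<phi> where "\<phi> z = alg_eval P f (SOME p. p \<in> z)" for z
  note ev = alg_eval_cong[OF P, of X f Rel, OF f rel]
  have val: "\<phi> (?E `` {p}) = alg_eval P f p" if "p \<in> alg_terms K X" for p
  proof -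
    have "p \<in> ?E `` {p}" using that by (simp add: alg_cong.refl)
    then have "(SOME q. q \<in> ?E `` {p}) \<in> ?E `` {p}" by (rule someI)
    then have "(p, SOME q. q \<in> ?E `` {p}) \<in> ?E" by simp
    then have "alg_eval P f p = alg_eval P f (SOME q. q \<in> ?E `` {p})" using ev(2) by blast
    then show ?thesis by (simp add: \<phi>_def)
  qed
  have E: "\<exists>p\<in>alg_terms K X. x = ?E `` {p}" if "x \<in> carrier ?M" for x
    using that by (auto simp: simps elim!: quotientE)
  have "\<phi> \<in> alg_hom K ?M P"
  proof (rule alg_homI[OF lin_homI])
    show "\<phi> \<one>\<^bsub>?M\<^esub> = \<one>\<^bsub>P\<^esub>" by (simp add: simps val alg_terms.intros)
    fix x assume x: "x \<in> carrier ?M"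
    then obtain p where p: "p \<in> alg_terms K X" "x = ?E `` {p}" using E by blast
    then show "\<phi> x \<in> carrier P" by (simp add: val ev(1))
    { fix c assume "c \<in> carrier K"
      then show "\<phi> (c \<odot>\<^bsub>?M\<^esub> x) = c \<odot>\<^bsub>P\<^esub> \<phi> x"
        using p by (simp add: val simps alg_terms.intros) }
    { fix y assume y: "y \<in> carrier ?M"
      then obtain q where q: "q \<in> alg_terms K X" "y = ?E `` {q}" using E by blast
      show "\<phi> (x \<oplus>\<^bsub>?M\<^esub> y) = \<phi> x \<oplus>\<^bsub>P\<^esub> \<phi> y"
        using p q by (simp add: val simps alg_terms.intros) }
    fix y assume y: "y \<in> carrier ?M"
    then obtain q where q: "q \<in> alg_terms K X" "y = ?E `` {q}" using E by blast
    show "\<phi> (x \<otimes>\<^bsub>?M\<^esub> y) = \<phi> x \<otimes>\<^bsub>P\<^esub> \<phi> y"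
      using p q by (simp add: val simps alg_terms.intros)
  qed
  moreover have "\<forall>x\<in>X. \<phi> (?E `` {AVar x}) = f x"
    by (simp add: val alg_terms.intros)
  ultimately show ?thesis by blast
qed

locale quot_alg = A: k_algebra K A + I: ideal J A
  for K :: "'k ring" and A :: "('k, 'a) module" and J
begin

abbreviation Q where "Q \<equiv> alg_quot A J"
abbreviation pr where "pr \<equiv> \<lambda>x. J +>\<^bsub>A\<^esub> x"

lemma J_smult: "c \<in> carrier K \<Longrightarrow> x \<in> J \<Longrightarrow> c \<odot>\<^bsub>A\<^esub> x \<in> J"
  using I.I_l_closed[of x "c \<odot>\<^bsub>A\<^esub> \<one>\<^bsub>A\<^esub>"] I.Icarr[of x] by (simp add: A.smult_mult_left)

lemma pr_eq_iff: "x \<in> carrier A \<Longrightarrow> y \<in> carrier A \<Longrightarrow> pr x = pr y \<longleftrightarrow> x \<ominus>\<^bsub>A\<^esub> y \<in> J"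
  using A.quotient_eq_iff_same_a_r_cos[OF I.ideal_axioms] by blast

lemma Q_simps:
  "carrier Q = pr ` carrier A"
  "x \<in> carrier A \<Longrightarrow> y \<in> carrier A \<Longrightarrow> pr x \<oplus>\<^bsub>Q\<^esub> pr y = pr (x \<oplus>\<^bsub>A\<^esub> y)"
  "x \<in> carrier A \<Longrightarrow> y \<in> carrier A \<Longrightarrow> pr x \<otimes>\<^bsub>Q\<^esub> pr y = pr (x \<otimes>\<^bsub>A\<^esub> y)"
  "c \<in> carrier K \<Longrightarrow> x \<in> carrier A \<Longrightarrow> c \<odot>\<^bsub>Q\<^esub> pr x = pr (c \<odot>\<^bsub>A\<^esub> x)"
  "\<zero>\<^bsub>Q\<^esub> = pr \<zero>\<^bsub>A\<^esub>" "\<one>\<^bsub>Q\<^esub> = pr \<one>\<^bsub>A\<^esub>"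
proof -
  show "carrier Q = pr ` carrier A"
    by (auto simp: alg_quot_def ring.extend_def module.fields_def FactRing_def A_RCOSETS_def RCOSETS_def a_r_coset_def)
  show "x \<in> carrier A \<Longrightarrow> y \<in> carrier A \<Longrightarrow> pr x \<oplus>\<^bsub>Q\<^esub> pr y = pr (x \<oplus>\<^bsub>A\<^esub> y)"
    by (simp add: alg_quot_def ring.extend_def module.fields_def FactRing_def I.a_rcos_sum)
  show "x \<in> carrier A \<Longrightarrow> y \<in> carrier A \<Longrightarrow> pr x \<otimes>\<^bsub>Q\<^esub> pr y = pr (x \<otimes>\<^bsub>A\<^esub> y)"
    by (simp add: alg_quot_def ring.extend_def module.fields_def FactRing_def I.rcoset_mult_add)
  show "\<zero>\<^bsub>Q\<^esub> = pr \<zero>\<^bsub>A\<^esub>" "\<one>\<^bsub>Q\<^esub> = pr \<one>\<^bsub>A\<^esub>"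
    by (simp_all add: alg_quot_def ring.extend_def module.fields_def FactRing_def A.a_coset_add_zero I.a_subset)
  assume c: "c \<in> carrier K" and x: "x \<in> carrier A"
  have "pr (c \<odot>\<^bsub>A\<^esub> y) = pr (c \<odot>\<^bsub>A\<^esub> x)" if "y \<in> pr x" for y
  proof -
    have y: "y \<in> carrier A" using that x I.a_subset A.a_r_coset_subset_G by blast
    have "y \<ominus>\<^bsub>A\<^esub> x \<in> J" using I.a_rcos_module_imp[OF x that] by (simp add: a_minus_def)
    then have "c \<odot>\<^bsub>A\<^esub> (y \<ominus>\<^bsub>A\<^esub> x) \<in> J" using J_smult c by blast
    then have "c \<odot>\<^bsub>A\<^esub> y \<ominus>\<^bsub>A\<^esub> c \<odot>\<^bsub>A\<^esub> x \<in> J"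
      using x y c by (simp add: a_minus_def A.smult_r_distr A.smult_r_minus)
    then show ?thesis using pr_eq_iff x y c by simp
  qed
  moreover have "x \<in> pr x" using I.a_rcos_self[OF x] .
  ultimately have "(\<Union>y\<in>pr x. pr (c \<odot>\<^bsub>A\<^esub> y)) = pr (c \<odot>\<^bsub>A\<^esub> x)" by blast
  then show "c \<odot>\<^bsub>Q\<^esub> pr x = pr (c \<odot>\<^bsub>A\<^esub> x)"
    by (simp add: alg_quot_def ring.extend_def module.fields_def)
qed

lemma Q_k_algebra: "k_algebra K Q"
proof -
  have E: "\<exists>a\<in>carrier A. x = pr a" if "x \<in> carrier Q" for x using that by (auto simp: Q_simps)
  have cl: "pr x \<in> carrier Q" if "x \<in> carrier A" for x using that by (auto simp: Q_simps)
  note S = Q_simps(2-)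
  have A1: "x \<oplus>\<^bsub>Q\<^esub> y \<in> carrier Q \<and> x \<otimes>\<^bsub>Q\<^esub> y \<in> carrier Q \<and>
      (x \<oplus>\<^bsub>Q\<^esub> y) \<oplus>\<^bsub>Q\<^esub> z = x \<oplus>\<^bsub>Q\<^esub> (y \<oplus>\<^bsub>Q\<^esub> z) \<and>
      (x \<otimes>\<^bsub>Q\<^esub> y) \<otimes>\<^bsub>Q\<^esub> z = x \<otimes>\<^bsub>Q\<^esub> (y \<otimes>\<^bsub>Q\<^esub> z) \<and>
      (x \<oplus>\<^bsub>Q\<^esub> y) \<otimes>\<^bsub>Q\<^esub> z = x \<otimes>\<^bsub>Q\<^esub> z \<oplus>\<^bsub>Q\<^esub> y \<otimes>\<^bsub>Q\<^esub> z \<and>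
      z \<otimes>\<^bsub>Q\<^esub> (x \<oplus>\<^bsub>Q\<^esub> y) = z \<otimes>\<^bsub>Q\<^esub> x \<oplus>\<^bsub>Q\<^esub> z \<otimes>\<^bsub>Q\<^esub> y \<and>
      x \<oplus>\<^bsub>Q\<^esub> y = y \<oplus>\<^bsub>Q\<^esub> x"
    if xyz: "x \<in> carrier Q" "y \<in> carrier Q" "z \<in> carrier Q" for x y z
  proof -
    obtain a b c where "x = pr a" "y = pr b" "z = pr c" "a \<in> carrier A" "b \<in> carrier A" "c \<in> carrier A"
      using E xyz by metis
    then show ?thesis by (simp add: S cl A.M.a_ac A.m_assoc A.l_distr A.r_distr)
  qed
  have A2: "\<zero>\<^bsub>Q\<^esub> \<oplus>\<^bsub>Q\<^esub> x = x \<and> \<one>\<^bsub>Q\<^esub> \<otimes>\<^bsub>Q\<^esub> x = x \<and> x \<otimes>\<^bsub>Q\<^esub> \<one>\<^bsub>Q\<^esub> = x \<and> \<one>\<^bsub>K\<^esub> \<odot>\<^bsub>Q\<^esub> x = x \<and> (\<exists>y\<in>carrier Q. y \<oplus>\<^bsub>Q\<^esub> x = \<zero>\<^bsub>Q\<^esub>)" if x: "x \<in> carrier Q" for x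
  proof -
    obtain a where "x = pr a" "a \<in> carrier A" using E[OF x] by metis
    then show ?thesis by (intro conjI bexI[of _ "pr (\<ominus>\<^bsub>A\<^esub> a)"]) (simp_all add: S cl A.M.l_neg)
  qed
  have A3: "a \<odot>\<^bsub>Q\<^esub> x \<in> carrier Q \<and> (a \<oplus>\<^bsub>K\<^esub> b) \<odot>\<^bsub>Q\<^esub> x = a \<odot>\<^bsub>Q\<^esub> x \<oplus>\<^bsub>Q\<^esub> b \<odot>\<^bsub>Q\<^esub> x \<and>
      (a \<otimes>\<^bsub>K\<^esub> b) \<odot>\<^bsub>Q\<^esub> x = a \<odot>\<^bsub>Q\<^esub> (b \<odot>\<^bsub>Q\<^esub> x) \<and>
      a \<odot>\<^bsub>Q\<^esub> (x \<oplus>\<^bsub>Q\<^esub> y) = a \<odot>\<^bsub>Q\<^esub> x \<oplus>\<^bsub>Q\<^esub> a \<odot>\<^bsub>Q\<^esub> y \<and>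
      (a \<odot>\<^bsub>Q\<^esub> x) \<otimes>\<^bsub>Q\<^esub> y = a \<odot>\<^bsub>Q\<^esub> (x \<otimes>\<^bsub>Q\<^esub> y) \<and> x \<otimes>\<^bsub>Q\<^esub> (a \<odot>\<^bsub>Q\<^esub> y) = a \<odot>\<^bsub>Q\<^esub> (x \<otimes>\<^bsub>Q\<^esub> y)"
    if ab: "a \<in> carrier K" "b \<in> carrier K" and xy: "x \<in> carrier Q" "y \<in> carrier Q" for a b x y
  proof -
    obtain u v where "x = pr u" "y = pr v" "u \<in> carrier A" "v \<in> carrier A" using E xy by metis
    then show ?thesis using ab
      by (simp add: S cl A.smult_l_distr A.smult_r_distr A.smult_assoc1 A.smult_mult_left A.smult_mult_right)
  qed
  have zc: "\<zero>\<^bsub>Q\<^esub> \<in> carrier Q" "\<one>\<^bsub>Q\<^esub> \<in> carrier Q" by (simp_all add: S cl)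
  have 1: "x \<oplus>\<^bsub>Q\<^esub> y \<in> carrier Q" "x \<otimes>\<^bsub>Q\<^esub> y \<in> carrier Q" "x \<oplus>\<^bsub>Q\<^esub> y = y \<oplus>\<^bsub>Q\<^esub> x"
    if "x \<in> carrier Q" "y \<in> carrier Q" for x y
    using A1[OF that that(1)] by blast+
  have 3: "a \<odot>\<^bsub>Q\<^esub> x \<in> carrier Q" "(a \<oplus>\<^bsub>K\<^esub> b) \<odot>\<^bsub>Q\<^esub> x = a \<odot>\<^bsub>Q\<^esub> x \<oplus>\<^bsub>Q\<^esub> b \<odot>\<^bsub>Q\<^esub> x"
    "(a \<otimes>\<^bsub>K\<^esub> b) \<odot>\<^bsub>Q\<^esub> x = a \<odot>\<^bsub>Q\<^esub> (b \<odot>\<^bsub>Q\<^esub> x)"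
    if "a \<in> carrier K" "b \<in> carrier K" "x \<in> carrier Q" for a b x
    using A3[OF that that(3)] by blast+
  have 4: "a \<odot>\<^bsub>Q\<^esub> (x \<oplus>\<^bsub>Q\<^esub> y) = a \<odot>\<^bsub>Q\<^esub> x \<oplus>\<^bsub>Q\<^esub> a \<odot>\<^bsub>Q\<^esub> y"
      "(a \<odot>\<^bsub>Q\<^esub> x) \<otimes>\<^bsub>Q\<^esub> y = a \<odot>\<^bsub>Q\<^esub> (x \<otimes>\<^bsub>Q\<^esub> y)" "x \<otimes>\<^bsub>Q\<^esub> (a \<odot>\<^bsub>Q\<^esub> y) = a \<odot>\<^bsub>Q\<^esub> (x \<otimes>\<^bsub>Q\<^esub> y)"
    if "a \<in> carrier K" "x \<in> carrier Q" "y \<in> carrier Q" for a x y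
    using A3[OF that(1,1,2,3)] by blast+
  have ag: "abelian_group Q"
  proof (rule abelian_groupI)
    show "\<exists>y\<in>carrier Q. y \<oplus>\<^bsub>Q\<^esub> x = \<zero>\<^bsub>Q\<^esub>" if "x \<in> carrier Q" for x
      using A2[OF that] by blast
    show "(x \<oplus>\<^bsub>Q\<^esub> y) \<oplus>\<^bsub>Q\<^esub> z = x \<oplus>\<^bsub>Q\<^esub> (y \<oplus>\<^bsub>Q\<^esub> z)"
      if "x \<in> carrier Q" "y \<in> carrier Q" "z \<in> carrier Q" for x y z
      using A1[OF that] by blast
    show "\<zero>\<^bsub>Q\<^esub> \<oplus>\<^bsub>Q\<^esub> x = x" if "x \<in> carrier Q" for x
      using A2[OF that] by blast
    show "x \<oplus>\<^bsub>Q\<^esub> y = y \<oplus>\<^bsub>Q\<^esub> x" if "x \<in> carrier Q" "y \<in> carrier Q" for x y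
      by (rule 1(3)[OF that])
  qed (simp_all add: 1(1) zc)
  have mod: "module K Q"
    by (rule moduleI[OF A.K.is_cring ag]) (simp_all add: A2 3(2,3) 4(1) 3(1)[OF _ A.K.zero_closed])
  have mon: "monoid Q"
    by (rule monoidI) (simp_all add: 1(2) A1 A2 zc)
  have rg: "ring Q"
    by (rule ringI[OF ag mon]) (simp_all add: A1)
  show ?thesis
    using A.K.field_axioms mod rg unfolding k_algebra_def k_algebra_axioms_def by (simp add: 4(2,3))
qed

lemma pr_hom: "pr \<in> alg_hom K A Q"
  by (intro alg_homI lin_homI) (auto simp: Q_simps)

lemma pr_zero_iff: "x \<in> carrier A \<Longrightarrow> pr x = \<zero>\<^bsub>Q\<^esub> \<longleftrightarrow> x \<in> J"
  using pr_eq_iff[of x "\<zero>\<^bsub>A\<^esub>"] by (simp add: Q_simps a_minus_def)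

end


section \<open>Words of automorphisms\<close>

definition letter_aut :: "('a, 'm) ring_scheme \<Rightarrow> (nat \<Rightarrow> 'a \<Rightarrow> 'a) \<Rightarrow> int \<Rightarrow> 'a \<Rightarrow> 'a" where
  "letter_aut R f u = (if u > 0 then f (nat u) else inv_into (carrier R) (f (nat (- u))))"

definition word_aut :: "('a, 'm) ring_scheme \<Rightarrow> (nat \<Rightarrow> 'a \<Rightarrow> 'a) \<Rightarrow> int list \<Rightarrow> 'a \<Rightarrow> 'a" where
  "word_aut R f us r = foldr (letter_aut R f) us r"

lemma word_aut_simps [simp]:
  "word_aut R f [] r = r" "word_aut R f (u # us) r = letter_aut R f u (word_aut R f us r)"
  "word_aut R f (us @ vs) r = word_aut R f us (word_aut R f vs r)"
  by (simp_all add: word_aut_def)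

lemma pm_uminus [simp]: "- u \<in> pm n \<longleftrightarrow> u \<in> pm n"
  by (auto simp: pm_def)

lemma lists_pm_uminus [simp]: "map uminus us \<in> lists (pm n) \<longleftrightarrow> us \<in> lists (pm n)"
  by (induction us) auto

lemma pm_cases:
  assumes "u \<in> pm n"
  obtains i where "i \<in> {1..n}" "u = int i" | i where "i \<in> {1..n}" "u = - int i"
proof (cases "u > 0")
  case True
  then show ?thesis using assms that(1)[of "nat u"] by (auto simp: pm_def)
next
  case False
  then show ?thesis using assms that(2)[of "nat (- u)"] by (auto simp: pm_def)
qed

lemma int_in_pm [simp]: "int i \<in> pm n \<longleftrightarrow> i \<in> {1..n}"
  by (auto simp: pm_def)

lemma word_degree_simps [simp]:
  "word_degree [] = (\<lambda>_. 0)"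
  "word_degree (u # us) = (\<lambda>i. gen_degree u i + word_degree us i)"
  "word_degree (us @ vs) = (\<lambda>i. word_degree us i + word_degree vs i)"
  by (simp_all add: word_degree_def)

lemma gen_degree_uminus [simp]: "gen_degree (- u) = (\<lambda>i. - gen_degree u i)"
  by (auto simp: gen_degree_def)

lemma word_degree_uminus [simp]: "word_degree (map uminus us) = (\<lambda>i. - word_degree us i)"
  by (induction us) auto

lemma word_degree_rev [simp]: "word_degree (rev us) = word_degree us"
  by (induction us) auto

lemma inv_into_iso:
  assumes R: "k_algebra K R" and g: "g \<in> alg_iso K R R"
  shows "inv_into (carrier R) g \<in> alg_iso K R R"
    "x \<in> carrier R \<Longrightarrow> inv_into (carrier R) g (g x) = x"
    "x \<in> carrier R \<Longrightarrow> g (inv_into (carrier R) g x) = x"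
proof -
  interpret R: k_algebra K R by fact
  let ?h = "inv_into (carrier R) g"
  have g': "g \<in> alg_hom K R R" "bij_betw g (carrier R) (carrier R)" using g by (simp_all add: alg_iso_iff)
  note gD = alg_homD[OF g'(1)]
  have 1: "?h (g x) = x" if "x \<in> carrier R" for x using g'(2) that by (simp add: bij_betw_def)
  have 2: "g (?h x) = x" if "x \<in> carrier R" for x
    using g'(2) that by (metis bij_betw_inv_into_right)
  have 3: "?h x \<in> carrier R" if "x \<in> carrier R" for x
    using g'(2) that by (metis bij_betw_def inv_into_into)
  have eq: "?h x = y" if "y \<in> carrier R" "x = g y" for x y using 1 that by simp
  have "?h \<in> alg_hom K R R"
  proof (intro alg_homI lin_homI)
    show "?h \<one>\<^bsub>R\<^esub> = \<one>\<^bsub>R\<^esub>" by (rule eq) (simp_all add: gD)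
    fix x assume x: "x \<in> carrier R"
    show "?h x \<in> carrier R" by (rule 3[OF x])
    { fix c assume "c \<in> carrier K"
      then show "?h (c \<odot>\<^bsub>R\<^esub> x) = c \<odot>\<^bsub>R\<^esub> ?h x" using x by (intro eq) (simp_all add: gD 2 3) }
    { fix y assume y: "y \<in> carrier R"
      show "?h (x \<oplus>\<^bsub>R\<^esub> y) = ?h x \<oplus>\<^bsub>R\<^esub> ?h y" using x y by (intro eq) (simp_all add: gD 2 3) }
    fix y assume y: "y \<in> carrier R"
    show "?h (x \<otimes>\<^bsub>R\<^esub> y) = ?h x \<otimes>\<^bsub>R\<^esub> ?h y" using x y by (intro eq) (simp_all add: gD 2 3)
  qed
  moreover have "bij_betw ?h (carrier R) (carrier R)" by (rule bij_betw_inv_into[OF g'(2)])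
  ultimately show "?h \<in> alg_iso K R R" by (simp add: alg_iso_iff)
  show "x \<in> carrier R \<Longrightarrow> ?h (g x) = x" "x \<in> carrier R \<Longrightarrow> g (?h x) = x" by fact+
qed

text \<open>A letter \<open>u\<close> in \<open>\<plusminus>[n]\<close> acts by \<open>\<sigma>\<close> with index \<open>\<bar>u\<bar>\<close> or by its inverse, and a word acts by the composite of its letters. As the
  automorphisms commute, the action of a word is the power of \<open>\<sigma>\<close> given by its degree (\<open>multi_aut_pow_word\<close>), but words are
  easier to handle in inductions.\<close>

locale aut_family = R: k_algebra K R
  for K :: "'k ring" and R :: "('k, 'r) module" and n :: nat and \<sigma> :: "nat \<Rightarrow> 'r \<Rightarrow> 'r" +
  assumes auts: "commuting_automorphisms K n R \<sigma>"
begin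

abbreviation sg where "sg \<equiv> letter_aut R \<sigma>"
abbreviation wsg where "wsg \<equiv> word_aut R \<sigma>"

lemma \<sigma>_iso: "i \<in> {1..n} \<Longrightarrow> \<sigma> i \<in> alg_iso K R R"
  using auts unfolding commuting_automorphisms_def by blast

lemma \<sigma>_comm: "i \<in> {1..n} \<Longrightarrow> j \<in> {1..n} \<Longrightarrow> x \<in> carrier R \<Longrightarrow> \<sigma> i (\<sigma> j x) = \<sigma> j (\<sigma> i x)"
  using auts unfolding commuting_automorphisms_def by blast

lemmas inv_\<sigma> = inv_into_iso[OF R.k_algebra_axioms \<sigma>_iso]

lemma sg_int [simp]: "i \<in> {1..n} \<Longrightarrow> sg (int i) = \<sigma> i" "i \<in> {1..n} \<Longrightarrow> sg (- int i) = inv_into (carrier R) (\<sigma> i)"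
  by (auto simp: letter_aut_def)

lemma sg_iso: "u \<in> pm n \<Longrightarrow> sg u \<in> alg_iso K R R"
  by (erule pm_cases) (auto simp: \<sigma>_iso inv_\<sigma>)

lemma sg_hom: "u \<in> pm n \<Longrightarrow> sg u \<in> alg_hom K R R"
  using sg_iso by (simp add: alg_iso_iff)

lemma sg_closed [simp]: "u \<in> pm n \<Longrightarrow> r \<in> carrier R \<Longrightarrow> sg u r \<in> carrier R"
  by (rule alg_homD(2)[OF sg_hom])

lemma sg_inv [simp]: "u \<in> pm n \<Longrightarrow> r \<in> carrier R \<Longrightarrow> sg (- u) (sg u r) = r"
  by (erule pm_cases) (simp_all add: inv_\<sigma>)

lemma sg_inv' [simp]: "u \<in> pm n \<Longrightarrow> r \<in> carrier R \<Longrightarrow> sg u (sg (- u) r) = r"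
  using sg_inv[of "- u" r] by simp

text \<open>A map commuting with a bijection commutes with its inverse.\<close>

lemma sg_comm_map:
  assumes g: "\<And>r. r \<in> carrier R \<Longrightarrow> g r \<in> carrier R"
    and c: "\<And>i r. i \<in> {1..n} \<Longrightarrow> r \<in> carrier R \<Longrightarrow> g (\<sigma> i r) = \<sigma> i (g r)"
    and u: "u \<in> pm n" and r: "r \<in> carrier R"
  shows "g (sg u r) = sg u (g r)"
  using u
proof (cases rule: pm_cases)
  case (1 i)
  then show ?thesis using c r by simp
next
  case (2 i)
  have s: "sg u r \<in> carrier R" using u r by simp
  have "sg (- u) (g (sg u r)) = g (sg (- u) (sg u r))" using c[OF 2(1) s] 2 by simp
  then have "sg u (sg (- u) (g (sg u r))) = sg u (g r)" using u r by simp
  then show ?thesis using u g[OF s] by simp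
qed

lemma sg_comm: "u \<in> pm n \<Longrightarrow> v \<in> pm n \<Longrightarrow> r \<in> carrier R \<Longrightarrow> sg u (sg v r) = sg v (sg u r)"
proof (rule sg_comm_map)
  fix i r assume "u \<in> pm n" "i \<in> {1..n}" "r \<in> carrier R"
  then show "sg u (\<sigma> i r) = \<sigma> i (sg u r)"
    using sg_comm_map[where g = "\<sigma> i", of u r] sg_closed[of "int i"] by (simp add: \<sigma>_comm)
qed auto

lemma wsg_hom: "us \<in> lists (pm n) \<Longrightarrow> wsg us \<in> alg_hom K R R"
proof (induction us)
  case Nil then show ?case by (auto intro!: alg_homI lin_homI)
next
  case (Cons u us)
  then have "sg u \<in> alg_hom K R R" "wsg us \<in> alg_hom K R R" using sg_hom by auto
  then show ?case by (auto intro!: alg_homI lin_homI simp: alg_homD)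
qed

lemma wsg_closed [simp]: "us \<in> lists (pm n) \<Longrightarrow> r \<in> carrier R \<Longrightarrow> wsg us r \<in> carrier R"
  by (rule alg_homD(2)[OF wsg_hom])

lemma wsg_comm_map:
  assumes g: "\<And>r. r \<in> carrier R \<Longrightarrow> g r \<in> carrier R"
    and c: "\<And>i r. i \<in> {1..n} \<Longrightarrow> r \<in> carrier R \<Longrightarrow> g (\<sigma> i r) = \<sigma> i (g r)"
    and us: "us \<in> lists (pm n)" and r: "r \<in> carrier R"
  shows "g (wsg us r) = wsg us (g r)"
  using us
proof (induction us)
  case (Cons u us)
  then show ?case using sg_comm_map[where g = g, OF g c, of u "wsg us r"] r by simp
qed simp

lemma sg_wsg: "u \<in> pm n \<Longrightarrow> us \<in> lists (pm n) \<Longrightarrow> r \<in> carrier R \<Longrightarrow> sg u (wsg us r) = wsg us (sg u r)"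
  by (induction us) (simp_all add: sg_comm)

lemma wsg_inv [simp]: "us \<in> lists (pm n) \<Longrightarrow> r \<in> carrier R \<Longrightarrow> wsg (map uminus us) (wsg us r) = r"
  by (induction us arbitrary: r) (simp_all add: sg_wsg[symmetric])

lemma wsg_inv' [simp]: "us \<in> lists (pm n) \<Longrightarrow> r \<in> carrier R \<Longrightarrow> wsg us (wsg (map uminus us) r) = r"
  using wsg_inv[of "map uminus us" r] by (simp add: comp_def)

lemma wsg_iso:
  assumes us: "us \<in> lists (pm n)"
  shows "wsg us \<in> alg_iso K R R"
proof -
  have us': "map uminus us \<in> lists (pm n)" using us by simp
  have "bij_betw (wsg us) (carrier R) (carrier R)"
    by (rule bij_betw_byWitness[where f' = "wsg (map uminus us)"])
      (use wsg_closed[OF us] wsg_closed[OF us'] wsg_inv[OF us] wsg_inv'[OF us] in blast)+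
  then show ?thesis by (simp add: alg_iso_iff wsg_hom[OF us])
qed

lemma aut_pow_step:
  assumes i: "i \<in> {1..n}" and r: "r \<in> carrier R"
  shows "aut_pow R (\<sigma> i) z r \<in> carrier R"
    "aut_pow R (\<sigma> i) (z + 1) r = \<sigma> i (aut_pow R (\<sigma> i) z r)"
    "aut_pow R (\<sigma> i) (z - 1) r = inv_into (carrier R) (\<sigma> i) (aut_pow R (\<sigma> i) z r)"
proof -
  let ?h = "inv_into (carrier R) (\<sigma> i)"
  have 1: "(\<sigma> i ^^ k) r \<in> carrier R" for k
    using i r alg_homD(2)[of "\<sigma> i" K R R] \<sigma>_iso by (induction k) (auto simp: alg_iso_iff)
  have 2: "(?h ^^ k) r \<in> carrier R" for k
    using i r inv_\<sigma>(1)[OF i] alg_homD(2)[of ?h K R R] by (induction k) (auto simp: alg_iso_iff)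
  show "aut_pow R (\<sigma> i) z r \<in> carrier R" using 1 2 by (simp add: aut_pow_def)
  show "aut_pow R (\<sigma> i) (z + 1) r = \<sigma> i (aut_pow R (\<sigma> i) z r)"
  proof (cases "z \<ge> 0")
    case True
    then have "nat (z + 1) = Suc (nat z)" by simp
    then show ?thesis using True by (simp add: aut_pow_def)
  next
    case False
    then have *: "nat (- z) = Suc (nat (- z - 1))" by simp
    show ?thesis
    proof (cases "z = -1")
      case True then show ?thesis using i r by (simp add: aut_pow_def inv_\<sigma>)
    next
      case f: False
      then have "- (z + 1) = - z - 1" by simp
      then show ?thesis using False f * 2[of "nat (- z - 1)"] i by (simp add: aut_pow_def inv_\<sigma>)
    qed
  qed
  show "aut_pow R (\<sigma> i) (z - 1) r = ?h (aut_pow R (\<sigma> i) z r)"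
  proof (cases "z \<le> 0")
    case True
    then have *: "nat (- (z - 1)) = Suc (nat (- z))" by simp
    show ?thesis
    proof (cases "z = 0")
      case True then show ?thesis by (simp add: aut_pow_def)
    next
      case False
      then show ?thesis using True * by (simp add: aut_pow_def del: nat_minus_as_int)
    qed
  next
    case False
    then have *: "nat z = Suc (nat (z - 1))" by simp
    then show ?thesis using False 1[of "nat (z - 1)"] i by (simp add: aut_pow_def inv_\<sigma>)
  qed
qed

lemma aut_pow_letter:
  assumes u: "u \<in> pm n" and r: "r \<in> carrier R" and i: "\<bar>u\<bar> = int i"
  shows "aut_pow R (\<sigma> i) (sgn u + z) r = sg u (aut_pow R (\<sigma> i) z r)"
  using u
proof (cases rule: pm_cases)
  case (1 j) then show ?thesis using aut_pow_step(2)[of i r z] i r by (simp add: add.commute)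
next
  case (2 j) then show ?thesis using aut_pow_step(3)[of i r z] i r by simp
qed

lemma sg_aut_pow:
  assumes u: "u \<in> pm n" and i: "i \<in> {1..n}" and r: "r \<in> carrier R"
  shows "sg u (aut_pow R (\<sigma> i) z r) = aut_pow R (\<sigma> i) z (sg u r)"
proof -
  have "sg u ((\<sigma> i ^^ k) r) = (\<sigma> i ^^ k) (sg u r) \<and> (\<sigma> i ^^ k) r \<in> carrier R" for k
    using r u sg_comm[OF u, of "int i"] sg_closed[of "int i"] i by (induction k) auto
  moreover have "sg u ((inv_into (carrier R) (\<sigma> i) ^^ k) r) = (inv_into (carrier R) (\<sigma> i) ^^ k) (sg u r)
      \<and> (inv_into (carrier R) (\<sigma> i) ^^ k) r \<in> carrier R" for k
    using r u sg_comm[OF u, of "- int i"] sg_closed[of "- int i"] i by (induction k) auto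
  ultimately show ?thesis by (simp add: aut_pow_def)
qed

text \<open>Prefixing a letter \<open>u\<close> changes one exponent in the ordered product of powers by \<open>\<plusminus>1\<close>; the corresponding automorphism is
  moved to the front past the other factors. The general form over a list \<open>xs\<close> of distinct indices makes this an induction.\<close>

lemma multi_aut_pow_word:
  assumes "us \<in> lists (pm n)" "r \<in> carrier R"
  shows "multi_aut_pow R n \<sigma> (word_degree us) r = wsg us r"
proof -
  define F where "F xs \<alpha> = foldr (\<lambda>i g. aut_pow R (\<sigma> i) (\<alpha> i) \<circ> g) xs id" for xs and \<alpha> :: "nat \<Rightarrow> int"
  have F_closed: "set xs \<subseteq> {1..n} \<Longrightarrow> F xs \<alpha> r \<in> carrier R" if "r \<in> carrier R" for xs \<alpha> r
    by (induction xs) (simp_all add: F_def that aut_pow_step)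
  have step: "F xs (\<lambda>i. gen_degree u i + \<alpha> i) r = (if nat \<bar>u\<bar> \<in> set xs then sg u (F xs \<alpha> r) else F xs \<alpha> r)"
    if "u \<in> pm n" "r \<in> carrier R" "set xs \<subseteq> {1..n}" "distinct xs" for xs u \<alpha> r
    using that(3,4)
  proof (induction xs)
    case Nil then show ?case by (simp add: F_def)
  next
    case (Cons i xs)
    have c: "F xs \<alpha> r \<in> carrier R" using F_closed that Cons.prems by simp
    have i: "i \<in> {1..n}" using Cons.prems by simp
    have F: "F (i # xs) \<beta> r = aut_pow R (\<sigma> i) (\<beta> i) (F xs \<beta> r)" for \<beta> by (simp add: F_def)
    show ?case
    proof (cases "\<bar>u\<bar> = int i")
      case True
      then have "gen_degree u i = sgn u" "nat \<bar>u\<bar> = i" by (simp_all add: gen_degree_def)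
      then show ?thesis using Cons aut_pow_letter[OF that(1) c True] by (simp add: F)
    next
      case False
      then have "gen_degree u i = 0" "nat \<bar>u\<bar> \<noteq> i" by (auto simp: gen_degree_def)
      then show ?thesis using Cons sg_aut_pow[OF that(1) i c] by (simp add: F)
    qed
  qed
  have "F [1..<Suc n] (word_degree us) r = wsg us r"
    using assms(1)
  proof (induction us)
    case Nil
    have "F xs (\<lambda>_. 0) r = r" for xs by (induction xs) (simp_all add: F_def aut_pow_def)
    then show ?case by simp
  next
    case (Cons u us)
    then have "nat \<bar>u\<bar> \<in> set [1..<Suc n]" "set [1..<Suc n] \<subseteq> {1..n}" by (auto simp: pm_def)
    then show ?case using Cons step[of u r "[1..<Suc n]" "word_degree us"] assms(2)
      by (simp del: upt_Suc set_upt)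
  qed
  then show ?thesis by (simp add: multi_aut_pow_def F_def)
qed

lemma sg_zero_iff: "u \<in> pm n \<Longrightarrow> r \<in> carrier R \<Longrightarrow> sg u r = \<zero>\<^bsub>R\<^esub> \<longleftrightarrow> r = \<zero>\<^bsub>R\<^esub>"
  using lin_hom_zero[OF alg_homD(1)[OF sg_hom]] sg_inv[of u r] k_algebra_vec_space[OF R.k_algebra_axioms]
  by (metis pm_uminus)

lemma regular_sg:
  assumes u: "u \<in> pm n" and c: "regular_element R c"
  shows "regular_element R (sg u c)"
proof -
  have cR: "c \<in> carrier R" using c by (simp add: regular_element_def)
  have "r = \<zero>\<^bsub>R\<^esub>" if r: "r \<in> carrier R" and z: "sg u c \<otimes>\<^bsub>R\<^esub> r = \<zero>\<^bsub>R\<^esub> \<or> r \<otimes>\<^bsub>R\<^esub> sg u c = \<zero>\<^bsub>R\<^esub>" for r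
  proof -
    let ?s = "sg (- u) r"
    have s: "?s \<in> carrier R" using u r by simp
    have "sg u (c \<otimes>\<^bsub>R\<^esub> ?s) = \<zero>\<^bsub>R\<^esub> \<or> sg u (?s \<otimes>\<^bsub>R\<^esub> c) = \<zero>\<^bsub>R\<^esub>"
      using z u r cR by (simp add: alg_homD[OF sg_hom[OF u]])
    then have "c \<otimes>\<^bsub>R\<^esub> ?s = \<zero>\<^bsub>R\<^esub> \<or> ?s \<otimes>\<^bsub>R\<^esub> c = \<zero>\<^bsub>R\<^esub>" using sg_zero_iff[OF u] cR s by simp
    then have "?s = \<zero>\<^bsub>R\<^esub>" using c s unfolding regular_element_def by blast
    then show ?thesis using sg_zero_iff[of "- u" r] u r by simp
  qed
  moreover have "sg u c \<in> carrier R" using u cR by simp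
  ultimately show ?thesis unfolding regular_element_def by blast
qed

end

lemma (in ring) regular_mult:
  assumes "regular_element R a" "regular_element R b"
  shows "regular_element R (a \<otimes> b)"
proof -
  have a: "a \<in> carrier R" "\<And>r. r \<in> carrier R \<Longrightarrow> a \<otimes> r = \<zero> \<Longrightarrow> r = \<zero>" "\<And>r. r \<in> carrier R \<Longrightarrow> r \<otimes> a = \<zero> \<Longrightarrow> r = \<zero>"
    and b: "b \<in> carrier R" "\<And>r. r \<in> carrier R \<Longrightarrow> b \<otimes> r = \<zero> \<Longrightarrow> r = \<zero>" "\<And>r. r \<in> carrier R \<Longrightarrow> r \<otimes> b = \<zero> \<Longrightarrow> r = \<zero>"
    using assms unfolding regular_element_def by blast+
  have "r = \<zero>" if "r \<in> carrier R" "a \<otimes> b \<otimes> r = \<zero>" for r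
    using a(2)[of "b \<otimes> r"] b(2)[of r] that a(1) b(1) by (simp add: m_assoc)
  moreover have "r = \<zero>" if "r \<in> carrier R" "r \<otimes> (a \<otimes> b) = \<zero>" for r
    using b(3)[of "r \<otimes> a"] a(3)[of r] that a(1) b(1) by (simp add: m_assoc)
  ultimately show ?thesis using m_closed[OF a(1) b(1)] unfolding regular_element_def by blast
qed


section \<open>Algebras generated by coefficients and letters\<close>

locale tgw_datum = R: k_algebra K R
  for K :: "'k ring" and n :: nat and \<mu> :: "nat \<Rightarrow> nat \<Rightarrow> 'k" and R :: "('k, 'r) module"
    and \<sigma> :: "nat \<Rightarrow> 'r \<Rightarrow> 'r" and t :: "nat \<Rightarrow> 'r" +
  assumes datum: "tgwd K n R \<sigma> t" and nonzero: "nonzero_matrix K n \<mu>"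
begin

sublocale aut_family K R n \<sigma>
  using datum by unfold_locales (simp add: tgwd_def)

text \<open>The coefficient \<open>X\<^bsub>-u\<^esub> X\<^sub>u\<close>, for letters \<open>u\<close> of either sign. It treats the two relations between a letter and its inverse
  uniformly.\<close>

definition tt :: "int \<Rightarrow> 'r" where
  "tt u = (if u > 0 then t (nat u) else \<sigma> (nat (- u)) (t (nat (- u))))"

lemma t_center: "i \<in> {1..n} \<Longrightarrow> t i \<in> carrier R" "i \<in> {1..n} \<Longrightarrow> r \<in> carrier R \<Longrightarrow> t i \<otimes>\<^bsub>R\<^esub> r = r \<otimes>\<^bsub>R\<^esub> t i"
  using datum by (auto simp: tgwd_def center_def)

lemma tt_closed [simp]: "u \<in> pm n \<Longrightarrow> tt u \<in> carrier R"
  by (erule pm_cases) (use t_center sg_closed[of "int i" for i] in \<open>auto simp: tt_def\<close>)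

lemma \<mu>_nonzero: "i \<in> {1..n} \<Longrightarrow> j \<in> {1..n} \<Longrightarrow> \<mu> i j \<in> carrier K" "i \<in> {1..n} \<Longrightarrow> j \<in> {1..n} \<Longrightarrow> \<mu> i j \<noteq> \<zero>\<^bsub>K\<^esub>"
  using nonzero by (auto simp: nonzero_matrix_def)

lemma regular_tt:
  assumes "regular_datum n R t" "u \<in> pm n"
  shows "regular_element R (tt u)"
  using assms(2)
proof (cases rule: pm_cases)
  case (1 i) then show ?thesis using assms(1) by (auto simp: regular_datum_def tt_def)
next
  case (2 i)
  have "regular_element R (sg (int i) (t i))"
    using assms(1) 2 by (intro regular_sg) (auto simp: regular_datum_def)
  then show ?thesis using 2 by (simp add: tt_def)
qed

end

text \<open>Algebras that receive the coefficients and the letters subject to the relations of a datum: the construction, its quotient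
  by the canonical ideal, and the twisted tensor product over the combined datum. The general theory of monomials is developed
  once for all three.\<close>

locale tgw_rel = tgw_datum K n \<mu> R \<sigma> t + A: k_algebra K A
  for K :: "'k ring" and n :: nat and \<mu> :: "nat \<Rightarrow> nat \<Rightarrow> 'k" and R :: "('k, 'r) module"
    and \<sigma> :: "nat \<Rightarrow> 'r \<Rightarrow> 'r" and t :: "nat \<Rightarrow> 'r" and A :: "('k, 'a) module" +
  fixes \<iota> :: "'r \<Rightarrow> 'a" and X :: "int \<Rightarrow> 'a"
  assumes \<iota>_hom: "\<iota> \<in> alg_hom K R A"
    and X_closed [simp]: "u \<in> pm n \<Longrightarrow> X u \<in> carrier A"
    and X_\<iota>: "u \<in> pm n \<Longrightarrow> r \<in> carrier R \<Longrightarrow> X u \<otimes>\<^bsub>A\<^esub> \<iota> r = \<iota> (sg u r) \<otimes>\<^bsub>A\<^esub> X u"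
    and X_uminus: "u \<in> pm n \<Longrightarrow> X (- u) \<otimes>\<^bsub>A\<^esub> X u = \<iota> (tt u)"
    and X_exchange: "i \<in> {1..n} \<Longrightarrow> j \<in> {1..n} \<Longrightarrow> i \<noteq> j \<Longrightarrow>
      X (int i) \<otimes>\<^bsub>A\<^esub> X (- int j) = \<mu> i j \<odot>\<^bsub>A\<^esub> (X (- int j) \<otimes>\<^bsub>A\<^esub> X (int i))"
begin

definition wX :: "int list \<Rightarrow> 'a" where
  "wX us = foldr (\<lambda>u x. X u \<otimes>\<^bsub>A\<^esub> x) us \<one>\<^bsub>A\<^esub>"

definition mon :: "'r \<Rightarrow> int list \<Rightarrow> 'a" where
  "mon r us = \<iota> r \<otimes>\<^bsub>A\<^esub> wX us"

abbreviation words :: "int list set" where "words \<equiv> lists (pm n)"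

definition monoms :: "'a set" where "monoms = {mon r us | r us. r \<in> carrier R \<and> us \<in> words}"

lemmas \<iota>D [simp] = alg_homD(2-)[OF \<iota>_hom]

lemma \<iota>_zero [simp]: "\<iota> \<zero>\<^bsub>R\<^esub> = \<zero>\<^bsub>A\<^esub>"
  by (rule lin_hom_zero[OF alg_homD(1)[OF \<iota>_hom] k_algebra_vec_space[OF R.k_algebra_axioms]
        k_algebra_vec_space[OF A.k_algebra_axioms]])

lemma wX_simps [simp]: "wX [] = \<one>\<^bsub>A\<^esub>" "wX (u # us) = X u \<otimes>\<^bsub>A\<^esub> wX us"
  by (simp_all add: wX_def)

lemma wX_closed [simp]: "us \<in> words \<Longrightarrow> wX us \<in> carrier A"
  by (induction us) simp_all

lemma wX_append: "us \<in> words \<Longrightarrow> vs \<in> words \<Longrightarrow> wX (us @ vs) = wX us \<otimes>\<^bsub>A\<^esub> wX vs"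
  by (induction us) (simp_all add: A.m_assoc)

lemma wX_\<iota>: "us \<in> words \<Longrightarrow> r \<in> carrier R \<Longrightarrow> wX us \<otimes>\<^bsub>A\<^esub> \<iota> r = \<iota> (wsg us r) \<otimes>\<^bsub>A\<^esub> wX us"
proof (induction us)
  case (Cons u us)
  then have "wX (u # us) \<otimes>\<^bsub>A\<^esub> \<iota> r = X u \<otimes>\<^bsub>A\<^esub> \<iota> (wsg us r) \<otimes>\<^bsub>A\<^esub> wX us" by (simp add: A.m_assoc)
  then show ?case using Cons by (simp add: X_\<iota> A.m_assoc)
qed simp

lemma mon_closed [simp]: "r \<in> carrier R \<Longrightarrow> us \<in> words \<Longrightarrow> mon r us \<in> carrier A"
  by (simp add: mon_def)

lemma mon_Nil [simp]: "r \<in> carrier R \<Longrightarrow> mon r [] = \<iota> r"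
  by (simp add: mon_def)

lemma mon_one: "us \<in> words \<Longrightarrow> mon \<one>\<^bsub>R\<^esub> us = wX us"
  by (simp add: mon_def)

lemma mon_mult:
  "r \<in> carrier R \<Longrightarrow> r' \<in> carrier R \<Longrightarrow> us \<in> words \<Longrightarrow> vs \<in> words \<Longrightarrow>
    mon r us \<otimes>\<^bsub>A\<^esub> mon r' vs = mon (r \<otimes>\<^bsub>R\<^esub> wsg us r') (us @ vs)"
proof -
  assume a: "r \<in> carrier R" "r' \<in> carrier R" "us \<in> words" "vs \<in> words"
  have "mon r us \<otimes>\<^bsub>A\<^esub> mon r' vs = \<iota> r \<otimes>\<^bsub>A\<^esub> (wX us \<otimes>\<^bsub>A\<^esub> \<iota> r') \<otimes>\<^bsub>A\<^esub> wX vs"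
    using a by (simp add: mon_def A.m_assoc)
  then show ?thesis using a by (simp add: wX_\<iota> mon_def wX_append A.m_assoc)
qed

lemma monoms_carrier: "monoms \<subseteq> carrier A"
  unfolding monoms_def using mon_closed by blast

text \<open>A product of monomials is a monomial, because coefficients can be moved to the left past letters.\<close>

lemma span_monoms_mult:
  assumes "x \<in> add_span A monoms" "y \<in> add_span A monoms"
  shows "x \<otimes>\<^bsub>A\<^esub> y \<in> add_span A monoms"
proof -
  note c = A.M.add_span_carrier[OF monoms_carrier] and ad = A.M.add_span_add[OF monoms_carrier, THEN conjunct2]
  have 1: "m \<otimes>\<^bsub>A\<^esub> y \<in> add_span A monoms" if m: "m \<in> monoms" for m
    using assms(2)
  proof induction
    case zero
      have "m \<in> carrier A" using m monoms_carrier by blast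
      then show ?case by (simp add: add_span.zero)
  next
    case (add b x)
    then have "b \<in> carrier A" "x \<in> carrier A" "m \<in> carrier A" using m monoms_carrier c by auto
    moreover have "m \<otimes>\<^bsub>A\<^esub> b \<in> monoms"
    proof -
      obtain r us s vs where "m = mon r us" "b = mon s vs" "r \<in> carrier R" "s \<in> carrier R" "us \<in> words" "vs \<in> words"
        using m add(1) unfolding monoms_def by blast
      then have "m \<otimes>\<^bsub>A\<^esub> b = mon (r \<otimes>\<^bsub>R\<^esub> wsg us s) (us @ vs)" "r \<otimes>\<^bsub>R\<^esub> wsg us s \<in> carrier R" "us @ vs \<in> words"
        by (simp_all add: mon_mult)
      then show ?thesis unfolding monoms_def by blast
    qed
    ultimately show ?case using add by (simp add: A.r_distr add_span.add)
  qed
  show ?thesis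
    using assms(1)
  proof induction
    case zero then show ?case using c[OF assms(2)] by (simp add: add_span.zero)
  next
    case (add b x)
    then have "b \<in> carrier A" "x \<in> carrier A" using monoms_carrier c by auto
    then show ?case using add 1 ad c[OF assms(2)] by (simp add: A.l_distr)
  qed
qed

lemma span_monoms_smult:
  assumes "x \<in> add_span A monoms" "c \<in> carrier K"
  shows "c \<odot>\<^bsub>A\<^esub> x \<in> add_span A monoms"
proof -
  have "mon (c \<odot>\<^bsub>R\<^esub> \<one>\<^bsub>R\<^esub>) [] \<in> monoms" using assms(2) unfolding monoms_def by blast
  then have "mon (c \<odot>\<^bsub>R\<^esub> \<one>\<^bsub>R\<^esub>) [] \<otimes>\<^bsub>A\<^esub> x \<in> add_span A monoms"
    using span_monoms_mult A.M.add_span_base[OF monoms_carrier] assms(1) by blast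
  then show ?thesis
    using assms A.M.add_span_carrier[OF monoms_carrier assms(1)] by (simp add: A.smult_mult_left)
qed

end

text \<open>The spanning condition replaces the statement that the coefficients and the letters generate the algebra.\<close>

locale tgw_alg = tgw_rel K n \<mu> R \<sigma> t A \<iota> X
  for K :: "'k ring" and n :: nat and \<mu> :: "nat \<Rightarrow> nat \<Rightarrow> 'k" and R :: "('k, 'r) module"
    and \<sigma> :: "nat \<Rightarrow> 'r \<Rightarrow> 'r" and t :: "nat \<Rightarrow> 'r" and A :: "('k, 'a) module"
    and \<iota> :: "'r \<Rightarrow> 'a" and X :: "int \<Rightarrow> 'a" +
  assumes span_monoms: "carrier A \<subseteq> add_span A monoms"
begin

lemma monom_induct [consumes 1, case_names zero add]:
  assumes "x \<in> carrier A" "P \<zero>\<^bsub>A\<^esub>"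
    "\<And>r us x. r \<in> carrier R \<Longrightarrow> us \<in> words \<Longrightarrow> x \<in> carrier A \<Longrightarrow> P x \<Longrightarrow> P (mon r us \<oplus>\<^bsub>A\<^esub> x)"
  shows "P x"
proof -
  have "x \<in> add_span A monoms" using assms(1) span_monoms by blast
  then show ?thesis
  proof induction
    case (add b x) then show ?case
      using assms(3) A.M.add_span_carrier[OF monoms_carrier, of x] by (auto simp: monoms_def)
  qed (rule assms)
qed

lemma A_vec_space: "vec_space K A"
  by (rule k_algebra_vec_space) (rule A.k_algebra_axioms)

lemma linear_eq_monoms:
  assumes "f \<in> lin_hom K A P" "g \<in> lin_hom K A P" "vec_space K P"
    "\<And>r us. r \<in> carrier R \<Longrightarrow> us \<in> words \<Longrightarrow> f (mon r us) = g (mon r us)" "x \<in> carrier A"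
  shows "f x = g x"
  by (rule lin_hom_eq_on_span[OF assms(1,2) A_vec_space assms(3) span_monoms monoms_carrier _ assms(5)])
    (use assms(4) in \<open>auto simp: monoms_def\<close>)

lemma mult_lin_left: "y \<in> carrier A \<Longrightarrow> (\<lambda>x. x \<otimes>\<^bsub>A\<^esub> y) \<in> lin_hom K A A"
  by (rule lin_homI) (simp_all add: A.l_distr A.smult_mult_left)

lemma mult_lin_right: "y \<in> carrier A \<Longrightarrow> (\<lambda>x. y \<otimes>\<^bsub>A\<^esub> x) \<in> lin_hom K A A"
  by (rule lin_homI) (simp_all add: A.r_distr A.smult_mult_right)

text \<open>The relations contain the exchange rule with the positive letter on the left; the reverse rule follows as the scalars are
  invertible. There is no rule for two letters of the same sign.\<close>

lemma exchange_letters: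
  assumes "u \<in> pm n" "v \<in> pm n" "\<bar>u\<bar> \<noteq> \<bar>v\<bar>" "sgn u \<noteq> sgn v"
  shows "\<exists>c\<in>carrier K. X u \<otimes>\<^bsub>A\<^esub> X v = c \<odot>\<^bsub>A\<^esub> (X v \<otimes>\<^bsub>A\<^esub> X u)"
  using assms(1)
proof (cases rule: pm_cases)
  case (1 i)
  then obtain j where "j \<in> {1..n}" "v = - int j" using assms(4) by (cases rule: pm_cases[OF assms(2)]) auto
  then show ?thesis using X_exchange[of i j] \<mu>_nonzero[of i j] 1 assms(3) by auto
next
  case (2 i)
  then obtain j where j: "j \<in> {1..n}" "v = int j" using assms(4) by (cases rule: pm_cases[OF assms(2)]) auto
  let ?c = "inv\<^bsub>K\<^esub> (\<mu> j i)"
  have "?c \<in> carrier K" using \<mu>_nonzero[of j i] 2 j by (simp add: R.K.field_Units)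
  moreover have "X v \<otimes>\<^bsub>A\<^esub> X u = \<mu> j i \<odot>\<^bsub>A\<^esub> (X u \<otimes>\<^bsub>A\<^esub> X v)"
    using X_exchange[of j i] 2 j assms(3) by auto
  then have "?c \<odot>\<^bsub>A\<^esub> (X v \<otimes>\<^bsub>A\<^esub> X u) = X u \<otimes>\<^bsub>A\<^esub> X v"
    using vec_space.smult_inv_cancel[OF A_vec_space, of "\<mu> j i" "X u \<otimes>\<^bsub>A\<^esub> X v"] \<mu>_nonzero[of j i] 2 j by simp
  ultimately show ?thesis by metis
qed

text \<open>Rewriting a word by the relations multiplies it by a coefficient. The relation is not symmetric, since a coefficient such
  as \<open>t\<^sub>i\<close>, which arises when a letter meets its inverse, need not be invertible.\<close>

definition coeff_multiple :: "'a \<Rightarrow> 'a \<Rightarrow> bool" where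
  "coeff_multiple x y \<longleftrightarrow> (\<exists>r\<in>carrier R. x = \<iota> r \<otimes>\<^bsub>A\<^esub> y)"

lemma coeff_multiple_refl: "x \<in> carrier A \<Longrightarrow> coeff_multiple x x"
  unfolding coeff_multiple_def by (intro bexI[of _ "\<one>\<^bsub>R\<^esub>"]) auto

lemma coeff_multiple_trans:
  "coeff_multiple x y \<Longrightarrow> coeff_multiple y z \<Longrightarrow> z \<in> carrier A \<Longrightarrow> coeff_multiple x z"
  unfolding coeff_multiple_def
proof (elim bexE)
  fix r s assume "r \<in> carrier R" "x = \<iota> r \<otimes>\<^bsub>A\<^esub> y" "s \<in> carrier R" "y = \<iota> s \<otimes>\<^bsub>A\<^esub> z" "z \<in> carrier A"
  then show "\<exists>r\<in>carrier R. x = \<iota> r \<otimes>\<^bsub>A\<^esub> z"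
    by (intro bexI[of _ "r \<otimes>\<^bsub>R\<^esub> s"]) (simp_all add: A.m_assoc)
qed

lemma coeff_multiple_word:
  assumes "coeff_multiple x y" "us \<in> words" "y \<in> carrier A"
  shows "coeff_multiple (wX us \<otimes>\<^bsub>A\<^esub> x) (wX us \<otimes>\<^bsub>A\<^esub> y)"
proof -
  obtain r where r: "r \<in> carrier R" "x = \<iota> r \<otimes>\<^bsub>A\<^esub> y" using assms(1) unfolding coeff_multiple_def by blast
  then have "wX us \<otimes>\<^bsub>A\<^esub> x = \<iota> (wsg us r) \<otimes>\<^bsub>A\<^esub> (wX us \<otimes>\<^bsub>A\<^esub> y)"
    using assms(2,3) wX_\<iota>[OF assms(2) r(1)] by (simp add: A.m_assoc[symmetric])
  then show ?thesis unfolding coeff_multiple_def using wsg_closed[OF assms(2) r(1)] by blast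
qed

lemma coeff_multiple_right:
  "coeff_multiple x y \<Longrightarrow> y \<in> carrier A \<Longrightarrow> z \<in> carrier A \<Longrightarrow> coeff_multiple (x \<otimes>\<^bsub>A\<^esub> z) (y \<otimes>\<^bsub>A\<^esub> z)"
  unfolding coeff_multiple_def by (metis A.m_assoc \<iota>D(1))

text \<open>A letter moves past letters of the opposite sign until it meets its inverse letter.\<close>

lemma letter_absorb:
  assumes "u \<in> pm n" "ws \<in> words" "\<forall>w\<in>set ws. sgn w \<noteq> sgn u"
  shows "if - u \<in> set ws then coeff_multiple (X u \<otimes>\<^bsub>A\<^esub> wX ws) (wX (remove1 (- u) ws))
    else coeff_multiple (X u \<otimes>\<^bsub>A\<^esub> wX ws) (wX ws \<otimes>\<^bsub>A\<^esub> X u)"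
  using assms(2,3)
proof (induction ws)
  case Nil then show ?case using assms by (simp add: coeff_multiple_refl)
next
  case (Cons w ws)
  have w: "w \<in> pm n" "ws \<in> words" "sgn w \<noteq> sgn u" using Cons.hyps Cons.prems by simp_all
  show ?case
  proof (cases "w = - u")
    case True
    then have "X u \<otimes>\<^bsub>A\<^esub> wX (w # ws) = \<iota> (tt w) \<otimes>\<^bsub>A\<^esub> wX ws"
      using X_uminus[of w] w assms(1) by (simp add: A.m_assoc[symmetric])
    then show ?thesis using True w unfolding coeff_multiple_def by auto
  next
    case False
    then have "\<bar>u\<bar> \<noteq> \<bar>w\<bar>" using w by (auto simp: abs_if split: if_splits)
    then obtain c where c: "c \<in> carrier K" "X u \<otimes>\<^bsub>A\<^esub> X w = c \<odot>\<^bsub>A\<^esub> (X w \<otimes>\<^bsub>A\<^esub> X u)"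
      using exchange_letters[of u w] w assms(1) by auto
    have "X u \<otimes>\<^bsub>A\<^esub> wX (w # ws) = c \<odot>\<^bsub>A\<^esub> (X w \<otimes>\<^bsub>A\<^esub> X u) \<otimes>\<^bsub>A\<^esub> wX ws"
      using w assms(1) c(2) by (simp add: A.m_assoc[symmetric])
    also have "\<dots> = \<iota> (c \<odot>\<^bsub>R\<^esub> \<one>\<^bsub>R\<^esub>) \<otimes>\<^bsub>A\<^esub> (wX [w] \<otimes>\<^bsub>A\<^esub> (X u \<otimes>\<^bsub>A\<^esub> wX ws))"
      using w assms(1) c(1) by (simp add: A.smult_mult_left A.m_assoc)
    finally have 1: "coeff_multiple (X u \<otimes>\<^bsub>A\<^esub> wX (w # ws)) (wX [w] \<otimes>\<^bsub>A\<^esub> (X u \<otimes>\<^bsub>A\<^esub> wX ws))"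
      unfolding coeff_multiple_def using c(1) R.one_closed by (meson R.smult_closed)
    have wl: "[w] \<in> words" using w by simp
    have r1: "remove1 (- u) ws \<in> words" using w(2) by (auto dest: notin_set_remove1)
    show ?thesis
    proof (cases "- u \<in> set ws")
      case True
      then have "coeff_multiple (X u \<otimes>\<^bsub>A\<^esub> wX ws) (wX (remove1 (- u) ws))" using Cons by simp
      from coeff_multiple_trans[OF 1 coeff_multiple_word[OF this wl wX_closed[OF r1]]]
      show ?thesis using True False w r1 by simp
    next
      case f: False
      then have "coeff_multiple (X u \<otimes>\<^bsub>A\<^esub> wX ws) (wX ws \<otimes>\<^bsub>A\<^esub> X u)" using Cons by simp
      from coeff_multiple_trans[OF 1 coeff_multiple_word[OF this wl]]
      show ?thesis using f False w assms(1) by (simp add: A.m_assoc)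
    qed
  qed
qed

lemma word_degree_remove1: "u \<in> set ws \<Longrightarrow> word_degree ws i = gen_degree u i + word_degree (remove1 u ws) i"
  by (induction ws) auto

text \<open>Letters are prefixed one at a time: a positive one is moved through the negative ones and is either cancelled there or
  added to the positive part. Letters of equal sign keep their order, as no relation interchanges them.\<close>

lemma word_normal_form:
  "us \<in> words \<Longrightarrow> \<exists>ns ps. ns \<in> words \<and> ps \<in> words \<and> (\<forall>v\<in>set ns. v < 0) \<and> (\<forall>v\<in>set ps. v > 0)
    \<and> word_degree us = (\<lambda>i. word_degree ns i + word_degree ps i) \<and> coeff_multiple (wX us) (wX ns \<otimes>\<^bsub>A\<^esub> wX ps)"
proof (induction us)
  case Nil
  then show ?case by (intro exI[of _ "[]"]) (simp add: coeff_multiple_refl)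
next
  case (Cons u us)
  then obtain ns ps where np: "ns \<in> words" "ps \<in> words" "\<forall>v\<in>set ns. v < 0" "\<forall>v\<in>set ps. v > 0"
    "word_degree us = (\<lambda>i. word_degree ns i + word_degree ps i)" "coeff_multiple (wX us) (wX ns \<otimes>\<^bsub>A\<^esub> wX ps)" by auto
  have u: "u \<in> pm n" "[u] \<in> words" "u \<noteq> 0" using Cons by (auto simp: pm_def)
  have 1: "coeff_multiple (wX (u # us)) (X u \<otimes>\<^bsub>A\<^esub> (wX ns \<otimes>\<^bsub>A\<^esub> wX ps))"
    using coeff_multiple_word[OF np(6) u(2)] np u Cons.prems by simp
  show ?case
  proof (cases "u < 0")
    case True
    then show ?thesis using np u 1
      by (intro exI[of _ "u # ns"] exI[of _ ps]) (auto simp: A.m_assoc add.assoc)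
  next
    case False
    then have sg: "\<forall>w\<in>set ns. sgn w \<noteq> sgn u" using np(3) u(3) by (auto simp: sgn_if)
    note ab = letter_absorb[OF u(1) np(1) sg]
    show ?thesis
    proof (cases "- u \<in> set ns")
      case True
      let ?ns = "remove1 (- u) ns"
      have r: "?ns \<in> words" using np(1) by (auto dest: notin_set_remove1)
      have "coeff_multiple (X u \<otimes>\<^bsub>A\<^esub> wX ns \<otimes>\<^bsub>A\<^esub> wX ps) (wX ?ns \<otimes>\<^bsub>A\<^esub> wX ps)"
        using ab True r np by (intro coeff_multiple_right) auto
      then have "coeff_multiple (wX (u # us)) (wX ?ns \<otimes>\<^bsub>A\<^esub> wX ps)"
        using coeff_multiple_trans[OF 1] np u r by (simp add: A.m_assoc)
      moreover have "word_degree (u # us) = (\<lambda>i. word_degree ?ns i + word_degree ps i)"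
        using np(5) word_degree_remove1[OF True] by (auto simp: fun_eq_iff)
      ultimately show ?thesis using np r by (intro exI[of _ ?ns] exI[of _ ps]) (auto dest: notin_set_remove1)
    next
      case f: False
      have "coeff_multiple (X u \<otimes>\<^bsub>A\<^esub> wX ns \<otimes>\<^bsub>A\<^esub> wX ps) (wX ns \<otimes>\<^bsub>A\<^esub> X u \<otimes>\<^bsub>A\<^esub> wX ps)"
        using ab f u np by (intro coeff_multiple_right) auto
      then have "coeff_multiple (wX (u # us)) (wX ns \<otimes>\<^bsub>A\<^esub> wX (u # ps))"
        using coeff_multiple_trans[OF 1] np u by (simp add: A.m_assoc)
      then show ?thesis using np u False by (intro exI[of _ ns] exI[of _ "u # ps"]) (auto simp: add_ac)
    qed
  qed
qed

lemma gen_degree_pos: "0 < u \<Longrightarrow> gen_degree u i \<ge> 0" "u < 0 \<Longrightarrow> gen_degree u i \<le> 0"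
  by (auto simp: gen_degree_def)

lemma word_degree_pos: "\<forall>v\<in>set ps. v > 0 \<Longrightarrow> word_degree ps i \<ge> 0"
  by (induction ps) (auto intro!: add_nonneg_nonneg gen_degree_pos)

lemma word_degree_neg: "\<forall>v\<in>set ps. v < 0 \<Longrightarrow> word_degree ps i \<le> 0"
  by (induction ps) (auto intro!: add_nonpos_nonpos gen_degree_pos)

text \<open>The last negative letter \<open>u\<close> has an inverse among the positive letters, since the total exponent of its index is \<open>0\<close>; it
  absorbs the first such occurrence, and the remaining word is shorter and still balanced.\<close>

lemma balanced_word_coeff:
  "ns \<in> words \<Longrightarrow> ps \<in> words \<Longrightarrow> \<forall>v\<in>set ns. v < 0 \<Longrightarrow> \<forall>v\<in>set ps. v > 0 \<Longrightarrow>
    (\<And>i. word_degree ns i + word_degree ps i = 0) \<Longrightarrow> coeff_multiple (wX ns \<otimes>\<^bsub>A\<^esub> wX ps) \<one>\<^bsub>A\<^esub>"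
proof (induction ns arbitrary: ps rule: rev_induct)
  case Nil
  have "ps = []"
  proof (cases ps)
    case (Cons p qs)
    have "word_degree ps (nat p) = 1 + word_degree qs (nat p)"
      using Nil(4) Cons by (simp add: gen_degree_def)
    then show ?thesis using Nil(5)[of "nat p"] word_degree_pos[of qs "nat p"] Nil(4) Cons by simp
  qed simp
  then show ?case by (simp add: coeff_multiple_refl)
next
  case (snoc u ns)
  have u: "u \<in> pm n" "u < 0" "ns \<in> words" using snoc.prems by auto
  have sg: "\<forall>w\<in>set ps. sgn w \<noteq> sgn u" using snoc.prems u by (auto simp: sgn_if)
  have pos: "- u \<in> set ps"
  proof (rule ccontr)
    assume np: "- u \<notin> set ps"
    let ?i = "nat (- u)"
    have "\<forall>v\<in>set qs. v > 0 \<Longrightarrow> - u \<notin> set qs \<Longrightarrow> word_degree qs ?i = 0" for qs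
      using u(2) by (induction qs) (auto simp: gen_degree_def)
    then have "word_degree ps ?i = 0" using snoc.prems np by blast
    moreover have "word_degree ns ?i \<le> 0" using snoc.prems by (intro word_degree_neg) auto
    moreover have "gen_degree u ?i = -1" using u(2) by (simp add: gen_degree_def)
    ultimately show False using snoc.prems(5)[of ?i] by simp
  qed
  let ?ps = "remove1 (- u) ps"
  have r: "?ps \<in> words" using snoc.prems(2) by (auto dest: notin_set_remove1)
  have "coeff_multiple (X u \<otimes>\<^bsub>A\<^esub> wX ps) (wX ?ps)"
    using letter_absorb[OF u(1) snoc.prems(2) sg] pos by simp
  then have "coeff_multiple (wX ns \<otimes>\<^bsub>A\<^esub> (X u \<otimes>\<^bsub>A\<^esub> wX ps)) (wX ns \<otimes>\<^bsub>A\<^esub> wX ?ps)"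
    using u r by (intro coeff_multiple_word) auto
  moreover have "coeff_multiple (wX ns \<otimes>\<^bsub>A\<^esub> wX ?ps) \<one>\<^bsub>A\<^esub>"
  proof (rule snoc.IH)
    fix i show "word_degree ns i + word_degree ?ps i = 0"
      using snoc.prems(5)[of i] word_degree_remove1[OF pos, of i] by simp
  qed (use u r snoc.prems in \<open>auto dest: notin_set_remove1\<close>)
  ultimately have "coeff_multiple (wX ns \<otimes>\<^bsub>A\<^esub> (X u \<otimes>\<^bsub>A\<^esub> wX ps)) \<one>\<^bsub>A\<^esub>"
    using coeff_multiple_trans by blast
  then show ?case using u snoc.prems(2) by (simp add: wX_append A.m_assoc)
qed

text \<open>Passage to the normal form, followed by complete cancellation.\<close>

lemma degree_zero_coeff:
  assumes "us \<in> words" "word_degree us = (\<lambda>_. 0)"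
  shows "\<exists>r\<in>carrier R. wX us = \<iota> r"
proof -
  obtain ns ps where np: "ns \<in> words" "ps \<in> words" "\<forall>v\<in>set ns. v < 0" "\<forall>v\<in>set ps. v > 0"
    "word_degree us = (\<lambda>i. word_degree ns i + word_degree ps i)" "coeff_multiple (wX us) (wX ns \<otimes>\<^bsub>A\<^esub> wX ps)"
    using word_normal_form[OF assms(1)] by blast
  have "coeff_multiple (wX us) \<one>\<^bsub>A\<^esub>"
    using coeff_multiple_trans[OF np(6) balanced_word_coeff] np(1-5) assms(2) by (metis A.one_closed)
  then show ?thesis unfolding coeff_multiple_def by auto
qed

text \<open>The formal inverse of a word. In the product of the two words all letters cancel from the inside out.\<close>

definition star :: "int list \<Rightarrow> int list" where "star us = rev (map uminus us)"

lemma star_words [simp]: "star us \<in> words \<longleftrightarrow> us \<in> words"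
  using lists_pm_uminus[of us n] by (auto simp: star_def)

lemma star_star [simp]: "star (star us) = us"
  by (simp add: star_def rev_map comp_def)

lemma star_degree [simp]: "word_degree (star us) = (\<lambda>i. - word_degree us i)"
  by (simp add: star_def)

text \<open>Each cancellation contributes an automorphic image of some \<open>t\<^sub>i\<close>, so the resulting coefficient is regular if the datum is.\<close>

lemma wX_star:
  assumes "regular_datum n R t" "us \<in> words"
  shows "\<exists>c. regular_element R c \<and> wX us \<otimes>\<^bsub>A\<^esub> wX (star us) = \<iota> c"
  using assms(2)
proof (induction us)
  case Nil
  show ?case by (intro exI[of _ "\<one>\<^bsub>R\<^esub>"]) (simp add: star_def regular_element_def)
next
  case (Cons u us)
  then obtain c where c: "regular_element R c" "wX us \<otimes>\<^bsub>A\<^esub> wX (star us) = \<iota> c"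
    by (metis Cons_in_lists_iff)
  have cR: "c \<in> carrier R" using c by (simp add: regular_element_def)
  have u: "u \<in> pm n" "us \<in> words" "star us \<in> words" using Cons.hyps by simp_all
  have "star (u # us) = star us @ [- u]" by (simp add: star_def)
  then have "wX (u # us) \<otimes>\<^bsub>A\<^esub> wX (star (u # us)) = X u \<otimes>\<^bsub>A\<^esub> (wX us \<otimes>\<^bsub>A\<^esub> wX (star us)) \<otimes>\<^bsub>A\<^esub> X (- u)"
    using u by (simp add: wX_append A.m_assoc)
  also have "\<dots> = \<iota> (sg u c) \<otimes>\<^bsub>A\<^esub> (X u \<otimes>\<^bsub>A\<^esub> X (- u))"
    using u cR by (simp add: c(2) X_\<iota> A.m_assoc)
  also have "\<dots> = \<iota> (sg u c \<otimes>\<^bsub>R\<^esub> tt (- u))"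
    using X_uminus[of "- u"] u cR by simp
  finally show ?case
    using R.regular_mult[OF regular_sg[OF u(1) c(1)] regular_tt[OF assms(1), of "- u"]] u by auto
qed

end

text \<open>Existence of \<open>p0\<close> expresses that the component of degree \<open>0\<close> splits off.\<close>

locale tgw_proj = tgw_alg +
  fixes p0
  assumes p0_lin: "p0 \<in> lin_hom K A A"
    and p0_mon: "r \<in> carrier R \<Longrightarrow> us \<in> lists (pm n) \<Longrightarrow> p0 (mon r us) = (if word_degree us = (\<lambda>_. 0) then mon r us else \<zero>\<^bsub>A\<^esub>)"
begin

lemmas p0D [simp] = lin_homD[OF p0_lin]

lemma p0_zero [simp]: "p0 \<zero>\<^bsub>A\<^esub> = \<zero>\<^bsub>A\<^esub>"
  by (rule lin_hom_zero[OF p0_lin A_vec_space A_vec_space])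

lemma p0_coeff: "x \<in> carrier A \<Longrightarrow> \<exists>r\<in>carrier R. p0 x = \<iota> r"
proof (induction rule: monom_induct)
  case zero show ?case by (intro bexI[of _ "\<zero>\<^bsub>R\<^esub>"]) auto
next
  case (add r us x)
  then obtain s where s: "s \<in> carrier R" "p0 x = \<iota> s" by blast
  have "\<exists>r'\<in>carrier R. p0 (mon r us) = \<iota> r'"
  proof (cases "word_degree us = (\<lambda>_. 0)")
    case True
    then obtain r' where "r' \<in> carrier R" "wX us = \<iota> r'" using degree_zero_coeff add by blast
    then show ?thesis using add True p0_mon[of r us]
      by (intro bexI[of _ "r \<otimes>\<^bsub>R\<^esub> r'"]) (simp_all add: mon_def)
  next
    case False
    then show ?thesis using add by (intro bexI[of _ "\<zero>\<^bsub>R\<^esub>"]) (simp_all add: p0_mon)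
  qed
  then obtain r' where "r' \<in> carrier R" "p0 (mon r us) = \<iota> r'" by blast
  then show ?case using add s by (intro bexI[of _ "r' \<oplus>\<^bsub>R\<^esub> s"]) simp_all
qed

lemma p0_\<iota> [simp]: "r \<in> carrier R \<Longrightarrow> p0 (\<iota> r) = \<iota> r"
  using p0_mon[of r "[]"] by simp

text \<open>Multiplication by monomials of opposite degrees preserves the degree.\<close>

lemma p0_sandwich:
  assumes "r \<in> carrier R" "us \<in> words" "s \<in> carrier R" "vs \<in> words"
    "\<And>i. word_degree us i + word_degree vs i = 0" "x \<in> carrier A"
  shows "p0 (mon r us \<otimes>\<^bsub>A\<^esub> x \<otimes>\<^bsub>A\<^esub> mon s vs) = mon r us \<otimes>\<^bsub>A\<^esub> p0 x \<otimes>\<^bsub>A\<^esub> mon s vs"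
proof (rule linear_eq_monoms[where f = "\<lambda>x. p0 (mon r us \<otimes>\<^bsub>A\<^esub> x \<otimes>\<^bsub>A\<^esub> mon s vs)" and P = A])
  have L: "(\<lambda>x. mon r us \<otimes>\<^bsub>A\<^esub> x \<otimes>\<^bsub>A\<^esub> mon s vs) \<in> lin_hom K A A"
    using lin_hom_comp[OF mult_lin_right mult_lin_left] assms by simp
  show "(\<lambda>x. p0 (mon r us \<otimes>\<^bsub>A\<^esub> x \<otimes>\<^bsub>A\<^esub> mon s vs)) \<in> lin_hom K A A" by (rule lin_hom_comp[OF L p0_lin])
  show "(\<lambda>x. mon r us \<otimes>\<^bsub>A\<^esub> p0 x \<otimes>\<^bsub>A\<^esub> mon s vs) \<in> lin_hom K A A" by (rule lin_hom_comp[OF p0_lin L])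
  fix r' ws assume w: "r' \<in> carrier R" "ws \<in> words"
  have "word_degree us i + (word_degree ws i + word_degree vs i) = word_degree ws i" for i
    using assms(5)[of i] by simp
  then have "word_degree (us @ ws @ vs) = word_degree ws" by (simp add: fun_eq_iff)
  then show "p0 (mon r us \<otimes>\<^bsub>A\<^esub> mon r' ws \<otimes>\<^bsub>A\<^esub> mon s vs) = mon r us \<otimes>\<^bsub>A\<^esub> p0 (mon r' ws) \<otimes>\<^bsub>A\<^esub> mon s vs"
    using assms w by (simp add: mon_mult p0_mon del: word_degree_simps)
qed (use assms A_vec_space in auto)

lemma p0_zero_from_monoms:
  assumes z: "z \<in> carrier A" and ab: "a \<in> carrier A" "b \<in> carrier A"
    and 0: "\<And>r us s vs. r \<in> carrier R \<Longrightarrow> us \<in> words \<Longrightarrow> s \<in> carrier R \<Longrightarrow> vs \<in> words \<Longrightarrow>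
      p0 (mon r us \<otimes>\<^bsub>A\<^esub> z \<otimes>\<^bsub>A\<^esub> mon s vs) = \<zero>\<^bsub>A\<^esub>"
  shows "p0 (a \<otimes>\<^bsub>A\<^esub> z \<otimes>\<^bsub>A\<^esub> b) = \<zero>\<^bsub>A\<^esub>"
proof -
  have Z: "(\<lambda>_. \<zero>\<^bsub>A\<^esub>) \<in> lin_hom K A A" by (rule lin_homI) auto
  have 1: "p0 (mon r us \<otimes>\<^bsub>A\<^esub> z \<otimes>\<^bsub>A\<^esub> b) = \<zero>\<^bsub>A\<^esub>" if m: "r \<in> carrier R" "us \<in> words" and b: "b \<in> carrier A" for r us b
  proof (rule linear_eq_monoms[where f = "\<lambda>b. p0 (mon r us \<otimes>\<^bsub>A\<^esub> z \<otimes>\<^bsub>A\<^esub> b)", OF _ Z A_vec_space _ b])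
    have "mon r us \<otimes>\<^bsub>A\<^esub> z \<in> carrier A" using m z by simp
    from lin_hom_comp[OF mult_lin_right[OF this] p0_lin]
    show "(\<lambda>b. p0 (mon r us \<otimes>\<^bsub>A\<^esub> z \<otimes>\<^bsub>A\<^esub> b)) \<in> lin_hom K A A" .
  qed (rule 0[OF m])
  show ?thesis
  proof (rule linear_eq_monoms[where f = "\<lambda>a. p0 (a \<otimes>\<^bsub>A\<^esub> z \<otimes>\<^bsub>A\<^esub> b)", OF _ Z A_vec_space _ ab(1)])
    from lin_hom_comp[OF lin_hom_comp[OF mult_lin_left[OF z] mult_lin_left[OF ab(2)]] p0_lin]
    show "(\<lambda>a. p0 (a \<otimes>\<^bsub>A\<^esub> z \<otimes>\<^bsub>A\<^esub> b)) \<in> lin_hom K A A" .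
  qed (rule 1[OF _ _ ab(2)])
qed

end

text \<open>The second condition says that no nonzero ideal lies in the kernel of \<open>p0\<close>, in a form that refers to elements.\<close>

locale tgw_nondeg = tgw_proj +
  assumes \<iota>_inj: "r \<in> carrier R \<Longrightarrow> \<iota> r = \<zero>\<^bsub>A\<^esub> \<Longrightarrow> r = \<zero>\<^bsub>R\<^esub>"
    and nondeg: "z \<in> carrier A \<Longrightarrow> z \<noteq> \<zero>\<^bsub>A\<^esub> \<Longrightarrow> \<exists>a\<in>carrier A. \<exists>b\<in>carrier A. p0 (a \<otimes>\<^bsub>A\<^esub> z \<otimes>\<^bsub>A\<^esub> b) \<noteq> \<zero>\<^bsub>A\<^esub>"
begin

lemma nondeg_monom:
  assumes z: "z \<in> carrier A" "z \<noteq> \<zero>\<^bsub>A\<^esub>"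
  shows "\<exists>r\<in>carrier R. \<exists>us\<in>words. \<exists>s\<in>carrier R. \<exists>vs\<in>words. p0 (mon r us \<otimes>\<^bsub>A\<^esub> z \<otimes>\<^bsub>A\<^esub> mon s vs) \<noteq> \<zero>\<^bsub>A\<^esub>"
  using p0_zero_from_monoms[OF z(1)] nondeg[OF z] by metis

text \<open>Let \<open>y\<close> be the nonzero coefficient \<open>p0 (r X\<^sub>u z s X\<^sub>v)\<close>. Then \<open>X\<^sub>v y X\<^bsub>v*\<^esub>\<close>, where \<open>v*\<close> is the formal inverse of \<open>v\<close>, is
  \<open>\<sigma>\<^sup>v(y)\<close> times a regular coefficient and hence nonzero; on the other hand it is the projection of \<open>X\<^sub>v r X\<^sub>u z s (X\<^sub>v X\<^bsub>v*\<^esub>)\<close>,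
  in which \<open>z\<close> is followed by a coefficient only. So multiplication on the left suffices. The other side is symmetric.\<close>

lemma regular_nondeg:
  assumes reg: "regular_datum n R t" and z: "z \<in> carrier A" "z \<noteq> \<zero>\<^bsub>A\<^esub>"
  shows "\<exists>a\<in>carrier A. p0 (a \<otimes>\<^bsub>A\<^esub> z) \<noteq> \<zero>\<^bsub>A\<^esub>" "\<exists>b\<in>carrier A. p0 (z \<otimes>\<^bsub>A\<^esub> b) \<noteq> \<zero>\<^bsub>A\<^esub>"
proof -
  obtain r us s vs where m: "r \<in> carrier R" "us \<in> words" "s \<in> carrier R" "vs \<in> words"
    and nz: "p0 (mon r us \<otimes>\<^bsub>A\<^esub> z \<otimes>\<^bsub>A\<^esub> mon s vs) \<noteq> \<zero>\<^bsub>A\<^esub>"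
    using nondeg_monom[OF z] by blast
  let ?x = "mon r us \<otimes>\<^bsub>A\<^esub> z \<otimes>\<^bsub>A\<^esub> mon s vs"
  have xc: "?x \<in> carrier A" using m z by simp
  obtain y where y: "y \<in> carrier R" "p0 ?x = \<iota> y" using p0_coeff[OF xc] by blast
  have y0: "y \<noteq> \<zero>\<^bsub>R\<^esub>" using nz y by auto
  \<comment> \<open>The coefficient \<open>p0 x\<close> remains nonzero when it is surrounded by a word and its formal inverse.\<close>
  have key: "wX ws \<otimes>\<^bsub>A\<^esub> p0 ?x \<otimes>\<^bsub>A\<^esub> wX (star ws) \<noteq> \<zero>\<^bsub>A\<^esub>" if ws: "ws \<in> words" for ws
  proof
    obtain c where c: "regular_element R c" "wX ws \<otimes>\<^bsub>A\<^esub> wX (star ws) = \<iota> c" using wX_star[OF reg ws] by blast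
    have cR: "c \<in> carrier R" using c by (simp add: regular_element_def)
    assume "wX ws \<otimes>\<^bsub>A\<^esub> p0 ?x \<otimes>\<^bsub>A\<^esub> wX (star ws) = \<zero>\<^bsub>A\<^esub>"
    then have "\<iota> (wsg ws y) \<otimes>\<^bsub>A\<^esub> (wX ws \<otimes>\<^bsub>A\<^esub> wX (star ws)) = \<zero>\<^bsub>A\<^esub>"
      using y ws by (simp add: wX_\<iota> A.m_assoc)
    then have "\<iota> (wsg ws y \<otimes>\<^bsub>R\<^esub> c) = \<zero>\<^bsub>A\<^esub>" using c(2) cR y ws by simp
    then have "wsg ws y \<otimes>\<^bsub>R\<^esub> c = \<zero>\<^bsub>R\<^esub>" using \<iota>_inj cR y ws by simp
    then have "wsg ws y = \<zero>\<^bsub>R\<^esub>" using c(1) wsg_closed[OF ws y(1)] unfolding regular_element_def by blast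
    then have "y = wsg (map uminus ws) \<zero>\<^bsub>R\<^esub>" using wsg_inv[OF ws y(1)] by simp
    moreover have "wsg (map uminus ws) \<zero>\<^bsub>R\<^esub> = \<zero>\<^bsub>R\<^esub>"
      using lin_hom_zero[OF alg_homD(1)[OF wsg_hom]] ws k_algebra_vec_space[OF R.k_algebra_axioms] by simp
    ultimately show False using y0 by simp
  qed
  have sw: "p0 (wX ws \<otimes>\<^bsub>A\<^esub> ?x \<otimes>\<^bsub>A\<^esub> wX (star ws)) = wX ws \<otimes>\<^bsub>A\<^esub> p0 ?x \<otimes>\<^bsub>A\<^esub> wX (star ws)" if "ws \<in> words" for ws
    using p0_sandwich[of "\<one>\<^bsub>R\<^esub>" ws "\<one>\<^bsub>R\<^esub>" "star ws" ?x] that xc by (simp add: mon_one)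
  show "\<exists>a\<in>carrier A. p0 (a \<otimes>\<^bsub>A\<^esub> z) \<noteq> \<zero>\<^bsub>A\<^esub>"
  proof (rule ccontr)
    assume no: "\<not> ?thesis"
    obtain c where c: "c \<in> carrier R" "wX vs \<otimes>\<^bsub>A\<^esub> wX (star vs) = \<iota> c"
      using wX_star[OF reg m(4)] by (auto simp: regular_element_def)
    let ?a = "wX vs \<otimes>\<^bsub>A\<^esub> mon r us"
    have "wX vs \<otimes>\<^bsub>A\<^esub> ?x \<otimes>\<^bsub>A\<^esub> wX (star vs) = ?a \<otimes>\<^bsub>A\<^esub> z \<otimes>\<^bsub>A\<^esub> (\<iota> s \<otimes>\<^bsub>A\<^esub> (wX vs \<otimes>\<^bsub>A\<^esub> wX (star vs)))"
      using m z by (simp add: mon_def[of s] A.m_assoc)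
    also have "\<dots> = mon \<one>\<^bsub>R\<^esub> [] \<otimes>\<^bsub>A\<^esub> (?a \<otimes>\<^bsub>A\<^esub> z) \<otimes>\<^bsub>A\<^esub> mon (s \<otimes>\<^bsub>R\<^esub> c) []"
      using m z c by simp
    finally have "p0 (wX vs \<otimes>\<^bsub>A\<^esub> ?x \<otimes>\<^bsub>A\<^esub> wX (star vs)) = mon \<one>\<^bsub>R\<^esub> [] \<otimes>\<^bsub>A\<^esub> p0 (?a \<otimes>\<^bsub>A\<^esub> z) \<otimes>\<^bsub>A\<^esub> mon (s \<otimes>\<^bsub>R\<^esub> c) []"
      using p0_sandwich[of "\<one>\<^bsub>R\<^esub>" "[]" "s \<otimes>\<^bsub>R\<^esub> c" "[]" "?a \<otimes>\<^bsub>A\<^esub> z"] m z c by simp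
    moreover have "p0 (?a \<otimes>\<^bsub>A\<^esub> z) = \<zero>\<^bsub>A\<^esub>" using no m z by simp
    ultimately show False using key[OF m(4)] sw[OF m(4)] m c by simp
  qed
  show "\<exists>b\<in>carrier A. p0 (z \<otimes>\<^bsub>A\<^esub> b) \<noteq> \<zero>\<^bsub>A\<^esub>"
  proof (rule ccontr)
    assume no: "\<not> ?thesis"
    have su: "star us \<in> words" using m by simp
    obtain c where c: "c \<in> carrier R" "wX (star us) \<otimes>\<^bsub>A\<^esub> wX us = \<iota> c"
      using wX_star[OF reg su] by (auto simp: regular_element_def)
    let ?b = "mon s vs \<otimes>\<^bsub>A\<^esub> wX us" and ?r = "wsg (star us) r \<otimes>\<^bsub>R\<^esub> c"
    have "wX (star us) \<otimes>\<^bsub>A\<^esub> ?x \<otimes>\<^bsub>A\<^esub> wX us = (wX (star us) \<otimes>\<^bsub>A\<^esub> \<iota> r) \<otimes>\<^bsub>A\<^esub> wX us \<otimes>\<^bsub>A\<^esub> (z \<otimes>\<^bsub>A\<^esub> ?b)"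
      using m z by (simp add: mon_def[of r] A.m_assoc)
    also have "\<dots> = \<iota> (wsg (star us) r) \<otimes>\<^bsub>A\<^esub> (wX (star us) \<otimes>\<^bsub>A\<^esub> wX us) \<otimes>\<^bsub>A\<^esub> (z \<otimes>\<^bsub>A\<^esub> ?b)"
      using m z by (simp add: wX_\<iota> A.m_assoc)
    also have "\<dots> = mon ?r [] \<otimes>\<^bsub>A\<^esub> (z \<otimes>\<^bsub>A\<^esub> ?b) \<otimes>\<^bsub>A\<^esub> mon \<one>\<^bsub>R\<^esub> []"
      using m z c by simp
    finally have "p0 (wX (star us) \<otimes>\<^bsub>A\<^esub> ?x \<otimes>\<^bsub>A\<^esub> wX us) = mon ?r [] \<otimes>\<^bsub>A\<^esub> p0 (z \<otimes>\<^bsub>A\<^esub> ?b) \<otimes>\<^bsub>A\<^esub> mon \<one>\<^bsub>R\<^esub> []"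
      using p0_sandwich[of ?r "[]" "\<one>\<^bsub>R\<^esub>" "[]" "z \<otimes>\<^bsub>A\<^esub> ?b"] m z c by simp
    moreover have "p0 (z \<otimes>\<^bsub>A\<^esub> ?b) = \<zero>\<^bsub>A\<^esub>" using no m z by simp
    ultimately show False using key[OF su] sw[OF su] m c by simp
  qed
qed

end


section \<open>The grading of a construction\<close>

text \<open>A grading of a presented algebra is not visible from the congruence classes. To obtain projections onto the components,
  let homogeneous letters act on functions from degrees to the algebra, a letter \<open>x\<close> of degree \<open>\<beta>\<close> by
  \<open>f \<mapsto> (\<alpha> \<mapsto> x f(\<alpha> - \<beta>))\<close>. Relations between letters of equal degree hold for these operators too, and the
  operator of an element, applied to the function that is \<open>1\<close> at \<open>0\<close> and \<open>0\<close> elsewhere, lists the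
  homogeneous components of the element. This is how the components are obtained.\<close>

primrec shift_op :: "('k, 'a) module \<Rightarrow> ('x \<Rightarrow> 'a) \<Rightarrow> ('x \<Rightarrow> nat \<Rightarrow> int) \<Rightarrow> ('k, 'x) alg_term
    \<Rightarrow> ((nat \<Rightarrow> int) \<Rightarrow> 'a) \<Rightarrow> (nat \<Rightarrow> int) \<Rightarrow> 'a" where
  "shift_op M g d (AVar x) f = (\<lambda>\<alpha>. g x \<otimes>\<^bsub>M\<^esub> f (\<lambda>i. \<alpha> i - d x i))"
| "shift_op M g d AZero f = (\<lambda>_. \<zero>\<^bsub>M\<^esub>)"
| "shift_op M g d AOne f = f"
| "shift_op M g d (AAdd p q) f = (\<lambda>\<alpha>. shift_op M g d p f \<alpha> \<oplus>\<^bsub>M\<^esub> shift_op M g d q f \<alpha>)"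
| "shift_op M g d (AMult p q) f = shift_op M g d p (shift_op M g d q f)"
| "shift_op M g d (AScal c p) f = (\<lambda>\<alpha>. c \<odot>\<^bsub>M\<^esub> shift_op M g d p f \<alpha>)"

text \<open>If the relations hold for the shift operators, then so does every consequence of them, because the operators satisfy the
  axioms of an algebra.\<close>

locale shift_algebra = k_algebra K A for K :: "'k ring" and A :: "('k, 'a) module"
begin

lemma shift_op_linear:
  assumes g: "\<And>x. x \<in> X \<Longrightarrow> g x \<in> carrier A" and p: "p \<in> alg_terms K X"
  shows "(\<And>\<alpha>. f \<alpha> \<in> carrier A) \<Longrightarrow> shift_op A g d p f \<alpha> \<in> carrier A"
    "(\<And>\<alpha>. f \<alpha> \<in> carrier A) \<Longrightarrow> (\<And>\<alpha>. f' \<alpha> \<in> carrier A) \<Longrightarrow>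
      shift_op A g d p (\<lambda>\<alpha>. f \<alpha> \<oplus>\<^bsub>A\<^esub> f' \<alpha>) = (\<lambda>\<alpha>. shift_op A g d p f \<alpha> \<oplus>\<^bsub>A\<^esub> shift_op A g d p f' \<alpha>)"
    "c \<in> carrier K \<Longrightarrow> (\<And>\<alpha>. f \<alpha> \<in> carrier A) \<Longrightarrow>
      shift_op A g d p (\<lambda>\<alpha>. c \<odot>\<^bsub>A\<^esub> f \<alpha>) = (\<lambda>\<alpha>. c \<odot>\<^bsub>A\<^esub> shift_op A g d p f \<alpha>)"
proof -
  show cl: "shift_op A g d p f \<alpha> \<in> carrier A" if "\<And>\<alpha>. f \<alpha> \<in> carrier A" for f \<alpha>
    using p that by (induction arbitrary: f \<alpha>) (simp_all add: g)
  have cl': "shift_op A g d p f \<alpha> \<in> carrier A" if "p \<in> alg_terms K X" "\<And>\<alpha>. f \<alpha> \<in> carrier A" for p f \<alpha>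
    using that by (induction arbitrary: f \<alpha>) (simp_all add: g)
  show "shift_op A g d p (\<lambda>\<alpha>. f \<alpha> \<oplus>\<^bsub>A\<^esub> f' \<alpha>) = (\<lambda>\<alpha>. shift_op A g d p f \<alpha> \<oplus>\<^bsub>A\<^esub> shift_op A g d p f' \<alpha>)"
    if "\<And>\<alpha>. f \<alpha> \<in> carrier A" "\<And>\<alpha>. f' \<alpha> \<in> carrier A"
    using p that
    by (induction arbitrary: f f') (simp_all add: g cl' r_distr smult_r_distr M.a_ac)
  show "shift_op A g d p (\<lambda>\<alpha>. c \<odot>\<^bsub>A\<^esub> f \<alpha>) = (\<lambda>\<alpha>. c \<odot>\<^bsub>A\<^esub> shift_op A g d p f \<alpha>)"
    if "c \<in> carrier K" "\<And>\<alpha>. f \<alpha> \<in> carrier A"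
    using p that(2)
    by (induction arbitrary: f) (simp_all add: that(1) g cl' smult_mult_right smult_r_distr K.m_comm flip: smult_assoc1)
qed

lemma shift_op_cong:
  assumes g: "\<And>x. x \<in> X \<Longrightarrow> g x \<in> carrier A"
    and rel: "\<And>p q f. (p, q) \<in> Rel \<Longrightarrow> p \<in> alg_terms K X \<Longrightarrow> q \<in> alg_terms K X \<Longrightarrow> (\<And>\<alpha>. f \<alpha> \<in> carrier A) \<Longrightarrow>
      shift_op A g d p f = shift_op A g d q f"
    and pq: "(p, q) \<in> alg_cong K X Rel" and f: "\<And>\<alpha>. f \<alpha> \<in> carrier A"
  shows "shift_op A g d p f = shift_op A g d q f"
proof -
  note cl = shift_op_linear(1)[OF g]
  show ?thesis
    using pq f
  proof (induction arbitrary: f)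
    case (mult p p' q q')
    have "q \<in> alg_terms K X" using alg_cong_terms[OF K.field_axioms mult.hyps(2)] by simp
    then have "shift_op A g d p (shift_op A g d q f) = shift_op A g d p' (shift_op A g d q f)"
      using mult.prems by (intro mult.IH(1) cl)
    then show ?case using mult.IH(2)[OF mult.prems] by simp
  qed (simp_all add: rel cl smult_assoc1 smult_l_distr smult_r_distr M.a_ac smult_l_minus M.r_neg
      shift_op_linear(2,3)[OF g])
qed

end

locale tgwc = tgw_datum
begin

abbreviation C where "C \<equiv> TGWC K n \<mu> R \<sigma> t"
abbreviation L where "L \<equiv> tgwc_letter K n \<mu> R \<sigma> t"
abbreviation gens where "gens \<equiv> tgwc_gens n R"
abbreviation rels where "rels \<equiv> tgwc_rels K n \<mu> R \<sigma> t"
abbreviation cls where "cls p \<equiv> alg_cong K gens rels `` {p}"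

lemma C_k_algebra: "k_algebra K C"
  unfolding TGWC_def by (rule presented_algebra_k_algebra[OF R.K.field_axioms])

sublocale Ck: shift_algebra K "TGWC K n \<mu> R \<sigma> t"
  by (simp add: shift_algebra_def C_k_algebra)

lemmas C_simps = presented_algebra_simps[OF R.K.field_axioms, where X = gens and Rel = rels, folded TGWC_def]

lemma cls_eq: "(p, q) \<in> alg_cong K gens rels \<Longrightarrow> cls p = cls q"
  by (rule equiv_class_eq[OF equiv_alg_cong[OF R.K.field_axioms]])

lemma cls_rel: "(p, q) \<in> rels \<Longrightarrow> p \<in> alg_terms K gens \<Longrightarrow> q \<in> alg_terms K gens \<Longrightarrow> cls p = cls q"
  by (intro cls_eq alg_cong.rel)

lemma gens_simps: "Coeff r \<in> gens \<longleftrightarrow> r \<in> carrier R" "Gen u \<in> gens \<longleftrightarrow> u \<in> pm n"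
  by (auto simp: tgwc_gens_def)

lemma AVar_terms: "AVar a \<in> alg_terms K gens \<longleftrightarrow> a \<in> gens"
  by (auto intro: alg_terms.intros elim: alg_terms.cases)

lemmas term_rules = AVar_terms gens_simps alg_terms.intros(2-)

lemma L_eq: "L a = cls (AVar a)"
  by (simp add: tgwc_letter_def)

lemma cls_closed: "p \<in> alg_terms K gens \<Longrightarrow> cls p \<in> carrier C"
  by (simp add: C_simps quotientI)

lemma L_closed: "a \<in> gens \<Longrightarrow> L a \<in> carrier C"
  by (simp add: L_eq cls_closed AVar_terms)

lemma carrier_cls: "x \<in> carrier C \<Longrightarrow> \<exists>p\<in>alg_terms K gens. x = cls p"
  by (auto simp: C_simps elim!: quotientE)

lemma inv_\<sigma>_closed: "i \<in> {1..n} \<Longrightarrow> r \<in> carrier R \<Longrightarrow> inv_into (carrier R) (\<sigma> i) r \<in> carrier R"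
  and \<sigma>_closed: "i \<in> {1..n} \<Longrightarrow> r \<in> carrier R \<Longrightarrow> \<sigma> i r \<in> carrier R"
  using sg_closed[of "- int i"] sg_closed[of "int i"] by auto

lemma L_rel:
  assumes "(p, q) \<in> rels" "p \<in> alg_terms K gens" "q \<in> alg_terms K gens"
  shows "alg_eval C L p = alg_eval C L q"
proof -
  have ev: "alg_eval C L p = cls p" if "p \<in> alg_terms K gens" for p
    using that by induction (simp_all add: C_simps L_eq)
  show ?thesis using assms by (simp add: ev cls_rel)
qed

lemma C_rel: "tgw_rel K n \<mu> R \<sigma> t C (\<lambda>r. L (Coeff r)) (\<lambda>u. L (Gen u))"
proof (unfold_locales)
  show "(\<lambda>r. L (Coeff r)) \<in> alg_hom K R C"
  proof (intro alg_homI lin_homI)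
    show "L (Coeff \<one>\<^bsub>R\<^esub>) = \<one>\<^bsub>C\<^esub>" using L_rel[OF tgwc_rels.coeff_one] by (simp add: term_rules)
    fix r assume r: "r \<in> carrier R"
    show "L (Coeff r) \<in> carrier C" using r by (simp add: L_closed gens_simps)
    { fix c assume "c \<in> carrier K"
      then show "L (Coeff (c \<odot>\<^bsub>R\<^esub> r)) = c \<odot>\<^bsub>C\<^esub> L (Coeff r)"
        using L_rel[OF tgwc_rels.coeff_scal, of c r] r by (simp add: term_rules) }
    { fix s assume s: "s \<in> carrier R"
      show "L (Coeff (r \<oplus>\<^bsub>R\<^esub> s)) = L (Coeff r) \<oplus>\<^bsub>C\<^esub> L (Coeff s)"
        using L_rel[OF tgwc_rels.coeff_add, of r s] r s by (simp add: term_rules) }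
    fix s assume s: "s \<in> carrier R"
    show "L (Coeff (r \<otimes>\<^bsub>R\<^esub> s)) = L (Coeff r) \<otimes>\<^bsub>C\<^esub> L (Coeff s)"
      using L_rel[OF tgwc_rels.coeff_mult, of r s] r s by (simp add: term_rules)
  qed
next
  fix u assume u: "u \<in> pm n"
  show "L (Gen u) \<in> carrier C" using u by (simp add: L_closed gens_simps)
  show "L (Gen (- u)) \<otimes>\<^bsub>C\<^esub> L (Gen u) = L (Coeff (tt u))"
    using u
  proof (cases rule: pm_cases)
    case (1 i) then show ?thesis
      using L_rel[OF tgwc_rels.minus_plus[OF 1(1)]] t_center(1)[OF 1(1)] u by (simp add: term_rules tt_def)
  next
    case (2 i) then show ?thesis
      using L_rel[OF tgwc_rels.plus_minus[OF 2(1)]] t_center(1)[OF 2(1)] u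
      by (simp add: term_rules tt_def \<sigma>_closed)
  qed
  fix r assume r: "r \<in> carrier R"
  show "L (Gen u) \<otimes>\<^bsub>C\<^esub> L (Coeff r) = L (Coeff (sg u r)) \<otimes>\<^bsub>C\<^esub> L (Gen u)"
    using u
  proof (cases rule: pm_cases)
    case (1 i) then show ?thesis
      using L_rel[OF tgwc_rels.plus_coeff[OF 1(1) r]] u r by (simp add: term_rules \<sigma>_closed)
  next
    case (2 i) then show ?thesis
      using L_rel[OF tgwc_rels.minus_coeff[OF 2(1) r]] u r by (simp add: term_rules inv_\<sigma>_closed)
  qed
next
  fix i j assume ij: "i \<in> {1..n}" "j \<in> {1..n}" "i \<noteq> j"
  then show "L (Gen (int i)) \<otimes>\<^bsub>C\<^esub> L (Gen (- int j)) = \<mu> i j \<odot>\<^bsub>C\<^esub> (L (Gen (- int j)) \<otimes>\<^bsub>C\<^esub> L (Gen (int i)))"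
    using L_rel[OF tgwc_rels.exchange[OF ij]] \<mu>_nonzero[OF ij(1,2)] by (simp add: term_rules)
qed

sublocale Cr: tgw_rel K n \<mu> R \<sigma> t "TGWC K n \<mu> R \<sigma> t" "\<lambda>r. tgwc_letter K n \<mu> R \<sigma> t (Coeff r)" "\<lambda>u. tgwc_letter K n \<mu> R \<sigma> t (Gen u)"
  by (rule C_rel)

abbreviation ic where "ic r \<equiv> L (Coeff r)"
abbreviation mon where "mon \<equiv> Cr.mon"
abbreviation words where "words \<equiv> lists (pm n)"

sublocale Ca: tgw_alg K n \<mu> R \<sigma> t "TGWC K n \<mu> R \<sigma> t" "\<lambda>r. tgwc_letter K n \<mu> R \<sigma> t (Coeff r)" "\<lambda>u. tgwc_letter K n \<mu> R \<sigma> t (Gen u)"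
proof
  show "carrier C \<subseteq> add_span C Cr.monoms"
  proof
    fix x assume "x \<in> carrier C"
    then obtain p where p: "p \<in> alg_terms K gens" "x = cls p" using carrier_cls by blast
    note base = Ck.M.add_span_base[OF Cr.monoms_carrier]
    have "cls p \<in> add_span C Cr.monoms"
      using p(1)
    proof induction
      case (1 a)
      show ?case
      proof (cases a)
        case (Coeff r)
        then have "r \<in> carrier R" "cls (AVar a) = mon r []" using 1 by (simp_all add: gens_simps L_eq[symmetric])
        then show ?thesis using base unfolding Cr.monoms_def by blast
      next
        case (Gen u)
        then have "[u] \<in> words" "cls (AVar a) = mon \<one>\<^bsub>R\<^esub> [u]"
          using 1 by (simp_all add: gens_simps L_eq[symmetric] Cr.mon_one)
        then show ?thesis using base unfolding Cr.monoms_def by blast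
      qed
    next
      case 2 then show ?case using add_span.zero[of C] by (simp add: C_simps)
    next
      case 3
      have "cls AOne = mon \<one>\<^bsub>R\<^esub> []" by (simp add: C_simps(3)[symmetric])
      then show ?case using base unfolding Cr.monoms_def by blast
    next
      case (4 p q)
      then show ?case using Ck.M.add_span_add[OF Cr.monoms_carrier] by (simp flip: C_simps(4))
    next
      case (5 p q)
      then show ?case using Cr.span_monoms_mult by (simp flip: C_simps(5))
    next
      case (6 c p)
      then show ?case using Cr.span_monoms_smult by (simp flip: C_simps(6))
    qed
    then show "x \<in> add_span C Cr.monoms" by (simp add: p)
  qed
qed

lemma tgwc_monom_eq: "tgwc_monom K n \<mu> R \<sigma> t r us = mon r us"
  by (simp add: tgwc_monom_def Let_def Cr.mon_def Cr.wX_def)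

abbreviation sop where "sop \<equiv> shift_op C L letter_degree"

definition \<Phi> where "\<Phi> x = sop (SOME p. p \<in> x)"

definition \<delta> :: "(nat \<Rightarrow> int) \<Rightarrow> ('a, 'b) tgwc" where
  "\<delta> \<alpha> = (if \<alpha> = (\<lambda>_. 0) then \<one>\<^bsub>C\<^esub> else \<zero>\<^bsub>C\<^esub>)"

definition proj where "proj \<alpha> x = \<Phi> x \<delta> \<alpha>"

lemma \<delta>_closed [simp]: "\<delta> \<alpha> \<in> carrier C"
  by (simp add: \<delta>_def)

text \<open>Both sides of each relation have the same degree, so that the shifts agree, and they are equal in the construction.\<close>

lemma sop_rel:
  assumes "(p, q) \<in> rels" "\<And>\<alpha>. f \<alpha> \<in> carrier C"
  shows "sop p f = sop q f"
  using assms(1)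
proof cases
  case (plus_coeff i r)
  then show ?thesis using Cr.X_\<iota>[of "int i" r] assms(2) by (simp add: fun_eq_iff L_closed gens_simps \<sigma>_closed flip: Ck.m_assoc)
next
  case (minus_coeff i r)
  then show ?thesis using Cr.X_\<iota>[of "- int i" r] assms(2) by (simp add: fun_eq_iff L_closed gens_simps inv_\<sigma>_closed flip: Ck.m_assoc)
next
  case (minus_plus i)
  then show ?thesis using Cr.X_uminus[of "int i"] assms(2) by (simp add: fun_eq_iff L_closed gens_simps tt_def flip: Ck.m_assoc)
next
  case (plus_minus i)
  then show ?thesis using Cr.X_uminus[of "- int i"] assms(2) by (simp add: fun_eq_iff L_closed gens_simps tt_def flip: Ck.m_assoc)
next
  case (exchange i j)
  have e: "(\<lambda>k. \<alpha> k - gen_degree (int i) k + gen_degree (int j) k) = (\<lambda>k. \<alpha> k + gen_degree (int j) k - gen_degree (int i) k)" for \<alpha>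
    by (simp add: algebra_simps)
  have "L (Gen (int i)) \<otimes>\<^bsub>C\<^esub> L (Gen (- int j)) \<otimes>\<^bsub>C\<^esub> y = \<mu> i j \<odot>\<^bsub>C\<^esub> (L (Gen (- int j)) \<otimes>\<^bsub>C\<^esub> (L (Gen (int i)) \<otimes>\<^bsub>C\<^esub> y))"
    if "y \<in> carrier C" for y
    using Cr.X_exchange[of i j] \<mu>_nonzero[of i j] exchange that
    by (simp add: Ck.smult_mult_left Ck.m_assoc L_closed gens_simps)
  then show ?thesis using assms(2) exchange by (simp add: fun_eq_iff L_closed gens_simps e Ck.m_assoc)
qed (use assms(2) in \<open>simp_all add: fun_eq_iff L_closed gens_simps Ck.l_distr Ck.smult_mult_left Ck.m_assoc\<close>)

lemma \<Phi>_cls: "p \<in> alg_terms K gens \<Longrightarrow> (\<And>\<alpha>. f \<alpha> \<in> carrier C) \<Longrightarrow> \<Phi> (cls p) f = sop p f"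
proof -
  assume p: "p \<in> alg_terms K gens" and f: "\<And>\<alpha>. f \<alpha> \<in> carrier C"
  have "p \<in> cls p" using p by (simp add: alg_cong.refl)
  then have "(SOME q. q \<in> cls p) \<in> cls p" by (rule someI)
  then have "(p, SOME q. q \<in> cls p) \<in> alg_cong K gens rels" by simp
  then have "sop p f = sop (SOME q. q \<in> cls p) f"
    by (rule Ck.shift_op_cong[rotated 2]) (use f sop_rel L_closed in auto)
  then show ?thesis by (simp add: \<Phi>_def)
qed

lemma \<Phi>_closed: "x \<in> carrier C \<Longrightarrow> (\<And>\<alpha>. f \<alpha> \<in> carrier C) \<Longrightarrow> \<Phi> x f \<alpha> \<in> carrier C"
  using carrier_cls[of x] Ck.shift_op_linear(1)[of gens L, OF L_closed] \<Phi>_cls by metis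

lemma \<Phi>_simps:
  assumes f: "\<And>\<alpha>. f \<alpha> \<in> carrier C" and x: "x \<in> carrier C"
  shows "\<Phi> \<zero>\<^bsub>C\<^esub> f = (\<lambda>_. \<zero>\<^bsub>C\<^esub>)"
    "a \<in> gens \<Longrightarrow> \<Phi> (L a) f = (\<lambda>\<alpha>. L a \<otimes>\<^bsub>C\<^esub> f (\<lambda>i. \<alpha> i - letter_degree a i))"
    "y \<in> carrier C \<Longrightarrow> \<Phi> (x \<oplus>\<^bsub>C\<^esub> y) f = (\<lambda>\<alpha>. \<Phi> x f \<alpha> \<oplus>\<^bsub>C\<^esub> \<Phi> y f \<alpha>)"
    "y \<in> carrier C \<Longrightarrow> \<Phi> (x \<otimes>\<^bsub>C\<^esub> y) f = \<Phi> x (\<Phi> y f)"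
    "c \<in> carrier K \<Longrightarrow> \<Phi> (c \<odot>\<^bsub>C\<^esub> x) f = (\<lambda>\<alpha>. c \<odot>\<^bsub>C\<^esub> \<Phi> x f \<alpha>)"
proof -
  show "\<Phi> \<zero>\<^bsub>C\<^esub> f = (\<lambda>_. \<zero>\<^bsub>C\<^esub>)" using \<Phi>_cls[OF _ f, of AZero] by (simp add: C_simps alg_terms.intros)
  show "\<Phi> (L a) f = (\<lambda>\<alpha>. L a \<otimes>\<^bsub>C\<^esub> f (\<lambda>i. \<alpha> i - letter_degree a i))" if "a \<in> gens"
    using \<Phi>_cls[OF _ f, of "AVar a"] that by (simp add: L_eq AVar_terms)
  obtain p where p: "p \<in> alg_terms K gens" "x = cls p" using carrier_cls x by blast
  show "\<Phi> (c \<odot>\<^bsub>C\<^esub> x) f = (\<lambda>\<alpha>. c \<odot>\<^bsub>C\<^esub> \<Phi> x f \<alpha>)" if c: "c \<in> carrier K"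
    using p c by (simp add: C_simps \<Phi>_cls[OF _ f] term_rules)
  { fix y assume y: "y \<in> carrier C"
    then obtain q where q: "q \<in> alg_terms K gens" "y = cls q" using carrier_cls by blast
    show "\<Phi> (x \<oplus>\<^bsub>C\<^esub> y) f = (\<lambda>\<alpha>. \<Phi> x f \<alpha> \<oplus>\<^bsub>C\<^esub> \<Phi> y f \<alpha>)"
      using p q by (simp add: C_simps \<Phi>_cls[OF _ f] term_rules)
    have "\<Phi> y f \<alpha> \<in> carrier C" for \<alpha> using \<Phi>_closed[OF y f] .
    then show "\<Phi> (x \<otimes>\<^bsub>C\<^esub> y) f = \<Phi> x (\<Phi> y f)"
      using p q by (simp add: C_simps \<Phi>_cls[OF _ f] \<Phi>_cls term_rules) }
qed

lemma homogeneous_\<Phi>: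
  assumes "tgwc_homogeneous K n \<mu> R \<sigma> t \<beta> x"
  shows "x \<in> carrier C \<and> (\<forall>f \<gamma>. (\<forall>\<alpha>. f \<alpha> \<in> carrier C) \<longrightarrow> \<Phi> x f \<gamma> = x \<otimes>\<^bsub>C\<^esub> f (\<lambda>i. \<gamma> i - \<beta> i))"
  using assms
proof induction
  case (mult \<alpha> x \<beta> y)
  then have xy: "x \<in> carrier C" "y \<in> carrier C" by auto
  have "\<Phi> (x \<otimes>\<^bsub>C\<^esub> y) f \<gamma> = x \<otimes>\<^bsub>C\<^esub> y \<otimes>\<^bsub>C\<^esub> f (\<lambda>i. \<gamma> i - (\<alpha> i + \<beta> i))" if "\<forall>\<alpha>. f \<alpha> \<in> carrier C" for f \<gamma>
    using mult that xy by (simp add: \<Phi>_simps \<Phi>_closed Ck.m_assoc diff_diff_eq)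
  then show ?case using xy by simp
qed (simp_all add: \<Phi>_simps \<Phi>_simps(1,2)[OF _ Ck.zero_closed] L_closed Ck.l_distr Ck.smult_mult_left)

lemma proj_homogeneous:
  assumes "tgwc_homogeneous K n \<mu> R \<sigma> t \<beta> x"
  shows "x \<in> carrier C" "proj \<alpha> x = (if \<alpha> = \<beta> then x else \<zero>\<^bsub>C\<^esub>)"
proof -
  have "(\<lambda>i. \<alpha> i - \<beta> i) = (\<lambda>_. 0) \<longleftrightarrow> \<alpha> = \<beta>" by (auto simp: fun_eq_iff)
  then show "x \<in> carrier C" "proj \<alpha> x = (if \<alpha> = \<beta> then x else \<zero>\<^bsub>C\<^esub>)"
    using homogeneous_\<Phi>[OF assms] by (auto simp: proj_def \<delta>_def)
qed

lemma proj_lin: "proj \<alpha> \<in> lin_hom K C C"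
  by (rule lin_homI) (simp_all add: proj_def \<Phi>_simps \<Phi>_closed)

lemmas projD [simp] = lin_homD[OF proj_lin]

lemma proj_zero [simp]: "proj \<alpha> \<zero>\<^bsub>C\<^esub> = \<zero>\<^bsub>C\<^esub>"
  by (rule lin_hom_zero[OF proj_lin Ca.A_vec_space Ca.A_vec_space])

lemma wX_homogeneous: "us \<in> words \<Longrightarrow> tgwc_homogeneous K n \<mu> R \<sigma> t (word_degree us) (Cr.wX us)"
proof (induction us rule: list.induct)
  case Nil
  then show ?case
    using tgwc_homogeneous.letter[of "Coeff \<one>\<^bsub>R\<^esub>" n R K \<mu> \<sigma> t] by (simp add: gens_simps)
next
  case (Cons u us)
  then show ?case
    using tgwc_homogeneous.mult[OF tgwc_homogeneous.letter[of "Gen u" n R]] by (simp add: gens_simps)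
qed

lemma mon_homogeneous: "r \<in> carrier R \<Longrightarrow> us \<in> words \<Longrightarrow> tgwc_homogeneous K n \<mu> R \<sigma> t (word_degree us) (mon r us)"
  using tgwc_homogeneous.mult[OF tgwc_homogeneous.letter[of "Coeff r" n R] wX_homogeneous]
  by (simp add: gens_simps Cr.mon_def)

lemma proj_mon: "r \<in> carrier R \<Longrightarrow> us \<in> words \<Longrightarrow> proj \<alpha> (mon r us) = (if \<alpha> = word_degree us then mon r us else \<zero>\<^bsub>C\<^esub>)"
  by (rule proj_homogeneous(2)[OF mon_homogeneous])

lemma homogeneous_proj:
  assumes "x \<in> carrier C"
  shows "tgwc_homogeneous K n \<mu> R \<sigma> t \<alpha> (proj \<alpha> x)"
  using assms
proof (induction rule: Ca.monom_induct)
  case zero show ?case by (simp add: tgwc_homogeneous.zero)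
next
  case (add r us x)
  then have "tgwc_homogeneous K n \<mu> R \<sigma> t \<alpha> (proj \<alpha> (mon r us))"
    using mon_homogeneous[of r us] tgwc_homogeneous.zero by (auto simp: proj_mon)
  then show ?case using add by (simp add: tgwc_homogeneous.add)
qed

lemma proj_proj: "x \<in> carrier C \<Longrightarrow> proj \<alpha> (proj \<beta> x) = (if \<alpha> = \<beta> then proj \<beta> x else \<zero>\<^bsub>C\<^esub>)"
  by (rule proj_homogeneous(2)[OF homogeneous_proj])

text \<open>The finite set of degrees is allowed to grow, so that the decompositions of two summands can be added.\<close>

lemma proj_decomposition:
  assumes "x \<in> carrier C"
  shows "\<exists>F. finite F \<and> (\<forall>F'. finite F' \<longrightarrow> F \<subseteq> F' \<longrightarrow> x = (\<Oplus>\<^bsub>C\<^esub>\<alpha>\<in>F'. proj \<alpha> x))"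
  using assms
proof (induction rule: Ca.monom_induct)
  case zero show ?case by (intro exI[of _ "{}"]) simp
next
  case (add r us x)
  then obtain F where F: "finite F" "\<And>F'. finite F' \<Longrightarrow> F \<subseteq> F' \<Longrightarrow> x = (\<Oplus>\<^bsub>C\<^esub>\<alpha>\<in>F'. proj \<alpha> x)" by blast
  have m: "mon r us = (\<Oplus>\<^bsub>C\<^esub>\<alpha>\<in>F'. proj \<alpha> (mon r us))" if "finite F'" "word_degree us \<in> F'" for F'
    using Ck.M.finsum_singleton[of "word_degree us" F' "\<lambda>_. mon r us"] that add by (simp add: proj_mon eq_commute)
  show ?case
  proof (intro exI[of _ "insert (word_degree us) F"] conjI allI impI)
    fix F' assume F': "finite F'" "insert (word_degree us) F \<subseteq> F'"
    have "(\<Oplus>\<^bsub>C\<^esub>\<alpha>\<in>F'. proj \<alpha> (mon r us \<oplus>\<^bsub>C\<^esub> x)) = (\<Oplus>\<^bsub>C\<^esub>\<alpha>\<in>F'. proj \<alpha> (mon r us) \<oplus>\<^bsub>C\<^esub> proj \<alpha> x)"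
      using add by simp
    also have "\<dots> = (\<Oplus>\<^bsub>C\<^esub>\<alpha>\<in>F'. proj \<alpha> (mon r us)) \<oplus>\<^bsub>C\<^esub> (\<Oplus>\<^bsub>C\<^esub>\<alpha>\<in>F'. proj \<alpha> x)"
      using add by (intro Ck.M.finsum_addf) auto
    also have "\<dots> = mon r us \<oplus>\<^bsub>C\<^esub> x" using m[of F'] F(2)[of F'] F' by simp
    finally show "mon r us \<oplus>\<^bsub>C\<^esub> x = (\<Oplus>\<^bsub>C\<^esub>\<alpha>\<in>F'. proj \<alpha> (mon r us \<oplus>\<^bsub>C\<^esub> x))" by simp
  qed (use F in auto)
qed

lemma lin_hom_finsum_zero:
  assumes f: "f \<in> lin_hom K C P" and P: "vec_space K P" and F: "finite F"
    and c: "\<And>i. i \<in> F \<Longrightarrow> c i \<in> carrier C" "\<And>i. i \<in> F \<Longrightarrow> f (c i) = \<zero>\<^bsub>P\<^esub>"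
  shows "f (\<Oplus>\<^bsub>C\<^esub>i\<in>F. c i) = \<zero>\<^bsub>P\<^esub>"
proof -
  interpret P: vec_space K P by fact
  show ?thesis using F c
  proof (induction F)
    case empty then show ?case using lin_hom_zero[OF f Ca.A_vec_space P] by simp
  next
    case (insert i F)
    then have "(\<Oplus>\<^bsub>C\<^esub>i\<in>F. c i) \<in> carrier C" by (intro Ck.M.finsum_closed) auto
    then show ?case using insert by (simp add: lin_homD[OF f] Pi_def)
  qed
qed

lemma linear_zero_by_components:
  assumes "f \<in> lin_hom K C P" "vec_space K P" "x \<in> carrier C" "\<And>\<alpha>. f (proj \<alpha> x) = \<zero>\<^bsub>P\<^esub>"
  shows "f x = \<zero>\<^bsub>P\<^esub>"
proof -
  obtain F where F: "finite F" "x = (\<Oplus>\<^bsub>C\<^esub>\<alpha>\<in>F. proj \<alpha> x)" using proj_decomposition[OF assms(3)] by blast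
  show ?thesis
    by (subst F(2), rule lin_hom_finsum_zero[OF assms(1,2) F(1)]) (use assms in auto)
qed

sublocale Cp: tgw_proj K n \<mu> R \<sigma> t "TGWC K n \<mu> R \<sigma> t" "\<lambda>r. tgwc_letter K n \<mu> R \<sigma> t (Coeff r)"
    "\<lambda>u. tgwc_letter K n \<mu> R \<sigma> t (Gen u)" "proj (\<lambda>_. 0)"
  by unfold_locales (auto simp: proj_mon[unfolded lists_eq_set] proj_lin lists_eq_set)

lemma proj_sandwich:
  assumes "r \<in> carrier R" "us \<in> words" "s \<in> carrier R" "vs \<in> words" "x \<in> carrier C"
  shows "proj \<alpha> (mon r us \<otimes>\<^bsub>C\<^esub> x \<otimes>\<^bsub>C\<^esub> mon s vs) =
    mon r us \<otimes>\<^bsub>C\<^esub> proj (\<lambda>i. \<alpha> i - word_degree us i - word_degree vs i) x \<otimes>\<^bsub>C\<^esub> mon s vs"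
proof (rule Ca.linear_eq_monoms[where f = "\<lambda>x. proj \<alpha> (mon r us \<otimes>\<^bsub>C\<^esub> x \<otimes>\<^bsub>C\<^esub> mon s vs)" and P = C])
  let ?\<beta> = "\<lambda>i. \<alpha> i - word_degree us i - word_degree vs i"
  have L: "(\<lambda>x. mon r us \<otimes>\<^bsub>C\<^esub> x \<otimes>\<^bsub>C\<^esub> mon s vs) \<in> lin_hom K C C"
    using lin_hom_comp[OF Ca.mult_lin_right Ca.mult_lin_left] assms by simp
  show "(\<lambda>x. proj \<alpha> (mon r us \<otimes>\<^bsub>C\<^esub> x \<otimes>\<^bsub>C\<^esub> mon s vs)) \<in> lin_hom K C C" by (rule lin_hom_comp[OF L proj_lin])
  show "(\<lambda>x. mon r us \<otimes>\<^bsub>C\<^esub> proj ?\<beta> x \<otimes>\<^bsub>C\<^esub> mon s vs) \<in> lin_hom K C C" by (rule lin_hom_comp[OF proj_lin L])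
  fix r' ws assume w: "r' \<in> carrier R" "ws \<in> words"
  have "\<alpha> = word_degree (us @ ws @ vs) \<longleftrightarrow> ?\<beta> = word_degree ws"
    by (auto simp: fun_eq_iff algebra_simps)
  then show "proj \<alpha> (mon r us \<otimes>\<^bsub>C\<^esub> mon r' ws \<otimes>\<^bsub>C\<^esub> mon s vs) = mon r us \<otimes>\<^bsub>C\<^esub> proj ?\<beta> (mon r' ws) \<otimes>\<^bsub>C\<^esub> mon s vs"
    using assms w by (simp add: Cr.mon_mult proj_mon del: word_degree_simps)
qed (use assms Ca.A_vec_space in auto)


section \<open>The canonical ideal\<close>

abbreviation p0 where "p0 \<equiv> proj (\<lambda>_. 0)"

text \<open>The largest ideal in the kernel of the projection onto the component of degree \<open>0\<close>.\<close>

definition radical where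
  "radical = {x \<in> carrier C. \<forall>a\<in>carrier C. \<forall>b\<in>carrier C. p0 (a \<otimes>\<^bsub>C\<^esub> x \<otimes>\<^bsub>C\<^esub> b) = \<zero>\<^bsub>C\<^esub>}"

lemma radical_ideal: "ideal radical C"
proof (rule idealI)
  show "ring C" by (rule Ck.ring_axioms)
  have add: "x \<oplus>\<^bsub>C\<^esub> y \<in> radical" if "x \<in> radical" "y \<in> radical" for x y
    using that unfolding radical_def by (simp add: Ck.r_distr Ck.l_distr)
  have smult: "c \<odot>\<^bsub>C\<^esub> x \<in> radical" if "c \<in> carrier K" "x \<in> radical" for c x
    using that unfolding radical_def by (simp add: Ck.smult_mult_left Ck.smult_mult_right)
  show "subgroup radical (add_monoid C)"
  proof (rule Ck.add.subgroupI)
    show "radical \<subseteq> carrier C" unfolding radical_def by blast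
    show "radical \<noteq> {}" unfolding radical_def by (auto intro!: exI[of _ "\<zero>\<^bsub>C\<^esub>"])
    fix x assume x: "x \<in> radical"
    then show "\<ominus>\<^bsub>C\<^esub> x \<in> radical"
      using smult[OF _ x, of "\<ominus>\<^bsub>K\<^esub> \<one>\<^bsub>K\<^esub>"] Ca.A_vec_space
      by (simp add: vec_space.uminus_eq_smult radical_def)
  qed (rule add)
  fix x c assume xc: "x \<in> radical" "c \<in> carrier C"
  then have x: "x \<in> carrier C" unfolding radical_def by blast
  have *: "p0 (a \<otimes>\<^bsub>C\<^esub> x \<otimes>\<^bsub>C\<^esub> b) = \<zero>\<^bsub>C\<^esub>" if "a \<in> carrier C" "b \<in> carrier C" for a b
    using xc that unfolding radical_def by blast
  have "p0 (a \<otimes>\<^bsub>C\<^esub> (c \<otimes>\<^bsub>C\<^esub> x) \<otimes>\<^bsub>C\<^esub> b) = \<zero>\<^bsub>C\<^esub>" if "a \<in> carrier C" "b \<in> carrier C" for a b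
    using *[of "a \<otimes>\<^bsub>C\<^esub> c" b] x xc that by (simp add: Ck.m_assoc)
  then show "c \<otimes>\<^bsub>C\<^esub> x \<in> radical" unfolding radical_def using x xc by simp
  have "p0 (a \<otimes>\<^bsub>C\<^esub> (x \<otimes>\<^bsub>C\<^esub> c) \<otimes>\<^bsub>C\<^esub> b) = \<zero>\<^bsub>C\<^esub>" if "a \<in> carrier C" "b \<in> carrier C" for a b
    using *[of a "c \<otimes>\<^bsub>C\<^esub> b"] x xc that by (simp add: Ck.m_assoc)
  then show "x \<otimes>\<^bsub>C\<^esub> c \<in> radical" unfolding radical_def using x xc by simp
qed

text \<open>For monomials \<open>a\<close> and \<open>b\<close>, the element \<open>p0 (a x b)\<close> involves a single component of \<open>x\<close>. Hence the conditions that define the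
  radical can be separated by degree.\<close>

lemma radical_proj:
  assumes "x \<in> radical"
  shows "proj \<alpha> x \<in> radical"
proof -
  have x: "x \<in> carrier C" and x0: "\<And>a b. a \<in> carrier C \<Longrightarrow> b \<in> carrier C \<Longrightarrow> p0 (a \<otimes>\<^bsub>C\<^esub> x \<otimes>\<^bsub>C\<^esub> b) = \<zero>\<^bsub>C\<^esub>"
    using assms unfolding radical_def by auto
  have "p0 (mon r us \<otimes>\<^bsub>C\<^esub> proj \<alpha> x \<otimes>\<^bsub>C\<^esub> mon s vs) = \<zero>\<^bsub>C\<^esub>"
    if m: "r \<in> carrier R" "us \<in> words" "s \<in> carrier R" "vs \<in> words" for r us s vs
  proof -
    let ?\<gamma> = "\<lambda>i. (0::int) - word_degree us i - word_degree vs i"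
    have "p0 (mon r us \<otimes>\<^bsub>C\<^esub> proj \<alpha> x \<otimes>\<^bsub>C\<^esub> mon s vs) = mon r us \<otimes>\<^bsub>C\<^esub> proj ?\<gamma> (proj \<alpha> x) \<otimes>\<^bsub>C\<^esub> mon s vs"
      using m x by (simp only: proj_sandwich projD)
    also have "\<dots> = \<zero>\<^bsub>C\<^esub>"
    proof (cases "?\<gamma> = \<alpha>")
      case True
      then have "proj ?\<gamma> (proj \<alpha> x) = proj ?\<gamma> x" using proj_proj[OF x] by simp
      then show ?thesis using x0[of "mon r us" "mon s vs"] proj_sandwich[OF m x, of "\<lambda>_. 0"] m by simp
    next
      case False
      then have "proj ?\<gamma> (proj \<alpha> x) = \<zero>\<^bsub>C\<^esub>" using proj_proj[OF x] by simp
      then show ?thesis using m by simp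
    qed
    finally show ?thesis .
  qed
  then show ?thesis unfolding radical_def using x Cp.p0_zero_from_monoms[of "proj \<alpha> x"] by simp
qed

text \<open>The radical is a graded ideal, and an element of degree \<open>0\<close> in it is its own projection, hence zero. Conversely, let \<open>J\<close> be a
  graded ideal with zero component of degree \<open>0\<close>. Then \<open>p0\<close> vanishes on \<open>J\<close>, hence on all \<open>a x b\<close> with \<open>x\<close> in \<open>J\<close>.\<close>

lemma canonical_ideal_eq: "canonical_ideal K n \<mu> R \<sigma> t = radical"
proof -
  define \<G> where "\<G> = {J. tgwc_graded_ideal K n \<mu> R \<sigma> t J \<and> J \<inter> tgwc_component K n \<mu> R \<sigma> t (\<lambda>_. 0) = {\<zero>\<^bsub>C\<^esub>}}"
  have eq: "canonical_ideal K n \<mu> R \<sigma> t = {(\<Oplus>\<^bsub>C\<^esub>J\<in>F. c J) | F c. finite F \<and> F \<subseteq> \<G> \<and> (\<forall>J\<in>F. c J \<in> J)}"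
    by (simp add: canonical_ideal_def \<G>_def Let_def)
  have "tgwc_graded_ideal K n \<mu> R \<sigma> t radical"
    unfolding tgwc_graded_ideal_def Let_def
  proof (intro conjI ballI radical_ideal)
    fix x assume x: "x \<in> radical"
    then have xc: "x \<in> carrier C" unfolding radical_def by blast
    obtain F where F: "finite F" "x = (\<Oplus>\<^bsub>C\<^esub>\<alpha>\<in>F. proj \<alpha> x)" using proj_decomposition[OF xc] by blast
    then show "\<exists>F c. finite F \<and> (\<forall>\<alpha>\<in>F. c \<alpha> \<in> radical \<inter> tgwc_component K n \<mu> R \<sigma> t \<alpha>) \<and> x = (\<Oplus>\<^bsub>C\<^esub>\<alpha>\<in>F. c \<alpha>)"
      using radical_proj[OF x] homogeneous_proj[OF xc]
      by (intro exI[of _ F] exI[of _ "\<lambda>\<alpha>. proj \<alpha> x"]) (simp add: tgwc_component_def)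
  qed
  moreover have "radical \<inter> tgwc_component K n \<mu> R \<sigma> t (\<lambda>_. 0) = {\<zero>\<^bsub>C\<^esub>}"
  proof -
    have "x = \<zero>\<^bsub>C\<^esub>" if "x \<in> radical" "tgwc_homogeneous K n \<mu> R \<sigma> t (\<lambda>_. 0) x" for x
    proof -
      have "p0 (\<one>\<^bsub>C\<^esub> \<otimes>\<^bsub>C\<^esub> x \<otimes>\<^bsub>C\<^esub> \<one>\<^bsub>C\<^esub>) = \<zero>\<^bsub>C\<^esub>" using that(1) unfolding radical_def by blast
      then show ?thesis using proj_homogeneous[OF that(2)] by simp
    qed
    then show ?thesis using tgwc_homogeneous.zero unfolding tgwc_component_def radical_def by auto
  qed
  ultimately have rG: "radical \<in> \<G>" unfolding \<G>_def by blast
  have GJ: "J \<subseteq> radical" if "J \<in> \<G>" for J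
  proof
    fix x assume x: "x \<in> J"
    interpret J: ideal J C using that unfolding \<G>_def tgwc_graded_ideal_def Let_def by blast
    have "p0 y = \<zero>\<^bsub>C\<^esub>" if y: "y \<in> J" for y
    proof -
      have "\<exists>F c. finite F \<and> (\<forall>\<alpha>\<in>F. c \<alpha> \<in> J \<inter> tgwc_component K n \<mu> R \<sigma> t \<alpha>) \<and> y = (\<Oplus>\<^bsub>C\<^esub>\<alpha>\<in>F. c \<alpha>)"
        using \<open>J \<in> \<G>\<close> y by (simp add: \<G>_def tgwc_graded_ideal_def Let_def)
      then obtain F c where F0: "finite F" "\<forall>\<alpha>\<in>F. c \<alpha> \<in> J \<inter> tgwc_component K n \<mu> R \<sigma> t \<alpha>" "y = (\<Oplus>\<^bsub>C\<^esub>\<alpha>\<in>F. c \<alpha>)"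
        by blast
      have F: "finite F" "\<And>\<alpha>. \<alpha> \<in> F \<Longrightarrow> c \<alpha> \<in> J \<and> tgwc_homogeneous K n \<mu> R \<sigma> t \<alpha> (c \<alpha>)" "y = (\<Oplus>\<^bsub>C\<^esub>\<alpha>\<in>F. c \<alpha>)"
        using F0 by (simp_all add: tgwc_component_def)
      have "p0 (c \<alpha>) = \<zero>\<^bsub>C\<^esub>" if \<alpha>: "\<alpha> \<in> F" for \<alpha>
      proof (cases "\<alpha> = (\<lambda>_. 0)")
        case True
        then have "c \<alpha> \<in> J \<inter> tgwc_component K n \<mu> R \<sigma> t (\<lambda>_. 0)" using F(2)[OF \<alpha>] by (simp add: tgwc_component_def)
        then have "c \<alpha> = \<zero>\<^bsub>C\<^esub>" using \<open>J \<in> \<G>\<close> unfolding \<G>_def by blast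
        then show ?thesis by simp
      next
        case False
        then show ?thesis using F(2)[OF \<alpha>] proj_homogeneous(2)[of \<alpha> "c \<alpha>" "\<lambda>_. 0"] by auto
      qed
      then show ?thesis
        using F(2) J.Icarr unfolding F(3) by (intro lin_hom_finsum_zero[OF proj_lin Ca.A_vec_space F(1)]) auto
    qed
    then show "x \<in> radical" unfolding radical_def using x J.Icarr J.I_l_closed J.I_r_closed by simp
  qed
  interpret N: ideal radical C by (rule radical_ideal)
  show ?thesis
  proof
    show "radical \<subseteq> canonical_ideal K n \<mu> R \<sigma> t"
    proof
      fix x assume x: "x \<in> radical"
      show "x \<in> canonical_ideal K n \<mu> R \<sigma> t"
        unfolding eq
      proof (intro CollectI exI conjI)
        show "x = (\<Oplus>\<^bsub>C\<^esub>J\<in>{radical}. x)" using N.Icarr[OF x] by simp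
        show "finite {radical}" "{radical} \<subseteq> \<G>" "\<forall>J\<in>{radical}. x \<in> J" using rG x by simp_all
      qed
    qed
    have "(\<Oplus>\<^bsub>C\<^esub>J\<in>F. c J) \<in> radical" if "finite F" "F \<subseteq> \<G>" "\<forall>J\<in>F. c J \<in> J" for F c
      using that
    proof (induction F)
      case empty then show ?case using N.zero_closed by simp
    next
      case (insert J F)
      have "c J' \<in> radical" if "J' \<in> insert J F" for J' using insert.prems that GJ by blast
      then show ?case using insert N.a_closed N.Icarr by (simp add: Pi_def)
    qed
    then show "canonical_ideal K n \<mu> R \<sigma> t \<subseteq> radical" unfolding eq by blast
  qed
qed

end


section \<open>The quotient by the canonical ideal\<close>

context quot_alg
begin

definition rep where "rep a = inv_into (carrier A) pr a"

lemma rep: "a \<in> carrier Q \<Longrightarrow> rep a \<in> carrier A" "a \<in> carrier Q \<Longrightarrow> pr (rep a) = a"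
  unfolding rep_def Q_simps(1) by (rule inv_into_into, assumption, rule f_inv_into_f)

lemma pr_closed [simp]: "x \<in> carrier A \<Longrightarrow> pr x \<in> carrier Q"
  by (simp add: Q_simps)

lemma lift_lin:
  assumes f: "f \<in> lin_hom K A P" and P: "vec_space K P" and J: "\<And>x. x \<in> J \<Longrightarrow> f x = \<zero>\<^bsub>P\<^esub>"
  shows "(\<lambda>a. f (rep a)) \<in> lin_hom K Q P" "x \<in> carrier A \<Longrightarrow> f (rep (pr x)) = f x"
proof -
  interpret P: vec_space K P by fact
  have eq: "f (rep (pr x)) = f x" if x: "x \<in> carrier A" for x
  proof -
    have r: "rep (pr x) \<in> carrier A" "pr (rep (pr x)) = pr x" using rep[of "pr x"] x by simp_all
    then have "f (rep (pr x) \<ominus>\<^bsub>A\<^esub> x) = \<zero>\<^bsub>P\<^esub>" using pr_eq_iff[of "rep (pr x)" x] x J by simp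
    then have "f (rep (pr x)) \<ominus>\<^bsub>P\<^esub> f x = \<zero>\<^bsub>P\<^esub>"
      using lin_hom_minus[OF f k_algebra_vec_space[OF A.k_algebra_axioms] P r(1) x] by simp
    then show ?thesis using P.diff_eq_zero_iff lin_homD(1)[OF f] r x by simp
  qed
  then show "x \<in> carrier A \<Longrightarrow> f (rep (pr x)) = f x" .
  show "(\<lambda>a. f (rep a)) \<in> lin_hom K Q P"
  proof (rule lin_homI)
    fix a assume "a \<in> carrier Q"
    then obtain x where x: "a = pr x" "x \<in> carrier A" by (auto simp: Q_simps)
    then show "f (rep a) \<in> carrier P" using lin_homD(1)[OF f] by (simp add: eq)
    { fix c assume "c \<in> carrier K"
      then show "f (rep (c \<odot>\<^bsub>Q\<^esub> a)) = c \<odot>\<^bsub>P\<^esub> f (rep a)" using x by (simp add: Q_simps eq lin_homD[OF f]) }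
    fix b assume "b \<in> carrier Q"
    then obtain y where y: "b = pr y" "y \<in> carrier A" by (auto simp: Q_simps)
    then show "f (rep (a \<oplus>\<^bsub>Q\<^esub> b)) = f (rep a) \<oplus>\<^bsub>P\<^esub> f (rep b)" using x by (simp add: Q_simps eq lin_homD[OF f])
  qed
qed

text \<open>The first isomorphism theorem, for algebras and with an explicit map.\<close>

lemma lift_iso:
  assumes f: "f \<in> alg_hom K A P" and P: "k_algebra K P" and sur: "f ` carrier A = carrier P"
    and ker: "\<And>x. x \<in> carrier A \<Longrightarrow> f x = \<zero>\<^bsub>P\<^esub> \<longleftrightarrow> x \<in> J"
  shows "(\<lambda>a. f (rep a)) \<in> alg_iso K Q P"
proof -
  interpret P: k_algebra K P by fact
  note vP = k_algebra_vec_space[OF P]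
  have J0: "x \<in> J \<Longrightarrow> f x = \<zero>\<^bsub>P\<^esub>" for x using ker[of x] I.Icarr[of x] by simp
  note lift = lift_lin[OF alg_homD(1)[OF f] vP J0]
  have "(\<lambda>a. f (rep a)) \<in> alg_hom K Q P"
  proof (rule alg_homI[OF lift(1)])
    show "f (rep \<one>\<^bsub>Q\<^esub>) = \<one>\<^bsub>P\<^esub>" by (simp add: Q_simps lift(2) alg_homD[OF f])
    fix a b assume "a \<in> carrier Q" "b \<in> carrier Q"
    then obtain x y where "a = pr x" "x \<in> carrier A" "b = pr y" "y \<in> carrier A" by (auto simp: Q_simps)
    then show "f (rep (a \<otimes>\<^bsub>Q\<^esub> b)) = f (rep a) \<otimes>\<^bsub>P\<^esub> f (rep b)"
      by (simp add: Q_simps lift(2) alg_homD[OF f])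
  qed
  moreover have "bij_betw (\<lambda>a. f (rep a)) (carrier Q) (carrier P)"
    unfolding bij_betw_def
  proof
    show "inj_on (\<lambda>a. f (rep a)) (carrier Q)"
    proof (rule inj_onI)
      fix a b assume ab: "a \<in> carrier Q" "b \<in> carrier Q" "f (rep a) = f (rep b)"
      have "f (rep a \<ominus>\<^bsub>A\<^esub> rep b) = f (rep a) \<ominus>\<^bsub>P\<^esub> f (rep b)"
        by (rule lin_hom_minus[OF alg_homD(1)[OF f] k_algebra_vec_space[OF A.k_algebra_axioms] vP])
          (use ab rep in auto)
      also have "\<dots> = \<zero>\<^bsub>P\<^esub>"
        using vec_space.diff_eq_zero_iff[OF vP] ab alg_homD(2)[OF f] rep by simp
      finally have "rep a \<ominus>\<^bsub>A\<^esub> rep b \<in> J" using ker ab rep by simp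
      then have "pr (rep a) = pr (rep b)" using pr_eq_iff[OF rep(1)[OF ab(1)] rep(1)[OF ab(2)]] by blast
      then show "a = b" using rep ab by simp
    qed
    show "(\<lambda>a. f (rep a)) ` carrier Q = carrier P"
    proof
      show "(\<lambda>a. f (rep a)) ` carrier Q \<subseteq> carrier P" using rep alg_homD(2)[OF f] by auto
      show "carrier P \<subseteq> (\<lambda>a. f (rep a)) ` carrier Q"
      proof
        fix y assume "y \<in> carrier P"
        then obtain x where x: "x \<in> carrier A" "y = f x" using sur by blast
        then have "y = f (rep (pr x))" by (simp add: lift(2))
        then show "y \<in> (\<lambda>a. f (rep a)) ` carrier Q" using x by (intro image_eqI[of _ _ "pr x"]) auto
      qed
    qed
  qed
  ultimately show ?thesis by (simp add: alg_iso_iff)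
qed

end

context tgwc
begin

sublocale Q: quot_alg K "TGWC K n \<mu> R \<sigma> t" "canonical_ideal K n \<mu> R \<sigma> t"
  unfolding quot_alg_def using C_k_algebra radical_ideal by (simp add: canonical_ideal_eq)

abbreviation A where "A \<equiv> TGWA K n \<mu> R \<sigma> t"
abbreviation prA where "prA \<equiv> tgwa_proj K n \<mu> R \<sigma> t"

lemma A_eq: "A = Q.Q"
  by (simp add: TGWA_def)

lemma prA_eq: "prA = Q.pr"
  by (rule ext) (simp add: tgwa_proj_def)

lemma A_k_algebra: "k_algebra K A"
  unfolding A_eq by (rule Q.Q_k_algebra)

lemma prA_hom: "prA \<in> alg_hom K C A"
  unfolding A_eq prA_eq by (rule Q.pr_hom)

lemmas prAD [simp] = alg_homD(2-)[OF prA_hom]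

lemma prA_zero [simp]: "prA \<zero>\<^bsub>C\<^esub> = \<zero>\<^bsub>A\<^esub>"
  by (rule lin_hom_zero[OF alg_homD(1)[OF prA_hom] Ca.A_vec_space k_algebra_vec_space[OF A_k_algebra]])

lemma carrier_A: "carrier A = prA ` carrier C"
  unfolding A_eq prA_eq by (rule Q.Q_simps)

lemma prA_zero_iff: "x \<in> carrier C \<Longrightarrow> prA x = \<zero>\<^bsub>A\<^esub> \<longleftrightarrow> x \<in> radical"
  unfolding A_eq prA_eq using Q.pr_zero_iff by (simp add: canonical_ideal_eq)

definition repA where "repA = Q.rep"

lemma repA: "a \<in> carrier A \<Longrightarrow> repA a \<in> carrier C" "a \<in> carrier A \<Longrightarrow> prA (repA a) = a"
  using Q.rep unfolding A_eq prA_eq repA_def by auto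

lemma A_lift_lin:
  assumes "f \<in> lin_hom K C P" "vec_space K P" "\<And>x. x \<in> radical \<Longrightarrow> f x = \<zero>\<^bsub>P\<^esub>"
  shows "(\<lambda>a. f (repA a)) \<in> lin_hom K A P" "x \<in> carrier C \<Longrightarrow> f (repA (prA x)) = f x"
  using Q.lift_lin[OF assms(1,2)] assms(3) unfolding A_eq prA_eq repA_def canonical_ideal_eq by auto

sublocale Ar: tgw_rel K n \<mu> R \<sigma> t "TGWA K n \<mu> R \<sigma> t" "\<lambda>r. tgwa_proj K n \<mu> R \<sigma> t (tgwc_letter K n \<mu> R \<sigma> t (Coeff r))"
    "\<lambda>u. tgwa_proj K n \<mu> R \<sigma> t (tgwc_letter K n \<mu> R \<sigma> t (Gen u))"
proof (intro tgw_rel.intro tgw_datum_axioms A_k_algebra tgw_rel_axioms.intro)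
  show "(\<lambda>r. prA (ic r)) \<in> alg_hom K R A"
    by (intro alg_homI lin_hom_comp[OF alg_homD(1)[OF Cr.\<iota>_hom] alg_homD(1)[OF prA_hom]]) simp_all
next
  fix u r assume "u \<in> pm n" "r \<in> carrier R"
  then show "prA (L (Gen u)) \<otimes>\<^bsub>A\<^esub> prA (ic r) = prA (ic (sg u r)) \<otimes>\<^bsub>A\<^esub> prA (L (Gen u))"
    by (simp add: Cr.X_\<iota> flip: prAD(4))
next
  fix u assume "u \<in> pm n"
  then show "prA (L (Gen (- u))) \<otimes>\<^bsub>A\<^esub> prA (L (Gen u)) = prA (ic (tt u))"
    by (simp add: Cr.X_uminus flip: prAD(4))
next
  fix i j assume ij: "i \<in> {1..n}" "j \<in> {1..n}" "i \<noteq> j"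
  then show "prA (L (Gen (int i))) \<otimes>\<^bsub>A\<^esub> prA (L (Gen (- int j))) = \<mu> i j \<odot>\<^bsub>A\<^esub> (prA (L (Gen (- int j))) \<otimes>\<^bsub>A\<^esub> prA (L (Gen (int i))))"
    using \<mu>_nonzero[OF ij(1,2)] by (simp add: Cr.X_exchange del: prAD flip: prAD(3,4))
qed auto

abbreviation monA where "monA \<equiv> Ar.mon"

lemma prA_wX: "us \<in> words \<Longrightarrow> prA (Cr.wX us) = Ar.wX us"
  by (induction us rule: list.induct) simp_all

lemma prA_mon: "r \<in> carrier R \<Longrightarrow> us \<in> words \<Longrightarrow> prA (mon r us) = monA r us"
  by (simp add: Cr.mon_def Ar.mon_def prA_wX)

sublocale Aa: tgw_alg K n \<mu> R \<sigma> t "TGWA K n \<mu> R \<sigma> t" "\<lambda>r. tgwa_proj K n \<mu> R \<sigma> t (tgwc_letter K n \<mu> R \<sigma> t (Coeff r))"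
    "\<lambda>u. tgwa_proj K n \<mu> R \<sigma> t (tgwc_letter K n \<mu> R \<sigma> t (Gen u))"
proof
  show "carrier A \<subseteq> add_span A Ar.monoms"
  proof
    fix a assume "a \<in> carrier A"
    then obtain x where x: "x \<in> carrier C" "a = prA x" using carrier_A by blast
    have "prA x \<in> add_span A Ar.monoms"
      using x(1)
    proof (induction rule: Ca.monom_induct)
      case zero
      show ?case by (simp add: add_span.zero)
    next
      case (add r us x)
      have "monA r us \<in> Ar.monoms" using add unfolding Ar.monoms_def by blast
      then show ?case using add by (simp add: prA_mon add_span.add)
    qed
    then show "a \<in> add_span A Ar.monoms" by (simp add: x)
  qed
qed

definition pA0 where "pA0 a = prA (p0 (repA a))"

lemma pA0:
  shows pA0_lin: "pA0 \<in> lin_hom K A A" and pA0_pr: "x \<in> carrier C \<Longrightarrow> pA0 (prA x) = prA (p0 x)"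
proof -
  have "prA (p0 x) = \<zero>\<^bsub>A\<^esub>" if "x \<in> radical" for x
  proof -
    have "x \<in> carrier C" using that unfolding radical_def by blast
    then show ?thesis using radical_proj[OF that] prA_zero_iff by simp
  qed
  note * = A_lift_lin[OF lin_hom_comp[OF proj_lin alg_homD(1)[OF prA_hom]] Aa.A_vec_space this]
  have "(\<lambda>a. prA (p0 (repA a))) = pA0" by (simp add: fun_eq_iff pA0_def)
  then show "pA0 \<in> lin_hom K A A" using *(1) by simp
  show "x \<in> carrier C \<Longrightarrow> pA0 (prA x) = prA (p0 x)" unfolding pA0_def by (rule *(2))
qed

sublocale Ap: tgw_proj K n \<mu> R \<sigma> t "TGWA K n \<mu> R \<sigma> t" "\<lambda>r. tgwa_proj K n \<mu> R \<sigma> t (tgwc_letter K n \<mu> R \<sigma> t (Coeff r))"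
    "\<lambda>u. tgwa_proj K n \<mu> R \<sigma> t (tgwc_letter K n \<mu> R \<sigma> t (Gen u))" pA0
proof (unfold_locales)
  show "pA0 \<in> lin_hom K A A" by (rule pA0_lin)
  fix r us assume m: "r \<in> carrier R" "us \<in> words"
  show "pA0 (monA r us) = (if word_degree us = (\<lambda>_. 0) then monA r us else \<zero>\<^bsub>A\<^esub>)"
    using pA0_pr[of "mon r us"] m by (simp add: Cp.p0_mon prA_mon)
qed

text \<open>For \<open>x\<close> outside the canonical ideal some \<open>p0 (a x b)\<close> is a nonzero coefficient, and its image in the quotient is nonzero by
  consistency.\<close>

lemma A_nondeg:
  assumes con: "consistent_datum K n \<mu> R \<sigma> t"
  shows "tgw_nondeg K n \<mu> R \<sigma> t A (\<lambda>r. prA (ic r)) (\<lambda>u. prA (L (Gen u))) pA0"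
proof (unfold_locales)
  have inj: "r = s" if "prA (ic r) = prA (ic s)" "r \<in> carrier R" "s \<in> carrier R" for r s
    using con that unfolding consistent_datum_def inj_on_def by blast
  have 0: "r = \<zero>\<^bsub>R\<^esub>" if "prA (ic r) = \<zero>\<^bsub>A\<^esub>" "r \<in> carrier R" for r
    using inj[of r "\<zero>\<^bsub>R\<^esub>"] that by simp
  then show "r \<in> carrier R \<Longrightarrow> prA (ic r) = \<zero>\<^bsub>A\<^esub> \<Longrightarrow> r = \<zero>\<^bsub>R\<^esub>" for r by blast
  fix z assume z: "z \<in> carrier A" "z \<noteq> \<zero>\<^bsub>A\<^esub>"
  then obtain x where x: "x \<in> carrier C" "z = prA x" using carrier_A by blast
  then have "x \<notin> radical" using z prA_zero_iff by simp
  then obtain a b where ab: "a \<in> carrier C" "b \<in> carrier C" "p0 (a \<otimes>\<^bsub>C\<^esub> x \<otimes>\<^bsub>C\<^esub> b) \<noteq> \<zero>\<^bsub>C\<^esub>"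
    using x unfolding radical_def by blast
  have axb: "a \<otimes>\<^bsub>C\<^esub> x \<otimes>\<^bsub>C\<^esub> b \<in> carrier C" using ab x by simp
  obtain r where r: "r \<in> carrier R" "p0 (a \<otimes>\<^bsub>C\<^esub> x \<otimes>\<^bsub>C\<^esub> b) = ic r" using Cp.p0_coeff[OF axb] by blast
  have "pA0 (prA a \<otimes>\<^bsub>A\<^esub> z \<otimes>\<^bsub>A\<^esub> prA b) = prA (ic r)"
    using pA0_pr[OF axb] r x ab by simp
  moreover have "prA (ic r) \<noteq> \<zero>\<^bsub>A\<^esub>" using 0[of r] r ab(3) by auto
  ultimately show "\<exists>a\<in>carrier A. \<exists>b\<in>carrier A. pA0 (a \<otimes>\<^bsub>A\<^esub> z \<otimes>\<^bsub>A\<^esub> b) \<noteq> \<zero>\<^bsub>A\<^esub>"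
    using ab by (intro bexI[of _ "prA a"] bexI[of _ "prA b"]) simp_all
qed

end


section \<open>Recognizing a twisted generalized Weyl algebra\<close>

context tgw_nondeg
begin

text \<open>The universal property provides a surjection \<open>\<phi>\<close> from the construction that commutes with the projections onto degree \<open>0\<close>.
  Since \<open>\<phi>\<close> is injective on coefficients, \<open>\<phi> x = 0\<close> implies \<open>p0 (a x b) = 0\<close> for all \<open>a\<close> and \<open>b\<close>; the converse is the
  nondegeneracy. So the kernel is the canonical ideal.\<close>

lemma tgwa_iso:
  "consistent_datum K n \<mu> R \<sigma> t \<and> alg_iso K (TGWA K n \<mu> R \<sigma> t) A \<noteq> {}"
proof -
  interpret T: tgwc K n \<mu> R \<sigma> t by (simp add: tgwc_def tgw_datum_axioms)
  define g where "g a = (case a of Coeff r \<Rightarrow> \<iota> r | Gen u \<Rightarrow> X u)" for a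
  have "\<exists>\<phi>\<in>alg_hom K T.C A. \<forall>a\<in>T.gens. \<phi> (T.cls (AVar a)) = g a"
    unfolding TGWC_def
  proof (rule presented_algebra_hom[OF A.k_algebra_axioms])
    show "g a \<in> carrier A" if "a \<in> T.gens" for a
      using that by (cases a) (simp_all add: g_def T.gens_simps)
    fix p q assume "(p, q) \<in> T.rels"
    then show "alg_eval A g p = alg_eval A g q"
    proof cases
      case (plus_coeff i r) then show ?thesis using X_\<iota>[of "int i" r] by (simp add: g_def)
    next
      case (minus_coeff i r) then show ?thesis using X_\<iota>[of "- int i" r] by (simp add: g_def)
    next
      case (minus_plus i) then show ?thesis using X_uminus[of "int i"] by (simp add: g_def tt_def)
    next
      case (plus_minus i) then show ?thesis using X_uminus[of "- int i"] by (simp add: g_def tt_def)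
    next
      case (exchange i j) then show ?thesis using X_exchange[of i j] by (simp add: g_def)
    qed (simp_all add: g_def)
  qed
  then obtain \<phi> where \<phi>: "\<phi> \<in> alg_hom K T.C A" and \<phi>L: "\<And>a. a \<in> T.gens \<Longrightarrow> \<phi> (T.L a) = g a"
    by (auto simp: T.L_eq)
  note \<phi>D [simp] = alg_homD(2-)[OF \<phi>]
  have \<phi>0: "\<phi> \<zero>\<^bsub>T.C\<^esub> = \<zero>\<^bsub>A\<^esub>" by (rule lin_hom_zero[OF alg_homD(1)[OF \<phi>] T.Ca.A_vec_space A_vec_space])
  have \<phi>\<iota>: "\<phi> (T.ic r) = \<iota> r" if "r \<in> carrier R" for r
    using \<phi>L[of "Coeff r"] that by (simp add: T.gens_simps g_def)
  have "\<phi> (T.Cr.wX us) = wX us" if "us \<in> words" for us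
    using that by (induction us rule: list.induct) (simp_all add: \<phi>L T.gens_simps g_def)
  then have \<phi>mon: "\<phi> (T.mon r us) = mon r us" if "r \<in> carrier R" "us \<in> words" for r us
    using that by (simp add: T.Cr.mon_def mon_def \<phi>\<iota>)
  have sur: "\<phi> ` carrier T.C = carrier A"
  proof
    show "\<phi> ` carrier T.C \<subseteq> carrier A" by auto
    show "carrier A \<subseteq> \<phi> ` carrier T.C"
    proof
      fix a assume "a \<in> carrier A"
      then show "a \<in> \<phi> ` carrier T.C"
      proof (induction rule: monom_induct)
        case zero show ?case using \<phi>0 by (intro image_eqI[of _ _ "\<zero>\<^bsub>T.C\<^esub>"]) simp_all
      next
        case (add r us x)
        then obtain y where "y \<in> carrier T.C" "x = \<phi> y" by blast
        then show ?case using add \<phi>mon by (intro image_eqI[of _ _ "T.mon r us \<oplus>\<^bsub>T.C\<^esub> y"]) simp_all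
      qed
    qed
  qed
  have \<phi>p: "\<phi> (T.p0 x) = p0 (\<phi> x)" if "x \<in> carrier T.C" for x
  proof (rule T.Ca.linear_eq_monoms[OF _ _ A_vec_space _ that])
    show "(\<lambda>x. \<phi> (T.p0 x)) \<in> lin_hom K T.C A" by (rule lin_hom_comp[OF T.proj_lin alg_homD(1)[OF \<phi>]])
    show "(\<lambda>x. p0 (\<phi> x)) \<in> lin_hom K T.C A" by (rule lin_hom_comp[OF alg_homD(1)[OF \<phi>] p0_lin])
    fix r us assume "r \<in> carrier R" "us \<in> words"
    then show "\<phi> (T.p0 (T.mon r us)) = p0 (\<phi> (T.mon r us))"
      by (simp add: T.Cp.p0_mon \<phi>mon p0_mon \<phi>0)
  qed
  have ker: "\<phi> x = \<zero>\<^bsub>A\<^esub> \<longleftrightarrow> x \<in> T.radical" if x: "x \<in> carrier T.C" for x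
  proof
    assume z: "\<phi> x = \<zero>\<^bsub>A\<^esub>"
    have "T.p0 (a \<otimes>\<^bsub>T.C\<^esub> x \<otimes>\<^bsub>T.C\<^esub> b) = \<zero>\<^bsub>T.C\<^esub>" if ab: "a \<in> carrier T.C" "b \<in> carrier T.C" for a b
    proof -
      have axb: "a \<otimes>\<^bsub>T.C\<^esub> x \<otimes>\<^bsub>T.C\<^esub> b \<in> carrier T.C" using ab x by simp
      obtain r where r: "r \<in> carrier R" "T.p0 (a \<otimes>\<^bsub>T.C\<^esub> x \<otimes>\<^bsub>T.C\<^esub> b) = T.ic r"
        using T.Cp.p0_coeff[OF axb] by blast
      have "\<iota> r = p0 (\<phi> (a \<otimes>\<^bsub>T.C\<^esub> x \<otimes>\<^bsub>T.C\<^esub> b))" using \<phi>p[OF axb] r by (simp add: \<phi>\<iota> del: \<phi>D)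
      also have "\<dots> = \<zero>\<^bsub>A\<^esub>" using ab x z by simp
      finally have "r = \<zero>\<^bsub>R\<^esub>" using \<iota>_inj r by blast
      then show ?thesis using r by simp
    qed
    then show "x \<in> T.radical" unfolding T.radical_def using x by blast
  next
    assume xr: "x \<in> T.radical"
    show "\<phi> x = \<zero>\<^bsub>A\<^esub>"
    proof (rule ccontr)
      assume "\<phi> x \<noteq> \<zero>\<^bsub>A\<^esub>"
      then obtain a' b' where "a' \<in> carrier A" "b' \<in> carrier A" "p0 (a' \<otimes>\<^bsub>A\<^esub> \<phi> x \<otimes>\<^bsub>A\<^esub> b') \<noteq> \<zero>\<^bsub>A\<^esub>"
        using nondeg[of "\<phi> x"] x by auto
      moreover obtain a where a: "a \<in> carrier T.C" "a' = \<phi> a" using sur \<open>a' \<in> carrier A\<close> by blast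
      moreover obtain b where b: "b \<in> carrier T.C" "b' = \<phi> b" using sur \<open>b' \<in> carrier A\<close> by blast
      ultimately have "\<phi> (T.p0 (a \<otimes>\<^bsub>T.C\<^esub> x \<otimes>\<^bsub>T.C\<^esub> b)) \<noteq> \<zero>\<^bsub>A\<^esub>" using \<phi>p x by simp
      moreover have "T.p0 (a \<otimes>\<^bsub>T.C\<^esub> x \<otimes>\<^bsub>T.C\<^esub> b) = \<zero>\<^bsub>T.C\<^esub>" using xr a b unfolding T.radical_def by blast
      ultimately show False using \<phi>0 by simp
    qed
  qed
  have "consistent_datum K n \<mu> R \<sigma> t"
    unfolding consistent_datum_def
  proof (rule inj_onI)
    fix r s assume rs: "r \<in> carrier R" "s \<in> carrier R" "T.prA (T.ic r) = T.prA (T.ic s)"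
    then have "T.ic r \<ominus>\<^bsub>T.C\<^esub> T.ic s \<in> T.radical"
      using T.Q.pr_eq_iff[of "T.ic r" "T.ic s"] by (simp add: T.prA_eq T.canonical_ideal_eq)
    then have "\<phi> (T.ic r \<ominus>\<^bsub>T.C\<^esub> T.ic s) = \<zero>\<^bsub>A\<^esub>" using ker rs by simp
    then have "\<iota> (r \<ominus>\<^bsub>R\<^esub> s) = \<zero>\<^bsub>A\<^esub>"
      using rs lin_hom_minus[OF alg_homD(1)[OF \<phi>] T.Ca.A_vec_space A_vec_space, of "T.ic r" "T.ic s"]
        lin_hom_minus[OF alg_homD(1)[OF \<iota>_hom] k_algebra_vec_space[OF R.k_algebra_axioms] A_vec_space rs(1,2)]
      by (simp add: \<phi>\<iota>)
    then have "r \<ominus>\<^bsub>R\<^esub> s = \<zero>\<^bsub>R\<^esub>" using \<iota>_inj rs by simp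
    then show "r = s" using vec_space.diff_eq_zero_iff[OF k_algebra_vec_space[OF R.k_algebra_axioms]] rs by blast
  qed
  moreover have "(\<lambda>a. \<phi> (T.Q.rep a)) \<in> alg_iso K (TGWA K n \<mu> R \<sigma> t) A"
    unfolding T.A_eq
    by (rule T.Q.lift_iso[OF \<phi> A.k_algebra_axioms sur]) (simp add: ker T.canonical_ideal_eq)
  ultimately show ?thesis by blast
qed

end


section \<open>Scaling maps preserve the canonical ideal\<close>

context tgwc
begin

text \<open>The conditions on \<open>c\<close> and \<open>g\<close> make \<open>\<theta>\<close> a surjective endomorphism. It commutes with \<open>p0\<close>, so that
  \<open>p0 (\<theta> a \<theta> x \<theta> b) = \<theta> (p0 (a x b)) = 0\<close>.\<close>

lemma scaling_radical:
  assumes \<theta>: "\<theta> \<in> lin_hom K C C"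
    and mon: "\<And>r us. r \<in> carrier R \<Longrightarrow> us \<in> words \<Longrightarrow> \<theta> (mon r us) = c us \<odot>\<^bsub>C\<^esub> mon (g r) us"
    and c: "\<And>us. us \<in> words \<Longrightarrow> c us \<in> carrier K - {\<zero>\<^bsub>K\<^esub>}"
    and c_app: "\<And>us vs. us \<in> words \<Longrightarrow> vs \<in> words \<Longrightarrow> c (us @ vs) = c us \<otimes>\<^bsub>K\<^esub> c vs"
    and g: "g \<in> alg_iso K R R"
    and g_comm: "\<And>us r. us \<in> words \<Longrightarrow> r \<in> carrier R \<Longrightarrow> g (wsg us r) = wsg us (g r)"
    and x: "x \<in> radical"
  shows "\<theta> x \<in> radical"
proof -
  note \<theta>D [simp] = lin_homD[OF \<theta>]
  have gh: "g \<in> alg_hom K R R" "g ` carrier R = carrier R" using g by (auto simp: alg_iso_iff bij_betw_def)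
  note gD [simp] = alg_homD(2-)[OF gh(1)]
  have c': "c us \<in> carrier K" "c us \<noteq> \<zero>\<^bsub>K\<^esub>" if "us \<in> words" for us using c[OF that] by auto
  have mult1: "\<theta> (mon r us \<otimes>\<^bsub>C\<^esub> y) = \<theta> (mon r us) \<otimes>\<^bsub>C\<^esub> \<theta> y"
    if m: "r \<in> carrier R" "us \<in> words" and y: "y \<in> carrier C" for r us y
  proof (rule Ca.linear_eq_monoms[OF _ _ Ca.A_vec_space _ y])
    show "(\<lambda>y. \<theta> (mon r us \<otimes>\<^bsub>C\<^esub> y)) \<in> lin_hom K C C" using lin_hom_comp[OF Ca.mult_lin_right \<theta>] m by simp
    show "(\<lambda>y. \<theta> (mon r us) \<otimes>\<^bsub>C\<^esub> \<theta> y) \<in> lin_hom K C C" using lin_hom_comp[OF \<theta> Ca.mult_lin_right] m by simp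
    fix s vs assume s: "s \<in> carrier R" "vs \<in> words"
    have w: "us @ vs \<in> words" using m s by simp
    show "\<theta> (mon r us \<otimes>\<^bsub>C\<^esub> mon s vs) = \<theta> (mon r us) \<otimes>\<^bsub>C\<^esub> \<theta> (mon s vs)"
      using m s w c'[of us] c'[of vs]
      by (simp add: mon Cr.mon_mult g_comm c_app Ck.smult_mult_left Ck.smult_mult_right R.K.m_comm
          flip: Ck.smult_assoc1)
  qed
  have mult: "\<theta> (a \<otimes>\<^bsub>C\<^esub> y) = \<theta> a \<otimes>\<^bsub>C\<^esub> \<theta> y" if a: "a \<in> carrier C" and y: "y \<in> carrier C" for a y
  proof (rule Ca.linear_eq_monoms[OF _ _ Ca.A_vec_space _ a])
    show "(\<lambda>a. \<theta> (a \<otimes>\<^bsub>C\<^esub> y)) \<in> lin_hom K C C" using lin_hom_comp[OF Ca.mult_lin_left[OF y] \<theta>] .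
    show "(\<lambda>a. \<theta> a \<otimes>\<^bsub>C\<^esub> \<theta> y) \<in> lin_hom K C C" using lin_hom_comp[OF \<theta> Ca.mult_lin_left] y by simp
  qed (rule mult1[OF _ _ y])
  have p: "p0 (\<theta> y) = \<theta> (p0 y)" if y: "y \<in> carrier C" for y
  proof (rule Ca.linear_eq_monoms[OF _ _ Ca.A_vec_space _ y])
    show "(\<lambda>y. p0 (\<theta> y)) \<in> lin_hom K C C" by (rule lin_hom_comp[OF \<theta> proj_lin])
    show "(\<lambda>y. \<theta> (p0 y)) \<in> lin_hom K C C" by (rule lin_hom_comp[OF proj_lin \<theta>])
    fix r us assume m: "r \<in> carrier R" "us \<in> words"
    have z: "\<theta> \<zero>\<^bsub>C\<^esub> = \<zero>\<^bsub>C\<^esub>" by (rule lin_hom_zero[OF \<theta> Ca.A_vec_space Ca.A_vec_space])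
    show "p0 (\<theta> (mon r us)) = \<theta> (p0 (mon r us))"
      using m c'[of us] by (simp add: mon Cp.p0_mon z)
  qed
  have sur: "\<exists>a\<in>carrier C. \<theta> a = y" if "y \<in> carrier C" for y
    using that
  proof (induction rule: Ca.monom_induct)
    case zero
    show ?case using lin_hom_zero[OF \<theta> Ca.A_vec_space Ca.A_vec_space] by (intro bexI[of _ "\<zero>\<^bsub>C\<^esub>"]) simp_all
  next
    case (add r us y)
    then obtain a where a: "a \<in> carrier C" "\<theta> a = y" by blast
    obtain r' where r': "r' \<in> carrier R" "g r' = r" using gh(2) add(1) by (metis imageE)
    have ic: "inv\<^bsub>K\<^esub> (c us) \<in> carrier K" using c'[OF add(2)] by (simp add: R.K.field_Units)
    have "\<theta> (inv\<^bsub>K\<^esub> (c us) \<odot>\<^bsub>C\<^esub> mon r' us) = inv\<^bsub>K\<^esub> (c us) \<odot>\<^bsub>C\<^esub> (c us \<odot>\<^bsub>C\<^esub> mon r us)"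
      using r' add ic by (simp add: mon)
    also have "\<dots> = mon r us"
      using vec_space.smult_inv_cancel[OF Ca.A_vec_space c'[OF add(2)]] add by simp
    finally show ?case
      using a r' add ic by (intro bexI[of _ "inv\<^bsub>K\<^esub> (c us) \<odot>\<^bsub>C\<^esub> mon r' us \<oplus>\<^bsub>C\<^esub> a"]) simp_all
  qed
  have xC: "x \<in> carrier C" using x unfolding radical_def by blast
  have "p0 (a \<otimes>\<^bsub>C\<^esub> \<theta> x \<otimes>\<^bsub>C\<^esub> b) = \<zero>\<^bsub>C\<^esub>" if ab: "a \<in> carrier C" "b \<in> carrier C" for a b
  proof -
    obtain a' b' where ab': "a' \<in> carrier C" "\<theta> a' = a" "b' \<in> carrier C" "\<theta> b' = b" using sur ab by metis
    have "a \<otimes>\<^bsub>C\<^esub> \<theta> x \<otimes>\<^bsub>C\<^esub> b = \<theta> (a' \<otimes>\<^bsub>C\<^esub> x \<otimes>\<^bsub>C\<^esub> b')" using ab' xC by (simp add: mult)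
    moreover have "p0 (a' \<otimes>\<^bsub>C\<^esub> x \<otimes>\<^bsub>C\<^esub> b') = \<zero>\<^bsub>C\<^esub>" using x ab' unfolding radical_def by blast
    ultimately show ?thesis
      using ab' xC lin_hom_zero[OF \<theta> Ca.A_vec_space Ca.A_vec_space] by (simp add: p)
  qed
  then show ?thesis unfolding radical_def using xC by simp
qed

end


section \<open>The scalars of a pair of words\<close>

context field
begin

text \<open>Products over the positions of a list, the form in which the scalars of a pair of words are given.\<close>

definition list_prod :: "('i \<Rightarrow> 'a) \<Rightarrow> 'i list \<Rightarrow> 'a" where
  "list_prod f xs = (\<Otimes>i\<in>{..<length xs}. f (xs ! i))"

lemma list_prod_cong: "(\<And>x. x \<in> set xs \<Longrightarrow> f x = g x) \<Longrightarrow> (\<And>x. x \<in> set xs \<Longrightarrow> g x \<in> carrier R) \<Longrightarrow> list_prod f xs = list_prod g xs"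
  unfolding list_prod_def by (rule finprod_cong') auto

lemma list_prod_snoc:
  assumes "\<And>x. x \<in> set (xs @ [y]) \<Longrightarrow> f x \<in> carrier R"
  shows "list_prod f (xs @ [y]) = list_prod f xs \<otimes> f y"
proof -
  have 1: "(\<Otimes>i\<in>{..<length xs}. f ((xs @ [y]) ! i)) = list_prod f xs"
    unfolding list_prod_def by (rule finprod_cong') (use assms in \<open>auto simp: nth_append\<close>)
  have "list_prod f xs \<in> carrier R" unfolding list_prod_def by (rule finprod_closed) (use assms in auto)
  moreover have "list_prod f (xs @ [y]) = (\<Otimes>i\<in>insert (length xs) {..<length xs}. f ((xs @ [y]) ! i))"
    unfolding list_prod_def by (simp add: lessThan_Suc)
  moreover have "\<dots> = f y \<otimes> (\<Otimes>i\<in>{..<length xs}. f ((xs @ [y]) ! i))"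
    using assms by (subst finprod_insert) (auto simp: nth_append)
  ultimately show ?thesis using assms by (simp add: 1 m_comm)
qed

lemma list_prod_append:
  "(\<And>x. x \<in> set (xs @ ys) \<Longrightarrow> f x \<in> carrier R) \<Longrightarrow> list_prod f (xs @ ys) = list_prod f xs \<otimes> list_prod f ys \<and> list_prod f ys \<in> carrier R"
proof (induction ys rule: rev_induct)
  case Nil
  have "list_prod f xs \<in> carrier R" unfolding list_prod_def by (rule finprod_closed) (use Nil in auto)
  then show ?case by (simp add: list_prod_def)
next
  case (snoc y ys)
  then have c: "list_prod f (xs @ ys) = list_prod f xs \<otimes> list_prod f ys" "list_prod f ys \<in> carrier R" "f y \<in> carrier R" by auto
  have x: "list_prod f xs \<in> carrier R" unfolding list_prod_def by (rule finprod_closed) (use snoc.prems in auto)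
  show ?case
  proof -
    have "list_prod f (ys @ [y]) = list_prod f ys \<otimes> f y" by (rule list_prod_snoc) (use snoc.prems in auto)
    moreover have "list_prod f ((xs @ ys) @ [y]) = list_prod f (xs @ ys) \<otimes> f y"
      by (rule list_prod_snoc) (use snoc.prems in auto)
    ultimately show ?thesis using c x by (simp add: m_assoc)
  qed
qed

lemma list_prod_nonzero:
  "(\<And>x. x \<in> set xs \<Longrightarrow> f x \<in> carrier R - {\<zero>}) \<Longrightarrow> list_prod f xs \<in> carrier R - {\<zero>}"
proof (induction xs rule: rev_induct)
  case Nil then show ?case by (simp add: list_prod_def)
next
  case (snoc x xs)
  then have "list_prod f (xs @ [x]) = list_prod f xs \<otimes> f x" by (intro list_prod_snoc) auto
  then show ?case using snoc integral_iff by auto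
qed

lemma list_prod_mult:
  assumes "\<And>x. x \<in> set xs \<Longrightarrow> f x \<in> carrier R" "\<And>x. x \<in> set xs \<Longrightarrow> g x \<in> carrier R"
  shows "list_prod (\<lambda>x. f x \<otimes> g x) xs = list_prod f xs \<otimes> list_prod g xs"
  unfolding list_prod_def by (rule finprod_multf) (use assms in auto)

end

definition q_letters :: "(nat \<Rightarrow> nat \<Rightarrow> int \<Rightarrow> int \<Rightarrow> 'k) \<Rightarrow> int \<Rightarrow> int \<Rightarrow> 'k" where
  "q_letters q v u = q (nat \<bar>v\<bar>) (nat \<bar>u\<bar>) (sgn v) (sgn u)"

locale q_scalars = field K for K :: "'k ring" and m n :: nat and q :: "nat \<Rightarrow> nat \<Rightarrow> int \<Rightarrow> int \<Rightarrow> 'k" +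
  assumes q_nonzero: "\<lbrakk>i \<in> {1..n}; j \<in> {1..m}; a \<in> {1, -1}; b \<in> {1, -1}\<rbrakk> \<Longrightarrow> q i j a b \<in> carrier K - {\<zero>\<^bsub>K\<^esub>}"
begin

abbreviation qw where "qw \<equiv> q_words K q"

lemma q_letters_nonzero: "v \<in> pm n \<Longrightarrow> u \<in> pm m \<Longrightarrow> q_letters q v u \<in> carrier K - {\<zero>\<^bsub>K\<^esub>}"
  unfolding q_letters_def by (rule q_nonzero) (auto simp: pm_def sgn_if)

lemma qw_eq: "qw vs us = list_prod (\<lambda>v. list_prod (q_letters q v) us) vs"
  by (simp add: q_words_def list_prod_def q_letters_def)

lemma row_nonzero: "v \<in> pm n \<Longrightarrow> us \<in> lists (pm m) \<Longrightarrow> list_prod (q_letters q v) us \<in> carrier K - {\<zero>\<^bsub>K\<^esub>}"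
  by (rule list_prod_nonzero, rule q_letters_nonzero) auto

lemma qw_nonzero: "vs \<in> lists (pm n) \<Longrightarrow> us \<in> lists (pm m) \<Longrightarrow> qw vs us \<in> carrier K - {\<zero>\<^bsub>K\<^esub>}"
  unfolding qw_eq by (rule list_prod_nonzero, rule row_nonzero) auto

lemma qw_closed [simp]: "vs \<in> lists (pm n) \<Longrightarrow> us \<in> lists (pm m) \<Longrightarrow> qw vs us \<in> carrier K"
  using qw_nonzero[of vs us] by simp

lemma qw_Nil [simp]: "qw [] us = \<one>\<^bsub>K\<^esub>" "qw vs [] = \<one>\<^bsub>K\<^esub>"
  by (simp_all add: q_words_def)

text \<open>The scalar of a pair of words is multiplicative in each of the words; this is the source of the multiplicativity of \<open>\<tau>\<close>.\<close>

lemma qw_append_left: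
  assumes "vs \<in> lists (pm n)" "vs' \<in> lists (pm n)" "us \<in> lists (pm m)"
  shows "qw (vs @ vs') us = qw vs us \<otimes>\<^bsub>K\<^esub> qw vs' us"
proof -
  have "list_prod (q_letters q v) us \<in> carrier K" if "v \<in> set (vs @ vs')" for v
  proof -
    have "v \<in> pm n" using that assms by auto
    then show ?thesis using row_nonzero[OF _ assms(3)] by blast
  qed
  then show ?thesis unfolding qw_eq by (intro list_prod_append[THEN conjunct1])
qed

lemma qw_append_right:
  assumes "vs \<in> lists (pm n)" "us \<in> lists (pm m)" "us' \<in> lists (pm m)"
  shows "qw vs (us @ us') = qw vs us \<otimes>\<^bsub>K\<^esub> qw vs us'"
proof -
  have v: "v \<in> pm n" if "v \<in> set vs" for v using that assms by auto
  have c: "list_prod (q_letters q v) us \<in> carrier K" "list_prod (q_letters q v) us' \<in> carrier K" if "v \<in> set vs" for v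
    using row_nonzero[OF v[OF that]] assms by auto
  have "list_prod (q_letters q v) (us @ us') = list_prod (q_letters q v) us \<otimes>\<^bsub>K\<^esub> list_prod (q_letters q v) us'"
    if "v \<in> set vs" for v
  proof -
    have "q_letters q v u \<in> carrier K" if "u \<in> set (us @ us')" for u
      using q_letters_nonzero[OF v[OF \<open>v \<in> set vs\<close>], of u] that assms by auto
    then show ?thesis by (intro list_prod_append[THEN conjunct1])
  qed
  then have "qw vs (us @ us') = list_prod (\<lambda>v. list_prod (q_letters q v) us \<otimes>\<^bsub>K\<^esub> list_prod (q_letters q v) us') vs"
    unfolding qw_eq by (rule list_prod_cong) (use c in auto)
  then show ?thesis unfolding qw_eq using list_prod_mult[of vs] c by simp
qed

lemma qw_letters: "v \<in> pm n \<Longrightarrow> u \<in> pm m \<Longrightarrow> qw [v] [u] = q_letters q v u"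
  using q_letters_nonzero[of v u] by (simp add: q_words_def q_letters_def lessThan_Suc)

end


section \<open>Descending the twisting map\<close>

text \<open>The actions \<open>\<rho>R\<close> and \<open>\<sigma>S\<close> of each family on the coefficients of the other datum are parameters here; in the theorem they are
  restrictions of automorphisms of \<open>R \<otimes> S\<close>.\<close>

locale tgwa_pair = RC: tgwc K m \<mu> R \<sigma> t + SD: tgwc K n \<nu> S \<rho> h + qs: q_scalars K m n q
  for K :: "'k ring" and m n :: nat and \<mu> \<nu> :: "nat \<Rightarrow> nat \<Rightarrow> 'k"
    and R :: "('k, 'r) module" and S :: "('k, 's) module"
    and \<sigma> :: "nat \<Rightarrow> 'r \<Rightarrow> 'r" and t :: "nat \<Rightarrow> 'r" and \<rho> :: "nat \<Rightarrow> 's \<Rightarrow> 's" and h :: "nat \<Rightarrow> 's"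
    and q :: "nat \<Rightarrow> nat \<Rightarrow> int \<Rightarrow> int \<Rightarrow> 'k" +
  fixes \<rho>R :: "nat \<Rightarrow> 'r \<Rightarrow> 'r" and \<sigma>S :: "nat \<Rightarrow> 's \<Rightarrow> 's"
    and \<tau> :: "('k, ('k, 's) tgwc, ('k, 'r) tgwc) tens \<Rightarrow> ('k, ('k, 'r) tgwc, ('k, 's) tgwc) tens"
  assumes \<rho>R_auts: "commuting_automorphisms K n R \<rho>R" and \<sigma>S_auts: "commuting_automorphisms K m S \<sigma>S"
    and \<rho>R_\<sigma>: "\<lbrakk>i \<in> {1..n}; j \<in> {1..m}; r \<in> carrier R\<rbrakk> \<Longrightarrow> \<rho>R i (\<sigma> j r) = \<sigma> j (\<rho>R i r)"
    and \<sigma>S_\<rho>: "\<lbrakk>i \<in> {1..n}; j \<in> {1..m}; s \<in> carrier S\<rbrakk> \<Longrightarrow> \<sigma>S j (\<rho> i s) = \<rho> i (\<sigma>S j s)"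
    and nontrivial: "\<one>\<^bsub>R\<^esub> \<noteq> \<zero>\<^bsub>R\<^esub>" "\<one>\<^bsub>S\<^esub> \<noteq> \<zero>\<^bsub>S\<^esub>"
    and regular: "regular_datum m R t" "regular_datum n S h"
    and consistent: "consistent_datum K m \<mu> R \<sigma> t" "consistent_datum K n \<nu> S \<rho> h"
    and \<tau>_linear: "\<tau> \<in> lin_hom K (tensor K SD.C RC.C) (tensor K RC.C SD.C)"
    and \<tau>_monom: "\<lbrakk>r \<in> carrier R; s \<in> carrier S; us \<in> lists (pm m); vs \<in> lists (pm n)\<rbrakk> \<Longrightarrow>
      \<tau> (tens K SD.C RC.C (SD.mon s vs) (RC.mon r us)) = q_words K q vs us \<odot>\<^bsub>tensor K RC.C SD.C\<^esub>
        tens K RC.C SD.C (RC.mon (multi_aut_pow R n \<rho>R (word_degree vs) r) us)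
          (SD.mon (multi_aut_pow S m \<sigma>S (\<lambda>j. - word_degree us j) s) vs)"
begin

sublocale RR: aut_family K R n \<rho>R using \<rho>R_auts by unfold_locales
sublocale SS: aut_family K S m \<sigma>S using \<sigma>S_auts by unfold_locales

sublocale RA: tgw_nondeg K m \<mu> R \<sigma> t RC.A "\<lambda>r. RC.prA (RC.ic r)" "\<lambda>u. RC.prA (RC.L (Gen u))" RC.pA0
  by (rule RC.A_nondeg[OF consistent(1)])
sublocale SB: tgw_nondeg K n \<nu> S \<rho> h SD.A "\<lambda>r. SD.prA (SD.ic r)" "\<lambda>u. SD.prA (SD.L (Gen u))" SD.pA0
  by (rule SD.A_nondeg[OF consistent(2)])

sublocale CD: tensor_prod K RC.C SD.C ..
sublocale DC: tensor_prod K SD.C RC.C ..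
sublocale AB: tensor_prod K RC.A SD.A
  using RC.Aa.A_vec_space SD.Aa.A_vec_space by (simp add: tensor_prod_def)
sublocale BA: tensor_prod K SD.A RC.A
  using RC.Aa.A_vec_space SD.Aa.A_vec_space by (simp add: tensor_prod_def)

sublocale PP: tensor_prod_map K RC.C SD.C RC.A SD.A RC.prA SD.prA
  by unfold_locales (rule alg_homD(1)[OF RC.prA_hom] alg_homD(1)[OF SD.prA_hom])+

abbreviation wordsm where "wordsm \<equiv> lists (pm m)"
abbreviation wordsn where "wordsn \<equiv> lists (pm n)"

lemma \<tau>D: "y \<in> carrier SD.C \<Longrightarrow> (\<lambda>x. \<tau> (DC.tn y x)) \<in> lin_hom K RC.C CD.TT"
  "x \<in> carrier RC.C \<Longrightarrow> (\<lambda>y. \<tau> (DC.tn y x)) \<in> lin_hom K SD.C CD.TT"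
  by (rule lin_homI; simp add: lin_homD[OF \<tau>_linear] DC.tens_add_left DC.tens_add_right DC.tens_smult_left DC.tens_smult_right)+

lemma \<rho>R_wsg: "vs \<in> wordsn \<Longrightarrow> us \<in> wordsm \<Longrightarrow> r \<in> carrier R \<Longrightarrow> RR.wsg vs (RC.wsg us r) = RC.wsg us (RR.wsg vs r)"
proof (rule RC.wsg_comm_map)
  fix j r assume "vs \<in> wordsn" "j \<in> {1..m}" "r \<in> carrier R"
  then show "RR.wsg vs (\<sigma> j r) = \<sigma> j (RR.wsg vs r)"
    using RR.wsg_comm_map[where g = "\<sigma> j", of vs r] RC.\<sigma>_closed \<rho>R_\<sigma> by simp
qed simp_all

lemma \<sigma>S_wsg: "vs \<in> wordsn \<Longrightarrow> us \<in> wordsm \<Longrightarrow> s \<in> carrier S \<Longrightarrow> SS.wsg us (SD.wsg vs s) = SD.wsg vs (SS.wsg us s)"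
proof (rule SD.wsg_comm_map)
  fix j s assume "us \<in> wordsm" "j \<in> {1..n}" "s \<in> carrier S"
  then show "SS.wsg us (\<rho> j s) = \<rho> j (SS.wsg us s)"
    using SS.wsg_comm_map[where g = "\<rho> j", of us s] SD.\<sigma>_closed \<sigma>S_\<rho> by simp
qed simp_all

lemma multi_S: "us \<in> wordsm \<Longrightarrow> s \<in> carrier S \<Longrightarrow> multi_aut_pow S m \<sigma>S (\<lambda>j. - word_degree us j) s = SS.wsg (map uminus us) s"
  using SS.multi_aut_pow_word[of "map uminus us" s] by simp

lemma multi_R: "vs \<in> wordsn \<Longrightarrow> r \<in> carrier R \<Longrightarrow> multi_aut_pow R n \<rho>R (word_degree vs) r = RR.wsg vs r"
  by (rule RR.multi_aut_pow_word)

lemma regular_nonzero: "\<one>\<^bsub>S\<^esub> \<noteq> \<zero>\<^bsub>S\<^esub> \<Longrightarrow> regular_element S c \<Longrightarrow> c \<noteq> \<zero>\<^bsub>S\<^esub>"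
  "\<one>\<^bsub>R\<^esub> \<noteq> \<zero>\<^bsub>R\<^esub> \<Longrightarrow> regular_element R d \<Longrightarrow> d \<noteq> \<zero>\<^bsub>R\<^esub>"
  unfolding regular_element_def using RC.R.l_null[OF RC.R.one_closed] SD.R.l_null[OF SD.R.one_closed] by blast+

text \<open>By regularity \<open>Y\<^sub>v\<close> divides a regular coefficient, which is nonzero as coefficients embed. This is what allows the factor \<open>Y\<^sub>v\<close>
  to be split off from values of \<open>\<tau>\<close>.\<close>

lemma wX_nonzero_D: "vs \<in> wordsn \<Longrightarrow> SD.Cr.wX vs \<noteq> \<zero>\<^bsub>SD.C\<^esub>"
proof
  assume vs: "vs \<in> wordsn" and z: "SD.Cr.wX vs = \<zero>\<^bsub>SD.C\<^esub>"
  obtain c where c: "regular_element S c" "SD.Cr.wX vs \<otimes>\<^bsub>SD.C\<^esub> SD.Cr.wX (SD.Ca.star vs) = SD.ic c"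
    using SD.Ca.wX_star[OF regular(2) vs] by blast
  have cS: "c \<in> carrier S" using c by (simp add: regular_element_def)
  have "SD.ic c = \<zero>\<^bsub>SD.C\<^esub>" using c z vs by simp
  then have "SD.prA (SD.ic c) = \<zero>\<^bsub>SD.A\<^esub>" by simp
  then show False using SB.\<iota>_inj[OF cS] regular_nonzero(1)[OF nontrivial(2) c(1)] by blast
qed

lemma wX_nonzero_C: "us \<in> wordsm \<Longrightarrow> RC.Cr.wX us \<noteq> \<zero>\<^bsub>RC.C\<^esub>"
proof
  assume us: "us \<in> wordsm" and z: "RC.Cr.wX us = \<zero>\<^bsub>RC.C\<^esub>"
  obtain c where c: "regular_element R c" "RC.Cr.wX us \<otimes>\<^bsub>RC.C\<^esub> RC.Cr.wX (RC.Ca.star us) = RC.ic c"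
    using RC.Ca.wX_star[OF regular(1) us] by blast
  have cR: "c \<in> carrier R" using c by (simp add: regular_element_def)
  have "RC.ic c = \<zero>\<^bsub>RC.C\<^esub>" using c z us by simp
  then have "RC.prA (RC.ic c) = \<zero>\<^bsub>RC.A\<^esub>" by simp
  then show False using RA.\<iota>_inj[OF cR] regular_nonzero(2)[OF nontrivial(1) c(1)] by blast
qed

lemma wsg_one: "us \<in> wordsm \<Longrightarrow> SS.wsg us \<one>\<^bsub>S\<^esub> = \<one>\<^bsub>S\<^esub>" "vs \<in> wordsn \<Longrightarrow> RR.wsg vs \<one>\<^bsub>R\<^esub> = \<one>\<^bsub>R\<^esub>"
  "us \<in> wordsm \<Longrightarrow> RC.wsg us \<one>\<^bsub>R\<^esub> = \<one>\<^bsub>R\<^esub>" "vs \<in> wordsn \<Longrightarrow> SD.wsg vs \<one>\<^bsub>S\<^esub> = \<one>\<^bsub>S\<^esub>"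
  using alg_homD(6)[OF SS.wsg_hom] alg_homD(6)[OF RR.wsg_hom] alg_homD(6)[OF RC.wsg_hom] alg_homD(6)[OF SD.wsg_hom] by auto

lemma \<tau>_word: "\<lbrakk>r \<in> carrier R; s \<in> carrier S; us \<in> wordsm; vs \<in> wordsn\<rbrakk> \<Longrightarrow>
    \<tau> (DC.tn (SD.mon s vs) (RC.mon r us)) = qs.qw vs us \<odot>\<^bsub>CD.TT\<^esub>
      CD.tn (RC.mon (RR.wsg vs r) us) (SD.mon (SS.wsg (map uminus us) s) vs)"
  by (simp add: \<tau>_monom multi_R multi_S)

text \<open>On the component of degree \<open>\<alpha>\<close>, \<open>x \<mapsto> \<tau> (s Y\<^sub>v \<otimes> x)\<close> is \<open>x \<mapsto> \<theta> x \<otimes> \<sigma>\<^bsup>-\<alpha>\<^esup>(s) Y\<^sub>v\<close> for one map \<open>\<theta>\<close>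
  that rescales the monomials. A functional with value \<open>1\<close> at \<open>Y\<^sub>v\<close> recovers \<open>\<theta>\<close> from \<open>\<tau>\<close>, so \<open>\<theta>\<close> is well defined although
  monomials are not linearly independent.\<close>

lemma \<theta>_exists:
  assumes vs: "vs \<in> wordsn"
  shows "\<exists>\<theta>\<in>lin_hom K RC.C RC.C. \<forall>r\<in>carrier R. \<forall>us\<in>wordsm. \<theta> (RC.mon r us) = qs.qw vs us \<odot>\<^bsub>RC.C\<^esub> RC.mon (RR.wsg vs r) us"
proof -
  obtain f where f: "f \<in> dual K SD.C" "f (SD.Cr.wX vs) = \<one>\<^bsub>K\<^esub>"
    using vec_space.functional_exists_nonzero[OF SD.Ca.A_vec_space _ wX_nonzero_D[OF vs]] vs by auto
  let ?\<theta> = "\<lambda>x. CD.contract_right f (\<tau> (DC.tn (SD.Cr.wX vs) x))"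
  have wc: "SD.Cr.wX vs \<in> carrier SD.C" using vs by simp
  note cr = CD.contract_right_linear[OF f(1)]
  have "?\<theta> \<in> lin_hom K RC.C RC.C" by (rule lin_hom_comp[OF \<tau>D(1)[OF wc] cr])
  moreover have "?\<theta> (RC.mon r us) = qs.qw vs us \<odot>\<^bsub>RC.C\<^esub> RC.mon (RR.wsg vs r) us" if "r \<in> carrier R" "us \<in> wordsm" for r us
    using \<tau>_word[of r "\<one>\<^bsub>S\<^esub>" us vs] that vs f(2)
    by (simp add: SD.Cr.mon_one wsg_one lin_homD[OF cr] CD.contract_right_tens[OF f(1)])
  ultimately show ?thesis by (intro bexI[of _ ?\<theta>]) simp_all
qed

lemma \<psi>_exists:
  assumes us: "us \<in> wordsm"
  shows "\<exists>\<psi>\<in>lin_hom K SD.C SD.C. \<forall>s\<in>carrier S. \<forall>vs\<in>wordsn. \<psi> (SD.mon s vs) = qs.qw vs us \<odot>\<^bsub>SD.C\<^esub> SD.mon (SS.wsg (map uminus us) s) vs"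
proof -
  obtain f where f: "f \<in> dual K RC.C" "f (RC.Cr.wX us) = \<one>\<^bsub>K\<^esub>"
    using vec_space.functional_exists_nonzero[OF RC.Ca.A_vec_space _ wX_nonzero_C[OF us]] us by auto
  let ?\<psi> = "\<lambda>y. CD.contract_left f (\<tau> (DC.tn y (RC.Cr.wX us)))"
  have wc: "RC.Cr.wX us \<in> carrier RC.C" using us by simp
  note cl = CD.contract_left_linear[OF f(1)]
  have "?\<psi> \<in> lin_hom K SD.C SD.C" by (rule lin_hom_comp[OF \<tau>D(2)[OF wc] cl])
  moreover have "?\<psi> (SD.mon s vs) = qs.qw vs us \<odot>\<^bsub>SD.C\<^esub> SD.mon (SS.wsg (map uminus us) s) vs" if "s \<in> carrier S" "vs \<in> wordsn" for s vs
    using \<tau>_word[of "\<one>\<^bsub>R\<^esub>" s us vs] that us f(2)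
    by (simp add: RC.Cr.mon_one wsg_one lin_homD[OF cl] CD.contract_left_tens[OF f(1)])
  ultimately show ?thesis by (intro bexI[of _ ?\<psi>]) simp_all
qed

abbreviation Pr where "Pr \<equiv> tensor_map K RC.A SD.A RC.prA SD.prA"

text \<open>The composite \<open>D \<times> C \<rightarrow> C \<otimes> D \<rightarrow> A \<otimes> B\<close>, which has to vanish on the canonical ideals in either argument.\<close>

definition G where "G y x = Pr (\<tau> (DC.tn y x))"

lemma G_linear: "y \<in> carrier SD.C \<Longrightarrow> G y \<in> lin_hom K RC.C AB.TT"
  "x \<in> carrier RC.C \<Longrightarrow> (\<lambda>y. G y x) \<in> lin_hom K SD.C AB.TT"
proof -
  assume y: "y \<in> carrier SD.C"
  have "(\<lambda>x. G y x) \<in> lin_hom K RC.C AB.TT"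
    unfolding G_def by (rule lin_hom_comp[OF \<tau>D(1)[OF y] PP.map_linear])
  then show "G y \<in> lin_hom K RC.C AB.TT" by simp
next
  assume x: "x \<in> carrier RC.C"
  show "(\<lambda>y. G y x) \<in> lin_hom K SD.C AB.TT"
    unfolding G_def by (rule lin_hom_comp[OF \<tau>D(2)[OF x] PP.map_linear])
qed

text \<open>The canonical ideal is graded, so \<open>x\<close> may be replaced by one of its components, where the second factor of
  \<open>\<tau> (s Y\<^sub>v \<otimes> x)\<close> is constant and the first is \<open>\<theta> x\<close>, an element of the canonical ideal.\<close>

lemma G_radical_right_monom:
  assumes s: "s \<in> carrier S" and vs: "vs \<in> wordsn" and x: "x \<in> RC.radical"
  shows "G (SD.mon s vs) x = \<zero>\<^bsub>AB.TT\<^esub>"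
proof -
  have yc: "SD.mon s vs \<in> carrier SD.C" using s vs by simp
  have xc: "x \<in> carrier RC.C" using x unfolding RC.radical_def by blast
  obtain \<theta> where \<theta>: "\<theta> \<in> lin_hom K RC.C RC.C"
    and \<theta>m: "\<And>r us. r \<in> carrier R \<Longrightarrow> us \<in> wordsm \<Longrightarrow> \<theta> (RC.mon r us) = qs.qw vs us \<odot>\<^bsub>RC.C\<^esub> RC.mon (RR.wsg vs r) us"
    using \<theta>_exists[OF vs] by blast
  have \<theta>rad: "\<theta> z \<in> RC.radical" if "z \<in> RC.radical" for z
  proof (rule RC.scaling_radical[where \<theta> = \<theta> and c = "\<lambda>us. qs.qw vs us" and g = "RR.wsg vs"])
    show "RR.wsg vs \<in> alg_iso K R R" by (rule RR.wsg_iso[OF vs])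
  qed (use \<theta> \<theta>m vs qs.qw_nonzero[OF vs] qs.qw_append_right[OF vs] \<rho>R_wsg[OF vs] that in \<open>blast+\<close>)
  show ?thesis
  proof (rule RC.linear_zero_by_components[OF G_linear(1)[OF yc] AB.TT_vec_space xc])
    fix \<alpha>
    \<comment> \<open>The power of \<open>\<sigma>\<close> with exponent \<open>\<alpha>\<close> is the action of a word if \<open>\<alpha>\<close> is the degree of one; otherwise the component is zero.\<close>
    show "G (SD.mon s vs) (RC.proj \<alpha> x) = \<zero>\<^bsub>AB.TT\<^esub>"
    proof (cases "\<exists>us\<in>wordsm. word_degree us = \<alpha>")
      case True
      let ?s = "multi_aut_pow S m \<sigma>S (\<lambda>j. - \<alpha> j) s"
      obtain us0 where us0: "us0 \<in> wordsm" "word_degree us0 = \<alpha>" using True by blast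
      have sc: "?s \<in> carrier S" using multi_S[OF us0(1) s] us0 s by auto
      have mc: "SD.mon ?s vs \<in> carrier SD.C" using sc vs by simp
      have L: "(\<lambda>x. CD.tn x (SD.mon ?s vs)) \<in> lin_hom K RC.C CD.TT"
        using mc by (intro lin_homI) (simp_all add: CD.tens_add_left CD.tens_smult_left)
      have *: "\<tau> (DC.tn (SD.mon s vs) (RC.proj \<alpha> x)) = CD.tn (\<theta> (RC.proj \<alpha> x)) (SD.mon ?s vs)"
      proof (rule RC.Ca.linear_eq_monoms[where f = "\<lambda>z. \<tau> (DC.tn (SD.mon s vs) (RC.proj \<alpha> z))", OF _ _ CD.TT_vec_space _ xc])
        show "(\<lambda>z. \<tau> (DC.tn (SD.mon s vs) (RC.proj \<alpha> z))) \<in> lin_hom K RC.C CD.TT"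
          by (rule lin_hom_comp[OF RC.proj_lin \<tau>D(1)[OF yc]])
        show "(\<lambda>z. CD.tn (\<theta> (RC.proj \<alpha> z)) (SD.mon ?s vs)) \<in> lin_hom K RC.C CD.TT"
          by (rule lin_hom_comp[OF lin_hom_comp[OF RC.proj_lin \<theta>] L])
        fix r us assume m: "r \<in> carrier R" "us \<in> wordsm"
        have "\<theta> \<zero>\<^bsub>RC.C\<^esub> = \<zero>\<^bsub>RC.C\<^esub>" by (rule lin_hom_zero[OF \<theta> RC.Ca.A_vec_space RC.Ca.A_vec_space])
        moreover have "\<tau> \<zero>\<^bsub>DC.TT\<^esub> = \<zero>\<^bsub>CD.TT\<^esub>"
          by (rule lin_hom_zero[OF \<tau>_linear DC.TT_vec_space CD.TT_vec_space])
        ultimately show "\<tau> (DC.tn (SD.mon s vs) (RC.proj \<alpha> (RC.mon r us))) = CD.tn (\<theta> (RC.proj \<alpha> (RC.mon r us))) (SD.mon ?s vs)"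
          using m yc mc s vs
          by (cases "\<alpha> = word_degree us") (simp_all add: RC.proj_mon \<theta>m \<tau>_monom multi_R CD.tens_smult_left)
      qed
      have t: "\<theta> (RC.proj \<alpha> x) \<in> RC.radical" by (rule \<theta>rad[OF RC.radical_proj[OF x]])
      then have tc: "\<theta> (RC.proj \<alpha> x) \<in> carrier RC.C" unfolding RC.radical_def by blast
      have "RC.prA (\<theta> (RC.proj \<alpha> x)) = \<zero>\<^bsub>RC.A\<^esub>" using RC.prA_zero_iff[OF tc] t by blast
      then show ?thesis using tc sc vs by (simp add: G_def * PP.map_tens)
    next
      case False
      have "RC.proj \<alpha> z = \<zero>\<^bsub>RC.C\<^esub>" if "z \<in> carrier RC.C" for z
        using that
      proof (induction rule: RC.Ca.monom_induct)
        case (add r us z)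
        then show ?case using False by (auto simp: RC.proj_mon)
      qed simp
      then show ?thesis
        using xc lin_hom_zero[OF G_linear(1)[OF yc] RC.Ca.A_vec_space AB.TT_vec_space] by simp
    qed
  qed
qed

text \<open>The mirror image of the previous argument: on the component of degree \<open>\<beta>\<close>, \<open>\<tau> (y \<otimes> r X\<^sub>u) = \<rho>\<^sup>\<beta>(r) X\<^sub>u \<otimes> \<psi> y\<close>.\<close>

lemma G_radical_left_monom:
  assumes r: "r \<in> carrier R" and us: "us \<in> wordsm" and y: "y \<in> SD.radical"
  shows "G y (RC.mon r us) = \<zero>\<^bsub>AB.TT\<^esub>"
proof -
  have mc: "RC.mon r us \<in> carrier RC.C" using r us by simp
  have yc: "y \<in> carrier SD.C" using y unfolding SD.radical_def by blast
  have us': "map uminus us \<in> wordsm" using us by simp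
  obtain \<psi> where \<psi>: "\<psi> \<in> lin_hom K SD.C SD.C"
    and \<psi>m: "\<And>s vs. s \<in> carrier S \<Longrightarrow> vs \<in> wordsn \<Longrightarrow> \<psi> (SD.mon s vs) = qs.qw vs us \<odot>\<^bsub>SD.C\<^esub> SD.mon (SS.wsg (map uminus us) s) vs"
    using \<psi>_exists[OF us] by blast
  have \<psi>rad: "\<psi> z \<in> SD.radical" if "z \<in> SD.radical" for z
  proof (rule SD.scaling_radical[where \<theta> = \<psi> and c = "\<lambda>vs. qs.qw vs us" and g = "SS.wsg (map uminus us)"])
    show "SS.wsg (map uminus us) \<in> alg_iso K S S" by (rule SS.wsg_iso[OF us'])
  qed (use \<psi> \<psi>m us qs.qw_nonzero[OF _ us] qs.qw_append_left[OF _ _ us] \<sigma>S_wsg[OF _ us'] that in \<open>blast+\<close>)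
  show ?thesis
  proof (rule SD.linear_zero_by_components[where f = "\<lambda>y. G y (RC.mon r us)", OF G_linear(2)[OF mc] AB.TT_vec_space yc])
    fix \<beta>
    show "G (SD.proj \<beta> y) (RC.mon r us) = \<zero>\<^bsub>AB.TT\<^esub>"
    proof (cases "\<exists>vs\<in>wordsn. word_degree vs = \<beta>")
      case True
      let ?r = "multi_aut_pow R n \<rho>R \<beta> r"
      obtain vs0 where vs0: "vs0 \<in> wordsn" "word_degree vs0 = \<beta>" using True by blast
      have rc: "?r \<in> carrier R" using multi_R[OF vs0(1) r] vs0 r by auto
      have rm: "RC.mon ?r us \<in> carrier RC.C" using rc us by simp
      have L: "(\<lambda>x. CD.tn (RC.mon ?r us) x) \<in> lin_hom K SD.C CD.TT"
        using rm by (intro lin_homI) (simp_all add: CD.tens_add_right CD.tens_smult_right)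
      have *: "\<tau> (DC.tn (SD.proj \<beta> y) (RC.mon r us)) = CD.tn (RC.mon ?r us) (\<psi> (SD.proj \<beta> y))"
      proof (rule SD.Ca.linear_eq_monoms[where f = "\<lambda>z. \<tau> (DC.tn (SD.proj \<beta> z) (RC.mon r us))", OF _ _ CD.TT_vec_space _ yc])
        show "(\<lambda>z. \<tau> (DC.tn (SD.proj \<beta> z) (RC.mon r us))) \<in> lin_hom K SD.C CD.TT"
          by (rule lin_hom_comp[OF SD.proj_lin \<tau>D(2)[OF mc]])
        show "(\<lambda>z. CD.tn (RC.mon ?r us) (\<psi> (SD.proj \<beta> z))) \<in> lin_hom K SD.C CD.TT"
          by (rule lin_hom_comp[OF lin_hom_comp[OF SD.proj_lin \<psi>] L])
        fix s vs assume m: "s \<in> carrier S" "vs \<in> wordsn"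
        have "\<psi> \<zero>\<^bsub>SD.C\<^esub> = \<zero>\<^bsub>SD.C\<^esub>" by (rule lin_hom_zero[OF \<psi> SD.Ca.A_vec_space SD.Ca.A_vec_space])
        moreover have "\<tau> \<zero>\<^bsub>DC.TT\<^esub> = \<zero>\<^bsub>CD.TT\<^esub>"
          by (rule lin_hom_zero[OF \<tau>_linear DC.TT_vec_space CD.TT_vec_space])
        ultimately show "\<tau> (DC.tn (SD.proj \<beta> (SD.mon s vs)) (RC.mon r us)) = CD.tn (RC.mon ?r us) (\<psi> (SD.proj \<beta> (SD.mon s vs)))"
          using m rm mc r us
          by (cases "\<beta> = word_degree vs") (simp_all add: SD.proj_mon \<psi>m \<tau>_monom multi_S CD.tens_smult_right)
      qed
      have t: "\<psi> (SD.proj \<beta> y) \<in> SD.radical" by (rule \<psi>rad[OF SD.radical_proj[OF y]])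
      then have tc: "\<psi> (SD.proj \<beta> y) \<in> carrier SD.C" unfolding SD.radical_def by blast
      have "SD.prA (\<psi> (SD.proj \<beta> y)) = \<zero>\<^bsub>SD.A\<^esub>" using SD.prA_zero_iff[OF tc] t by blast
      then show ?thesis using tc rc us by (simp add: G_def * PP.map_tens)
    next
      case False
      have "SD.proj \<beta> z = \<zero>\<^bsub>SD.C\<^esub>" if "z \<in> carrier SD.C" for z
        using that
      proof (induction rule: SD.Ca.monom_induct)
        case (add s vs z)
        then show ?case using False by (auto simp: SD.proj_mon)
      qed simp
      then show ?thesis
        using yc lin_hom_zero[OF G_linear(2)[OF mc] SD.Ca.A_vec_space AB.TT_vec_space] by simp
    qed
  qed
qed

lemma G_radical:
  "y \<in> carrier SD.C \<Longrightarrow> x \<in> RC.radical \<Longrightarrow> G y x = \<zero>\<^bsub>AB.TT\<^esub>"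
  "x \<in> carrier RC.C \<Longrightarrow> y \<in> SD.radical \<Longrightarrow> G y x = \<zero>\<^bsub>AB.TT\<^esub>"
proof -
  assume y: "y \<in> carrier SD.C" and x: "x \<in> RC.radical"
  have xc: "x \<in> carrier RC.C" using x unfolding RC.radical_def by blast
  show "G y x = \<zero>\<^bsub>AB.TT\<^esub>"
    by (rule SD.Ca.linear_eq_monoms[OF G_linear(2)[OF xc] zero_lin_hom[OF AB.TT_vec_space] AB.TT_vec_space G_radical_right_monom[OF _ _ x] y])
next
  assume x: "x \<in> carrier RC.C" and y: "y \<in> SD.radical"
  have yc: "y \<in> carrier SD.C" using y unfolding SD.radical_def by blast
  show "G y x = \<zero>\<^bsub>AB.TT\<^esub>"
    by (rule RC.Ca.linear_eq_monoms[OF G_linear(1)[OF yc] zero_lin_hom[OF AB.TT_vec_space] AB.TT_vec_space G_radical_left_monom[OF _ _ y] x])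
qed

definition \<tau>' where "\<tau>' = tensor_lift AB.TT (\<lambda>b a. G (SD.repA b) (RC.repA a))"

lemma G_rep_right: "y \<in> carrier SD.C \<Longrightarrow> (\<lambda>a. G y (RC.repA a)) \<in> lin_hom K RC.A AB.TT"
  "y \<in> carrier SD.C \<Longrightarrow> x \<in> carrier RC.C \<Longrightarrow> G y (RC.repA (RC.prA x)) = G y x"
  by (rule RC.A_lift_lin[OF G_linear(1) AB.TT_vec_space G_radical(1)]; assumption)+

lemma G_rep_left: "x \<in> carrier RC.C \<Longrightarrow> (\<lambda>b. G (SD.repA b) x) \<in> lin_hom K SD.A AB.TT"
  "x \<in> carrier RC.C \<Longrightarrow> y \<in> carrier SD.C \<Longrightarrow> G (SD.repA (SD.prA y)) x = G y x"
  by (rule SD.A_lift_lin[where f = "\<lambda>y. G y x", OF G_linear(2) AB.TT_vec_space G_radical(2)]; assumption)+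

lemma G_rep_bilinear: "bilinear_map K SD.A RC.A AB.TT (\<lambda>b a. G (SD.repA b) (RC.repA a))"
  unfolding bilinear_map_def using G_rep_right(1) G_rep_left(1) RC.repA(1) SD.repA(1) by simp

lemma \<tau>'_linear: "\<tau>' \<in> lin_hom K BA.TT AB.TT"
  unfolding \<tau>'_def by (rule BA.tensor_lift_linear[OF AB.TT_vec_space G_rep_bilinear])

lemma \<tau>'_tens:
  assumes "y \<in> carrier SD.C" "x \<in> carrier RC.C"
  shows "\<tau>' (BA.tn (SD.prA y) (RC.prA x)) = G y x"
proof -
  have "\<tau>' (BA.tn (SD.prA y) (RC.prA x)) = G (SD.repA (SD.prA y)) (RC.repA (RC.prA x))"
    unfolding \<tau>'_def using assms by (intro BA.tensor_lift_tens[OF AB.TT_vec_space G_rep_bilinear]) simp_all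
  also have "\<dots> = G y x"
    using assms G_rep_left(2)[OF RC.repA(1), of "RC.prA x" y] G_rep_right(2) by simp
  finally show ?thesis .
qed

lemma \<tau>'_map: "z \<in> carrier DC.TT \<Longrightarrow> \<tau>' (tensor_map K SD.A RC.A SD.prA RC.prA z) = Pr (\<tau> z)"
proof -
  assume z: "z \<in> carrier DC.TT"
  interpret QQ: tensor_prod_map K SD.C RC.C SD.A RC.A SD.prA RC.prA
    by unfold_locales (rule alg_homD(1)[OF RC.prA_hom] alg_homD(1)[OF SD.prA_hom])+
  show ?thesis
    by (rule DC.tensor_linear_eqI[OF lin_hom_comp[OF QQ.map_linear \<tau>'_linear] lin_hom_comp[OF \<tau>_linear PP.map_linear] AB.TT_vec_space _ z])
      (simp add: QQ.map_tens \<tau>'_tens G_def)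
qed

abbreviation mA where "mA \<equiv> RC.monA"
abbreviation mB where "mB \<equiv> SD.monA"

lemma \<tau>'_mon: "\<lbrakk>r \<in> carrier R; s \<in> carrier S; us \<in> wordsm; vs \<in> wordsn\<rbrakk> \<Longrightarrow>
    \<tau>' (BA.tn (mB s vs) (mA r us)) = qs.qw vs us \<odot>\<^bsub>AB.TT\<^esub>
      AB.tn (mA (RR.wsg vs r) us) (mB (SS.wsg (map uminus us) s) vs)"
  using \<tau>'_tens[of "SD.mon s vs" "RC.mon r us"]
  by (simp add: RC.prA_mon SD.prA_mon G_def \<tau>_word lin_homD[OF PP.map_linear] PP.map_tens)

lemma twisting: "twisting_map K RC.A SD.A \<tau>'"
  unfolding twisting_map_def
proof (intro conjI ballI \<tau>'_linear)
  fix b assume b: "b \<in> carrier SD.A"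
  show "\<tau>' (BA.tn b \<one>\<^bsub>RC.A\<^esub>) = AB.tn \<one>\<^bsub>RC.A\<^esub> b"
  proof (rule SD.Aa.linear_eq_monoms[OF _ _ AB.TT_vec_space _ b])
    show "(\<lambda>b. \<tau>' (BA.tn b \<one>\<^bsub>RC.A\<^esub>)) \<in> lin_hom K SD.A AB.TT"
      by (rule lin_homI) (simp_all add: lin_homD[OF \<tau>'_linear] BA.tens_add_left BA.tens_smult_left)
    show "(\<lambda>b. AB.tn \<one>\<^bsub>RC.A\<^esub> b) \<in> lin_hom K SD.A AB.TT"
      by (rule lin_homI) (simp_all add: AB.tens_add_right AB.tens_smult_right)
    fix s vs assume "s \<in> carrier S" "vs \<in> wordsn"
    then show "\<tau>' (BA.tn (mB s vs) \<one>\<^bsub>RC.A\<^esub>) = AB.tn \<one>\<^bsub>RC.A\<^esub> (mB s vs)"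
      using \<tau>'_mon[of "\<one>\<^bsub>R\<^esub>" s "[]" vs] by (simp add: wsg_one)
  qed
next
  fix a assume a: "a \<in> carrier RC.A"
  show "\<tau>' (BA.tn \<one>\<^bsub>SD.A\<^esub> a) = AB.tn a \<one>\<^bsub>SD.A\<^esub>"
  proof (rule RC.Aa.linear_eq_monoms[OF _ _ AB.TT_vec_space _ a])
    show "(\<lambda>a. \<tau>' (BA.tn \<one>\<^bsub>SD.A\<^esub> a)) \<in> lin_hom K RC.A AB.TT"
      by (rule lin_homI) (simp_all add: lin_homD[OF \<tau>'_linear] BA.tens_add_right BA.tens_smult_right)
    show "(\<lambda>a. AB.tn a \<one>\<^bsub>SD.A\<^esub>) \<in> lin_hom K RC.A AB.TT"
      by (rule lin_homI) (simp_all add: AB.tens_add_left AB.tens_smult_left)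
    fix r us assume m: "r \<in> carrier R" "us \<in> wordsm"
    then have "map uminus us \<in> wordsm" by simp
    with m show "\<tau>' (BA.tn \<one>\<^bsub>SD.A\<^esub> (mA r us)) = AB.tn (mA r us) \<one>\<^bsub>SD.A\<^esub>"
      using \<tau>'_mon[of r "\<one>\<^bsub>S\<^esub>" us "[]"] by (simp add: wsg_one)
  qed
qed

sublocale tw: twist K RC.A SD.A \<tau>'
  by (intro twist.intro twist_axioms.intro RC.A_k_algebra SD.A_k_algebra \<tau>'_linear)

abbreviation W where "W \<equiv> twisted_tensor K RC.A SD.A \<tau>'"

definition M :: "'r \<Rightarrow> int list \<Rightarrow> 's \<Rightarrow> int list \<Rightarrow> _" where
  "M r us s vs = AB.tn (mA r us) (mB s vs)"

lemma M_closed [simp]: "\<lbrakk>r \<in> carrier R; s \<in> carrier S; us \<in> wordsm; vs \<in> wordsn\<rbrakk> \<Longrightarrow> M r us s vs \<in> carrier AB.TT"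
  by (simp add: M_def)

text \<open>The multiplication table of \<open>A \<otimes>\<^sub>\<tau> B\<close>: moving \<open>s Y\<^sub>v\<close> past \<open>r' X\<^bsub>u'\<^esub>\<close> produces the scalar, a power of \<open>\<rho>\<close> on \<open>r'\<close>, and
  an inverse power of \<open>\<sigma>\<close> on \<open>s\<close>.\<close>

lemma M_mult:
  assumes "r \<in> carrier R" "s \<in> carrier S" "us \<in> wordsm" "vs \<in> wordsn"
    "r' \<in> carrier R" "s' \<in> carrier S" "us' \<in> wordsm" "vs' \<in> wordsn"
  shows "M r us s vs \<otimes>\<^bsub>W\<^esub> M r' us' s' vs' = qs.qw vs us' \<odot>\<^bsub>W\<^esub>
    M (r \<otimes>\<^bsub>R\<^esub> RC.wsg us (RR.wsg vs r')) (us @ us') (SS.wsg (map uminus us') s \<otimes>\<^bsub>S\<^esub> SD.wsg vs s') (vs @ vs')"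
  using assms
  by (simp add: M_def tw.mult_tens \<tau>'_mon tw.sandwichD tw.sandwich_tens RC.Ar.mon_mult SD.Ar.mon_mult)

text \<open>Associativity on monomials: both bracketings produce the same words; the coefficients agree because the actions commute, and
  the scalars because \<open>q\<close> is multiplicative in each word.\<close>

lemma W_k_algebra: "k_algebra K W"
proof (rule tw.twisted_k_algebra[OF twisting RC.Ar.monoms_carrier RC.Aa.span_monoms SD.Ar.monoms_carrier SD.Aa.span_monoms])
  fix a b a' b' a'' b''
  assume "a \<in> RC.Ar.monoms" "b \<in> SD.Ar.monoms" "a' \<in> RC.Ar.monoms" "b' \<in> SD.Ar.monoms" "a'' \<in> RC.Ar.monoms" "b'' \<in> SD.Ar.monoms"
  then obtain r us s vs r' us' s' vs' r'' us'' s'' vs'' where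
    e: "a = mA r us" "b = mB s vs" "a' = mA r' us'" "b' = mB s' vs'" "a'' = mA r'' us''" "b'' = mB s'' vs''"
    and c: "r \<in> carrier R" "s \<in> carrier S" "us \<in> wordsm" "vs \<in> wordsn"
    "r' \<in> carrier R" "s' \<in> carrier S" "us' \<in> wordsm" "vs' \<in> wordsn"
    "r'' \<in> carrier R" "s'' \<in> carrier S" "us'' \<in> wordsm" "vs'' \<in> wordsn"
    unfolding RC.Ar.monoms_def SD.Ar.monoms_def by (elim CollectE exE conjE) simp
  note L = lin_homD[OF tw.mult_linear_left] and Rr = lin_homD[OF tw.mult_linear_right]
  have neg: "map uminus us' \<in> wordsm" "map uminus us'' \<in> wordsm" using c by simp_all
  note h = alg_homD(5)[OF RC.wsg_hom] alg_homD(5)[OF RR.wsg_hom] alg_homD(5)[OF SS.wsg_hom] alg_homD(5)[OF SD.wsg_hom]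
  let ?r = "r \<otimes>\<^bsub>R\<^esub> RC.wsg us (RR.wsg vs r') \<otimes>\<^bsub>R\<^esub> RC.wsg us (RC.wsg us' (RR.wsg vs (RR.wsg vs' r'')))"
  let ?s = "SS.wsg (map uminus us'') (SS.wsg (map uminus us') s) \<otimes>\<^bsub>S\<^esub> SD.wsg vs (SS.wsg (map uminus us'') s') \<otimes>\<^bsub>S\<^esub> SD.wsg vs (SD.wsg vs' s'')"
  have sc: "SS.wsg (map uminus us') (SS.wsg (map uminus us'') s) = SS.wsg (map uminus us'') (SS.wsg (map uminus us') s)"
    using SS.wsg_comm_map[where g = "SS.wsg (map uminus us')", of "map uminus us''" s]
      SS.wsg_comm_map[where us = "map uminus us'" and r = "x" and g = "\<sigma>S i" for i x] neg c SS.\<sigma>_comm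
      SS.sg_closed[of "int i" for i] by simp
  have 1: "M r us s vs \<otimes>\<^bsub>W\<^esub> M r' us' s' vs' \<otimes>\<^bsub>W\<^esub> M r'' us'' s'' vs''
      = (qs.qw vs us' \<otimes>\<^bsub>K\<^esub> (qs.qw vs us'' \<otimes>\<^bsub>K\<^esub> qs.qw vs' us'')) \<odot>\<^bsub>W\<^esub> M ?r (us @ us' @ us'') ?s (vs @ vs' @ vs'')"
    using c neg
    by (simp add: M_mult[unfolded tw.W_simps] L Rr qs.qw_append_left h \<sigma>S_wsg AB.T.smult_assoc1)
  have 2: "M r us s vs \<otimes>\<^bsub>W\<^esub> (M r' us' s' vs' \<otimes>\<^bsub>W\<^esub> M r'' us'' s'' vs'')
      = (qs.qw vs' us'' \<otimes>\<^bsub>K\<^esub> (qs.qw vs us' \<otimes>\<^bsub>K\<^esub> qs.qw vs us'')) \<odot>\<^bsub>W\<^esub> M ?r (us @ us' @ us'') ?s (vs @ vs' @ vs'')"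
    using c neg
    by (simp add: M_mult[unfolded tw.W_simps] L Rr qs.qw_append_right h \<rho>R_wsg AB.T.smult_assoc1 RC.R.m_assoc SD.R.m_assoc sc)
  show "tw.tn a b \<otimes>\<^bsub>W\<^esub> tw.tn a' b' \<otimes>\<^bsub>W\<^esub> tw.tn a'' b'' = tw.tn a b \<otimes>\<^bsub>W\<^esub> (tw.tn a' b' \<otimes>\<^bsub>W\<^esub> tw.tn a'' b'')"
    using 1 2 c unfolding e by (simp only: M_def RC.R.K.m_ac qs.qw_closed)
qed

end


section \<open>The twisted tensor product over the combined datum\<close>

context tensor_alg
begin

lemma mult_lin:
  assumes "z \<in> carrier (tensor K A B)"
  shows "(\<lambda>x. x \<otimes>\<^bsub>tensor_algebra K A B\<^esub> z) \<in> lin_hom K (tensor K A B) (tensor K A B)"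
    "(\<lambda>x. z \<otimes>\<^bsub>tensor_algebra K A B\<^esub> x) \<in> lin_hom K (tensor K A B) (tensor K A B)"
  unfolding tensor_algebra_eq using tw.mult_linear_left[OF assms] tw.mult_linear_right[OF assms] by simp_all

lemma tens_center:
  assumes "a \<in> center A" "b \<in> center B"
  shows "tens K A B a b \<in> center (tensor_algebra K A B)"
proof -
  have ab: "a \<in> carrier A" "b \<in> carrier B"
    and c: "\<And>x. x \<in> carrier A \<Longrightarrow> a \<otimes>\<^bsub>A\<^esub> x = x \<otimes>\<^bsub>A\<^esub> a" "\<And>y. y \<in> carrier B \<Longrightarrow> b \<otimes>\<^bsub>B\<^esub> y = y \<otimes>\<^bsub>B\<^esub> b"
    using assms by (auto simp: center_def)
  have "tens K A B a b \<otimes>\<^bsub>tensor_algebra K A B\<^esub> z = z \<otimes>\<^bsub>tensor_algebra K A B\<^esub> tens K A B a b"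
    if z: "z \<in> carrier (tensor K A B)" for z
    by (rule tw.AB.tensor_linear_eqI[OF mult_lin(2) mult_lin(1) tw.AB.TT_vec_space _ z])
      (use ab c in \<open>simp_all add: tens_mult\<close>)
  then show ?thesis using ab by (simp add: center_def)
qed

text \<open>Multiplication by \<open>a \<otimes> b\<close> is the tensor product of two injective maps.\<close>

lemma tens_regular:
  assumes a: "regular_element A a" and b: "regular_element B b"
  shows "regular_element (tensor_algebra K A B) (tens K A B a b)"
proof -
  have ab: "a \<in> carrier A" "b \<in> carrier B" using a b by (simp_all add: regular_element_def)
  have a0: "x = \<zero>\<^bsub>A\<^esub>" if "x \<in> carrier A" "a \<otimes>\<^bsub>A\<^esub> x = \<zero>\<^bsub>A\<^esub> \<or> x \<otimes>\<^bsub>A\<^esub> a = \<zero>\<^bsub>A\<^esub>" for x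
    using a that unfolding regular_element_def by blast
  have b0: "x = \<zero>\<^bsub>B\<^esub>" if "x \<in> carrier B" "b \<otimes>\<^bsub>B\<^esub> x = \<zero>\<^bsub>B\<^esub> \<or> x \<otimes>\<^bsub>B\<^esub> b = \<zero>\<^bsub>B\<^esub>" for x
    using b that unfolding regular_element_def by blast
  interpret l: tensor_prod_map K A B A B "\<lambda>x. a \<otimes>\<^bsub>A\<^esub> x" "\<lambda>y. b \<otimes>\<^bsub>B\<^esub> y"
    by unfold_locales
      (rule lin_homI; simp add: ab A.r_distr B.r_distr A.smult_mult_right B.smult_mult_right)+
  interpret r: tensor_prod_map K A B A B "\<lambda>x. x \<otimes>\<^bsub>A\<^esub> a" "\<lambda>y. y \<otimes>\<^bsub>B\<^esub> b"
    by unfold_locales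
      (rule lin_homI; simp add: ab A.l_distr B.l_distr A.smult_mult_left B.smult_mult_left)+
  have t: "tens K A B a b \<in> carrier (tensor K A B)" using ab by simp
  have "z = \<zero>\<^bsub>tensor K A B\<^esub>" if z: "z \<in> carrier (tensor K A B)" "tens K A B a b \<otimes>\<^bsub>tensor_algebra K A B\<^esub> z = \<zero>\<^bsub>tensor K A B\<^esub>" for z
  proof (rule l.map_nonzero[OF _ _ z(1)])
    have "tensor_map K A B (\<lambda>x. a \<otimes>\<^bsub>A\<^esub> x) (\<lambda>y. b \<otimes>\<^bsub>B\<^esub> y) z = tens K A B a b \<otimes>\<^bsub>tensor_algebra K A B\<^esub> z"
      by (rule tw.AB.tensor_linear_eqI[OF l.map_linear mult_lin(2)[OF t] tw.AB.TT_vec_space _ z(1)])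
        (use ab in \<open>simp_all add: tens_mult l.map_tens\<close>)
    then show "tensor_map K A B (\<lambda>x. a \<otimes>\<^bsub>A\<^esub> x) (\<lambda>y. b \<otimes>\<^bsub>B\<^esub> y) z = \<zero>\<^bsub>tensor K A B\<^esub>" using z(2) by simp
  qed (use a0 b0 in blast)+
  moreover have "z = \<zero>\<^bsub>tensor K A B\<^esub>" if z: "z \<in> carrier (tensor K A B)" "z \<otimes>\<^bsub>tensor_algebra K A B\<^esub> tens K A B a b = \<zero>\<^bsub>tensor K A B\<^esub>" for z
  proof (rule r.map_nonzero[OF _ _ z(1)])
    have "tensor_map K A B (\<lambda>x. x \<otimes>\<^bsub>A\<^esub> a) (\<lambda>y. y \<otimes>\<^bsub>B\<^esub> b) z = z \<otimes>\<^bsub>tensor_algebra K A B\<^esub> tens K A B a b"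
      by (rule tw.AB.tensor_linear_eqI[OF r.map_linear mult_lin(1)[OF t] tw.AB.TT_vec_space _ z(1)])
        (use ab in \<open>simp_all add: tens_mult r.map_tens\<close>)
    then show "tensor_map K A B (\<lambda>x. x \<otimes>\<^bsub>A\<^esub> a) (\<lambda>y. y \<otimes>\<^bsub>B\<^esub> b) z = \<zero>\<^bsub>tensor K A B\<^esub>" using z(2) by simp
  qed (use a0 b0 in blast)+
  ultimately show ?thesis using t unfolding regular_element_def TA_simps by blast
qed

lemma one_regular: "regular_element A \<one>\<^bsub>A\<^esub>" "regular_element B \<one>\<^bsub>B\<^esub>"
  by (simp_all add: regular_element_def)

lemma one_center: "\<one>\<^bsub>A\<^esub> \<in> center A" "\<one>\<^bsub>B\<^esub> \<in> center B"
  by (simp_all add: center_def)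

end

text \<open>Letters and words of the combined algebra: \<open>u\<close> with \<open>\<bar>u\<bar> \<le> m\<close> belongs to the first factor, \<open>shift m v\<close> is
  the letter \<open>v\<close> of the second factor.\<close>

definition shift :: "nat \<Rightarrow> int \<Rightarrow> int" where "shift m v = v + sgn v * int m"

definition left_letters :: "nat \<Rightarrow> int list \<Rightarrow> int list" where
  "left_letters m ws = filter (\<lambda>u. \<bar>u\<bar> \<le> int m) ws"

definition right_letters :: "nat \<Rightarrow> int list \<Rightarrow> int list" where
  "right_letters m ws = map (\<lambda>u. u - sgn u * int m) (filter (\<lambda>u. \<bar>u\<bar> > int m) ws)"

lemma shift_pm: "v \<in> pm n \<Longrightarrow> shift m v \<in> pm (m + n) \<and> shift m v \<notin> pm m \<and> shift m v - sgn (shift m v) * int m = v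
    \<and> \<not> \<bar>shift m v\<bar> \<le> int m \<and> shift m (- v) = - shift m v"
  by (auto simp: shift_def pm_def sgn_if abs_if split: if_splits)

lemma shift_int: "i \<in> {1..n} \<Longrightarrow> shift m (int i) = int (m + i)" "i \<in> {1..n} \<Longrightarrow> shift m (- int i) = - int (m + i)"
  by (auto simp: shift_def sgn_if)

lemma pm_mono: "u \<in> pm m \<Longrightarrow> u \<in> pm (m + n)"
  by (auto simp: pm_def)

lemma pm_split:
  assumes "u \<in> pm (m + n)"
  obtains "u \<in> pm m" | v where "v \<in> pm n" "u = shift m v"
proof (cases "\<bar>u\<bar> \<le> int m")
  case True
  then show ?thesis using assms that(1) by (auto simp: pm_def)
next
  case False
  then have "u - sgn u * int m \<in> pm n" "u = shift m (u - sgn u * int m)"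
    using assms by (auto simp: shift_def pm_def sgn_if abs_if split: if_splits)
  then show ?thesis using that(2) by blast
qed

lemma letters_Cons:
  "u \<in> pm m \<Longrightarrow> left_letters m (u # ws) = u # left_letters m ws \<and> right_letters m (u # ws) = right_letters m ws"
  "v \<in> pm n \<Longrightarrow> left_letters m (shift m v # ws) = left_letters m ws \<and> right_letters m (shift m v # ws) = v # right_letters m ws"
  using shift_pm[of v n m] by (auto simp: left_letters_def right_letters_def pm_def)

lemma letters_words:
  "ws \<in> lists (pm (m + n)) \<Longrightarrow> left_letters m ws \<in> lists (pm m) \<and> right_letters m ws \<in> lists (pm n)"
proof (induction ws rule: list.induct)
  case Nil then show ?case by (simp add: left_letters_def right_letters_def)
next
  case (Cons u ws)
  then have u: "u \<in> pm (m + n)" and IH: "left_letters m ws \<in> lists (pm m)" "right_letters m ws \<in> lists (pm n)" by simp_all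
  show ?case by (rule pm_split[OF u]) (use IH letters_Cons in simp_all)
qed

text \<open>Degrees are functions on all of \<open>\<nat>\<close>. The values of the two parts outside their ranges, above \<open>m\<close> and at \<open>0\<close>, are included, so
  that the degree of a word vanishes only if both parts do.\<close>

lemma letters_degree:
  "ws \<in> lists (pm (m + n)) \<Longrightarrow> (\<forall>i. word_degree ws i = (if i \<le> m then word_degree (left_letters m ws) i else word_degree (right_letters m ws) (i - m)))
    \<and> (\<forall>i>m. word_degree (left_letters m ws) i = 0) \<and> word_degree (right_letters m ws) 0 = 0"
proof (induction ws rule: list.induct)
  case Nil then show ?case by (simp add: left_letters_def right_letters_def)
next
  case (Cons u ws)
  then have u: "u \<in> pm (m + n)" by simp
  show ?case
  proof (rule pm_split[OF u])
    assume um: "u \<in> pm m"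
    then have "gen_degree u i = 0" if "i > m" for i using that by (auto simp: gen_degree_def pm_def)
    then show ?thesis using Cons letters_Cons(1)[OF um, of ws] by simp
  next
    fix v assume v: "v \<in> pm n" "u = shift m v"
    have "gen_degree u i = 0" if "i \<le> m" for i
      using v that by (auto simp: gen_degree_def pm_def shift_def sgn_if abs_if)
    moreover have "gen_degree u i = gen_degree v (i - m)" if "\<not> i \<le> m" for i
      using v that by (auto simp: gen_degree_def pm_def shift_def sgn_if abs_if)
    moreover have "gen_degree v 0 = 0" using v by (auto simp: gen_degree_def pm_def)
    ultimately show ?thesis using Cons letters_Cons(2)[OF v(1), of m ws] v(2) by simp
  qed
qed

lemma letters_degree_zero:
  assumes "ws \<in> lists (pm (m + n))"
  shows "word_degree ws = (\<lambda>_. 0) \<longleftrightarrow> word_degree (left_letters m ws) = (\<lambda>_. 0) \<and> word_degree (right_letters m ws) = (\<lambda>_. 0)"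
proof -
  note d = letters_degree[OF assms]
  show ?thesis
  proof
    assume z: "word_degree ws = (\<lambda>_. 0)"
    have "word_degree (left_letters m ws) i = 0" for i
    proof (cases "i \<le> m")
      case True
      then have "word_degree ws i = word_degree (left_letters m ws) i" using d by simp
      then show ?thesis using z by simp
    qed (use d in simp)
    moreover have "word_degree (right_letters m ws) i = 0" for i
    proof (cases "i = 0")
      case False
      then have "word_degree ws (i + m) = word_degree (right_letters m ws) i" using d by simp
      then show ?thesis using z by simp
    qed (use d in simp)
    ultimately show "word_degree (left_letters m ws) = (\<lambda>_. 0) \<and> word_degree (right_letters m ws) = (\<lambda>_. 0)" by blast
  qed (use d in \<open>simp add: fun_eq_iff\<close>)
qed

text \<open>Regularity and the automorphisms of \<open>R \<otimes> S\<close> are enough for the combined datum itself; the twisting map enters later, so that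
  this part also covers zero rings.\<close>

locale combined_datum = RC: tgwc K m \<mu> R \<sigma> t + SD: tgwc K n \<nu> S \<rho> h + qs: q_scalars K m n q
  for K :: "'k ring" and m n :: nat and \<mu> \<nu> :: "nat \<Rightarrow> nat \<Rightarrow> 'k"
    and R :: "('k, 'r) module" and S :: "('k, 's) module"
    and \<sigma> :: "nat \<Rightarrow> 'r \<Rightarrow> 'r" and t :: "nat \<Rightarrow> 'r" and \<rho> :: "nat \<Rightarrow> 's \<Rightarrow> 's" and h :: "nat \<Rightarrow> 's"
    and q :: "nat \<Rightarrow> nat \<Rightarrow> int \<Rightarrow> int \<Rightarrow> 'k" +
  fixes \<sigma>T \<rho>T :: "nat \<Rightarrow> ('k, 'r, 's) tens \<Rightarrow> ('k, 'r, 's) tens"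
  assumes T_auts: "commuting_automorphisms K (m + n) (tensor_algebra K R S) (comb_aut m \<sigma>T \<rho>T)"
    and regular_data: "regular_datum m R t" "regular_datum n S h"
begin

sublocale TA: tensor_alg K R S ..

abbreviation T where "T \<equiv> tensor_algebra K R S"
abbreviation tT where "tT \<equiv> tens K R S"
abbreviation \<pi> where "\<pi> \<equiv> comb_aut m \<sigma>T \<rho>T"
abbreviation w where "w \<equiv> comb_elem K R S m t h"
abbreviation \<eta> where "\<eta> \<equiv> comb_matrix K m \<mu> \<nu> q"

lemma t_w: "i \<in> {1..m} \<Longrightarrow> w i = tT (t i) \<one>\<^bsub>S\<^esub>" "i \<in> {1..n} \<Longrightarrow> w (m + i) = tT \<one>\<^bsub>R\<^esub> (h i)"
  by (auto simp: comb_elem_def)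

lemma index_split:
  assumes "i \<in> {1..m + n}"
  obtains "i \<in> {1..m}" | i' where "i' \<in> {1..n}" "i = m + i'"
proof (cases "i \<le> m")
  case False
  then show ?thesis using assms that(2)[of "i - m"] by simp
qed (use assms that in auto)

lemma T_tgwd: "tgwd K (m + n) T \<pi> w"
  unfolding tgwd_def
proof (intro conjI ballI TA.tensor_k_algebra T_auts)
  fix i assume "i \<in> {1..m + n}"
  then show "w i \<in> center T"
    by (rule index_split)
      (use RC.datum SD.datum in \<open>auto simp: t_w tgwd_def intro!: TA.tens_center TA.one_center\<close>)
qed

lemma T_regular: "regular_datum (m + n) T w"
  unfolding regular_datum_def
proof
  fix i assume "i \<in> {1..m + n}"
  then show "regular_element T (w i)"
    by (rule index_split)
      (use regular_data in \<open>auto simp: t_w regular_datum_def intro!: TA.tens_regular TA.one_regular\<close>)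
qed

lemma \<eta>_nonzero: "nonzero_matrix K (m + n) \<eta>"
  unfolding nonzero_matrix_def
proof (intro ballI)
  fix i j assume i: "i \<in> {1..m + n}" and j: "j \<in> {1..m + n}"
  have inv: "inv\<^bsub>K\<^esub> c \<in> carrier K - {\<zero>\<^bsub>K\<^esub>}" if "c \<in> carrier K - {\<zero>\<^bsub>K\<^esub>}" for c
    using that RC.R.K.Units_inv_Units[of c] by (simp add: RC.R.K.field_Units)
  show "\<eta> i j \<in> carrier K - {\<zero>\<^bsub>K\<^esub>}"
    using i
  proof (rule index_split)
    assume i: "i \<in> {1..m}"
    show ?thesis using j
      by (rule index_split)
        (use i RC.\<mu>_nonzero[of i j] inv[OF qs.q_nonzero[of _ i "-1" 1]] in \<open>auto simp: comb_matrix_def\<close>)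
  next
    fix i' assume i: "i' \<in> {1..n}" "i = m + i'"
    show ?thesis using j
      by (rule index_split)
        (use i SD.\<mu>_nonzero qs.q_nonzero[of i' j 1 "-1"] in \<open>auto simp: comb_matrix_def\<close>)
  qed
qed

sublocale TD: tgw_datum K "m + n" \<eta> T \<pi> w
  by (intro tgw_datum.intro tgw_datum_axioms.intro TA.tensor_k_algebra T_tgwd \<eta>_nonzero)

end

text \<open>Here the actions on the factors and the automorphisms of \<open>R \<otimes> S\<close> are tied together: the latter act factorwise.\<close>

locale tgwa_pair_T = tgwa_pair K m n \<mu> \<nu> R S \<sigma> t \<rho> h q \<rho>R \<sigma>S \<tau> + combined_datum K m n \<mu> \<nu> R S \<sigma> t \<rho> h q \<sigma>T \<rho>T
  for K :: "'k ring" and m n :: nat and \<mu> \<nu> :: "nat \<Rightarrow> nat \<Rightarrow> 'k"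
    and R :: "('k, 'r) module" and S :: "('k, 's) module"
    and \<sigma> :: "nat \<Rightarrow> 'r \<Rightarrow> 'r" and t :: "nat \<Rightarrow> 'r" and \<rho> :: "nat \<Rightarrow> 's \<Rightarrow> 's" and h :: "nat \<Rightarrow> 's"
    and q :: "nat \<Rightarrow> nat \<Rightarrow> int \<Rightarrow> int \<Rightarrow> 'k" and \<rho>R :: "nat \<Rightarrow> 'r \<Rightarrow> 'r" and \<sigma>S :: "nat \<Rightarrow> 's \<Rightarrow> 's"
    and \<tau> :: "('k, ('k, 's) tgwc, ('k, 'r) tgwc) tens \<Rightarrow> ('k, ('k, 'r) tgwc, ('k, 's) tgwc) tens"
    and \<sigma>T \<rho>T :: "nat \<Rightarrow> ('k, 'r, 's) tens \<Rightarrow> ('k, 'r, 's) tens" +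
  assumes \<sigma>T_tens: "\<lbrakk>j \<in> {1..m}; r \<in> carrier R; s \<in> carrier S\<rbrakk> \<Longrightarrow> \<sigma>T j (tens K R S r s) = tens K R S (\<sigma> j r) (\<sigma>S j s)"
    and \<rho>T_tens: "\<lbrakk>i \<in> {1..n}; r \<in> carrier R; s \<in> carrier S\<rbrakk> \<Longrightarrow> \<rho>T i (tens K R S r s) = tens K R S (\<rho>R i r) (\<rho> i s)"
begin

lemma sgT_left: "u \<in> pm m \<Longrightarrow> r \<in> carrier R \<Longrightarrow> s \<in> carrier S \<Longrightarrow> TD.sg u (tT r s) = tT (RC.sg u r) (SS.sg u s)"
proof (elim pm_cases)
  assume c: "r \<in> carrier R" "s \<in> carrier S"
  fix i assume i: "i \<in> {1..m}"
  have pos: "TD.sg (int i) (tT r s) = tT (\<sigma> i r) (\<sigma>S i s)" if "r \<in> carrier R" "s \<in> carrier S" for r s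
    using i \<sigma>T_tens[OF i that] by (simp add: comb_aut_def)
  { assume "u = int i" then show ?thesis using pos[OF c] i by simp }
  assume u: "u = - int i"
  have d: "RC.sg (- int i) r \<in> carrier R" "SS.sg (- int i) s \<in> carrier S"
    using c i RC.sg_closed[of "- int i" r] SS.sg_closed[of "- int i" s] by auto
  have "TD.sg (int i) (tT (RC.sg (- int i) r) (SS.sg (- int i) s)) = tT r s"
    using pos[OF d] RC.sg_inv'[of "int i" r] SS.sg_inv'[of "int i" s] c i by simp
  then have "TD.sg (- int i) (tT r s) = TD.sg (- int i) (TD.sg (int i) (tT (RC.sg (- int i) r) (SS.sg (- int i) s)))" by simp
  then show ?thesis using d i u TD.sg_inv[of "int i"] by simp
qed

lemma sgT_right: "v \<in> pm n \<Longrightarrow> r \<in> carrier R \<Longrightarrow> s \<in> carrier S \<Longrightarrow> TD.sg (shift m v) (tT r s) = tT (RR.sg v r) (SD.sg v s)"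
proof (elim pm_cases)
  assume c: "r \<in> carrier R" "s \<in> carrier S"
  fix i assume i: "i \<in> {1..n}"
  have i': "m + i \<in> {1..m + n}" using i by auto
  have pos: "TD.sg (int (m + i)) (tT r s) = tT (\<rho>R i r) (\<rho> i s)" if "r \<in> carrier R" "s \<in> carrier S" for r s
    using i \<rho>T_tens[OF i that] TD.sg_int(1)[OF i'] by (simp add: comb_aut_def)
  { assume "v = int i" then show ?thesis using pos[OF c] i by (simp add: shift_int[OF i] del: of_nat_add) }
  assume v: "v = - int i"
  have d: "RR.sg (- int i) r \<in> carrier R" "SD.sg (- int i) s \<in> carrier S"
    using c i RR.sg_closed[of "- int i" r] SD.sg_closed[of "- int i" s] by auto
  have "TD.sg (int (m + i)) (tT (RR.sg (- int i) r) (SD.sg (- int i) s)) = tT r s"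
    using pos[OF d] RR.sg_inv'[of "int i" r] SD.sg_inv'[of "int i" s] c i by simp
  then have "TD.sg (- int (m + i)) (tT r s) = TD.sg (- int (m + i)) (TD.sg (int (m + i)) (tT (RR.sg (- int i) r) (SD.sg (- int i) s)))" by simp
  then show ?thesis using d i' i v TD.sg_inv[of "int (m + i)"] by (simp add: shift_int[OF i] del: of_nat_add)
qed

text \<open>The automorphisms fix \<open>1\<close>, so the coefficient of a letter comes from the factor to which the letter belongs.\<close>

lemma ttT: "u \<in> pm m \<Longrightarrow> TD.tt u = tT (RC.tt u) \<one>\<^bsub>S\<^esub>" "v \<in> pm n \<Longrightarrow> TD.tt (shift m v) = tT \<one>\<^bsub>R\<^esub> (SD.tt v)"
proof -
  have 1: "\<sigma>S i \<one>\<^bsub>S\<^esub> = \<one>\<^bsub>S\<^esub>" if "i \<in> {1..m}" for i using wsg_one(1)[of "[int i]"] that by simp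
  have 2: "\<rho>R i \<one>\<^bsub>R\<^esub> = \<one>\<^bsub>R\<^esub>" if "i \<in> {1..n}" for i using wsg_one(2)[of "[int i]"] that by simp
  show "u \<in> pm m \<Longrightarrow> TD.tt u = tT (RC.tt u) \<one>\<^bsub>S\<^esub>"
    by (erule pm_cases) (simp_all add: TD.tt_def RC.tt_def comb_elem_def comb_aut_def \<sigma>T_tens RC.t_center 1)
  show "v \<in> pm n \<Longrightarrow> TD.tt (shift m v) = tT \<one>\<^bsub>R\<^esub> (SD.tt v)"
  proof (erule pm_cases)
    fix i assume i: "i \<in> {1..n}"
    { assume "v = int i"
      then show ?thesis using i by (simp add: TD.tt_def SD.tt_def shift_int[OF i] t_w del: of_nat_add) }
    assume "v = - int i"
    then show ?thesis
      using i \<rho>T_tens[OF i RC.R.one_closed SD.t_center(1)[OF i]]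
      by (simp add: TD.tt_def SD.tt_def shift_int[OF i] t_w comb_aut_def 2 del: of_nat_add)
  qed
qed

abbreviation \<iota>A where "\<iota>A r \<equiv> RC.prA (RC.ic r)"
abbreviation \<iota>B where "\<iota>B s \<equiv> SD.prA (SD.ic s)"

definition \<iota>P where "\<iota>P = tensor_map K RC.A SD.A \<iota>A \<iota>B"

text \<open>The letters of the combined datum in \<open>A \<otimes>\<^sub>\<tau> B\<close>: \<open>X\<^sub>u \<otimes> 1\<close> and \<open>1 \<otimes> Y\<^sub>v\<close>.\<close>

definition XP where
  "XP u = (if u \<in> pm m then M \<one>\<^bsub>R\<^esub> [u] \<one>\<^bsub>S\<^esub> [] else M \<one>\<^bsub>R\<^esub> [] \<one>\<^bsub>S\<^esub> [u - sgn u * int m])"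

sublocale \<iota>\<iota>: tensor_prod_map K R S RC.A SD.A \<iota>A \<iota>B
proof unfold_locales
  show "\<iota>A \<in> lin_hom K R RC.A" by (rule alg_homD(1)[OF RC.Ar.\<iota>_hom])
  show "\<iota>B \<in> lin_hom K S SD.A" by (rule alg_homD(1)[OF SD.Ar.\<iota>_hom])
qed

lemma \<iota>P_linear: "\<iota>P \<in> lin_hom K (tensor K R S) AB.TT"
  unfolding \<iota>P_def by (rule \<iota>\<iota>.map_linear)

lemma \<iota>P_tens: "r \<in> carrier R \<Longrightarrow> s \<in> carrier S \<Longrightarrow> \<iota>P (tT r s) = M r [] s []"
  by (simp add: \<iota>P_def \<iota>\<iota>.map_tens M_def)

lemma XP_left: "u \<in> pm m \<Longrightarrow> XP u = M \<one>\<^bsub>R\<^esub> [u] \<one>\<^bsub>S\<^esub> []"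
  by (simp add: XP_def)

lemma XP_right: "v \<in> pm n \<Longrightarrow> XP (shift m v) = M \<one>\<^bsub>R\<^esub> [] \<one>\<^bsub>S\<^esub> [v]"
  using shift_pm[of v n m] by (simp add: XP_def)

lemma XP_closed: "u \<in> pm (m + n) \<Longrightarrow> XP u \<in> carrier AB.TT"
  by (erule pm_split) (simp_all add: XP_left XP_right)

lemma lin_hom_WT: "lin_hom K X W = lin_hom K X AB.TT" "lin_hom K W X = lin_hom K AB.TT X"
  "lin_hom K X T = lin_hom K X (tensor K R S)" "lin_hom K T X = lin_hom K (tensor K R S) X"
  by (simp_all add: lin_hom_def)

lemma W_mult_lin: "z \<in> carrier AB.TT \<Longrightarrow> (\<lambda>x. x \<otimes>\<^bsub>W\<^esub> z) \<in> lin_hom K AB.TT AB.TT"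
  "z \<in> carrier AB.TT \<Longrightarrow> (\<lambda>x. z \<otimes>\<^bsub>W\<^esub> x) \<in> lin_hom K AB.TT AB.TT"
  using tw.mult_linear_left tw.mult_linear_right by simp_all

text \<open>Two cases of the multiplication table in which the scalar or the automorphisms are trivial.\<close>

lemma M_mult_\<iota>: "\<lbrakk>r \<in> carrier R; s \<in> carrier S; r' \<in> carrier R; s' \<in> carrier S; us \<in> wordsm; vs \<in> wordsn\<rbrakk> \<Longrightarrow>
    M r [] s [] \<otimes>\<^bsub>W\<^esub> M r' us s' vs = M (r \<otimes>\<^bsub>R\<^esub> r') us (SS.wsg (map uminus us) s \<otimes>\<^bsub>S\<^esub> s') vs"
proof -
  assume a: "r \<in> carrier R" "s \<in> carrier S" "r' \<in> carrier R" "s' \<in> carrier S" "us \<in> wordsm" "vs \<in> wordsn"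
  have "map uminus us \<in> wordsm" using a by simp
  then show ?thesis using M_mult[of r s "[]" "[]" r' s' us vs] a by simp
qed

lemma M_one_mult: "\<lbrakk>us \<in> wordsm; vs \<in> wordsn; us' \<in> wordsm; vs' \<in> wordsn\<rbrakk> \<Longrightarrow>
    M \<one>\<^bsub>R\<^esub> us \<one>\<^bsub>S\<^esub> vs \<otimes>\<^bsub>W\<^esub> M \<one>\<^bsub>R\<^esub> us' \<one>\<^bsub>S\<^esub> vs' = qs.qw vs us' \<odot>\<^bsub>W\<^esub> M \<one>\<^bsub>R\<^esub> (us @ us') \<one>\<^bsub>S\<^esub> (vs @ vs')"
proof -
  assume a: "us \<in> wordsm" "vs \<in> wordsn" "us' \<in> wordsm" "vs' \<in> wordsn"
  have "map uminus us' \<in> wordsm" using a by simp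
  then show ?thesis using M_mult[of "\<one>\<^bsub>R\<^esub>" "\<one>\<^bsub>S\<^esub>" us vs "\<one>\<^bsub>R\<^esub>" "\<one>\<^bsub>S\<^esub>" us' vs'] a by (simp add: wsg_one)
qed

lemma \<iota>P_hom: "\<iota>P \<in> alg_hom K T W"
proof (rule alg_homI)
  show "\<iota>P \<in> lin_hom K T W" unfolding lin_hom_WT by (rule \<iota>P_linear)
  show "\<iota>P \<one>\<^bsub>T\<^esub> = \<one>\<^bsub>W\<^esub>" by (simp add: \<iota>P_tens M_def)
  have 1: "\<iota>P (tT r s \<otimes>\<^bsub>T\<^esub> y) = \<iota>P (tT r s) \<otimes>\<^bsub>W\<^esub> \<iota>P y" if rs: "r \<in> carrier R" "s \<in> carrier S" and y: "y \<in> carrier (tensor K R S)" for r s y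
  proof (rule TA.tw.AB.tensor_linear_eqI[OF _ _ AB.TT_vec_space _ y])
    have c: "tT r s \<in> carrier (tensor K R S)" "\<iota>P (tT r s) \<in> carrier AB.TT"
      using rs lin_homD(1)[OF \<iota>P_linear] by simp_all
    show "(\<lambda>y. \<iota>P (tT r s \<otimes>\<^bsub>T\<^esub> y)) \<in> lin_hom K (tensor K R S) AB.TT"
      by (rule lin_hom_comp[OF TA.mult_lin(2)[OF c(1)] \<iota>P_linear])
    show "(\<lambda>y. \<iota>P (tT r s) \<otimes>\<^bsub>W\<^esub> \<iota>P y) \<in> lin_hom K (tensor K R S) AB.TT"
      by (rule lin_hom_comp[OF \<iota>P_linear W_mult_lin(2)[OF c(2)]])
    fix r' s' assume "r' \<in> carrier R" "s' \<in> carrier S"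
    then show "\<iota>P (tT r s \<otimes>\<^bsub>T\<^esub> tT r' s') = \<iota>P (tT r s) \<otimes>\<^bsub>W\<^esub> \<iota>P (tT r' s')"
      using rs by (simp only: TA.tens_mult \<iota>P_tens RC.R.m_closed SD.R.m_closed) (simp only: M_mult_\<iota> lists.Nil list.map word_aut_simps)
  qed
  fix x y assume "x \<in> carrier T" "y \<in> carrier T"
  then have x: "x \<in> carrier (tensor K R S)" and y: "y \<in> carrier (tensor K R S)" by simp_all
  show "\<iota>P (x \<otimes>\<^bsub>T\<^esub> y) = \<iota>P x \<otimes>\<^bsub>W\<^esub> \<iota>P y"
  proof (rule TA.tw.AB.tensor_linear_eqI[OF _ _ AB.TT_vec_space _ x])
    show "(\<lambda>x. \<iota>P (x \<otimes>\<^bsub>T\<^esub> y)) \<in> lin_hom K (tensor K R S) AB.TT"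
      by (rule lin_hom_comp[OF TA.mult_lin(1)[OF y] \<iota>P_linear])
    show "(\<lambda>x. \<iota>P x \<otimes>\<^bsub>W\<^esub> \<iota>P y) \<in> lin_hom K (tensor K R S) AB.TT"
      by (rule lin_hom_comp[OF \<iota>P_linear W_mult_lin(1)[OF lin_homD(1)[OF \<iota>P_linear y]]])
  qed (rule 1[OF _ _ y])
qed

lemma XP_\<iota>P:
  assumes u: "u \<in> pm (m + n)" and z: "z \<in> carrier (tensor K R S)"
  shows "XP u \<otimes>\<^bsub>W\<^esub> \<iota>P z = \<iota>P (TD.sg u z) \<otimes>\<^bsub>W\<^esub> XP u"
proof (rule TA.tw.AB.tensor_linear_eqI[OF _ _ AB.TT_vec_space _ z])
  show "(\<lambda>z. XP u \<otimes>\<^bsub>W\<^esub> \<iota>P z) \<in> lin_hom K (tensor K R S) AB.TT"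
    by (rule lin_hom_comp[OF \<iota>P_linear W_mult_lin(2)[OF XP_closed[OF u]]])
  have "TD.sg u \<in> lin_hom K (tensor K R S) (tensor K R S)"
    using alg_homD(1)[OF TD.sg_hom[OF u]] by (simp only: lin_hom_WT)
  from lin_hom_comp[OF lin_hom_comp[OF this \<iota>P_linear] W_mult_lin(1)[OF XP_closed[OF u]]]
  show "(\<lambda>z. \<iota>P (TD.sg u z) \<otimes>\<^bsub>W\<^esub> XP u) \<in> lin_hom K (tensor K R S) AB.TT" .
  fix r s assume rs: "r \<in> carrier R" "s \<in> carrier S"
  show "XP u \<otimes>\<^bsub>W\<^esub> \<iota>P (tT r s) = \<iota>P (TD.sg u (tT r s)) \<otimes>\<^bsub>W\<^esub> XP u"
    using u
  proof (rule pm_split)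
    assume u: "u \<in> pm m"
    have "XP u \<otimes>\<^bsub>W\<^esub> \<iota>P (tT r s) = M (RC.sg u r) [u] s []"
      using M_mult[of "\<one>\<^bsub>R\<^esub>" "\<one>\<^bsub>S\<^esub>" "[u]" "[]" r s "[]" "[]"] u rs by (simp add: XP_left \<iota>P_tens del: tw.W_simps(5))
    moreover have "\<iota>P (TD.sg u (tT r s)) \<otimes>\<^bsub>W\<^esub> XP u = M (RC.sg u r) [u] s []"
      using M_mult_\<iota>[of "RC.sg u r" "SS.sg u s" "\<one>\<^bsub>R\<^esub>" "\<one>\<^bsub>S\<^esub>" "[u]" "[]"] u rs
      by (simp add: XP_left \<iota>P_tens sgT_left del: tw.W_simps(5))
    ultimately show ?thesis by simp
  next
    fix v assume v: "v \<in> pm n" "u = shift m v"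
    have "XP u \<otimes>\<^bsub>W\<^esub> \<iota>P (tT r s) = M (RR.sg v r) [] (SD.sg v s) [v]"
      using M_mult[of "\<one>\<^bsub>R\<^esub>" "\<one>\<^bsub>S\<^esub>" "[]" "[v]" r s "[]" "[]"] v rs by (simp add: XP_right \<iota>P_tens del: tw.W_simps(5))
    moreover have "\<iota>P (TD.sg u (tT r s)) \<otimes>\<^bsub>W\<^esub> XP u = M (RR.sg v r) [] (SD.sg v s) [v]"
      using M_mult_\<iota>[of "RR.sg v r" "SD.sg v s" "\<one>\<^bsub>R\<^esub>" "\<one>\<^bsub>S\<^esub>" "[]" "[v]"] v rs
      by (simp add: XP_right \<iota>P_tens sgT_right del: tw.W_simps(5))
    ultimately show ?thesis by simp
  qed
qed

lemma XP_uminus: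
  assumes u: "u \<in> pm (m + n)"
  shows "XP (- u) \<otimes>\<^bsub>W\<^esub> XP u = \<iota>P (TD.tt u)"
  using u
proof (rule pm_split)
  assume u: "u \<in> pm m"
  have "mA \<one>\<^bsub>R\<^esub> [- u, u] = \<iota>A (RC.tt u)"
    using RC.Ar.X_uminus[OF u] u by (simp add: RC.Ar.mon_one)
  then have "M \<one>\<^bsub>R\<^esub> [- u, u] \<one>\<^bsub>S\<^esub> [] = M (RC.tt u) [] \<one>\<^bsub>S\<^esub> []" using u by (simp add: M_def)
  then show ?thesis using M_one_mult[of "[- u]" "[]" "[u]" "[]"] u
    by (simp add: XP_left ttT \<iota>P_tens del: tw.W_simps(5))
next
  fix v assume v: "v \<in> pm n" "u = shift m v"
  then have u: "- u = shift m (- v)" using shift_pm[of v n m] by simp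
  have "mB \<one>\<^bsub>S\<^esub> [- v, v] = \<iota>B (SD.tt v)"
    using SD.Ar.X_uminus[OF v(1)] v(1) by (simp add: SD.Ar.mon_one)
  then have "M \<one>\<^bsub>R\<^esub> [] \<one>\<^bsub>S\<^esub> [- v, v] = M \<one>\<^bsub>R\<^esub> [] (SD.tt v) []" using v by (simp add: M_def)
  then show ?thesis using M_one_mult[of "[]" "[- v]" "[]" "[v]"] v(1)
    by (simp add: u[unfolded v(2)] v(2) XP_right ttT \<iota>P_tens del: tw.W_simps(5))
qed

text \<open>Between letters of the same factor this is the relation of that factor. In the mixed cases the product \<open>(X \<otimes> 1) (1 \<otimes> Y)\<close> is
  \<open>X \<otimes> Y\<close>, whereas \<open>(1 \<otimes> Y) (X \<otimes> 1)\<close> is \<open>X \<otimes> Y\<close> multiplied by the scalar of the two letters.\<close>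

lemma XP_exchange:
  assumes "i \<in> {1..m + n}" "j \<in> {1..m + n}" "i \<noteq> j"
  shows "XP (int i) \<otimes>\<^bsub>W\<^esub> XP (- int j) = \<eta> i j \<odot>\<^bsub>W\<^esub> (XP (- int j) \<otimes>\<^bsub>W\<^esub> XP (int i))"
  using assms(1)
proof (rule index_split)
  assume i: "i \<in> {1..m}"
  show ?thesis using assms(2)
  proof (rule index_split)
    assume j: "j \<in> {1..m}"
    have "mA \<one>\<^bsub>R\<^esub> [int i, - int j] = \<mu> i j \<odot>\<^bsub>RC.A\<^esub> mA \<one>\<^bsub>R\<^esub> [- int j, int i]"
      using RC.Ar.X_exchange[OF i j assms(3)] i j by (simp add: RC.Ar.mon_one)
    then have "M \<one>\<^bsub>R\<^esub> [int i, - int j] \<one>\<^bsub>S\<^esub> [] = \<mu> i j \<odot>\<^bsub>W\<^esub> M \<one>\<^bsub>R\<^esub> [- int j, int i] \<one>\<^bsub>S\<^esub> []"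
      using RC.\<mu>_nonzero[OF i j] i j by (simp add: M_def AB.tens_smult_left)
    then show ?thesis
      using M_one_mult[of "[int i]" "[]" "[- int j]" "[]"] M_one_mult[of "[- int j]" "[]" "[int i]" "[]"] i j
        RC.\<mu>_nonzero[OF i j]
      by (simp add: XP_left comb_matrix_def del: tw.W_simps(5))
  next
    fix j' assume j: "j' \<in> {1..n}" "j = m + j'"
    have X: "XP (- int j) = M \<one>\<^bsub>R\<^esub> [] \<one>\<^bsub>S\<^esub> [- int j']"
      using XP_right[of "- int j'"] j by (simp add: shift_int[OF j(1)] del: of_nat_add)
    let ?q = "q j' i (-1) 1"
    have q: "?q \<in> carrier K" "?q \<noteq> \<zero>\<^bsub>K\<^esub>" using qs.q_nonzero[of j' i "-1" 1] i j by auto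
    have qq: "qs.qw [- int j'] [int i] = ?q" using qs.qw_letters[of "- int j'" "int i"] i j by (simp add: q_letters_def sgn_if)
    have "\<eta> i j = inv\<^bsub>K\<^esub> ?q" using i j by (simp add: comb_matrix_def)
    then show ?thesis
      using M_one_mult[of "[int i]" "[]" "[]" "[- int j']"] M_one_mult[of "[]" "[- int j']" "[int i]" "[]"] i j(1)
        AB.T.smult_inv_cancel[OF q]
      by (simp add: XP_left X qq del: tw.W_simps(5))
  qed
next
  fix i' assume i: "i' \<in> {1..n}" "i = m + i'"
  have X: "XP (int i) = M \<one>\<^bsub>R\<^esub> [] \<one>\<^bsub>S\<^esub> [int i']"
    using XP_right[of "int i'"] i by (simp add: shift_int[OF i(1)] del: of_nat_add)
  show ?thesis using assms(2)
  proof (rule index_split)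
    assume j: "j \<in> {1..m}"
    have qq: "qs.qw [int i'] [- int j] = q i' j 1 (-1)" using qs.qw_letters[of "int i'" "- int j"] i j by (simp add: q_letters_def sgn_if)
    have "\<eta> i j = q i' j 1 (-1)" using i j by (simp add: comb_matrix_def)
    then show ?thesis
      using M_one_mult[of "[- int j]" "[]" "[]" "[int i']"] M_one_mult[of "[]" "[int i']" "[- int j]" "[]"] i(1) j
      by (simp add: XP_left X qq del: tw.W_simps(5))
  next
    fix j' assume j: "j' \<in> {1..n}" "j = m + j'"
    have Y: "XP (- int j) = M \<one>\<^bsub>R\<^esub> [] \<one>\<^bsub>S\<^esub> [- int j']"
      using XP_right[of "- int j'"] j by (simp add: shift_int[OF j(1)] del: of_nat_add)
    have ne: "i' \<noteq> j'" using assms(3) i j by simp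
    have "mB \<one>\<^bsub>S\<^esub> [int i', - int j'] = \<nu> i' j' \<odot>\<^bsub>SD.A\<^esub> mB \<one>\<^bsub>S\<^esub> [- int j', int i']"
      using SD.Ar.X_exchange[OF i(1) j(1) ne] i j by (simp add: SD.Ar.mon_one)
    then have "M \<one>\<^bsub>R\<^esub> [] \<one>\<^bsub>S\<^esub> [int i', - int j'] = \<nu> i' j' \<odot>\<^bsub>W\<^esub> M \<one>\<^bsub>R\<^esub> [] \<one>\<^bsub>S\<^esub> [- int j', int i']"
      using SD.\<mu>_nonzero[OF i(1) j(1)] i j by (simp add: M_def AB.tens_smult_right)
    moreover have "\<eta> i j = \<nu> i' j'" using i j by (simp add: comb_matrix_def)
    ultimately show ?thesis
      using M_one_mult[of "[]" "[int i']" "[]" "[- int j']"] M_one_mult[of "[]" "[- int j']" "[]" "[int i']"] i(1) j(1)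
        SD.\<mu>_nonzero[OF i(1) j(1)]
      by (simp add: X Y del: tw.W_simps(5))
  qed
qed

sublocale Wr: tgw_rel K "m + n" \<eta> T \<pi> w W \<iota>P XP
proof (intro tgw_rel.intro TD.tgw_datum_axioms W_k_algebra tgw_rel_axioms.intro \<iota>P_hom XP_exchange XP_uminus)
  show "XP u \<in> carrier W" if "u \<in> pm (m + n)" for u using XP_closed[OF that] by simp
  show "XP u \<otimes>\<^bsub>W\<^esub> \<iota>P r = \<iota>P (TD.sg u r) \<otimes>\<^bsub>W\<^esub> XP u" if "u \<in> pm (m + n)" "r \<in> carrier T" for u r
    using XP_\<iota>P[of u r] that by simp
qed

lemma wX_left: "us \<in> wordsm \<Longrightarrow> Wr.wX us = M \<one>\<^bsub>R\<^esub> us \<one>\<^bsub>S\<^esub> []"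
proof (induction us rule: list.induct)
  case Nil then show ?case by (simp add: M_def)
next
  case (Cons u us)
  then show ?case using M_one_mult[of "[u]" "[]" us "[]"] by (simp add: XP_left del: tw.W_simps(5))
qed

lemma wX_right: "vs \<in> wordsn \<Longrightarrow> Wr.wX (map (shift m) vs) = M \<one>\<^bsub>R\<^esub> [] \<one>\<^bsub>S\<^esub> vs"
proof (induction vs rule: list.induct)
  case Nil then show ?case by (simp add: M_def)
next
  case (Cons v vs)
  then show ?case using M_one_mult[of "[]" "[v]" "[]" vs] by (simp add: XP_right del: tw.W_simps(5))
qed

lemma shift_words: "us \<in> wordsm \<Longrightarrow> us \<in> lists (pm (m + n))" "vs \<in> wordsn \<Longrightarrow> map (shift m) vs \<in> lists (pm (m + n))"
  using pm_mono[of _ m n] shift_pm[of _ n m] by (auto simp: lists_eq_set)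

text \<open>The coefficient \<open>s\<close> stands to the right of \<open>X\<^sub>u\<close> in \<open>r X\<^sub>u \<otimes> s Y\<^sub>v\<close>; moving it to the front applies \<open>\<sigma>\<^sup>u\<close>.\<close>

lemma M_monom:
  assumes "r \<in> carrier R" "s \<in> carrier S" "us \<in> wordsm" "vs \<in> wordsn"
  shows "M r us s vs = Wr.mon (tT r (SS.wsg us s)) (us @ map (shift m) vs)"
proof -
  have w: "us \<in> lists (pm (m + n))" "map (shift m) vs \<in> lists (pm (m + n))" using shift_words assms by auto
  have s: "SS.wsg us s \<in> carrier S" using assms by simp
  have "Wr.wX (us @ map (shift m) vs) = M \<one>\<^bsub>R\<^esub> us \<one>\<^bsub>S\<^esub> vs"
    using M_one_mult[of us "[]" "[]" vs] assms w by (simp add: Wr.wX_append wX_left wX_right del: tw.W_simps(5))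
  then show ?thesis
    using M_mult_\<iota>[of r "SS.wsg us s" "\<one>\<^bsub>R\<^esub>" "\<one>\<^bsub>S\<^esub>" us vs] assms s
    by (simp add: Wr.mon_def \<iota>P_tens del: tw.W_simps(5))
qed

sublocale Wa: tgw_alg K "m + n" \<eta> T \<pi> w W \<iota>P XP
proof
  show "carrier W \<subseteq> add_span W Wr.monoms"
  proof
    fix x assume "x \<in> carrier W"
    then have "x \<in> add_span AB.TT (case_prod AB.tn ` (RC.Ar.monoms \<times> SD.Ar.monoms))"
      using AB.tensor_product_span[OF RC.Ar.monoms_carrier RC.Aa.span_monoms SD.Ar.monoms_carrier SD.Aa.span_monoms] by auto
    then show "x \<in> add_span W Wr.monoms"
    proof induction
      case zero then show ?case using add_span.zero[of W] by simp
    next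
      case (add b x)
      then obtain r us s vs where "b = M r us s vs" "r \<in> carrier R" "us \<in> wordsm" "s \<in> carrier S" "vs \<in> wordsn"
        unfolding RC.Ar.monoms_def SD.Ar.monoms_def M_def by blast
      moreover from this have "us @ map (shift m) vs \<in> lists (pm (m + n))" "tT r (SS.wsg us s) \<in> carrier T"
        using shift_words by simp_all
      ultimately have "b \<in> Wr.monoms" unfolding Wr.monoms_def using M_monom by blast
      then show ?case using add_span.add[of b Wr.monoms x W] add by simp
    qed
  qed
qed

text \<open>A mixed word is sorted into its letters from the two factors at the cost of a scalar.\<close>

lemma wX_letters:
  "ws \<in> lists (pm (m + n)) \<Longrightarrow> \<exists>c\<in>carrier K. Wr.wX ws = c \<odot>\<^bsub>W\<^esub> M \<one>\<^bsub>R\<^esub> (left_letters m ws) \<one>\<^bsub>S\<^esub> (right_letters m ws)"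
proof (induction ws rule: list.induct)
  case Nil
  then show ?case by (intro bexI[of _ "\<one>\<^bsub>K\<^esub>"]) (simp_all add: left_letters_def right_letters_def M_def)
next
  case (Cons u ws)
  let ?l = "left_letters m ws" and ?r = "right_letters m ws"
  have ws: "ws \<in> lists (pm (m + n))" and u: "u \<in> pm (m + n)" using Cons.prems by simp_all
  then obtain c where c: "c \<in> carrier K" "Wr.wX ws = c \<odot>\<^bsub>W\<^esub> M \<one>\<^bsub>R\<^esub> ?l \<one>\<^bsub>S\<^esub> ?r" using Cons by auto
  have lr: "?l \<in> wordsm" "?r \<in> wordsn" using letters_words[OF ws] by simp_all
  have mc: "M \<one>\<^bsub>R\<^esub> ?l \<one>\<^bsub>S\<^esub> ?r \<in> carrier AB.TT" using lr by simp
  have s: "XP u \<otimes>\<^bsub>W\<^esub> (c \<odot>\<^bsub>W\<^esub> M \<one>\<^bsub>R\<^esub> ?l \<one>\<^bsub>S\<^esub> ?r) = c \<odot>\<^bsub>W\<^esub> (XP u \<otimes>\<^bsub>W\<^esub> M \<one>\<^bsub>R\<^esub> ?l \<one>\<^bsub>S\<^esub> ?r)"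
    using lin_homD(3)[OF W_mult_lin(2)[OF XP_closed[OF u]] c(1) mc] by simp
  show ?case
    using u
  proof (rule pm_split)
    assume um: "u \<in> pm m"
    then show ?thesis
      using M_one_mult[of "[u]" "[]" ?l ?r] lr c s letters_Cons(1)[OF um, of ws]
      by (intro bexI[of _ c]) (simp_all add: XP_left del: tw.W_simps(5))
  next
    fix v assume v: "v \<in> pm n" "u = shift m v"
    then have "[v] \<in> wordsn" by simp
    then show ?thesis
      using M_one_mult[of "[]" "[v]" ?l ?r] lr c s letters_Cons(2)[OF v(1), of m ws] v AB.T.smult_assoc1[of c "qs.qw [v] ?l"]
      by (intro bexI[of _ "c \<otimes>\<^bsub>K\<^esub> qs.qw [v] ?l"]) (simp_all add: XP_right del: tw.W_simps(5))
  qed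
qed

text \<open>The projection onto bidegree \<open>(0, 0)\<close>, that is, onto degree \<open>0\<close> in \<open>\<int>\<^sup>m\<^sup>+\<^sup>n\<close>.\<close>

definition pP where "pP = tensor_map K RC.A SD.A RC.pA0 SD.pA0"

sublocale pp: tensor_prod_map K RC.A SD.A RC.A SD.A RC.pA0 SD.pA0
  by unfold_locales (rule RC.pA0_lin SD.pA0_lin)+

lemma pP_linear: "pP \<in> lin_hom K AB.TT AB.TT"
  unfolding pP_def by (rule pp.map_linear)

lemma pP_M: "\<lbrakk>r \<in> carrier R; s \<in> carrier S; us \<in> wordsm; vs \<in> wordsn\<rbrakk> \<Longrightarrow> pP (M r us s vs) =
    (if word_degree us = (\<lambda>_. 0) \<and> word_degree vs = (\<lambda>_. 0) then M r us s vs else \<zero>\<^bsub>AB.TT\<^esub>)"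
  by (simp add: pP_def M_def pp.map_tens RC.Ap.p0_mon SD.Ap.p0_mon)

sublocale Wp: tgw_proj K "m + n" \<eta> T \<pi> w W \<iota>P XP pP
proof (intro tgw_proj.intro Wa.tgw_alg_axioms tgw_proj_axioms.intro)
  show "pP \<in> lin_hom K W W" unfolding lin_hom_WT by (rule pP_linear)
  fix z ws assume z: "z \<in> carrier T" and ws: "ws \<in> lists (pm (m + n))"
  let ?l = "left_letters m ws" and ?r = "right_letters m ws"
  have lr: "?l \<in> wordsm" "?r \<in> wordsn" "map uminus ?l \<in> wordsm" using letters_words[OF ws] by simp_all
  obtain c where c: "c \<in> carrier K" "Wr.wX ws = c \<odot>\<^bsub>W\<^esub> M \<one>\<^bsub>R\<^esub> ?l \<one>\<^bsub>S\<^esub> ?r" using wX_letters[OF ws] by blast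
  have wc: "Wr.wX ws \<in> carrier AB.TT" using Wr.wX_closed[OF ws] by simp
  note L = lin_hom_comp[OF \<iota>P_linear W_mult_lin(1)[OF wc]]
  let ?b = "word_degree ws = (\<lambda>_. 0)"
  have "pP (\<iota>P z \<otimes>\<^bsub>W\<^esub> Wr.wX ws) = (if ?b then \<iota>P z \<otimes>\<^bsub>W\<^esub> Wr.wX ws else \<zero>\<^bsub>AB.TT\<^esub>)"
  proof (rule TA.tw.AB.tensor_linear_eqI[OF _ _ AB.TT_vec_space])
    show "(\<lambda>z. pP (\<iota>P z \<otimes>\<^bsub>W\<^esub> Wr.wX ws)) \<in> lin_hom K (tensor K R S) AB.TT" by (rule lin_hom_comp[OF L pP_linear])
    show "(\<lambda>z. if ?b then \<iota>P z \<otimes>\<^bsub>W\<^esub> Wr.wX ws else \<zero>\<^bsub>AB.TT\<^esub>) \<in> lin_hom K (tensor K R S) AB.TT"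
      using L zero_lin_hom[OF AB.TT_vec_space] by (cases ?b) simp_all
    show "z \<in> carrier (tensor K R S)" using z by simp
    fix r s assume rs: "r \<in> carrier R" "s \<in> carrier S"
    let ?m = "M r ?l (SS.wsg (map uminus ?l) s) ?r"
    have mc: "?m \<in> carrier AB.TT" "M r [] s [] \<in> carrier AB.TT" "M \<one>\<^bsub>R\<^esub> ?l \<one>\<^bsub>S\<^esub> ?r \<in> carrier AB.TT"
      using rs lr by simp_all
    have e: "\<iota>P (tT r s) \<otimes>\<^bsub>W\<^esub> Wr.wX ws = c \<odot>\<^bsub>W\<^esub> ?m"
      using lin_homD(3)[OF W_mult_lin(2)[OF mc(2)] c(1) mc(3)] M_mult_\<iota>[of r s "\<one>\<^bsub>R\<^esub>" "\<one>\<^bsub>S\<^esub>" ?l ?r] rs lr c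
      by (simp add: \<iota>P_tens del: tw.W_simps(5))
    have "pP (c \<odot>\<^bsub>W\<^esub> ?m) = c \<odot>\<^bsub>W\<^esub> pP ?m" using lin_homD(3)[OF pP_linear c(1) mc(1)] by simp
    then show "pP (\<iota>P (tT r s) \<otimes>\<^bsub>W\<^esub> Wr.wX ws) = (if ?b then \<iota>P (tT r s) \<otimes>\<^bsub>W\<^esub> Wr.wX ws else \<zero>\<^bsub>AB.TT\<^esub>)"
      unfolding e letters_degree_zero[OF ws] using rs lr c by (simp add: pP_M)
  qed
  then show "pP (Wr.mon z ws) = (if ?b then Wr.mon z ws else \<zero>\<^bsub>W\<^esub>)" by (simp add: Wr.mon_def)
qed

text \<open>A nonzero \<open>z\<close> is moved to a nonzero element of degree \<open>0\<close> by an element of the first factor on the left and one of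
  the second factor on the right. These multiplications, followed by projection, act on one tensor factor each; a functional on
  the other factor reduces nonvanishing to the corresponding property of \<open>A\<close> and of \<open>B\<close>.\<close>

lemma W_nondeg:
  assumes z: "z \<in> carrier AB.TT" "z \<noteq> \<zero>\<^bsub>AB.TT\<^esub>"
  shows "\<exists>a\<in>carrier W. \<exists>b\<in>carrier W. pP (a \<otimes>\<^bsub>W\<^esub> z \<otimes>\<^bsub>W\<^esub> b) \<noteq> \<zero>\<^bsub>W\<^esub>"
proof -
  obtain \<phi> where \<phi>: "\<phi> \<in> dual K SD.A" "AB.contract_right \<phi> z \<noteq> \<zero>\<^bsub>RC.A\<^esub>" using AB.separate_right[OF z] by blast
  obtain a where a: "a \<in> carrier RC.A" "RC.pA0 (a \<otimes>\<^bsub>RC.A\<^esub> AB.contract_right \<phi> z) \<noteq> \<zero>\<^bsub>RC.A\<^esub>"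
    using RA.regular_nondeg(1)[OF regular(1) lin_homD(1)[OF AB.contract_right_linear[OF \<phi>(1)] z(1)] \<phi>(2)] by blast
  interpret f: tensor_prod_map K RC.A SD.A RC.A SD.A "\<lambda>x. RC.pA0 (a \<otimes>\<^bsub>RC.A\<^esub> x)" "\<lambda>y. y"
    by (rule tensor_prod_mapI[OF RC.Aa.A_vec_space SD.Aa.A_vec_space RC.Aa.A_vec_space SD.Aa.A_vec_space
          lin_hom_comp[OF RC.Aa.mult_lin_right[OF a(1)] RC.pA0_lin] id_lin_hom])
  let ?z1 = "tensor_map K RC.A SD.A (\<lambda>x. RC.pA0 (a \<otimes>\<^bsub>RC.A\<^esub> x)) (\<lambda>y. y) z"
  have z1c: "?z1 \<in> carrier AB.TT" using lin_homD(1)[OF f.map_linear z(1)] .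
  have "AB.contract_right \<phi> ?z1 \<noteq> \<zero>\<^bsub>RC.A\<^esub>" using f.contract_right_map[OF \<phi>(1) z(1)] a(2) by simp
  then have z1: "?z1 \<noteq> \<zero>\<^bsub>AB.TT\<^esub>"
    using lin_hom_zero[OF AB.contract_right_linear[OF \<phi>(1)] AB.TT_vec_space RC.Aa.A_vec_space] by auto
  obtain \<psi> where \<psi>: "\<psi> \<in> dual K RC.A" "AB.contract_left \<psi> ?z1 \<noteq> \<zero>\<^bsub>SD.A\<^esub>" using AB.separate_left[OF z1c z1] by blast
  obtain b where b: "b \<in> carrier SD.A" "SD.pA0 (AB.contract_left \<psi> ?z1 \<otimes>\<^bsub>SD.A\<^esub> b) \<noteq> \<zero>\<^bsub>SD.A\<^esub>"
    using SB.regular_nondeg(2)[OF regular(2) lin_homD(1)[OF AB.contract_left_linear[OF \<psi>(1)] z1c] \<psi>(2)] by blast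
  interpret g: tensor_prod_map K RC.A SD.A RC.A SD.A "\<lambda>x. x" "\<lambda>y. SD.pA0 (y \<otimes>\<^bsub>SD.A\<^esub> b)"
    by (rule tensor_prod_mapI[OF RC.Aa.A_vec_space SD.Aa.A_vec_space RC.Aa.A_vec_space SD.Aa.A_vec_space
          id_lin_hom lin_hom_comp[OF SD.Aa.mult_lin_left[OF b(1)] SD.pA0_lin]])
  let ?z2 = "tensor_map K RC.A SD.A (\<lambda>x. x) (\<lambda>y. SD.pA0 (y \<otimes>\<^bsub>SD.A\<^esub> b)) ?z1"
  have "AB.contract_left \<psi> ?z2 \<noteq> \<zero>\<^bsub>SD.A\<^esub>" using g.contract_left_map[OF \<psi>(1) z1c] b(2) by simp
  then have z2: "?z2 \<noteq> \<zero>\<^bsub>AB.TT\<^esub>"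
    using lin_hom_zero[OF AB.contract_left_linear[OF \<psi>(1)] AB.TT_vec_space SD.Aa.A_vec_space] by auto
  let ?a = "AB.tn a \<one>\<^bsub>SD.A\<^esub>" and ?b = "AB.tn \<one>\<^bsub>RC.A\<^esub> b"
  have ab: "?a \<in> carrier AB.TT" "?b \<in> carrier AB.TT" using a b by simp_all
  have \<tau>1: "\<tau>' (BA.tn y \<one>\<^bsub>RC.A\<^esub>) = AB.tn \<one>\<^bsub>RC.A\<^esub> y" "\<tau>' (BA.tn \<one>\<^bsub>SD.A\<^esub> x) = AB.tn x \<one>\<^bsub>SD.A\<^esub>"
    if "x \<in> carrier RC.A" "y \<in> carrier SD.A" for x y using twisting that unfolding twisting_map_def by auto
  have "pP (?a \<otimes>\<^bsub>W\<^esub> z \<otimes>\<^bsub>W\<^esub> ?b) = ?z2"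
  proof (rule AB.tensor_linear_eqI[OF _ _ AB.TT_vec_space _ z(1)])
    show "(\<lambda>z. pP (?a \<otimes>\<^bsub>W\<^esub> z \<otimes>\<^bsub>W\<^esub> ?b)) \<in> lin_hom K AB.TT AB.TT"
      by (rule lin_hom_comp[OF lin_hom_comp[OF W_mult_lin(2)[OF ab(1)] W_mult_lin(1)[OF ab(2)]] pP_linear])
    show "(\<lambda>z. tensor_map K RC.A SD.A (\<lambda>x. x) (\<lambda>y. SD.pA0 (y \<otimes>\<^bsub>SD.A\<^esub> b)) (tensor_map K RC.A SD.A (\<lambda>x. RC.pA0 (a \<otimes>\<^bsub>RC.A\<^esub> x)) (\<lambda>y. y) z))
        \<in> lin_hom K AB.TT AB.TT"
      by (rule lin_hom_comp[OF f.map_linear g.map_linear])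
    fix x y assume "x \<in> carrier RC.A" "y \<in> carrier SD.A"
    then show "pP (?a \<otimes>\<^bsub>W\<^esub> AB.tn x y \<otimes>\<^bsub>W\<^esub> ?b) = tensor_map K RC.A SD.A (\<lambda>x. x) (\<lambda>y. SD.pA0 (y \<otimes>\<^bsub>SD.A\<^esub> b))
        (tensor_map K RC.A SD.A (\<lambda>x. RC.pA0 (a \<otimes>\<^bsub>RC.A\<^esub> x)) (\<lambda>y. y) (AB.tn x y))"
      using a b by (simp add: tw.mult_tens \<tau>1 tw.sandwich_tens pP_def pp.map_tens f.map_tens g.map_tens)
  qed
  then show ?thesis using z2 ab by (intro bexI[of _ ?a] bexI[of _ ?b]) simp_all
qed

sublocale Wn: tgw_nondeg K "m + n" \<eta> T \<pi> w W \<iota>P XP pP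
proof (intro tgw_nondeg.intro Wp.tgw_proj_axioms tgw_nondeg_axioms.intro)
  fix z assume "z \<in> carrier T" "\<iota>P z = \<zero>\<^bsub>W\<^esub>"
  then have "z \<in> carrier (tensor K R S)" "tensor_map K RC.A SD.A \<iota>A \<iota>B z = \<zero>\<^bsub>AB.TT\<^esub>"
    by (simp_all add: \<iota>P_def)
  then have "z = \<zero>\<^bsub>tensor K R S\<^esub>" by (intro \<iota>\<iota>.map_nonzero RA.\<iota>_inj SB.\<iota>_inj)
  then show "z = \<zero>\<^bsub>T\<^esub>" by simp
next
  fix z assume "z \<in> carrier W" "z \<noteq> \<zero>\<^bsub>W\<^esub>"
  then show "\<exists>a\<in>carrier W. \<exists>b\<in>carrier W. pP (a \<otimes>\<^bsub>W\<^esub> z \<otimes>\<^bsub>W\<^esub> b) \<noteq> \<zero>\<^bsub>W\<^esub>"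
    using W_nondeg[of z] by simp
qed

lemma combined_tgwa:
  "regular_consistent K (m + n) \<eta> T \<pi> w" "alg_iso K (TGWA K (m + n) \<eta> T \<pi> w) W \<noteq> {}"
  using Wn.tgwa_iso T_tgwd \<eta>_nonzero T_regular by (simp_all add: regular_consistent_def)

end


section \<open>The actions on the tensor factors\<close>

text \<open>The automorphisms of \<open>R \<otimes> S\<close> are given, and their actions on the factors are extracted. Since \<open>1 \<noteq> 0\<close> in both rings, \<open>R\<close> and
  \<open>S\<close> embed into \<open>R \<otimes> S\<close>, and identities in \<open>R\<close> and \<open>S\<close> can be verified there.\<close>

locale tensor_actions = tensor_alg K R S + Rf: aut_family K R m \<sigma> + Sf: aut_family K S n \<rho>
  for K :: "'k ring" and R :: "('k, 'r) module" and S :: "('k, 's) module" and m n :: nat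
    and \<sigma> :: "nat \<Rightarrow> 'r \<Rightarrow> 'r" and \<rho> :: "nat \<Rightarrow> 's \<Rightarrow> 's" +
  fixes \<sigma>T \<rho>T :: "nat \<Rightarrow> ('k, 'r, 's) tens \<Rightarrow> ('k, 'r, 's) tens"
  assumes T_auts: "commuting_automorphisms K (m + n) (tensor_algebra K R S) (comb_aut m \<sigma>T \<rho>T)"
    and \<sigma>_ext: "\<lbrakk>j \<in> {1..m}; r \<in> carrier R\<rbrakk> \<Longrightarrow> \<sigma>T j (tens K R S r \<one>\<^bsub>S\<^esub>) = tens K R S (\<sigma> j r) \<one>\<^bsub>S\<^esub>"
    and \<rho>_ext: "\<lbrakk>i \<in> {1..n}; s \<in> carrier S\<rbrakk> \<Longrightarrow> \<rho>T i (tens K R S \<one>\<^bsub>R\<^esub> s) = tens K R S \<one>\<^bsub>R\<^esub> (\<rho> i s)"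
    and \<rho>_on_R: "i \<in> {1..n}
      \<Longrightarrow> \<rho>T i ` (\<lambda>r. tens K R S r \<one>\<^bsub>S\<^esub>) ` carrier R \<subseteq> (\<lambda>r. tens K R S r \<one>\<^bsub>S\<^esub>) ` carrier R"
    and \<sigma>_on_S: "j \<in> {1..m}
      \<Longrightarrow> \<sigma>T j ` (\<lambda>s. tens K R S \<one>\<^bsub>R\<^esub> s) ` carrier S \<subseteq> (\<lambda>s. tens K R S \<one>\<^bsub>R\<^esub> s) ` carrier S"
    and nontrivial: "\<one>\<^bsub>R\<^esub> \<noteq> \<zero>\<^bsub>R\<^esub>" "\<one>\<^bsub>S\<^esub> \<noteq> \<zero>\<^bsub>S\<^esub>"
begin

abbreviation T where "T \<equiv> tensor_algebra K R S"
abbreviation tT where "tT \<equiv> tens K R S"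
abbreviation \<rho>R where "\<rho>R i \<equiv> act_left K R S (\<rho>T i)"
abbreviation \<sigma>S where "\<sigma>S j \<equiv> act_right K R S (\<sigma>T j)"

text \<open>A functional with value \<open>1\<close> at \<open>1\<close> provides a left inverse of \<open>r \<mapsto> r \<otimes> 1\<close>.\<close>

lemma left_inj: "r \<in> carrier R \<Longrightarrow> r' \<in> carrier R \<Longrightarrow> tT r \<one>\<^bsub>S\<^esub> = tT r' \<one>\<^bsub>S\<^esub> \<Longrightarrow> r = r'"
proof -
  assume r: "r \<in> carrier R" "r' \<in> carrier R" "tT r \<one>\<^bsub>S\<^esub> = tT r' \<one>\<^bsub>S\<^esub>"
  obtain f where f: "f \<in> dual K S" "f \<one>\<^bsub>S\<^esub> = \<one>\<^bsub>K\<^esub>"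
    using vec_space.functional_exists_nonzero[OF k_algebra_vec_space[OF B.k_algebra_axioms] _ nontrivial(2)] by auto
  have "tw.AB.contract_right f (tT r \<one>\<^bsub>S\<^esub>) = tw.AB.contract_right f (tT r' \<one>\<^bsub>S\<^esub>)" using r by simp
  then show "r = r'" using r(1,2) f by (simp add: tw.AB.contract_right_tens[OF f(1)])
qed

lemma right_inj: "s \<in> carrier S \<Longrightarrow> s' \<in> carrier S \<Longrightarrow> tT \<one>\<^bsub>R\<^esub> s = tT \<one>\<^bsub>R\<^esub> s' \<Longrightarrow> s = s'"
proof -
  assume s: "s \<in> carrier S" "s' \<in> carrier S" "tT \<one>\<^bsub>R\<^esub> s = tT \<one>\<^bsub>R\<^esub> s'"
  obtain f where f: "f \<in> dual K R" "f \<one>\<^bsub>R\<^esub> = \<one>\<^bsub>K\<^esub>"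
    using vec_space.functional_exists_nonzero[OF k_algebra_vec_space[OF A.k_algebra_axioms] _ nontrivial(1)] by auto
  have "tw.AB.contract_left f (tT \<one>\<^bsub>R\<^esub> s) = tw.AB.contract_left f (tT \<one>\<^bsub>R\<^esub> s')" using s by simp
  then show "s = s'" using s(1,2) f by (simp add: tw.AB.contract_left_tens[OF f(1)])
qed

lemma \<sigma>T_iso: "j \<in> {1..m} \<Longrightarrow> \<sigma>T j \<in> alg_iso K T T"
  using T_auts unfolding commuting_automorphisms_def comb_aut_def by (auto dest!: bspec[of _ _ j])

lemma \<rho>T_iso: "i \<in> {1..n} \<Longrightarrow> \<rho>T i \<in> alg_iso K T T"
  using T_auts unfolding commuting_automorphisms_def comb_aut_def by (auto dest!: bspec[of _ _ "m + i"])

lemma T_comm: "i \<in> {1..m + n} \<Longrightarrow> j \<in> {1..m + n} \<Longrightarrow> x \<in> carrier (tensor K R S) \<Longrightarrow>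
    comb_aut m \<sigma>T \<rho>T i (comb_aut m \<sigma>T \<rho>T j x) = comb_aut m \<sigma>T \<rho>T j (comb_aut m \<sigma>T \<rho>T i x)"
  using T_auts unfolding commuting_automorphisms_def by simp

lemma \<sigma>T_hom: "j \<in> {1..m} \<Longrightarrow> \<sigma>T j \<in> alg_hom K T T" and \<rho>T_hom: "i \<in> {1..n} \<Longrightarrow> \<rho>T i \<in> alg_hom K T T"
  using \<sigma>T_iso \<rho>T_iso by (simp_all add: alg_iso_iff)

lemma \<rho>R: "i \<in> {1..n} \<Longrightarrow> r \<in> carrier R \<Longrightarrow> \<rho>R i r \<in> carrier R \<and> tT (\<rho>R i r) \<one>\<^bsub>S\<^esub> = \<rho>T i (tT r \<one>\<^bsub>S\<^esub>)"
proof -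
  assume "i \<in> {1..n}" "r \<in> carrier R"
  then have "\<rho>T i (tT r \<one>\<^bsub>S\<^esub>) \<in> (\<lambda>r. tT r \<one>\<^bsub>S\<^esub>) ` carrier R" using \<rho>_on_R by blast
  then show ?thesis unfolding act_left_def
    using f_inv_into_f[of "\<rho>T i (tT r \<one>\<^bsub>S\<^esub>)" "\<lambda>r. tT r \<one>\<^bsub>S\<^esub>" "carrier R"]
      inv_into_into[of "\<rho>T i (tT r \<one>\<^bsub>S\<^esub>)" "\<lambda>r. tT r \<one>\<^bsub>S\<^esub>" "carrier R"] by blast
qed

lemma \<sigma>S: "j \<in> {1..m} \<Longrightarrow> s \<in> carrier S \<Longrightarrow> \<sigma>S j s \<in> carrier S \<and> tT \<one>\<^bsub>R\<^esub> (\<sigma>S j s) = \<sigma>T j (tT \<one>\<^bsub>R\<^esub> s)"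
proof -
  assume "j \<in> {1..m}" "s \<in> carrier S"
  then have "\<sigma>T j (tT \<one>\<^bsub>R\<^esub> s) \<in> (\<lambda>s. tT \<one>\<^bsub>R\<^esub> s) ` carrier S" using \<sigma>_on_S by blast
  then show ?thesis unfolding act_right_def
    using f_inv_into_f[of "\<sigma>T j (tT \<one>\<^bsub>R\<^esub> s)" "\<lambda>s. tT \<one>\<^bsub>R\<^esub> s" "carrier S"]
      inv_into_into[of "\<sigma>T j (tT \<one>\<^bsub>R\<^esub> s)" "\<lambda>s. tT \<one>\<^bsub>R\<^esub> s" "carrier S"] by blast
qed

lemma tens_split: "r \<in> carrier R \<Longrightarrow> s \<in> carrier S \<Longrightarrow> tT r s = tT r \<one>\<^bsub>S\<^esub> \<otimes>\<^bsub>T\<^esub> tT \<one>\<^bsub>R\<^esub> s"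
  by (simp add: tens_mult)

lemma \<rho>T_tens: "i \<in> {1..n} \<Longrightarrow> r \<in> carrier R \<Longrightarrow> s \<in> carrier S \<Longrightarrow> \<rho>T i (tT r s) = tT (\<rho>R i r) (\<rho> i s)"
proof -
  assume a: "i \<in> {1..n}" "r \<in> carrier R" "s \<in> carrier S"
  have s: "\<rho> i s \<in> carrier S" using Sf.sg_closed[of "int i" s] a by simp
  have "\<rho>T i (tT r s) = \<rho>T i (tT r \<one>\<^bsub>S\<^esub>) \<otimes>\<^bsub>T\<^esub> \<rho>T i (tT \<one>\<^bsub>R\<^esub> s)"
    unfolding tens_split[OF a(2,3)] using a by (intro alg_homD(5)[OF \<rho>T_hom]) simp_all
  also have "\<dots> = tT (\<rho>R i r) \<one>\<^bsub>S\<^esub> \<otimes>\<^bsub>T\<^esub> tT \<one>\<^bsub>R\<^esub> (\<rho> i s)" using \<rho>R[OF a(1,2)] \<rho>_ext[OF a(1,3)] by simp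
  finally show ?thesis using tens_split[of "\<rho>R i r" "\<rho> i s"] \<rho>R[OF a(1,2)] s by simp
qed

lemma \<sigma>T_tens: "j \<in> {1..m} \<Longrightarrow> r \<in> carrier R \<Longrightarrow> s \<in> carrier S \<Longrightarrow> \<sigma>T j (tT r s) = tT (\<sigma> j r) (\<sigma>S j s)"
proof -
  assume a: "j \<in> {1..m}" "r \<in> carrier R" "s \<in> carrier S"
  have r: "\<sigma> j r \<in> carrier R" using Rf.sg_closed[of "int j" r] a by simp
  have "\<sigma>T j (tT r s) = \<sigma>T j (tT r \<one>\<^bsub>S\<^esub>) \<otimes>\<^bsub>T\<^esub> \<sigma>T j (tT \<one>\<^bsub>R\<^esub> s)"
    unfolding tens_split[OF a(2,3)] using a by (intro alg_homD(5)[OF \<sigma>T_hom]) simp_all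
  also have "\<dots> = tT (\<sigma> j r) \<one>\<^bsub>S\<^esub> \<otimes>\<^bsub>T\<^esub> tT \<one>\<^bsub>R\<^esub> (\<sigma>S j s)" using \<sigma>S[OF a(1,3)] \<sigma>_ext[OF a(1,2)] by simp
  finally show ?thesis using tens_split[of "\<sigma> j r" "\<sigma>S j s"] \<sigma>S[OF a(1,3)] r by simp
qed

text \<open>Surjectivity: \<open>\<rho>\<^sub>i\<close> on \<open>R \<otimes> S\<close> is the tensor product of its actions on the factors; if \<open>f\<close> is a functional on \<open>S\<close>
  with \<open>f 1 = 1\<close> and \<open>\<rho>\<^sub>i z = r \<otimes> 1\<close>, then applying \<open>id \<otimes> f\<close> shows that \<open>r\<close> is the image of \<open>(id \<otimes> f \<rho>\<^sub>i) z\<close>.\<close>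

lemma \<rho>R_iso: assumes i: "i \<in> {1..n}" shows "\<rho>R i \<in> alg_iso K R R"
proof -
  note \<rho>R' = \<rho>R[OF i]
  note h = alg_homD(2-)[OF \<rho>T_hom[OF i], simplified]
  have cl: "\<rho>R i r \<in> carrier R" if "r \<in> carrier R" for r using \<rho>R' that by blast
  have im: "tT (\<rho>R i r) \<one>\<^bsub>S\<^esub> = \<rho>T i (tT r \<one>\<^bsub>S\<^esub>)" if "r \<in> carrier R" for r using \<rho>R' that by blast
  have hom: "\<rho>R i \<in> alg_hom K R R"
  proof (intro alg_homI lin_homI)
    show "\<rho>R i \<one>\<^bsub>R\<^esub> = \<one>\<^bsub>R\<^esub>" by (rule left_inj) (simp_all add: cl im h)
    fix r assume r: "r \<in> carrier R"
    show "\<rho>R i r \<in> carrier R" using cl r by blast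
    { fix c assume c: "c \<in> carrier K"
      show "\<rho>R i (c \<odot>\<^bsub>R\<^esub> r) = c \<odot>\<^bsub>R\<^esub> \<rho>R i r"
        by (rule left_inj) (use r c in \<open>simp_all add: cl im h tw.AB.tens_smult_left\<close>) }
    fix r' assume r': "r' \<in> carrier R"
    show "\<rho>R i (r \<oplus>\<^bsub>R\<^esub> r') = \<rho>R i r \<oplus>\<^bsub>R\<^esub> \<rho>R i r'"
      by (rule left_inj) (use r r' in \<open>simp_all add: cl im h tw.AB.tens_add_left\<close>)
    have e: "tT (a \<otimes>\<^bsub>R\<^esub> b) \<one>\<^bsub>S\<^esub> = tT a \<one>\<^bsub>S\<^esub> \<otimes>\<^bsub>T\<^esub> tT b \<one>\<^bsub>S\<^esub>" if "a \<in> carrier R" "b \<in> carrier R" for a b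
      using that by (simp add: tens_mult)
    show "\<rho>R i (r \<otimes>\<^bsub>R\<^esub> r') = \<rho>R i r \<otimes>\<^bsub>R\<^esub> \<rho>R i r'"
      by (rule left_inj) (use r r' in \<open>simp_all add: cl im h e\<close>)
  qed
  have bij: "bij_betw (\<rho>T i) (carrier (tensor K R S)) (carrier (tensor K R S))"
    using \<rho>T_iso[OF i] by (simp add: alg_iso_iff)
  have inj: "inj_on (\<rho>R i) (carrier R)"
  proof (rule inj_onI)
    fix r r' assume r: "r \<in> carrier R" "r' \<in> carrier R" "\<rho>R i r = \<rho>R i r'"
    then have "\<rho>T i (tT r \<one>\<^bsub>S\<^esub>) = \<rho>T i (tT r' \<one>\<^bsub>S\<^esub>)" using im by metis
    then have "tT r \<one>\<^bsub>S\<^esub> = tT r' \<one>\<^bsub>S\<^esub>" using bij r by (auto simp: bij_betw_def dest: inj_onD)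
    then show "r = r'" using left_inj r by blast
  qed
  have "r \<in> \<rho>R i ` carrier R" if r: "r \<in> carrier R" for r
  proof -
    have "tT r \<one>\<^bsub>S\<^esub> \<in> \<rho>T i ` carrier (tensor K R S)" using bij r by (simp add: bij_betw_def)
    then obtain z where z: "z \<in> carrier (tensor K R S)" "\<rho>T i z = tT r \<one>\<^bsub>S\<^esub>" by (metis imageE)
    obtain f where f: "f \<in> dual K S" "f \<one>\<^bsub>S\<^esub> = \<one>\<^bsub>K\<^esub>"
      using vec_space.functional_exists_nonzero[OF k_algebra_vec_space[OF B.k_algebra_axioms] _ nontrivial(2)] by auto
    have sh: "\<rho> i \<in> lin_hom K S S" using alg_homD(1)[OF Sf.sg_hom[of "int i"]] i by simp
    note f' = dual_comp[OF f(1) sh]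
    have hl: "\<rho>T i \<in> lin_hom K (tensor K R S) (tensor K R S)"
      using alg_homD(1)[OF \<rho>T_hom[OF i]] by (simp add: lin_hom_def)
    have "tw.AB.contract_right f (\<rho>T i z) = \<rho>R i (tw.AB.contract_right (\<lambda>s. f (\<rho> i s)) z)"
    proof (rule tw.AB.tensor_linear_eqI[OF _ _ k_algebra_vec_space[OF A.k_algebra_axioms] _ z(1)])
      show "(\<lambda>z. tw.AB.contract_right f (\<rho>T i z)) \<in> lin_hom K (tensor K R S) R"
        by (rule lin_hom_comp[OF hl tw.AB.contract_right_linear[OF f(1)]])
      show "(\<lambda>z. \<rho>R i (tw.AB.contract_right (\<lambda>s. f (\<rho> i s)) z)) \<in> lin_hom K (tensor K R S) R"
        by (rule lin_hom_comp[OF tw.AB.contract_right_linear[OF f'] alg_homD(1)[OF hom]])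
      fix x y assume xy: "x \<in> carrier R" "y \<in> carrier S"
      then show "tw.AB.contract_right f (\<rho>T i (tT x y)) = \<rho>R i (tw.AB.contract_right (\<lambda>s. f (\<rho> i s)) (tT x y))"
        using cl lin_homD(1)[OF sh] dualD(1)[OF f']
        by (simp add: \<rho>T_tens[OF i] tw.AB.contract_right_tens[OF f(1)] tw.AB.contract_right_tens[OF f'] alg_homD(4)[OF hom])
    qed
    then have "r = \<rho>R i (tw.AB.contract_right (\<lambda>s. f (\<rho> i s)) z)"
      using r f(2) by (simp add: z(2) tw.AB.contract_right_tens[OF f(1)])
    then show ?thesis using lin_homD(1)[OF tw.AB.contract_right_linear[OF f'] z(1)] by blast
  qed
  then have "\<rho>R i ` carrier R = carrier R" using cl by blast
  then show ?thesis using hom inj by (simp add: alg_iso_iff bij_betw_def)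
qed

lemma \<sigma>S_iso: assumes j: "j \<in> {1..m}" shows "\<sigma>S j \<in> alg_iso K S S"
proof -
  note \<sigma>S' = \<sigma>S[OF j]
  note h = alg_homD(2-)[OF \<sigma>T_hom[OF j], simplified]
  have cl: "\<sigma>S j s \<in> carrier S" if "s \<in> carrier S" for s using \<sigma>S' that by blast
  have im: "tT \<one>\<^bsub>R\<^esub> (\<sigma>S j s) = \<sigma>T j (tT \<one>\<^bsub>R\<^esub> s)" if "s \<in> carrier S" for s using \<sigma>S' that by blast
  have hom: "\<sigma>S j \<in> alg_hom K S S"
  proof (intro alg_homI lin_homI)
    show "\<sigma>S j \<one>\<^bsub>S\<^esub> = \<one>\<^bsub>S\<^esub>" by (rule right_inj) (simp_all add: cl im h)
    fix s assume s: "s \<in> carrier S"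
    show "\<sigma>S j s \<in> carrier S" using cl s by blast
    { fix c assume c: "c \<in> carrier K"
      show "\<sigma>S j (c \<odot>\<^bsub>S\<^esub> s) = c \<odot>\<^bsub>S\<^esub> \<sigma>S j s"
        by (rule right_inj) (use s c in \<open>simp_all add: cl im h tw.AB.tens_smult_right\<close>) }
    fix s' assume s': "s' \<in> carrier S"
    show "\<sigma>S j (s \<oplus>\<^bsub>S\<^esub> s') = \<sigma>S j s \<oplus>\<^bsub>S\<^esub> \<sigma>S j s'"
      by (rule right_inj) (use s s' in \<open>simp_all add: cl im h tw.AB.tens_add_right\<close>)
    have e: "tT \<one>\<^bsub>R\<^esub> (a \<otimes>\<^bsub>S\<^esub> b) = tT \<one>\<^bsub>R\<^esub> a \<otimes>\<^bsub>T\<^esub> tT \<one>\<^bsub>R\<^esub> b" if "a \<in> carrier S" "b \<in> carrier S" for a b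
      using that by (simp add: tens_mult)
    show "\<sigma>S j (s \<otimes>\<^bsub>S\<^esub> s') = \<sigma>S j s \<otimes>\<^bsub>S\<^esub> \<sigma>S j s'"
      by (rule right_inj) (use s s' in \<open>simp_all add: cl im h e\<close>)
  qed
  have bij: "bij_betw (\<sigma>T j) (carrier (tensor K R S)) (carrier (tensor K R S))"
    using \<sigma>T_iso[OF j] by (simp add: alg_iso_iff)
  have inj: "inj_on (\<sigma>S j) (carrier S)"
  proof (rule inj_onI)
    fix s s' assume s: "s \<in> carrier S" "s' \<in> carrier S" "\<sigma>S j s = \<sigma>S j s'"
    then have "\<sigma>T j (tT \<one>\<^bsub>R\<^esub> s) = \<sigma>T j (tT \<one>\<^bsub>R\<^esub> s')" using im by metis
    then have "tT \<one>\<^bsub>R\<^esub> s = tT \<one>\<^bsub>R\<^esub> s'" using bij s by (auto simp: bij_betw_def dest: inj_onD)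
    then show "s = s'" using right_inj s by blast
  qed
  have "s \<in> \<sigma>S j ` carrier S" if s: "s \<in> carrier S" for s
  proof -
    have "tT \<one>\<^bsub>R\<^esub> s \<in> \<sigma>T j ` carrier (tensor K R S)" using bij s by (simp add: bij_betw_def)
    then obtain z where z: "z \<in> carrier (tensor K R S)" "\<sigma>T j z = tT \<one>\<^bsub>R\<^esub> s" by (metis imageE)
    obtain f where f: "f \<in> dual K R" "f \<one>\<^bsub>R\<^esub> = \<one>\<^bsub>K\<^esub>"
      using vec_space.functional_exists_nonzero[OF k_algebra_vec_space[OF A.k_algebra_axioms] _ nontrivial(1)] by auto
    have rh: "\<sigma> j \<in> lin_hom K R R" using alg_homD(1)[OF Rf.sg_hom[of "int j"]] j by simp
    note f' = dual_comp[OF f(1) rh]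
    have hl: "\<sigma>T j \<in> lin_hom K (tensor K R S) (tensor K R S)"
      using alg_homD(1)[OF \<sigma>T_hom[OF j]] by (simp add: lin_hom_def)
    have "tw.AB.contract_left f (\<sigma>T j z) = \<sigma>S j (tw.AB.contract_left (\<lambda>r. f (\<sigma> j r)) z)"
    proof (rule tw.AB.tensor_linear_eqI[OF _ _ k_algebra_vec_space[OF B.k_algebra_axioms] _ z(1)])
      show "(\<lambda>z. tw.AB.contract_left f (\<sigma>T j z)) \<in> lin_hom K (tensor K R S) S"
        by (rule lin_hom_comp[OF hl tw.AB.contract_left_linear[OF f(1)]])
      show "(\<lambda>z. \<sigma>S j (tw.AB.contract_left (\<lambda>r. f (\<sigma> j r)) z)) \<in> lin_hom K (tensor K R S) S"
        by (rule lin_hom_comp[OF tw.AB.contract_left_linear[OF f'] alg_homD(1)[OF hom]])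
      fix x y assume xy: "x \<in> carrier R" "y \<in> carrier S"
      then show "tw.AB.contract_left f (\<sigma>T j (tT x y)) = \<sigma>S j (tw.AB.contract_left (\<lambda>r. f (\<sigma> j r)) (tT x y))"
        using cl lin_homD(1)[OF rh] dualD(1)[OF f']
        by (simp add: \<sigma>T_tens[OF j] tw.AB.contract_left_tens[OF f(1)] tw.AB.contract_left_tens[OF f'] alg_homD(4)[OF hom])
    qed
    then have "s = \<sigma>S j (tw.AB.contract_left (\<lambda>r. f (\<sigma> j r)) z)"
      using s f(2) by (simp add: z(2) tw.AB.contract_left_tens[OF f(1)])
    then show ?thesis using lin_homD(1)[OF tw.AB.contract_left_linear[OF f'] z(1)] by blast
  qed
  then have "\<sigma>S j ` carrier S = carrier S" using cl by blast
  then show ?thesis using hom inj by (simp add: alg_iso_iff bij_betw_def)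
qed

lemma \<rho>R_\<sigma>: "i \<in> {1..n} \<Longrightarrow> j \<in> {1..m} \<Longrightarrow> r \<in> carrier R \<Longrightarrow> \<rho>R i (\<sigma> j r) = \<sigma> j (\<rho>R i r)"
proof -
  assume a: "i \<in> {1..n}" "j \<in> {1..m}" "r \<in> carrier R"
  have c: "\<sigma> j r \<in> carrier R" "\<rho>R i r \<in> carrier R" "\<sigma> j (\<rho>R i r) \<in> carrier R" "\<rho>R i (\<sigma> j r) \<in> carrier R"
    using Rf.sg_closed[of "int j"] \<rho>R a by simp_all
  have "\<rho>T i (\<sigma>T j (tT r \<one>\<^bsub>S\<^esub>)) = \<sigma>T j (\<rho>T i (tT r \<one>\<^bsub>S\<^esub>))"
    using T_comm[of "m + i" j "tT r \<one>\<^bsub>S\<^esub>"] a by (simp add: comb_aut_def)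
  then have "tT (\<rho>R i (\<sigma> j r)) \<one>\<^bsub>S\<^esub> = tT (\<sigma> j (\<rho>R i r)) \<one>\<^bsub>S\<^esub>"
    using \<rho>R[OF a(1) c(1)] \<rho>R[OF a(1,3)] \<sigma>_ext[OF a(2,3)] \<sigma>_ext[OF a(2) c(2)] by metis
  then show ?thesis by (rule left_inj[OF c(4,3)])
qed

lemma \<sigma>S_\<rho>: "i \<in> {1..n} \<Longrightarrow> j \<in> {1..m} \<Longrightarrow> s \<in> carrier S \<Longrightarrow> \<sigma>S j (\<rho> i s) = \<rho> i (\<sigma>S j s)"
proof -
  assume a: "i \<in> {1..n}" "j \<in> {1..m}" "s \<in> carrier S"
  have c: "\<rho> i s \<in> carrier S" "\<sigma>S j s \<in> carrier S" "\<rho> i (\<sigma>S j s) \<in> carrier S" "\<sigma>S j (\<rho> i s) \<in> carrier S"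
    using Sf.sg_closed[of "int i"] \<sigma>S a by simp_all
  have "\<sigma>T j (\<rho>T i (tT \<one>\<^bsub>R\<^esub> s)) = \<rho>T i (\<sigma>T j (tT \<one>\<^bsub>R\<^esub> s))"
    using T_comm[of j "m + i" "tT \<one>\<^bsub>R\<^esub> s"] a by (simp add: comb_aut_def)
  then have "tT \<one>\<^bsub>R\<^esub> (\<sigma>S j (\<rho> i s)) = tT \<one>\<^bsub>R\<^esub> (\<rho> i (\<sigma>S j s))"
    using \<sigma>S[OF a(2) c(1)] \<sigma>S[OF a(2,3)] \<rho>_ext[OF a(1,3)] \<rho>_ext[OF a(1) c(2)] by metis
  then show ?thesis by (rule right_inj[OF c(4,3)])
qed

lemma \<rho>R_auts: "commuting_automorphisms K n R \<rho>R"
  unfolding commuting_automorphisms_def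
proof (intro conjI ballI \<rho>R_iso)
  fix i j r assume a: "i \<in> {1..n}" "j \<in> {1..n}" "r \<in> carrier R"
  have "\<rho>T i (\<rho>T j (tT r \<one>\<^bsub>S\<^esub>)) = \<rho>T j (\<rho>T i (tT r \<one>\<^bsub>S\<^esub>))"
    using T_comm[of "m + i" "m + j" "tT r \<one>\<^bsub>S\<^esub>"] a by (simp add: comb_aut_def)
  then have "tT (\<rho>R i (\<rho>R j r)) \<one>\<^bsub>S\<^esub> = tT (\<rho>R j (\<rho>R i r)) \<one>\<^bsub>S\<^esub>" using a \<rho>R by simp
  moreover have "\<rho>R i (\<rho>R j r) \<in> carrier R" "\<rho>R j (\<rho>R i r) \<in> carrier R" using a \<rho>R by simp_all
  ultimately show "\<rho>R i (\<rho>R j r) = \<rho>R j (\<rho>R i r)" by (intro left_inj)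
qed

lemma \<sigma>S_auts: "commuting_automorphisms K m S \<sigma>S"
  unfolding commuting_automorphisms_def
proof (intro conjI ballI \<sigma>S_iso)
  fix i j s assume a: "i \<in> {1..m}" "j \<in> {1..m}" "s \<in> carrier S"
  have "\<sigma>T i (\<sigma>T j (tT \<one>\<^bsub>R\<^esub> s)) = \<sigma>T j (\<sigma>T i (tT \<one>\<^bsub>R\<^esub> s))"
    using T_comm[of i j "tT \<one>\<^bsub>R\<^esub> s"] a by (simp add: comb_aut_def)
  then have "tT \<one>\<^bsub>R\<^esub> (\<sigma>S i (\<sigma>S j s)) = tT \<one>\<^bsub>R\<^esub> (\<sigma>S j (\<sigma>S i s))" using a \<sigma>S by simp
  moreover have "\<sigma>S i (\<sigma>S j s) \<in> carrier S" "\<sigma>S j (\<sigma>S i s) \<in> carrier S" using a \<sigma>S by simp_all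
  ultimately show "\<sigma>S i (\<sigma>S j s) = \<sigma>S j (\<sigma>S i s)" by (intro right_inj)
qed

end


section \<open>The theorem\<close>

context combined_datum
begin

text \<open>If \<open>R\<close> or \<open>S\<close> is the zero ring, then \<open>R \<otimes> S\<close> and \<open>A \<otimes> B\<close> are zero and the zero map is a twisting map. The general argument
  does not cover this case, as it uses functionals with value \<open>1\<close> at \<open>1\<close>.\<close>

lemma degenerate_case:
  assumes triv: "\<one>\<^bsub>R\<^esub> = \<zero>\<^bsub>R\<^esub> \<or> \<one>\<^bsub>S\<^esub> = \<zero>\<^bsub>S\<^esub>"
    and \<tau>: "\<tau> \<in> lin_hom K (tensor K SD.C RC.C) (tensor K RC.C SD.C)"
  shows "\<exists>\<tau>'. twisting_map K RC.A SD.A \<tau>'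
      \<and> (\<forall>z\<in>carrier (tensor K SD.C RC.C).
            \<tau>' (tensor_map K SD.A RC.A SD.prA RC.prA z) = tensor_map K RC.A SD.A RC.prA SD.prA (\<tau> z))
      \<and> k_algebra K (twisted_tensor K RC.A SD.A \<tau>')
      \<and> regular_consistent K (m + n) \<eta> T \<pi> w
      \<and> alg_iso K (TGWA K (m + n) \<eta> T \<pi> w) (twisted_tensor K RC.A SD.A \<tau>') \<noteq> {}"
proof -
  interpret AB: tensor_prod K RC.A SD.A
    using RC.Aa.A_vec_space SD.Aa.A_vec_space by (simp add: tensor_prod_def)
  have sA: "a = \<zero>\<^bsub>RC.A\<^esub>" if "\<one>\<^bsub>R\<^esub> = \<zero>\<^bsub>R\<^esub>" "a \<in> carrier RC.A" for a
  proof -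
    have "\<one>\<^bsub>RC.A\<^esub> = \<zero>\<^bsub>RC.A\<^esub>" using RC.Ar.\<iota>_zero alg_homD(6)[OF RC.Ar.\<iota>_hom] that(1) by metis
    then show ?thesis using RC.Ar.A.l_one[OF that(2)] RC.Ar.A.l_null[OF that(2)] by metis
  qed
  have sB: "b = \<zero>\<^bsub>SD.A\<^esub>" if "\<one>\<^bsub>S\<^esub> = \<zero>\<^bsub>S\<^esub>" "b \<in> carrier SD.A" for b
  proof -
    have "\<one>\<^bsub>SD.A\<^esub> = \<zero>\<^bsub>SD.A\<^esub>" using SD.Ar.\<iota>_zero alg_homD(6)[OF SD.Ar.\<iota>_hom] that(1) by metis
    then show ?thesis using SD.Ar.A.l_one[OF that(2)] SD.Ar.A.l_null[OF that(2)] by metis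
  qed
  have AB0: "z = \<zero>\<^bsub>tensor K RC.A SD.A\<^esub>" if "z \<in> carrier (tensor K RC.A SD.A)" for z
    using that
  proof (induction rule: AB.tensor_induct)
    case (add x y z)
    then show ?case using triv sA[of x] sB[of y] by auto
  qed simp
  have T0: "z = \<zero>\<^bsub>tensor K R S\<^esub>" if "z \<in> carrier (tensor K R S)" for z
    using that
  proof (induction rule: TA.tw.AB.tensor_induct)
    case (add x y z)
    have "x = \<zero>\<^bsub>R\<^esub> \<or> y = \<zero>\<^bsub>S\<^esub>"
      using triv RC.R.l_one[OF add(1)] RC.R.l_null[OF add(1)] SD.R.l_one[OF add(2)] SD.R.l_null[OF add(2)] by metis
    then show ?case using add by auto
  qed simp
  define \<tau>' :: "('k, ('k, 's) tgwc set, ('k, 'r) tgwc set) tens \<Rightarrow> ('k, ('k, 'r) tgwc set, ('k, 's) tgwc set) tens"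
    where "\<tau>' = (\<lambda>_. \<zero>\<^bsub>tensor K RC.A SD.A\<^esub>)"
  have \<tau>'_lin: "\<tau>' \<in> lin_hom K (tensor K SD.A RC.A) (tensor K RC.A SD.A)"
    unfolding \<tau>'_def by (rule zero_lin_hom[OF AB.TT_vec_space])
  interpret tw: twist K RC.A SD.A \<tau>'
    by (intro twist.intro twist_axioms.intro RC.A_k_algebra SD.A_k_algebra \<tau>'_lin)
  let ?W = "twisted_tensor K RC.A SD.A \<tau>'"
  have W0: "x = y" if "x \<in> carrier (tensor K RC.A SD.A)" "y \<in> carrier (tensor K RC.A SD.A)" for x y
    using AB0[OF that(1)] AB0[OF that(2)] by simp
  have tw: "twisting_map K RC.A SD.A \<tau>'"
    unfolding twisting_map_def using \<tau>'_lin AB0 by (auto simp: \<tau>'_def intro!: HOL.sym[OF AB0])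
  have mc: "x \<otimes>\<^bsub>?W\<^esub> y \<in> carrier (tensor K RC.A SD.A)" if "x \<in> carrier (tensor K RC.A SD.A)" "y \<in> carrier (tensor K RC.A SD.A)" for x y
    using lin_homD(1)[OF tw.mult_linear_left[OF that(2)] that(1)] by simp
  have W: "k_algebra K ?W"
  proof (rule tw.twisted_k_algebra[OF tw RC.Ar.monoms_carrier RC.Aa.span_monoms SD.Ar.monoms_carrier SD.Aa.span_monoms])
    fix a b a' b' a'' b''
    assume "a \<in> RC.Ar.monoms" "b \<in> SD.Ar.monoms" "a' \<in> RC.Ar.monoms" "b' \<in> SD.Ar.monoms" "a'' \<in> RC.Ar.monoms" "b'' \<in> SD.Ar.monoms"
    then have "AB.tn a b \<in> carrier (tensor K RC.A SD.A)" "AB.tn a' b' \<in> carrier (tensor K RC.A SD.A)" "AB.tn a'' b'' \<in> carrier (tensor K RC.A SD.A)"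
      using RC.Ar.monoms_carrier SD.Ar.monoms_carrier by (auto intro!: AB.tens_closed)
    then show "AB.tn a b \<otimes>\<^bsub>?W\<^esub> AB.tn a' b' \<otimes>\<^bsub>?W\<^esub> AB.tn a'' b'' = AB.tn a b \<otimes>\<^bsub>?W\<^esub> (AB.tn a' b' \<otimes>\<^bsub>?W\<^esub> AB.tn a'' b'')"
      by (intro W0 mc)
  qed
  interpret W: k_algebra K ?W by (rule W)
  have Weq: "x = y" if "x \<in> carrier ?W" "y \<in> carrier ?W" for x y using that W0 by simp
  define z0 where "z0 = \<zero>\<^bsub>?W\<^esub>"
  have z0: "z0 \<in> carrier ?W" unfolding z0_def by (rule W.zero_closed)
  interpret Wr: tgw_rel K "m + n" \<eta> T \<pi> w ?W "\<lambda>_. z0" "\<lambda>_. z0"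
  proof (intro tgw_rel.intro TD.tgw_datum_axioms W tgw_rel_axioms.intro)
    show "(\<lambda>_. z0) \<in> alg_hom K T ?W"
      using z0 by (intro alg_homI lin_homI Weq) (blast intro: W.m_closed W.a_closed W.smult_closed W.one_closed)+
  next
    fix i j assume "i \<in> {1..m + n}" "j \<in> {1..m + n}" "i \<noteq> j"
    then show "z0 \<otimes>\<^bsub>?W\<^esub> z0 = \<eta> i j \<odot>\<^bsub>?W\<^esub> (z0 \<otimes>\<^bsub>?W\<^esub> z0)"
      using TD.\<mu>_nonzero[of i j] by (intro Weq W.m_closed W.smult_closed z0)
  next
    show "z0 \<otimes>\<^bsub>?W\<^esub> z0 = z0" by (intro Weq W.m_closed z0)
  qed (rule z0 HOL.refl)+
  interpret Wn: tgw_nondeg K "m + n" \<eta> T \<pi> w ?W "\<lambda>_. z0" "\<lambda>_. z0" "\<lambda>x. x"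
  proof (intro tgw_nondeg.intro tgw_proj.intro tgw_alg.intro Wr.tgw_rel_axioms tgw_alg_axioms.intro
      tgw_proj_axioms.intro tgw_nondeg_axioms.intro id_lin_hom)
    show "carrier ?W \<subseteq> add_span ?W Wr.monoms"
    proof
      fix x assume "x \<in> carrier ?W"
      then have "x = \<zero>\<^bsub>?W\<^esub>" using Weq W.zero_closed by blast
      then show "x \<in> add_span ?W Wr.monoms" using add_span.zero[of ?W] by simp
    qed
  next
    fix r us assume "r \<in> carrier T" "us \<in> lists (pm (m + n))"
    then have "Wr.mon r us \<in> carrier ?W" by (rule Wr.mon_closed)
    then show "Wr.mon r us = (if word_degree us = (\<lambda>_. 0) then Wr.mon r us else \<zero>\<^bsub>?W\<^esub>)"
      using Weq W.zero_closed by presburger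
  next
    show "r = \<zero>\<^bsub>T\<^esub>" if "r \<in> carrier T" for r using T0[of r] that by simp
  next
    fix z assume "z \<in> carrier ?W" "z \<noteq> \<zero>\<^bsub>?W\<^esub>"
    then show "\<exists>a\<in>carrier ?W. \<exists>b\<in>carrier ?W. a \<otimes>\<^bsub>?W\<^esub> z \<otimes>\<^bsub>?W\<^esub> b \<noteq> \<zero>\<^bsub>?W\<^esub>" using Weq W.zero_closed by blast
  qed
  interpret CD: tensor_prod K RC.C SD.C
    using RC.Ca.A_vec_space SD.Ca.A_vec_space by (simp add: tensor_prod_def)
  interpret PP: tensor_prod_map K RC.C SD.C RC.A SD.A RC.prA SD.prA
    by unfold_locales (rule alg_homD(1)[OF RC.prA_hom] alg_homD(1)[OF SD.prA_hom])+
  have "\<tau>' (tensor_map K SD.A RC.A SD.prA RC.prA z) = tensor_map K RC.A SD.A RC.prA SD.prA (\<tau> z)"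
    if "z \<in> carrier (tensor K SD.C RC.C)" for z
    unfolding \<tau>'_def by (rule HOL.sym, rule AB0, rule lin_homD(1)[OF PP.map_linear], rule lin_homD(1)[OF \<tau> that])
  then show ?thesis
    using tw W Wn.tgwa_iso T_tgwd \<eta>_nonzero T_regular unfolding regular_consistent_def by blast
qed

end

theorem theorem3p17:
  fixes K :: "'k ring"
    and R :: "('k, 'r) module" and S :: "('k, 's) module"
    and m n :: nat
    and \<mu> \<nu> :: "nat \<Rightarrow> nat \<Rightarrow> 'k"
    and \<sigma> :: "nat \<Rightarrow> 'r \<Rightarrow> 'r" and t :: "nat \<Rightarrow> 'r"
    and \<rho> :: "nat \<Rightarrow> 's \<Rightarrow> 's" and h :: "nat \<Rightarrow> 's"
    and \<sigma>T \<rho>T :: "nat \<Rightarrow> ('k, 'r, 's) tens \<Rightarrow> ('k, 'r, 's) tens"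
    and q :: "nat \<Rightarrow> nat \<Rightarrow> int \<Rightarrow> int \<Rightarrow> 'k"
    and \<tau> :: "('k, ('k, 's) tgwc, ('k, 'r) tgwc) tens \<Rightarrow> ('k, ('k, 'r) tgwc, ('k, 's) tgwc) tens"
  defines "C \<equiv> TGWC K m \<mu> R \<sigma> t" and "A \<equiv> TGWA K m \<mu> R \<sigma> t"
    and "D \<equiv> TGWC K n \<nu> S \<rho> h" and "B \<equiv> TGWA K n \<nu> S \<rho> h"
    and "pA \<equiv> tgwa_proj K m \<mu> R \<sigma> t" and "pB \<equiv> tgwa_proj K n \<nu> S \<rho> h"
    and "T \<equiv> tensor_algebra K R S"
    and "\<sigma>S \<equiv> \<lambda>j. act_right K R S (\<sigma>T j)" and "\<rho>R \<equiv> \<lambda>i. act_left K R S (\<rho>T i)"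
    and "\<pi> \<equiv> comb_aut m \<sigma>T \<rho>T" and "w \<equiv> comb_elem K R S m t h"
    and "\<eta> \<equiv> comb_matrix K m \<mu> \<nu> q"
  assumes K: "field K"
    and C: "regular_consistent K m \<mu> R \<sigma> t"
    and D: "regular_consistent K n \<nu> S \<rho> h"
    and commuting: "commuting_automorphisms K (m + n) T \<pi>"
    and \<sigma>_extends: "\<And>j r. \<lbrakk>j \<in> {1..m}; r \<in> carrier R\<rbrakk>
      \<Longrightarrow> \<sigma>T j (tens K R S r \<one>\<^bsub>S\<^esub>) = tens K R S (\<sigma> j r) \<one>\<^bsub>S\<^esub>"
    and \<rho>_extends: "\<And>i s. \<lbrakk>i \<in> {1..n}; s \<in> carrier S\<rbrakk>
      \<Longrightarrow> \<rho>T i (tens K R S \<one>\<^bsub>R\<^esub> s) = tens K R S \<one>\<^bsub>R\<^esub> (\<rho> i s)"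
    and \<rho>_on_R: "\<And>i. i \<in> {1..n}
      \<Longrightarrow> \<rho>T i ` (\<lambda>r. tens K R S r \<one>\<^bsub>S\<^esub>) ` carrier R \<subseteq> (\<lambda>r. tens K R S r \<one>\<^bsub>S\<^esub>) ` carrier R"
    and \<sigma>_on_S: "\<And>j. j \<in> {1..m}
      \<Longrightarrow> \<sigma>T j ` (\<lambda>s. tens K R S \<one>\<^bsub>R\<^esub> s) ` carrier S \<subseteq> (\<lambda>s. tens K R S \<one>\<^bsub>R\<^esub> s) ` carrier S"
    and q_nonzero: "\<And>i j a b. \<lbrakk>i \<in> {1..n}; j \<in> {1..m}; a \<in> {1, -1}; b \<in> {1, -1}\<rbrakk>
      \<Longrightarrow> q i j a b \<in> carrier K - {\<zero>\<^bsub>K\<^esub>}"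
    and \<rho>_t: "\<And>i j. \<lbrakk>i \<in> {1..n}; j \<in> {1..m}\<rbrakk>
      \<Longrightarrow> \<rho>R i (t j) = (q i j 1 (-1) \<otimes>\<^bsub>K\<^esub> q i j 1 1) \<odot>\<^bsub>R\<^esub> t j"
    and \<sigma>_h: "\<And>i j. \<lbrakk>i \<in> {1..n}; j \<in> {1..m}\<rbrakk>
      \<Longrightarrow> \<sigma>S j (h i) = (q i j (-1) (-1) \<otimes>\<^bsub>K\<^esub> q i j 1 (-1)) \<odot>\<^bsub>S\<^esub> h i"
    and \<tau>_linear: "\<tau> \<in> lin_hom K (tensor K D C) (tensor K C D)"
    and \<tau>_monom: "\<And>r s us vs.
      \<lbrakk>r \<in> carrier R; s \<in> carrier S; us \<in> lists (pm m); vs \<in> lists (pm n)\<rbrakk>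
      \<Longrightarrow> \<tau> (tens K D C (tgwc_monom K n \<nu> S \<rho> h s vs) (tgwc_monom K m \<mu> R \<sigma> t r us))
        = q_words K q vs us \<odot>\<^bsub>tensor K C D\<^esub>
            tens K C D
              (tgwc_monom K m \<mu> R \<sigma> t (multi_aut_pow R n \<rho>R (word_degree vs) r) us)
              (tgwc_monom K n \<nu> S \<rho> h
                (multi_aut_pow S m \<sigma>S (\<lambda>j. - word_degree us j) s) vs)"
  shows "\<exists>\<tau>'. twisting_map K A B \<tau>'
      \<and> (\<forall>z\<in>carrier (tensor K D C).
            \<tau>' (tensor_map K B A pB pA z) = tensor_map K A B pA pB (\<tau> z))
      \<and> k_algebra K (twisted_tensor K A B \<tau>')
      \<and> regular_consistent K (m + n) \<eta> T \<pi> w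
      \<and> alg_iso K (TGWA K (m + n) \<eta> T \<pi> w) (twisted_tensor K A B \<tau>') \<noteq> {}"
proof -
  interpret RC: tgwc K m \<mu> R \<sigma> t
    using C by (simp add: tgwc_def tgw_datum_def tgw_datum_axioms_def regular_consistent_def tgwd_def)
  interpret SD: tgwc K n \<nu> S \<rho> h
    using D by (simp add: tgwc_def tgw_datum_def tgw_datum_axioms_def regular_consistent_def tgwd_def)
  interpret qs: q_scalars K m n q
    by (intro q_scalars.intro K q_scalars_axioms.intro q_nonzero)
  have reg: "regular_datum m R t" "regular_datum n S h"
    and con: "consistent_datum K m \<mu> R \<sigma> t" "consistent_datum K n \<nu> S \<rho> h"
    using C D by (simp_all add: regular_consistent_def)
  note T_auts = commuting[unfolded T_def \<pi>_def]
  interpret cd: combined_datum K m n \<mu> \<nu> R S \<sigma> t \<rho> h q \<sigma>T \<rho>T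
    by unfold_locales (rule T_auts reg)+
  note \<tau>_lin = \<tau>_linear[unfolded C_def D_def]
  show ?thesis
  proof (cases "\<one>\<^bsub>R\<^esub> = \<zero>\<^bsub>R\<^esub> \<or> \<one>\<^bsub>S\<^esub> = \<zero>\<^bsub>S\<^esub>")
    case True
    show ?thesis
      unfolding C_def A_def D_def B_def pA_def pB_def T_def \<pi>_def w_def \<eta>_def
      by (rule cd.degenerate_case[OF True \<tau>_lin])
  next
    case False
    interpret ta: tensor_actions K R S m n \<sigma> \<rho> \<sigma>T \<rho>T
      by unfold_locales (use T_auts \<sigma>_extends \<rho>_extends \<rho>_on_R \<sigma>_on_S False in simp_all)
    interpret P: tgwa_pair_T K m n \<mu> \<nu> R S \<sigma> t \<rho> h q "\<lambda>i. act_left K R S (\<rho>T i)" "\<lambda>j. act_right K R S (\<sigma>T j)" \<tau> \<sigma>T \<rho>T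
    proof unfold_locales
      fix r s us vs assume "r \<in> carrier R" "s \<in> carrier S" "us \<in> lists (pm m)" "vs \<in> lists (pm n)"
      from \<tau>_monom[OF this]
      show "\<tau> (tens K SD.C RC.C (SD.mon s vs) (RC.mon r us)) = q_words K q vs us \<odot>\<^bsub>tensor K RC.C SD.C\<^esub>
        tens K RC.C SD.C (RC.mon (multi_aut_pow R n (\<lambda>i. act_left K R S (\<rho>T i)) (word_degree vs) r) us)
          (SD.mon (multi_aut_pow S m (\<lambda>j. act_right K R S (\<sigma>T j)) (\<lambda>j. - word_degree us j) s) vs)"
        by (simp only: C_def D_def \<rho>R_def \<sigma>S_def RC.tgwc_monom_eq SD.tgwc_monom_eq)
    qed (use ta.\<rho>R_auts ta.\<sigma>S_auts ta.\<rho>R_\<sigma> ta.\<sigma>S_\<rho> reg con \<tau>_lin False ta.\<sigma>T_tens ta.\<rho>T_tens in simp_all)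
    show ?thesis
      unfolding C_def A_def D_def B_def pA_def pB_def T_def \<pi>_def w_def \<eta>_def
      by (intro exI[of _ P.\<tau>'] conjI ballI P.twisting P.\<tau>'_map P.W_k_algebra P.combined_tgwa)
  qed
qed


end
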